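(* Let $k$ be a field, let $A=kQ/I$ be a quadratic monomial algebra, and let $B=k\mathcal{R}_A/J^2$ be the algebra with radical square zero defined by the relation quiver $\mathcal{R}_A$ of $A$. Let $F\colon B\text{-}\underline{\mathrm{ssmod}}\to A\text{-}\underline{\mathrm{mod}}$ be the $k$-linear functor sending $S_\alpha$ to $A\alpha$ for each arrow $\alpha$ of $Q$. Then $F$ (equipped with the natural isomorphism $F\Omega_B\simeq\Omega_AF$ described in the context) is a pre-triangle equivalence.
   Context: **Quivers and algebras.** $Q=(Q_0,Q_1;s,t)$ is a finite quiver; paths are written right to left: $\beta\alpha$ is a path if $s(\beta)=t(\alpha)$. $J$ denotes the ideal of a path algebra generated by arrows. $A=kQ/I$ is quadratic monomial: $I$ is generated by paths of length two and $J^d\subseteq I\subseteq J^2$ for some $d\ge2$. $\mathbf{F}$ is the set of paths of length two lying in $I$. The relation quiver $\mathcal{R}_A$ has as vertices the arrows of $Q$, and one arrow $[\beta\alpha]$ from $\alpha$ to $\beta$ for each $\beta\alpha\in\mathbf{F}$. Modules are finitely generated left modules. For an arrow $\alpha$ of $Q$, $A\alpha$ is the left ideal of $A$ generated by $\alpha$; $S_\alpha$ and $P_\alpha$ are the simple and the indecomposable projective $B$-modules at the vertex $\alpha$ of $\mathcal{R}_A$. **Stable categories.** $A\text{-}\underline{\mathrm{mod}}$ is the category of finitely generated left $A$-modules modulo morphisms factoring through projectives, with syzygy functor $\Omega_A$ given by kernels of (fixed) projective covers $P(M)\to M$. Its left triangles are the sequences isomorphic to $\Omega_A(Z)\xrightarrow{\bar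 h}X\xrightarrow{\bar f}Y\xrightarrow{\bar g}Z$ arising from short exact sequences $0\to X\xrightarrow{f}Y\xrightarrow{g}Z\to0$, where $h\colon\Omega_A(Z)\to X$ is induced by a lift $P(Z)\to Y$ of $P(Z)\to Z$; this makes $A\text{-}\underline{\mathrm{mod}}$ a left triangulated category. $B\text{-}\underline{\mathrm{ssmod}}$ is the full subcategory of $B\text{-}\underline{\mathrm{mod}}$ of semisimple $B$-modules; it is closed under $\Omega_B$ (syzygies of $B$-modules are semisimple) and is a left triangulated subcategory, all of whose left triangles are direct sums of trivial ones. **The functor $F$.** There are short exact sequences $0\to\bigoplus_{\{\beta\in Q_1\,|\,\beta\alpha\in\mathbf{F}\}}A\beta\to Ae_{t(\alpha)}\to A\alpha\to0$ (the second map sending $e_{t(\alpha)}$ to $\alpha$) and $0\to\bigoplus_{\{\beta\in Q_1\,|\,\beta\alpha\in\mathbf{F}\}}S_\beta\to P_\alpha\to S_\alpha\to0$ ($S_\beta$ identified with $k[\beta\alpha]$). In particular $S_\alpha$ is projective iff $A\alpha$ is, so there is a unique (up to isomorphism) $k$-linear functor $F$ with $F(S_\alpha)=A\alpha$. The sequences identify $\Omega_B(S_\alpha)$ with $\bigoplus S_\beta$ and $\Omega_A(A\alpha)$ with $\bigoplus A\beta$ (sums over $\beta$ with $\beta\alpha\in\mathbf{F}$), and this gives a natural isomorphism $\delta\colon F\Omega_B\to\Omega_AF$. **Pre-triangle equivalence.** A looped functor $(F,\delta)\colon(\mathcal{C},\Omega)\to(\mathcal{C}',\Omega')$ between categories with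 endofunctors is a functor $F$ with a natural isomorphism $\delta\colon F\Omega\to\Omega'F$; put $\delta^0=\mathrm{id}_F$, $\delta^1=\delta$, $\delta^{i+1}=\Omega'^i\delta\circ\delta^i\Omega$. Between left triangulated categories it is a triangle functor if $F$ is additive and for every left triangle $\Omega Z\xrightarrow{h}X\xrightarrow{f}Y\xrightarrow{g}Z$ the sequence $\Omega'FZ\xrightarrow{F(h)\delta_Z^{-1}}FX\xrightarrow{F(f)}FY\xrightarrow{F(g)}FZ$ is a left triangle. It is a pre-triangle equivalence if it is a triangle functor satisfying: (S1) for any morphism $g\colon FX\to FY$ in $\mathcal{C}'$ there exist $i\ge0$ and $f\colon\Omega^iX\to\Omega^iY$ in $\mathcal{C}$ with $\Omega'^i(g)=\delta^i_Y\circ F(f)\circ(\delta^i_X)^{-1}$; (S2) for any $f,f'\colon X\to Y$ in $\mathcal{C}$ with $F(f)=F(f')$ there is $i\ge0$ with $\Omega^i(f)=\Omega^i(f')$; (S3) for any object $C'$ of $\mathcal{C}'$ there exist $i\ge0$ and an object $X$ of $\mathcal{C}$ with $\Omega'^i(C')\simeq F(X)$. *)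

theory Defs
  imports
    "HOL-Algebra.Module"
    "HOL-Algebra.QuotRing"
    "HOL-Algebra.Ideal_Product"
    "HOL-Library.FuncSet"
    "Graph_Theory.Arc_Walk"
begin

section \<open>Path algebras and their quotients\<close>

text \<open>
  A finite quiver is a \<^locale>\<open>fin_digraph\<close>: \<open>tail\<close> is the source map, \<open>head\<close> the target map.
  A path is a pair of its source and its list of arrows in order of traversal, so the path
  written \<open>\<beta>\<alpha>\<close> in right-to-left notation is \<open>(tail Q \<alpha>, [\<alpha>, \<beta>])\<close>, and the trivial path
  \<open>e_v\<close> is \<open>(v, [])\<close>.
\<close>

type_synonym ('v, 'e) path = "'v \<times> 'e list"

definition paths :: "('v, 'e) pre_digraph \<Rightarrow> ('v, 'e) path set" where
  "paths Q = {(u, as). \<exists>v. pre_digraph.awalk Q u as v}"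

definition path_target :: "('v, 'e) pre_digraph \<Rightarrow> ('v, 'e) path \<Rightarrow> 'v" where
  "path_target Q p = (if snd p = [] then fst p else head Q (last (snd p)))"

definition path_elt :: "('v, 'e) path \<Rightarrow> ('v, 'e) path \<Rightarrow> 'k::field" where
  "path_elt p = (\<lambda>q. if q = p then 1 else 0)"

text \<open>
  In the product of \<open>f\<close> and \<open>g\<close> the basis elements \<open>p\<close>, \<open>q\<close> multiply to \<open>pq\<close> (first \<open>q\<close>, then
  \<open>p\<close>) if \<open>p\<close> starts where \<open>q\<close> ends, and to zero otherwise. The index set of the sum is finite.
\<close>

definition path_alg :: "('v, 'e) pre_digraph \<Rightarrow> (('v, 'e) path \<Rightarrow> 'k::field) ring" where
  "path_alg Q =
    \<lparr> carrier = {f. finite {p. f p \<noteq> 0} \<and> {p. f p \<noteq> 0} \<subseteq> paths Q},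
      mult = (\<lambda>f g r. \<Sum>(p, q)\<in>{(p, q). p \<in> paths Q \<and> q \<in> paths Q \<and> fst p = path_target Q q \<and>
                                     (fst q, snd q @ snd p) = r}. f p * g q),
      one = (\<lambda>p. if p \<in> paths Q \<and> snd p = [] then 1 else 0),
      zero = (\<lambda>p. 0),
      add = (\<lambda>f g p. f p + g p) \<rparr>"

definition arrow_ideal :: "('v, 'e) pre_digraph \<Rightarrow> (('v, 'e) path \<Rightarrow> 'k::field) set" where
  "arrow_ideal Q = Idl\<^bsub>path_alg Q\<^esub> ((\<lambda>\<alpha>. path_elt (tail Q \<alpha>, [\<alpha>])) ` arcs Q)"

primrec ideal_power :: "('a, 'b) ring_scheme \<Rightarrow> 'a set \<Rightarrow> nat \<Rightarrow> 'a set" where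
  "ideal_power R J 0 = carrier R"
| "ideal_power R J (Suc n) = ideal_prod R (ideal_power R J n) J"

definition quadratic_monomial ::
    "('v, 'e) pre_digraph \<Rightarrow> (('v, 'e) path \<Rightarrow> 'k::field) set \<Rightarrow> bool" where
  "quadratic_monomial Q I \<longleftrightarrow>
     (\<exists>X. X \<subseteq> {p \<in> paths Q. length (snd p) = 2} \<and> I = Idl\<^bsub>path_alg Q\<^esub> (path_elt ` X)) \<and>
     (\<exists>d\<ge>2. ideal_power (path_alg Q) (arrow_ideal Q) d \<subseteq> I \<and>
            I \<subseteq> ideal_power (path_alg Q) (arrow_ideal Q) 2)"

definition quiver_alg ::
    "('v, 'e) pre_digraph \<Rightarrow> (('v, 'e) path \<Rightarrow> 'k::field) set \<Rightarrow> (('v, 'e) path \<Rightarrow> 'k) set ring" where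
  "quiver_alg Q I = path_alg Q Quot I"

definition residue ::
    "('v, 'e) pre_digraph \<Rightarrow> (('v, 'e) path \<Rightarrow> 'k::field) set \<Rightarrow> (('v, 'e) path \<Rightarrow> 'k) \<Rightarrow>
     (('v, 'e) path \<Rightarrow> 'k) set" where
  "residue Q I f = I +>\<^bsub>path_alg Q\<^esub> f"

text \<open>The structure map \<open>c \<mapsto> c \<cdot> 1\<close> of the \<open>k\<close>-algebra \<open>kQ/I\<close>.\<close>

definition scalar ::
    "('v, 'e) pre_digraph \<Rightarrow> (('v, 'e) path \<Rightarrow> 'k::field) set \<Rightarrow> 'k \<Rightarrow> (('v, 'e) path \<Rightarrow> 'k) set" where
  "scalar Q I c = residue Q I (\<lambda>p. c * one (path_alg Q) p)"

definition relations ::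
    "('v, 'e) pre_digraph \<Rightarrow> (('v, 'e) path \<Rightarrow> 'k::field) set \<Rightarrow> ('v, 'e) path set" where
  "relations Q I = {p \<in> paths Q. length (snd p) = 2 \<and> path_elt p \<in> I}"

definition relation_quiver ::
    "('v, 'e) pre_digraph \<Rightarrow> (('v, 'e) path \<Rightarrow> 'k::field) set \<Rightarrow>
     ('e, ('v, 'e) path) pre_digraph" where
  "relation_quiver Q I =
    \<lparr> verts = arcs Q, arcs = relations Q I,
      tail = (\<lambda>p. hd (snd p)), head = (\<lambda>p. last (snd p)) \<rparr>"

definition arrow_ideal_sq :: "('v, 'e) pre_digraph \<Rightarrow> (('v, 'e) path \<Rightarrow> 'k::field) set" where
  "arrow_ideal_sq Q = ideal_power (path_alg Q) (arrow_ideal Q) 2"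


section \<open>Left modules over a ring that need not be commutative\<close>

text \<open>
  The record \<^type>\<open>module\<close> of HOL-Algebra is reused; its fields \<open>mult\<close> and \<open>one\<close> play no role.
  The library locale \<open>module\<close> assumes a commutative ring.
\<close>

locale left_module = ring R + M: abelian_group M
  for R :: "('a, 'b) ring_scheme" (structure) and M :: "('a, 'm, 'c) module_scheme" +
  assumes lsmult_closed: "a \<in> carrier R \<Longrightarrow> x \<in> carrier M \<Longrightarrow> a \<odot>\<^bsub>M\<^esub> x \<in> carrier M"
    and lsmult_l_distr: "a \<in> carrier R \<Longrightarrow> b \<in> carrier R \<Longrightarrow> x \<in> carrier M \<Longrightarrow>
      (a \<oplus> b) \<odot>\<^bsub>M\<^esub> x = a \<odot>\<^bsub>M\<^esub> x \<oplus>\<^bsub>M\<^esub> b \<odot>\<^bsub>M\<^esub> x"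
    and lsmult_r_distr: "a \<in> carrier R \<Longrightarrow> x \<in> carrier M \<Longrightarrow> y \<in> carrier M \<Longrightarrow>
      a \<odot>\<^bsub>M\<^esub> (x \<oplus>\<^bsub>M\<^esub> y) = a \<odot>\<^bsub>M\<^esub> x \<oplus>\<^bsub>M\<^esub> a \<odot>\<^bsub>M\<^esub> y"
    and lsmult_assoc: "a \<in> carrier R \<Longrightarrow> b \<in> carrier R \<Longrightarrow> x \<in> carrier M \<Longrightarrow>
      (a \<otimes> b) \<odot>\<^bsub>M\<^esub> x = a \<odot>\<^bsub>M\<^esub> (b \<odot>\<^bsub>M\<^esub> x)"
    and lsmult_one: "x \<in> carrier M \<Longrightarrow> \<one> \<odot>\<^bsub>M\<^esub> x = x"

definition finitely_generated :: "'a ring \<Rightarrow> ('a, 'm) module \<Rightarrow> bool" where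
  "finitely_generated R M \<longleftrightarrow>
     (\<exists>X. finite X \<and> X \<subseteq> carrier M \<and> (\<forall>N. submodule N R M \<and> X \<subseteq> N \<longrightarrow> N = carrier M))"

definition fg_mod :: "'a ring \<Rightarrow> ('a, 'm) module set" where
  "fg_mod R = {M. left_module R M \<and> finitely_generated R M}"

text \<open>Homomorphisms are extensional functions, so that equality of homomorphisms is \<open>=\<close>.\<close>

definition mod_hom :: "'a ring \<Rightarrow> ('a, 'm) module \<Rightarrow> ('a, 'n) module \<Rightarrow> ('m \<Rightarrow> 'n) set" where
  "mod_hom R M N = {f \<in> carrier M \<rightarrow>\<^sub>E carrier N.
     (\<forall>x\<in>carrier M. \<forall>y\<in>carrier M. f (x \<oplus>\<^bsub>M\<^esub> y) = f x \<oplus>\<^bsub>N\<^esub> f y) \<and>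
     (\<forall>a\<in>carrier R. \<forall>x\<in>carrier M. f (a \<odot>\<^bsub>M\<^esub> x) = a \<odot>\<^bsub>N\<^esub> f x)}"

definition mod_iso :: "'a ring \<Rightarrow> ('a, 'm) module \<Rightarrow> ('a, 'n) module \<Rightarrow> ('m \<Rightarrow> 'n) set" where
  "mod_iso R M N = {f \<in> mod_hom R M N. bij_betw f (carrier M) (carrier N)}"

definition hom_ker :: "('a, 'm) module \<Rightarrow> ('a, 'n) module \<Rightarrow> ('m \<Rightarrow> 'n) \<Rightarrow> 'm set" where
  "hom_ker M N f = {x \<in> carrier M. f x = \<zero>\<^bsub>N\<^esub>}"

definition short_exact ::
    "'a ring \<Rightarrow> ('a, 'm) module \<Rightarrow> ('a, 'm) module \<Rightarrow> ('a, 'm) module \<Rightarrow>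
     ('m \<Rightarrow> 'm) \<Rightarrow> ('m \<Rightarrow> 'm) \<Rightarrow> bool" where
  "short_exact R X Y Z f g \<longleftrightarrow> f \<in> mod_hom R X Y \<and> g \<in> mod_hom R Y Z \<and>
     inj_on f (carrier X) \<and> f ` carrier X = hom_ker Y Z g \<and> g ` carrier Y = carrier Z"

definition simple_module :: "'a ring \<Rightarrow> ('a, 'm) module \<Rightarrow> bool" where
  "simple_module R M \<longleftrightarrow> left_module R M \<and> carrier M \<noteq> {\<zero>\<^bsub>M\<^esub>} \<and>
     (\<forall>N. submodule N R M \<longrightarrow> N = {\<zero>\<^bsub>M\<^esub>} \<or> N = carrier M)"

text \<open>A module is semisimple if it is the sum of its simple submodules.\<close>

definition semisimple_module :: "'a ring \<Rightarrow> ('a, 'm) module \<Rightarrow> bool" where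
  "semisimple_module R M \<longleftrightarrow> left_module R M \<and>
     (\<forall>N. submodule N R M \<and>
          (\<forall>K. submodule K R M \<and> simple_module R (M\<lparr>carrier := K\<rparr>) \<longrightarrow> K \<subseteq> N) \<longrightarrow>
          N = carrier M)"

definition projective :: "'a ring \<Rightarrow> ('a, 'm) module \<Rightarrow> bool" where
  "projective R P \<longleftrightarrow>
     (\<forall>M\<in>fg_mod R. \<forall>N\<in>fg_mod R. \<forall>p\<in>mod_hom R (M :: ('a, 'm) module) (N :: ('a, 'm) module).
        p ` carrier M = carrier N \<longrightarrow>
        (\<forall>f\<in>mod_hom R P N. \<exists>g\<in>mod_hom R P M. \<forall>x\<in>carrier P. p (g x) = f x))"

definition projective_cover ::
    "'a ring \<Rightarrow> ('a, 'm) module \<Rightarrow> ('m \<Rightarrow> 'm) \<Rightarrow> ('a, 'm) module \<Rightarrow> bool" where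
  "projective_cover R P p M \<longleftrightarrow> P \<in> fg_mod R \<and> projective R P \<and>
     p \<in> mod_hom R P M \<and> p ` carrier P = carrier M \<and>
     (\<forall>N. submodule N R P \<and> N <+>\<^bsub>P\<^esub> hom_ker P M p = carrier P \<longrightarrow> N = carrier P)"

text \<open>
  A choice of projective covers \<open>\<pi> M : P M \<rightarrow> M\<close>, one for each finitely generated module whose
  elements are taken from the type \<open>'m\<close>.
\<close>

definition projective_covers ::
    "'a ring \<Rightarrow> (('a, 'm) module \<Rightarrow> ('a, 'm) module) \<Rightarrow> (('a, 'm) module \<Rightarrow> 'm \<Rightarrow> 'm) \<Rightarrow> bool" where
  "projective_covers R P \<pi> \<longleftrightarrow> (\<forall>M\<in>fg_mod R. projective_cover R (P M) (\<pi> M) M)"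

definition left_ideal_module :: "'a ring \<Rightarrow> 'a \<Rightarrow> ('a, 'a) module" where
  "left_ideal_module R x =
    \<lparr> carrier = {a \<otimes>\<^bsub>R\<^esub> x |a. a \<in> carrier R}, mult = mult R, one = one R, zero = zero R,
      add = add R, smult = mult R \<rparr>"


section \<open>Categories with a loop functor and left triangles\<close>

text \<open>
  The data of a \<open>k\<close>-linear category with an endofunctor (\<open>LoopO\<close> on objects, \<open>LoopA\<close> on arrows)
  and a class of distinguished sequences \<open>(X, Y, Z, h, f, g)\<close>, read as
  \<open>\<Omega>Z \<rightarrow> X \<rightarrow> Y \<rightarrow> Z\<close> with maps \<open>h\<close>, \<open>f\<close>, \<open>g\<close>.
\<close>

record ('o, 'r, 'k) left_tri_cat =
  Obj :: "'o set"
  Arr :: "'o \<Rightarrow> 'o \<Rightarrow> 'r set"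
  Comp :: "'r \<Rightarrow> 'r \<Rightarrow> 'r"
  Ident :: "'o \<Rightarrow> 'r"
  Plus :: "'r \<Rightarrow> 'r \<Rightarrow> 'r"
  Scale :: "'k \<Rightarrow> 'r \<Rightarrow> 'r"
  LoopO :: "'o \<Rightarrow> 'o"
  LoopA :: "'r \<Rightarrow> 'r"
  Tri :: "('o \<times> 'o \<times> 'o \<times> 'r \<times> 'r \<times> 'r) set"

definition is_category :: "('o, 'r, 'k) left_tri_cat \<Rightarrow> bool" where
  "is_category C \<longleftrightarrow>
     (\<forall>X\<in>Obj C. Ident C X \<in> Arr C X X) \<and>
     (\<forall>X\<in>Obj C. \<forall>Y\<in>Obj C. \<forall>f\<in>Arr C X Y. Comp C f (Ident C X) = f \<and> Comp C (Ident C Y) f = f) \<and>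
     (\<forall>X\<in>Obj C. \<forall>Y\<in>Obj C. \<forall>Z\<in>Obj C. \<forall>f\<in>Arr C X Y. \<forall>g\<in>Arr C Y Z. Comp C g f \<in> Arr C X Z) \<and>
     (\<forall>W\<in>Obj C. \<forall>X\<in>Obj C. \<forall>Y\<in>Obj C. \<forall>Z\<in>Obj C. \<forall>f\<in>Arr C W X. \<forall>g\<in>Arr C X Y. \<forall>h\<in>Arr C Y Z.
        Comp C h (Comp C g f) = Comp C (Comp C h g) f)"

definition is_functor ::
    "('o, 'r, 'k) left_tri_cat \<Rightarrow> ('p, 's, 'k) left_tri_cat \<Rightarrow> ('o \<Rightarrow> 'p) \<Rightarrow> ('r \<Rightarrow> 's) \<Rightarrow> bool" where
  "is_functor C D F0 F1 \<longleftrightarrow>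
     (\<forall>X\<in>Obj C. F0 X \<in> Obj D \<and> F1 (Ident C X) = Ident D (F0 X)) \<and>
     (\<forall>X\<in>Obj C. \<forall>Y\<in>Obj C. \<forall>f\<in>Arr C X Y. F1 f \<in> Arr D (F0 X) (F0 Y)) \<and>
     (\<forall>X\<in>Obj C. \<forall>Y\<in>Obj C. \<forall>Z\<in>Obj C. \<forall>f\<in>Arr C X Y. \<forall>g\<in>Arr C Y Z.
        F1 (Comp C g f) = Comp D (F1 g) (F1 f))"

definition additive_on_arrows ::
    "('o, 'r, 'k) left_tri_cat \<Rightarrow> ('p, 's, 'k) left_tri_cat \<Rightarrow> ('r \<Rightarrow> 's) \<Rightarrow> bool" where
  "additive_on_arrows C D F1 \<longleftrightarrow>
     (\<forall>X\<in>Obj C. \<forall>Y\<in>Obj C. \<forall>f\<in>Arr C X Y. \<forall>g\<in>Arr C X Y. F1 (Plus C f g) = Plus D (F1 f) (F1 g))"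

definition linear_on_arrows ::
    "('o, 'r, 'k) left_tri_cat \<Rightarrow> ('p, 's, 'k) left_tri_cat \<Rightarrow> ('r \<Rightarrow> 's) \<Rightarrow> bool" where
  "linear_on_arrows C D F1 \<longleftrightarrow> additive_on_arrows C D F1 \<and>
     (\<forall>X\<in>Obj C. \<forall>Y\<in>Obj C. \<forall>f\<in>Arr C X Y. \<forall>c. F1 (Scale C c f) = Scale D c (F1 f))"

definition inverse_arrows ::
    "('o, 'r, 'k) left_tri_cat \<Rightarrow> 'o \<Rightarrow> 'o \<Rightarrow> 'r \<Rightarrow> 'r \<Rightarrow> bool" where
  "inverse_arrows C X Y f g \<longleftrightarrow> f \<in> Arr C X Y \<and> g \<in> Arr C Y X \<and>
     Comp C g f = Ident C X \<and> Comp C f g = Ident C Y"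

definition is_iso :: "('o, 'r, 'k) left_tri_cat \<Rightarrow> 'o \<Rightarrow> 'o \<Rightarrow> 'r \<Rightarrow> bool" where
  "is_iso C X Y f \<longleftrightarrow> (\<exists>g. inverse_arrows C X Y f g)"

definition inverse_of :: "('o, 'r, 'k) left_tri_cat \<Rightarrow> 'o \<Rightarrow> 'o \<Rightarrow> 'r \<Rightarrow> 'r" where
  "inverse_of C X Y f = (THE g. inverse_arrows C X Y f g)"

definition looped_category :: "('o, 'r, 'k) left_tri_cat \<Rightarrow> bool" where
  "looped_category C \<longleftrightarrow> is_category C \<and> is_functor C C (LoopO C) (LoopA C)"

definition loop_natural_iso ::
    "('o, 'r, 'k) left_tri_cat \<Rightarrow> ('p, 's, 'k) left_tri_cat \<Rightarrow> ('o \<Rightarrow> 'p) \<Rightarrow> ('r \<Rightarrow> 's) \<Rightarrow>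
     ('o \<Rightarrow> 's) \<Rightarrow> bool" where
  "loop_natural_iso C D F0 F1 \<delta> \<longleftrightarrow>
     (\<forall>X\<in>Obj C. is_iso D (F0 (LoopO C X)) (LoopO D (F0 X)) (\<delta> X)) \<and>
     (\<forall>X\<in>Obj C. \<forall>Y\<in>Obj C. \<forall>f\<in>Arr C X Y.
        Comp D (\<delta> Y) (F1 (LoopA C f)) = Comp D (LoopA D (F1 f)) (\<delta> X))"

definition looped_functor ::
    "('o, 'r, 'k) left_tri_cat \<Rightarrow> ('p, 's, 'k) left_tri_cat \<Rightarrow> ('o \<Rightarrow> 'p) \<Rightarrow> ('r \<Rightarrow> 's) \<Rightarrow>
     ('o \<Rightarrow> 's) \<Rightarrow> bool" where
  "looped_functor C D F0 F1 \<delta> \<longleftrightarrow> looped_category C \<and> looped_category D \<and>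
     is_functor C D F0 F1 \<and> loop_natural_iso C D F0 F1 \<delta>"

text \<open>\<open>delta_power C D F0 \<delta> i X\<close> is the component at \<open>X\<close> of
  \<open>\<delta>\<^sup>i : F \<Omega>\<^sup>i \<rightarrow> \<Omega>'\<^sup>i F\<close>.\<close>

primrec delta_power ::
    "('o, 'r, 'k) left_tri_cat \<Rightarrow> ('p, 's, 'k) left_tri_cat \<Rightarrow> ('o \<Rightarrow> 'p) \<Rightarrow> ('o \<Rightarrow> 's) \<Rightarrow>
     nat \<Rightarrow> 'o \<Rightarrow> 's" where
  "delta_power C D F0 \<delta> 0 = (\<lambda>X. Ident D (F0 X))"
| "delta_power C D F0 \<delta> (Suc i) =
     (\<lambda>X. Comp D ((LoopA D ^^ i) (\<delta> X)) (delta_power C D F0 \<delta> i (LoopO C X)))"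

definition triangle_functor ::
    "('o, 'r, 'k) left_tri_cat \<Rightarrow> ('p, 's, 'k) left_tri_cat \<Rightarrow> ('o \<Rightarrow> 'p) \<Rightarrow> ('r \<Rightarrow> 's) \<Rightarrow>
     ('o \<Rightarrow> 's) \<Rightarrow> bool" where
  "triangle_functor C D F0 F1 \<delta> \<longleftrightarrow>
     looped_functor C D F0 F1 \<delta> \<and> additive_on_arrows C D F1 \<and>
     (\<forall>X Y Z h f g. (X, Y, Z, h, f, g) \<in> Tri C \<longrightarrow>
        (F0 X, F0 Y, F0 Z,
         Comp D (F1 h) (inverse_of D (F0 (LoopO C Z)) (LoopO D (F0 Z)) (\<delta> Z)),
         F1 f, F1 g) \<in> Tri D)"

definition pre_triangle_equivalence ::
    "('o, 'r, 'k) left_tri_cat \<Rightarrow> ('p, 's, 'k) left_tri_cat \<Rightarrow> ('o \<Rightarrow> 'p) \<Rightarrow> ('r \<Rightarrow> 's) \<Rightarrow>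
     ('o \<Rightarrow> 's) \<Rightarrow> bool" where
  "pre_triangle_equivalence C D F0 F1 \<delta> \<longleftrightarrow> triangle_functor C D F0 F1 \<delta> \<and>
     (\<forall>X\<in>Obj C. \<forall>Y\<in>Obj C. \<forall>g\<in>Arr D (F0 X) (F0 Y).
        \<exists>i. \<exists>f\<in>Arr C ((LoopO C ^^ i) X) ((LoopO C ^^ i) Y).
          (LoopA D ^^ i) g =
            Comp D (Comp D (delta_power C D F0 \<delta> i Y) (F1 f))
              (inverse_of D (F0 ((LoopO C ^^ i) X)) ((LoopO D ^^ i) (F0 X))
                 (delta_power C D F0 \<delta> i X))) \<and>
     (\<forall>X\<in>Obj C. \<forall>Y\<in>Obj C. \<forall>f\<in>Arr C X Y. \<forall>f'\<in>Arr C X Y.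
        F1 f = F1 f' \<longrightarrow> (\<exists>i. (LoopA C ^^ i) f = (LoopA C ^^ i) f')) \<and>
     (\<forall>W\<in>Obj D. \<exists>i. \<exists>X\<in>Obj C. \<exists>u. is_iso D ((LoopO D ^^ i) W) (F0 X) u)"

text \<open>The sequences isomorphic to a given distinguished one.\<close>

definition iso_closure ::
    "('o, 'r, 'k) left_tri_cat \<Rightarrow> ('o \<times> 'o \<times> 'o \<times> 'r \<times> 'r \<times> 'r) set" where
  "iso_closure C = {(X, Y, Z, h, f, g).
     X \<in> Obj C \<and> Y \<in> Obj C \<and> Z \<in> Obj C \<and>
     h \<in> Arr C (LoopO C Z) X \<and> f \<in> Arr C X Y \<and> g \<in> Arr C Y Z \<and>
     (\<exists>X' Y' Z' h' f' g' a b c. (X', Y', Z', h', f', g') \<in> Tri C \<and>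
        is_iso C X X' a \<and> is_iso C Y Y' b \<and> is_iso C Z Z' c \<and>
        Comp C a h = Comp C h' (LoopA C c) \<and>
        Comp C b f = Comp C f' a \<and> Comp C c g = Comp C g' b)}"

definition full_subcat :: "('o, 'r, 'k) left_tri_cat \<Rightarrow> 'o set \<Rightarrow> ('o, 'r, 'k) left_tri_cat" where
  "full_subcat C \<O> = C\<lparr>Obj := Obj C \<inter> \<O>,
     Tri := {(X, Y, Z, h, f, g) \<in> Tri C. X \<in> \<O> \<and> Y \<in> \<O> \<and> Z \<in> \<O>}\<rparr>"


section \<open>Stable module categories\<close>

definition stably_equal ::
    "'a ring \<Rightarrow> ('a, 'm) module \<Rightarrow> ('a, 'm) module \<Rightarrow> ('m \<Rightarrow> 'm) \<Rightarrow> ('m \<Rightarrow> 'm) \<Rightarrow> bool" where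
  "stably_equal R M N f g \<longleftrightarrow> f \<in> mod_hom R M N \<and> g \<in> mod_hom R M N \<and>
     (\<exists>P\<in>fg_mod R. projective R (P :: ('a, 'm) module) \<and>
       (\<exists>a\<in>mod_hom R M P. \<exists>b\<in>mod_hom R P N. \<forall>x\<in>carrier M. f x \<ominus>\<^bsub>N\<^esub> g x = b (a x)))"

text \<open>An arrow of the stable category: source, class of homomorphisms, target.\<close>

type_synonym ('a, 'm) st_arrow = "('a, 'm) module \<times> ('m \<Rightarrow> 'm) set \<times> ('a, 'm) module"

definition st_class ::
    "'a ring \<Rightarrow> ('a, 'm) module \<Rightarrow> ('a, 'm) module \<Rightarrow> ('m \<Rightarrow> 'm) \<Rightarrow> ('a, 'm) st_arrow" where
  "st_class R M N f = (M, {g. stably_equal R M N f g}, N)"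

definition syzygy ::
    "(('a, 'm) module \<Rightarrow> ('a, 'm) module) \<Rightarrow> (('a, 'm) module \<Rightarrow> 'm \<Rightarrow> 'm) \<Rightarrow>
     ('a, 'm) module \<Rightarrow> ('a, 'm) module" where
  "syzygy P \<pi> M = (P M)\<lparr>carrier := hom_ker (P M) M (\<pi> M)\<rparr>"

text \<open>
  The operations on stable arrows collect the results for all representatives (and, for the
  syzygy functor, for all lifts \<open>l\<close> to projective covers); these results form one class.
\<close>

definition st_syzygy ::
    "'a ring \<Rightarrow> (('a, 'm) module \<Rightarrow> ('a, 'm) module) \<Rightarrow> (('a, 'm) module \<Rightarrow> 'm \<Rightarrow> 'm) \<Rightarrow>
     ('a, 'm) st_arrow \<Rightarrow> ('a, 'm) st_arrow" where
  "st_syzygy R P \<pi> = (\<lambda>(M, c, N). (syzygy P \<pi> M,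
     {g. \<exists>f\<in>c. \<exists>l\<in>mod_hom R (P M) (P N). (\<forall>x\<in>carrier (P M). \<pi> N (l x) = f (\<pi> M x)) \<and>
         stably_equal R (syzygy P \<pi> M) (syzygy P \<pi> N) (restrict l (carrier (syzygy P \<pi> M))) g},
     syzygy P \<pi> N))"

definition standard_triangles ::
    "'a ring \<Rightarrow> (('a, 'm) module \<Rightarrow> ('a, 'm) module) \<Rightarrow> (('a, 'm) module \<Rightarrow> 'm \<Rightarrow> 'm) \<Rightarrow>
     (('a, 'm) module \<times> ('a, 'm) module \<times> ('a, 'm) module \<times>
      ('a, 'm) st_arrow \<times> ('a, 'm) st_arrow \<times> ('a, 'm) st_arrow) set" where
  "standard_triangles R P \<pi> =
     {(X, Y, Z, st_class R (syzygy P \<pi> Z) X h, st_class R X Y f, st_class R Y Z g) |X Y Z h f g.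
        X \<in> fg_mod R \<and> Y \<in> fg_mod R \<and> Z \<in> fg_mod R \<and> short_exact R X Y Z f g \<and>
        h \<in> mod_hom R (syzygy P \<pi> Z) X \<and>
        (\<exists>s\<in>mod_hom R (P Z) Y. (\<forall>x\<in>carrier (P Z). g (s x) = \<pi> Z x) \<and>
           (\<forall>x\<in>carrier (syzygy P \<pi> Z). f (h x) = s x))}"

definition stmod_base ::
    "'a ring \<Rightarrow> ('k \<Rightarrow> 'a) \<Rightarrow> (('a, 'm) module \<Rightarrow> ('a, 'm) module) \<Rightarrow>
     (('a, 'm) module \<Rightarrow> 'm \<Rightarrow> 'm) \<Rightarrow> (('a, 'm) module, ('a, 'm) st_arrow, 'k) left_tri_cat" where
  "stmod_base R \<rho> P \<pi> =
    \<lparr> Obj = fg_mod R,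
      Arr = (\<lambda>M N. st_class R M N ` mod_hom R M N),
      Comp = (\<lambda>(Y', d, Z) (X, c, Y).
        (X, {h. \<exists>g\<in>d. \<exists>f\<in>c. stably_equal R X Z (compose (carrier X) g f) h}, Z)),
      Ident = (\<lambda>M. st_class R M M (\<lambda>x\<in>carrier M. x)),
      Plus = (\<lambda>(X, c, Y) (X', d, Y').
        (X, {h. \<exists>f\<in>c. \<exists>g\<in>d. stably_equal R X Y (\<lambda>x\<in>carrier X. f x \<oplus>\<^bsub>Y\<^esub> g x) h}, Y)),
      Scale = (\<lambda>t (X, c, Y).
        (X, {h. \<exists>f\<in>c. stably_equal R X Y (\<lambda>x\<in>carrier X. \<rho> t \<odot>\<^bsub>Y\<^esub> f x) h}, Y)),
      LoopO = syzygy P \<pi>,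
      LoopA = st_syzygy R P \<pi>,
      Tri = standard_triangles R P \<pi> \<rparr>"

definition stmod ::
    "'a ring \<Rightarrow> ('k \<Rightarrow> 'a) \<Rightarrow> (('a, 'm) module \<Rightarrow> ('a, 'm) module) \<Rightarrow>
     (('a, 'm) module \<Rightarrow> 'm \<Rightarrow> 'm) \<Rightarrow> (('a, 'm) module, ('a, 'm) st_arrow, 'k) left_tri_cat" where
  "stmod R \<rho> P \<pi> = (stmod_base R \<rho> P \<pi>)\<lparr>Tri := iso_closure (stmod_base R \<rho> P \<pi>)\<rparr>"

definition ssmod ::
    "'a ring \<Rightarrow> ('k \<Rightarrow> 'a) \<Rightarrow> (('a, 'm) module \<Rightarrow> ('a, 'm) module) \<Rightarrow>
     (('a, 'm) module \<Rightarrow> 'm \<Rightarrow> 'm) \<Rightarrow> (('a, 'm) module, ('a, 'm) st_arrow, 'k) left_tri_cat" where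
  "ssmod R \<rho> P \<pi> = full_subcat (stmod R \<rho> P \<pi>) {M. semisimple_module R M}"

text \<open>
  Let \<open>V \<rightarrow> Z\<close> be a homomorphism \<open>p\<close> from a projective module and \<open>i : K \<rightarrow> V\<close> with \<open>p \<circ> i = 0\<close>.
  Lifting \<open>p\<close> to \<open>l : V \<rightarrow> P Z\<close> gives \<open>l \<circ> i : K \<rightarrow> \<Omega>Z\<close>, whose stable class is independent of
  \<open>l\<close>. For an exact sequence \<open>0 \<rightarrow> \<Oplus>K\<^sub>j \<rightarrow> V \<rightarrow> Z \<rightarrow> 0\<close> the maps so obtained from the
  components \<open>K\<^sub>j \<rightarrow> V\<close> are the components of the identification \<open>\<Oplus>K\<^sub>j \<rightarrow> \<Omega>Z\<close>.
\<close>

definition syzygy_component ::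
    "'a ring \<Rightarrow> (('a, 'm) module \<Rightarrow> ('a, 'm) module) \<Rightarrow> (('a, 'm) module \<Rightarrow> 'm \<Rightarrow> 'm) \<Rightarrow>
     ('a, 'm) module \<Rightarrow> ('a, 'v) module \<Rightarrow> ('a, 'm) module \<Rightarrow> ('m \<Rightarrow> 'v) \<Rightarrow> ('v \<Rightarrow> 'm) \<Rightarrow>
     ('a, 'm) st_arrow" where
  "syzygy_component R P \<pi> K V Z i p = (K,
     {g. \<exists>l\<in>mod_hom R V (P Z). (\<forall>y\<in>carrier V. \<pi> Z (l y) = p y) \<and>
         stably_equal R K (syzygy P \<pi> Z) (\<lambda>x\<in>carrier K. l (i x)) g},
     syzygy P \<pi> Z)"


section \<open>The modules attached to an arrow, and the two syzygy sequences\<close>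

text \<open>
  The coefficient at \<open>p\<close> of a residue class; it is well defined if all elements of the ideal
  have coefficient zero at \<open>p\<close>, as is the case for trivial paths and ideals inside \<open>J\<^sup>2\<close>.
\<close>

definition residue_coeff :: "(('v, 'e) path \<Rightarrow> 'k::field) set \<Rightarrow> ('v, 'e) path \<Rightarrow> 'k" where
  "residue_coeff b p = (THE c. \<forall>f\<in>b. f p = c)"

text \<open>
  The simple module at the vertex \<open>v\<close>: the one-dimensional module on which \<open>e_v\<close> acts as the
  identity and all other paths act as zero.
\<close>

definition vertex_simple :: "'v \<Rightarrow> ((('v, 'e) path \<Rightarrow> 'k::field) set, 'k) module" where
  "vertex_simple v =
    \<lparr> carrier = UNIV, mult = (*), one = 1, zero = 0, add = (+),
      smult = (\<lambda>b x. residue_coeff b (v, []) * x) \<rparr>"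

text \<open>
  In the following, \<open>\<sigma> \<alpha> : S \<alpha> \<rightarrow> S\<^sub>\<alpha>\<close> and \<open>\<tau> \<alpha> : L \<alpha> \<rightarrow> A\<alpha>\<close> are isomorphisms which compare
  copies \<open>S \<alpha>\<close>, \<open>L \<alpha>\<close> in the module categories with the simple module and the left ideal
  themselves. The path \<open>q = (tail Q \<alpha>, [\<alpha>, \<beta>])\<close> is an arrow of the relation quiver from \<open>\<alpha>\<close> to
  \<open>\<beta>\<close>. The first arrow is the component \<open>S\<^sub>\<beta> \<rightarrow> \<Omega>\<^sub>B(S\<^sub>\<alpha>)\<close> obtained from
  \<open>0 \<rightarrow> \<Oplus>S\<^sub>\<beta> \<rightarrow> P\<^sub>\<alpha> \<rightarrow> S\<^sub>\<alpha> \<rightarrow> 0\<close>, with \<open>P\<^sub>\<alpha> = B e_\<alpha>\<close> and \<open>S\<^sub>\<beta>\<close> embedded as \<open>k q\<close>; the second one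
  is the component \<open>A\<beta> \<rightarrow> \<Omega>\<^sub>A(A\<alpha>)\<close> obtained from
  \<open>0 \<rightarrow> \<Oplus>A\<beta> \<rightarrow> A e \<rightarrow> A\<alpha> \<rightarrow> 0\<close>, with \<open>e\<close> the idempotent at the target of \<open>\<alpha>\<close>.
\<close>

definition simple_syzygy_component where
  "simple_syzygy_component Q I P \<pi> S \<sigma> \<alpha> \<beta> =
    (let G = relation_quiver Q I; K = arrow_ideal_sq G; B = quiver_alg G K;
         q = (tail Q \<alpha>, [\<alpha>, \<beta>])
     in syzygy_component B P \<pi> (S \<beta>)
          (left_ideal_module B (residue G K (path_elt (\<alpha>, [])))) (S \<alpha>)
          (\<lambda>x. residue G K (\<lambda>r. \<sigma> \<beta> x * path_elt (\<alpha>, [q]) r))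
          (\<lambda>y. inv_into (carrier (S \<alpha>)) (\<sigma> \<alpha>) (residue_coeff y (\<alpha>, []))))"

definition ideal_syzygy_component where
  "ideal_syzygy_component Q I P \<pi> L \<tau> \<alpha> \<beta> =
    (let A = quiver_alg Q I
     in syzygy_component A P \<pi> (L \<beta>)
          (left_ideal_module A (residue Q I (path_elt (head Q \<alpha>, [])))) (L \<alpha>)
          (\<tau> \<beta>)
          (\<lambda>y. inv_into (carrier (L \<alpha>)) (\<tau> \<alpha>)
                 (y \<otimes>\<^bsub>A\<^esub> residue Q I (path_elt (tail Q \<alpha>, [\<alpha>])))))"

end

theory Submission
 imports Defs
begin

text \<open>
  Over the algebra with radical square zero a module is semisimple iff all arrows act as zero. Hence each
  homomorphism \<open>g\<close> of semisimple modules is regular: \<open>g s g = g\<close> for a sum \<open>s\<close> of maps through simple modules.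
  Regularity splits every left triangle of semisimple modules into trivial ones. The splitting is expressed by
  equations, which every additive functor commuting with the loop functors preserves, and a sequence satisfying
  these equations is a left triangle; so \<open>F\<close> is a triangle functor.

  Regularity of identities also reduces (S1) and (S2) to simple modules. If \<open>F\<close> annihilates the identity of
  \<open>S\<^sub>\<alpha>\<close>, then \<open>A\<alpha>\<close> is projective, no \<open>\<beta>\<alpha>\<close> is a relation, and \<open>S\<^sub>\<alpha>\<close> is projective; thus \<open>F\<close> is faithful.
  For \<open>g : A\<alpha> \<rightarrow> A\<alpha>'\<close>, \<open>g \<alpha> = y \<alpha>'\<close>, the relation \<open>\<beta>\<alpha> = 0\<close> gives \<open>\<beta> y \<alpha>' = 0\<close>; as the relations have length two,
  \<open>\<beta> y\<close> is a scalar multiple of \<open>\<beta>\<close> once the paths \<open>p\<close> with \<open>p \<alpha>' = 0\<close> are dropped from \<open>y\<close>. Therefore \<open>\<Omega> g\<close> maps each summand \<open>A\<beta>\<close> of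
  \<open>\<Omega>(A\<alpha>)\<close> to zero or to a multiple of the summand \<open>A\<beta>\<close> of \<open>\<Omega>(A\<alpha>')\<close>, which is (S1) with \<open>i = 1\<close>.

  For (S3) take \<open>i = 2\<close>. The module \<open>\<Omega>\<^sup>2 M\<close> lies in the radical of a projective module and, \<open>\<Omega> M\<close> being torsionless,
  contains with \<open>\<Sum> \<gamma> q\<^sub>\<gamma>\<close> all the \<open>\<gamma> q\<^sub>\<gamma>\<close>. A minimal generating set of elements \<open>\<gamma> q\<close> admits only relations \<open>\<Sum> a \<gamma> q = 0\<close> with all
  \<open>a \<gamma> = 0\<close>, by induction on the length of the paths in the coefficients; so \<open>\<Omega>\<^sup>2 M\<close> is a direct sum of ideals \<open>A\<gamma>\<close>.
\<close>

text \<open>Besides linearity, only the values of \<open>F\<close> on simple modules and the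
  components of \<open>\<delta>\<close> at single relations are given. Every claim about
  \<open>F\<close> is therefore written as an equation between finite sums of maps through simple
  modules, and additivity and naturality do the rest. Recognising a left triangle from equations
  needs a genuine short exact sequence. Stably, a map \<open>Y \<rightarrow> Z\<close> becomes
  surjective by adding the projective cover of \<open>Z\<close> to \<open>Y\<close>; the kernel then
  gives a triangle, and a five lemma identifies it with the given sequence. In \<open>A\<close>,
  products with different arrows on the left have no path in common, so a sum of such products
  vanishes only termwise. Functionals into \<open>A\<close> carry this over to submodules of
  projective modules, and (S3) rests on it: the first syzygy supplies the embedding, the second one
  the containment in a radical. Module elements come from one fixed type, and projectivity is tested
  against such modules only. Copies of \<open>A\<close> and of direct sums are thus built inside
  that type, by coding vectors as lists over the field.\<close>

abbreviation (input) smult_sub ("_ \<odot>\<^sub>_ _" [70, 1000, 71] 70) where "a\<odot>\<^sub>M x \<equiv> a \<odot>\<^bsub>M\<^esub> x"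
abbreviation (input) mult_sub ("_ \<otimes>\<^sub>_ _" [70, 1000, 71] 70) where "a\<otimes>\<^sub>R b \<equiv> a \<otimes>\<^bsub>R\<^esub> b"
abbreviation (input) add_sub ("_ \<oplus>\<^sub>_ _" [65, 1000, 66] 65) where "x \<oplus>\<^sub>M y \<equiv> x \<oplus>\<^bsub>M\<^esub> y"
abbreviation (input) minus_sub ("\<ominus>\<^sub>_ _" [1000, 81] 80) where "\<ominus>\<^sub>M x \<equiv> \<ominus>\<^bsub>M\<^esub> x"
abbreviation (input) zero_sub ("\<zero>\<^sub>_" [1000] 1000) where "\<zero>\<^sub>M \<equiv> \<zero>\<^bsub>M\<^esub>"
abbreviation (input) one_sub ("\<one>\<^sub>_" [1000] 1000) where "\<one>\<^sub>R \<equiv> \<one>\<^bsub>R\<^esub>"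

abbreviation (input) car where "car \<equiv> carrier"
abbreviation (input) cmps where "cmps M \<equiv> compose (carrier M)"

section \<open>Homomorphisms of left modules\<close>

context left_module
begin

lemma zero_lsmult: "x\<in>car M ==> \<zero>\<odot>\<^sub>M x = \<zero>\<^sub>M" using lsmult_l_distr[of \<zero> \<zero> x] lsmult_closed[of \<zero> x] by (simp add: M.add.l_cancel_one)

lemma lsmult_zero: "a\<in>car R ==> a\<odot>\<^sub>M \<zero>\<^sub>M = \<zero>\<^sub>M" using lsmult_r_distr[of a "\<zero>\<^sub>M" "\<zero>\<^sub>M"] lsmult_closed[of a "\<zero>\<^sub>M"] by (simp add: M.add.l_cancel_one)

lemma minus_lsmult: "a\<in>car R ==> x\<in>car M ==> (\<ominus> a)\<odot>\<^sub>M x = \<ominus>\<^sub>M (a\<odot>\<^sub>M x)"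
 using lsmult_l_distr[of "\<ominus> a" a x] by (simp add: l_neg zero_lsmult lsmult_closed M.minus_equality)

lemma lsmult_minus: "a\<in>car R ==> x\<in>car M ==> a\<odot>\<^sub>M (\<ominus>\<^sub>M x) = \<ominus>\<^sub>M (a\<odot>\<^sub>M x)"
 using lsmult_r_distr[of a "\<ominus>\<^sub>M x" x] by (simp add: M.l_neg lsmult_zero lsmult_closed M.minus_equality)

lemma minus_one_lsmult: "x\<in>car M ==> (\<ominus> \<one>)\<odot>\<^sub>M x = \<ominus>\<^sub>M x" by (simp add: minus_lsmult lsmult_one)

text \<open>Negatives come for free, being multiples by the negative of one.\<close>

lemma lsubmoduleI:
 assumes "H \<subseteq> car M" "\<zero>\<^sub>M\<in>H" "!!x y. x\<in>H ==> y\<in>H ==> x \<oplus>\<^sub>M y\<in>H"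
  "!!a x. a\<in>car R ==> x\<in>H ==> a\<odot>\<^sub>M x\<in>H"
 shows "submodule H R M"
proof -
 have "\<ominus>\<^sub>M x\<in>H" if "x\<in>H" for x using assms(1,4) minus_one_lsmult[of x] that by (metis a_inv_closed one_closed subsetD)
 thus ?thesis using assms by (auto simp: submodule_def submodule_axioms_def subgroup_def a_inv_def)
qed

lemma lsubmoduleD:
 assumes "submodule H R M"
 shows "H \<subseteq> car M" "\<zero>\<^sub>M\<in>H" "x\<in>H ==> y\<in>H ==> x \<oplus>\<^sub>M y\<in>H"
  "a\<in>car R ==> x\<in>H ==> a\<odot>\<^sub>M x\<in>H" "x\<in>H ==> \<ominus>\<^sub>M x\<in>H" using assms unfolding submodule_def submodule_axioms_def subgroup_def a_inv_def by auto

lemma lsubmodule_is_left_module: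
 assumes H: "submodule H R M"
 shows "left_module R (M\<lparr>carrier := H\<rparr>)"
proof -
 have "abelian_group (M\<lparr>carrier := H\<rparr>)"
 proof (rule abelian_groupI, goal_cases)
  case (6 x)
  thus ?case using lsubmoduleD[OF H] M.l_neg by (intro bexI[of _ "\<ominus>\<^sub>M x"]) auto
 qed (use lsubmoduleD[OF H] M.a_ac in \<open>auto simp: subset_iff\<close>)
 thus ?thesis using lsubmoduleD[OF H] by (auto simp: left_module_def left_module_axioms_def ring_axioms subset_iff
    lsmult_l_distr lsmult_r_distr lsmult_assoc lsmult_one)
qed

lemma zero_lsubmodule: "submodule {\<zero>\<^sub>M} R M" by (rule lsubmoduleI) (auto simp: lsmult_zero)

lemma diff_add: "x\<in>car M ==> y\<in>car M ==> y \<oplus>\<^sub>M (x \<oplus>\<^sub>M \<ominus>\<^sub>M y) = x" by (metis M.a_comm M.add.inv_closed M.add.m_closed M.minus_eq M.r_neg2)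

end

lemma mod_homD:
 assumes "f\<in>mod_hom R M N"
 shows hom_closed: "x\<in>car M ==> f x\<in>car N"
  and hom_add: "x\<in>car M ==> y\<in>car M ==> f (x \<oplus>\<^sub>M y) = f x \<oplus>\<^sub>N f y"
  and hom_smult: "a\<in>car R ==> x\<in>car M ==> f (a\<odot>\<^sub>M x) = a\<odot>\<^sub>N f x"
  and hom_ext: "f\<in>extensional (car M)" using assms unfolding mod_hom_def by (auto simp: PiE_def)

lemma mod_homI:
 assumes "!!x. x\<in>car M ==> f x\<in>car N"
  and "!!x y. x\<in>car M ==> y\<in>car M ==> f (x \<oplus>\<^sub>M y) = f x \<oplus>\<^sub>N f y"
  and "!!a x. a\<in>car R ==> x\<in>car M ==> f (a\<odot>\<^sub>M x) = a\<odot>\<^sub>N f x"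
  and "f\<in>extensional (car M)"
 shows "f\<in>mod_hom R M N" using assms unfolding mod_hom_def by (auto simp: PiE_def)

lemma hom_restrictI:
 assumes M: "left_module R M"
  and "!!x. x\<in>car M ==> f x\<in>car N"
  and "!!x y. x\<in>car M ==> y\<in>car M ==> f (x \<oplus>\<^sub>M y) = f x \<oplus>\<^sub>N f y"
  and "!!a x. a\<in>car R ==> x\<in>car M ==> f (a\<odot>\<^sub>M x) = a\<odot>\<^sub>N f x"
 shows "(\<lambda>x\<in>car M. f x)\<in>mod_hom R M N"
proof -
 interpret M: left_module R M by fact
 show ?thesis by (rule mod_homI) (use assms in \<open>auto simp: M.lsmult_closed\<close>)
qed

lemma hom_eqI:
 "f\<in>mod_hom R M N ==> g\<in>mod_hom R M N ==> (!!x. x\<in>car M ==> f x = g x) ==> f = g" by (metis extensionalityI hom_ext)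

lemma hom_zero:
 assumes "left_module R M" "left_module R N" "f\<in>mod_hom R M N"
 shows "f \<zero>\<^sub>M = \<zero>\<^sub>N"
proof -
 interpret M: left_module R M by fact
 interpret N: left_module R N by fact
 have "f (\<zero>\<^sub>M \<oplus>\<^sub>M \<zero>\<^sub>M) = f \<zero>\<^sub>M \<oplus>\<^sub>N f \<zero>\<^sub>M" using assms by (intro hom_add) auto
 thus ?thesis using hom_closed[OF assms(3), of "\<zero>\<^sub>M"] by (simp add: N.M.add.l_cancel_one)
qed

lemma hom_minus:
 assumes "left_module R M" "left_module R N" "f\<in>mod_hom R M N" "x\<in>car M"
 shows "f (\<ominus>\<^sub>M x) = \<ominus>\<^sub>N f x"
proof -
 interpret M: left_module R M by fact
 interpret N: left_module R N by fact
 show ?thesis using assms hom_smult[OF assms(3), of "\<ominus>\<^sub>R \<one>\<^sub>R" x] hom_closed[OF assms(3)] by (simp add: M.minus_one_lsmult N.minus_one_lsmult)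
qed

lemma hom_compose:
 assumes "f\<in>mod_hom R L M" "g\<in>mod_hom R M N" "left_module R L"
 shows "cmps L g f\<in>mod_hom R L N"
proof -
 interpret L: left_module R L by fact
 show ?thesis unfolding compose_def by (rule hom_restrictI)
   (use assms in \<open>auto simp: L.lsmult_closed hom_closed[OF assms(1)] hom_closed[OF assms(2)]
    hom_add[OF assms(1)] hom_add[OF assms(2)] hom_smult[OF assms(1)] hom_smult[OF assms(2)]\<close>)
qed

definition hom_add where
 "hom_add M N f g = (\<lambda>x\<in>car M. f x \<oplus>\<^sub>N g x)"

definition hom_zero where
 "hom_zero M N = (\<lambda>x\<in>car M. \<zero>\<^sub>N)"

definition hom_minus where
 "hom_minus M N f = (\<lambda>x\<in>car M. \<ominus>\<^sub>N f x)"

definition hom_id where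
 "hom_id M = (\<lambda>x\<in>car M. x)"

lemma hom_apply [simp]:
 "x\<in>car M ==> hom_add M N f g x = f x \<oplus>\<^sub>N g x"
 "x\<in>car M ==> hom_zero M N x = \<zero>\<^sub>N"
 "x\<in>car M ==> hom_minus M N f x = \<ominus>\<^sub>N f x"
 "x\<in>car M ==> hom_id M x = x" by (simp_all add: hom_add_def hom_zero_def hom_minus_def hom_id_def)

lemma hom_add_in:
 assumes "left_module R M" "left_module R N" "f\<in>mod_hom R M N" "g\<in>mod_hom R M N"
 shows "hom_add M N f g\<in>mod_hom R M N"
proof -
 interpret M: left_module R M by fact
 interpret N: left_module R N by fact
 show ?thesis unfolding hom_add_def
 proof (rule hom_restrictI)
  fix x y assume "x\<in>car M" "y\<in>car M"
  thus "f (x \<oplus>\<^sub>M y) \<oplus>\<^sub>N g (x \<oplus>\<^sub>M y) = f x \<oplus>\<^sub>N g x \<oplus>\<^sub>N (f y \<oplus>\<^sub>N g y)"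
   by (simp add: hom_add[OF assms(3)] hom_add[OF assms(4)] hom_closed[OF assms(3)]
     hom_closed[OF assms(4)] N.M.a_ac)
 qed (use assms in \<open>auto simp: hom_smult[OF assms(3)] hom_smult[OF assms(4)] hom_closed[OF assms(3)]
     hom_closed[OF assms(4)] N.lsmult_r_distr\<close>)
qed

lemma hom_zero_in:
 assumes "left_module R M" "left_module R N"
 shows "hom_zero M N\<in>mod_hom R M N"
proof -
 interpret M: left_module R M by fact
 interpret N: left_module R N by fact
 show ?thesis unfolding hom_zero_def by (rule hom_restrictI) (use assms in \<open>auto simp: N.lsmult_zero\<close>)
qed

lemma hom_minus_in:
 assumes "left_module R M" "left_module R N" "f\<in>mod_hom R M N"
 shows "hom_minus M N f\<in>mod_hom R M N"
proof -
 interpret M: left_module R M by fact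
 interpret N: left_module R N by fact
 show ?thesis unfolding hom_minus_def by (rule hom_restrictI) (use assms in \<open>auto simp: hom_smult[OF assms(3)] hom_closed[OF assms(3)]
    hom_add[OF assms(3)] N.lsmult_minus N.M.minus_add\<close>)
qed

lemma hom_id_in: "left_module R M ==> hom_id M\<in>mod_hom R M M" unfolding hom_id_def by (rule hom_restrictI) auto

lemma hom_ker_submodule:
 assumes "left_module R M" "left_module R N" "f\<in>mod_hom R M N"
 shows "submodule (hom_ker M N f) R M"
proof -
 interpret M: left_module R M by fact
 interpret N: left_module R N by fact
 show ?thesis by (rule M.lsubmoduleI) (auto simp: hom_ker_def hom_add[OF assms(3)] hom_smult[OF assms(3)]
    hom_zero[OF assms] N.lsmult_zero M.lsmult_closed)
qed

lemma hom_restrict: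
 assumes "left_module R M" "submodule H R M" "f\<in>mod_hom R M N"
 shows "restrict f H\<in>mod_hom R (M\<lparr>carrier := H\<rparr>) N"
proof -
 interpret M: left_module R M by fact
 have sub: "left_module R (M\<lparr>carrier := H\<rparr>)" by (rule M.lsubmodule_is_left_module) fact
 show ?thesis using hom_restrictI[OF sub, of f N] M.lsubmoduleD[OF assms(2)]
  by (auto simp: subset_iff hom_add[OF assms(3)] hom_smult[OF assms(3)] hom_closed[OF assms(3)])
qed

lemma hom_corestrict:
 assumes "f\<in>mod_hom R M N" "!!x. x\<in>car M ==> f x\<in>H"
 shows "f\<in>mod_hom R M (N\<lparr>carrier := H\<rparr>)" using assms unfolding mod_hom_def by (auto simp: PiE_def)

lemma hom_corestrictD:
 assumes "f\<in>mod_hom R M (N\<lparr>carrier := H\<rparr>)" "H \<subseteq> car N"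
 shows "f\<in>mod_hom R M N" using assms unfolding mod_hom_def by (auto simp: PiE_def)

lemma hom_incl:
 assumes "left_module R M" "submodule H R M"
 shows "(\<lambda>x\<in>H. x)\<in>mod_hom R (M\<lparr>carrier := H\<rparr>) M"
proof -
 interpret M: left_module R M by fact
 have sub: "left_module R (M\<lparr>carrier := H\<rparr>)" by (rule M.lsubmodule_is_left_module) fact
 show ?thesis using hom_restrictI[OF sub, of "\<lambda>x. x" M] M.lsubmoduleD[OF assms(2)] by auto
qed

text \<open>The difference of \<open>p\<close> and \<open>q\<close> is killed by \<open>g\<close>,
  so it lies in the image of \<open>f\<close>, and injectivity of \<open>f\<close> makes its
  pointwise preimage linear. The conclusion is phrased as a sum, the form in which stable equality
  and exactness are used below.\<close>

lemma short_exact_factor: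
 assumes mods: "left_module R W" "left_module R X" "left_module R Y" "left_module R Z"
  and ex: "short_exact R X Y Z f g"
  and p: "p\<in>mod_hom R W Y" and q: "q\<in>mod_hom R W Y"
  and eq: "!!w. w\<in>car W ==> g (p w) = g (q w)"
 shows "\<exists>x\<in>mod_hom R W X. \<forall>w\<in>car W. p w = q w \<oplus>\<^sub>Y f (x w)"
proof -
 interpret W: left_module R W by fact
 interpret X: left_module R X by fact
 interpret Y: left_module R Y by fact
 interpret Z: left_module R Z by fact
 have f: "f\<in>mod_hom R X Y" and g: "g\<in>mod_hom R Y Z" and inj: "inj_on f (car X)"
  and im: "f ` car X = hom_ker Y Z g" using ex by (auto simp: short_exact_def)
 note [simp] = hom_closed[OF p] hom_closed[OF q] hom_closed[OF f] hom_closed[OF g]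
 define d where "d w = p w \<oplus>\<^sub>Y \<ominus>\<^sub>Y q w" for w
 have d: "d w\<in>f ` car X" if "w\<in>car W" for w unfolding im hom_ker_def using that
  by (auto simp: d_def hom_add[OF g] hom_minus[OF mods(3,4) g] eq Z.M.r_neg)
 define x where "x w = inv_into (car X) f (d w)" for w
 have x: "x w\<in>car X" "f (x w) = d w" if "w\<in>car W" for w using d[OF that] by (auto simp: x_def inv_into_into f_inv_into_f)
 have xeq: "x w = u" if "w\<in>car W" "u\<in>car X" "f u = d w" for u w using x[OF that(1)] that inj by (metis inj_onD)
 have "(\<lambda>w\<in>car W. x w)\<in>mod_hom R W X"
 proof (rule hom_restrictI[OF mods(1)])
  fix w v assume wv: "w\<in>car W" "v\<in>car W"
  show "x (w \<oplus>\<^sub>W v) = x w \<oplus>\<^sub>X x v" using wv x by (intro xeq) (auto simp: hom_add[OF f] d_def hom_add[OF p] hom_add[OF q]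
     Y.M.minus_add Y.M.a_ac)
 next
  fix a w assume wv: "a\<in>car R" "w\<in>car W"
  show "x (a\<odot>\<^sub>W w) = a\<odot>\<^sub>X x w" using wv x by (intro xeq) (auto simp: hom_smult[OF f] d_def hom_smult[OF p] hom_smult[OF q]
     Y.lsmult_r_distr Y.lsmult_minus W.lsmult_closed X.lsmult_closed)
 qed (rule x)
 moreover have "\<forall>w\<in>car W. p w = q w \<oplus>\<^sub>Y f ((\<lambda>w\<in>car W. x w) w)" using x by (auto simp: d_def Y.diff_add)
 ultimately show ?thesis by blast
qed

section \<open>Split triangles in preadditive categories with a loop functor\<close>

text \<open>The record of category data has no zero arrows, so they enter as the parameter
  \<open>Zero\<close>. Arrows are triples containing their source and target, as classes of stable
  maps do.\<close>

locale preadditive =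
 fixes C :: "('o, 'o \<times> 'c \<times> 'o, 'k) left_tri_cat" and Zero :: "'o => 'o => 'o \<times> 'c \<times> 'o"
 assumes cat: "is_category C"
  and arr_ends: "f\<in>Arr C X Y ==> fst f = X \<and> snd (snd f) = Y"
  and plus_in: "[|X\<in>Obj C; Y\<in>Obj C; f\<in>Arr C X Y; g\<in>Arr C X Y|] ==> Plus C f g\<in>Arr C X Y"
  and plus_assoc_in: "[|X\<in>Obj C; Y\<in>Obj C; f\<in>Arr C X Y; g\<in>Arr C X Y; h\<in>Arr C X Y|] ==>
   Plus C (Plus C f g) h = Plus C f (Plus C g h)"
  and plus_comm_in: "[|X\<in>Obj C; Y\<in>Obj C; f\<in>Arr C X Y; g\<in>Arr C X Y|] ==>
   Plus C f g = Plus C g f"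
  and zero_in: "[|X\<in>Obj C; Y\<in>Obj C|] ==> Zero X Y\<in>Arr C X Y"
  and plus_zero_in: "[|X\<in>Obj C; Y\<in>Obj C; f\<in>Arr C X Y|] ==> Plus C f (Zero X Y) = f"
  and neg_in: "[|X\<in>Obj C; Y\<in>Obj C; f\<in>Arr C X Y|] ==> \<exists>g\<in>Arr C X Y. Plus C f g = Zero X Y"
  and comp_plus_in: "[|X\<in>Obj C; Y\<in>Obj C; Z\<in>Obj C; f\<in>Arr C X Y; g\<in>Arr C X Y; h\<in>Arr C Y Z|] ==>
   Comp C h (Plus C f g) = Plus C (Comp C h f) (Comp C h g)"
  and plus_comp_in: "[|X\<in>Obj C; Y\<in>Obj C; Z\<in>Obj C; f\<in>Arr C X Y; g\<in>Arr C Y Z; h\<in>Arr C Y Z|] ==>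
   Comp C (Plus C g h) f = Plus C (Comp C g f) (Comp C h f)"
begin

abbreviation src :: "'o \<times> 'c \<times> 'o => 'o" where "src f \<equiv> fst f"
abbreviation tgt :: "'o \<times> 'c \<times> 'o => 'o" where "tgt f \<equiv> snd (snd f)"

text \<open>Since arrows know their ends, membership in a Hom set splits into one predicate and two
  equations, which the simplifier discharges without guessing intermediate objects.\<close>

definition arr where "arr f \<longleftrightarrow> src f\<in>Obj C \<and> tgt f\<in>Obj C \<and> f\<in>Arr C (src f) (tgt f)"

abbreviation cmp (infixr "\<cdot>" 75) where "g\<cdot>f \<equiv> Comp C g f"
abbreviation pls (infixl "\<boxplus>" 65) where "f \<boxplus> g \<equiv> Plus C f g"
abbreviation ide where "ide X \<equiv> Ident C X"

lemma arrI: "[|f\<in>Arr C X Y; X\<in>Obj C; Y\<in>Obj C|] ==> arr f \<and> src f = X \<and> tgt f = Y" using arr_ends[of f X Y] by (auto simp: arr_def)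

lemma arrD: "arr f ==> f\<in>Arr C (src f) (tgt f)" "arr f ==> src f\<in>Obj C" "arr f ==> tgt f\<in>Obj C" by (auto simp: arr_def)

lemma in_Arr: "arr f ==> src f = X ==> tgt f = Y ==> f\<in>Arr C X Y" by (auto simp: arr_def)

lemma comp_arr:
 assumes "arr f" "arr g" "tgt f = src g"
 shows "arr (g\<cdot>f) \<and> src (g\<cdot>f) = src f \<and> tgt (g\<cdot>f) = tgt g"
proof (rule arrI)
 show "g\<cdot>f\<in>Arr C (src f) (tgt g)" using cat assms arrD[of f] arrD[of g] unfolding is_category_def by metis
qed (use assms arrD in auto)

lemmas comp_simps [simp] = comp_arr[THEN conjunct1] comp_arr[THEN conjunct2, THEN conjunct1]
 comp_arr[THEN conjunct2, THEN conjunct2]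

lemma comp_assoc:
 assumes "arr f" "arr g" "arr h" "tgt f = src g" "tgt g = src h"
 shows "(h\<cdot>g)\<cdot>f = h\<cdot>(g\<cdot>f)"
proof -
 have *: "\<forall>W\<in>Obj C. \<forall>X\<in>Obj C. \<forall>Y\<in>Obj C. \<forall>Z\<in>Obj C. \<forall>f\<in>Arr C W X. \<forall>g\<in>Arr C X Y. \<forall>h\<in>Arr C Y Z.
    h\<cdot>(g\<cdot>f) = (h\<cdot>g)\<cdot>f" using cat unfolding is_category_def by blast
 show ?thesis using *[rule_format, of "src f" "src g" "src h" "tgt h" f g h] assms arrD[of f] arrD[of g] arrD[of h] by simp
qed

lemma ide_arr [simp]: "X\<in>Obj C ==> arr (ide X)" "X\<in>Obj C ==> src (ide X) = X" "X\<in>Obj C ==> tgt (ide X) = X"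
proof -
 assume X: "X\<in>Obj C"
 hence "ide X\<in>Arr C X X" using cat unfolding is_category_def by blast
 from arrI[OF this X X] show "arr (ide X)" "src (ide X) = X" "tgt (ide X) = X" by auto
qed

lemma comp_ide [simp]: "arr f ==> X = src f ==> f\<cdot>ide X = f" "arr f ==> Y = tgt f ==> ide Y\<cdot>f = f" using cat arrD[of f] unfolding is_category_def by blast+

lemma plus_arr:
 assumes "arr f" "arr g" "src f = src g" "tgt f = tgt g"
 shows "arr (f \<boxplus> g) \<and> src (f \<boxplus> g) = src g \<and> tgt (f \<boxplus> g) = tgt g" using assms arrD[of f] arrD[of g] by (intro arrI plus_in) auto

lemmas plus_simps [simp] = plus_arr[THEN conjunct1] plus_arr[THEN conjunct2, THEN conjunct1]
 plus_arr[THEN conjunct2, THEN conjunct2]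

lemma zero_arr [simp]: "X\<in>Obj C ==> Y\<in>Obj C ==> arr (Zero X Y)"
 "X\<in>Obj C ==> Y\<in>Obj C ==> src (Zero X Y) = X" "X\<in>Obj C ==> Y\<in>Obj C ==> tgt (Zero X Y) = Y" using arrI[OF zero_in, of X Y] by auto

lemma src_tgt_Obj [simp]: "arr f ==> src f\<in>Obj C" "arr f ==> tgt f\<in>Obj C" by (auto simp: arr_def)

lemma plus_assoc:
 "[|arr f; arr g; arr h; src f = src g; src g = src h; tgt f = tgt g; tgt g = tgt h|] ==>
  (f \<boxplus> g) \<boxplus> h = f \<boxplus> (g \<boxplus> h)" using plus_assoc_in[of "src h" "tgt h" f g h] arrD[of f] arrD[of g] arrD[of h] by simp

lemma plus_comm: "[|arr f; arr g; src f = src g; tgt f = tgt g|] ==> f \<boxplus> g = g \<boxplus> f"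
 using plus_comm_in[of "src g" "tgt g" f g] arrD[of f] arrD[of g] by simp

lemma plus_zero [simp]:
 "[|arr f; X = src f; Y = tgt f|] ==> f \<boxplus> Zero X Y = f"
 "[|arr f; X = src f; Y = tgt f|] ==> Zero X Y \<boxplus> f = f"
proof -
 assume f: "arr f" "X = src f" "Y = tgt f"
 show *: "f \<boxplus> Zero X Y = f" using plus_zero_in[of X Y f] f arrD[of f] by simp
 have "Zero X Y \<boxplus> f = f \<boxplus> Zero X Y" using f by (intro plus_comm) auto
 with * show "Zero X Y \<boxplus> f = f" by simp
qed

lemma neg_ex: "arr f ==> \<exists>g. arr g \<and> src g = src f \<and> tgt g = tgt f \<and> f \<boxplus> g = Zero (src f) (tgt f)"
 using neg_in[of "src f" "tgt f" f] arrD[of f] arrI by blast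

lemma comp_plus: "[|arr f; arr g; arr h; src f = src g; tgt f = tgt g; tgt g = src h|] ==>
  h\<cdot>(f \<boxplus> g) = h\<cdot>f \<boxplus> h\<cdot>g" using comp_plus_in[of "src g" "src h" "tgt h" f g h] arrD[of f] arrD[of g] arrD[of h] by simp

lemma plus_comp: "[|arr f; arr g; arr h; src g = src h; tgt g = tgt h; tgt f = src h|] ==>
  (g \<boxplus> h)\<cdot>f = g\<cdot>f \<boxplus> h\<cdot>f" using plus_comp_in[of "src f" "src h" "tgt h" f g h] arrD[of f] arrD[of g] arrD[of h] by simp

lemma plus_cancel:
 assumes "arr f" "arr g" "arr h" "src f = src h" "src g = src h" "tgt f = tgt h" "tgt g = tgt h"
  and eq: "f \<boxplus> h = g \<boxplus> h"
 shows "f = g"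
proof -
 obtain n where n: "arr n" "src n = src h" "tgt n = tgt h" "h \<boxplus> n = Zero (src h) (tgt h)" using neg_ex[of h] assms by auto
 have "f = f \<boxplus> (h \<boxplus> n)" using assms n by simp
 also have "\<dots> = (f \<boxplus> h) \<boxplus> n" using assms n by (intro plus_assoc[symmetric]) auto
 also have "\<dots> = g \<boxplus> (h \<boxplus> n)" unfolding eq using assms n by (intro plus_assoc) auto
 also have "\<dots> = g" using assms n by simp
 finally show ?thesis .
qed

lemma idem_plus_zero: "[|arr f; f \<boxplus> f = f|] ==> f = Zero (src f) (tgt f)" using plus_cancel[of f "Zero (src f) (tgt f)" f] by simp

lemma comp_zero [simp]:
 assumes "arr f"
 shows "X\<in>Obj C ==> Y = src f ==> f\<cdot>Zero X Y = Zero X (tgt f)"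
  and "Y\<in>Obj C ==> X = tgt f ==> Zero X Y\<cdot>f = Zero (src f) Y"
proof -
 show "f\<cdot>Zero X Y = Zero X (tgt f)" if "X\<in>Obj C" "Y = src f"
 proof -
  have "f\<cdot>Zero X Y = f\<cdot>(Zero X Y \<boxplus> Zero X Y)" using assms that by simp
  also have "\<dots> = f\<cdot>Zero X Y \<boxplus> f\<cdot>Zero X Y" using assms that by (intro comp_plus) auto
  finally show ?thesis using idem_plus_zero[of "f\<cdot>Zero X Y"] assms that by simp
 qed
 show "Zero X Y\<cdot>f = Zero (src f) Y" if "Y\<in>Obj C" "X = tgt f"
 proof -
  have "Zero X Y\<cdot>f = (Zero X Y \<boxplus> Zero X Y)\<cdot>f" using assms that by simp
  also have "\<dots> = Zero X Y\<cdot>f \<boxplus> Zero X Y\<cdot>f" using assms that by (intro plus_comp) auto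
  finally show ?thesis using idem_plus_zero[of "Zero X Y\<cdot>f"] assms that by simp
 qed
qed

lemma diff_ex:
 assumes "arr f" "arr g" "src f = src g" "tgt f = tgt g"
 shows "\<exists>d. arr d \<and> src d = src g \<and> tgt d = tgt g \<and> f = g \<boxplus> d"
proof -
 obtain n where n: "arr n" "src n = src g" "tgt n = tgt g" "g \<boxplus> n = Zero (src g) (tgt g)" using neg_ex[of g] assms by auto
 have "f = (g \<boxplus> n) \<boxplus> f" using assms n by simp
 also have "\<dots> = g \<boxplus> (n \<boxplus> f)" using assms n by (intro plus_assoc) auto
 finally show ?thesis using assms n by (intro exI[of _ "n \<boxplus> f"]) auto
qed

definition iso where
 "iso f g \<longleftrightarrow> arr f \<and> arr g \<and> src f = tgt g \<and> src g = tgt f \<and> g\<cdot>f = ide (src f) \<and> f\<cdot>g = ide (tgt f)"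

lemma iso_inverse_arrows:
 "X\<in>Obj C ==> Y\<in>Obj C ==> inverse_arrows C X Y f g \<longleftrightarrow> iso f g \<and> src f = X \<and> tgt f = Y" unfolding inverse_arrows_def iso_def using arrI arrD(1) by metis

lemma is_iso_iff: "X\<in>Obj C ==> Y\<in>Obj C ==> is_iso C X Y f \<longleftrightarrow> (\<exists>g. iso f g \<and> src f = X \<and> tgt f = Y)" by (auto simp: is_iso_def iso_inverse_arrows)

lemma iso_unique:
 assumes "iso f g" "iso f g'" shows "g = g'"
proof -
 have "g = g\<cdot>(f\<cdot>g')" using assms by (simp add: iso_def)
 also have "\<dots> = (g\<cdot>f)\<cdot>g'" using assms by (intro comp_assoc[symmetric]) (auto simp: iso_def)
 also have "\<dots> = g'" using assms by (simp add: iso_def)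
 finally show ?thesis .
qed

lemma inverse_of_eq:
 assumes f: "iso f g" "src f = X" "tgt f = Y"
 shows "inverse_of C X Y f = g"
proof -
 have "X\<in>Obj C" "Y\<in>Obj C" using f by (auto simp: iso_def)
 hence "inverse_arrows C X Y f = (\<lambda>g'. g' = g)" using f iso_unique[OF f(1)] by (intro ext) (metis iso_inverse_arrows)
 thus ?thesis by (simp add: inverse_of_def)
qed

lemma iso_sym: "iso f g ==> iso g f" by (auto simp: iso_def)

lemma iso_cancel_left:
 assumes "iso f g" "arr h" "tgt h = src f" shows "g\<cdot>(f\<cdot>h) = h" using assms comp_assoc[of h f g] by (simp add: iso_def)

end

section \<open>Exact and split sequences in a category with a loop functor\<close>

locale looped_preadditive = preadditive +
 assumes loop: "is_functor C C (LoopO C) (LoopA C)" and loop_add: "additive_on_arrows C C (LoopA C)"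
begin

abbreviation LO where "LO \<equiv> LoopO C"
abbreviation LA where "LA \<equiv> LoopA C"

lemma LO_Obj [simp]: "X\<in>Obj C ==> LO X\<in>Obj C" using loop by (auto simp: is_functor_def)

lemma LA_ide [simp]: "X\<in>Obj C ==> LA (ide X) = ide (LO X)" using loop by (auto simp: is_functor_def)

lemma LA_arr [simp]: "arr f ==> arr (LA f)" "arr f ==> src (LA f) = LO (src f)" "arr f ==> tgt (LA f) = LO (tgt f)"
proof -
 assume f: "arr f"
 have "LA f\<in>Arr C (LO (src f)) (LO (tgt f))" using loop f arrD[of f] by (auto simp: is_functor_def)
 from arrI[OF this] f show "arr (LA f)" "src (LA f) = LO (src f)" "tgt (LA f) = LO (tgt f)" by auto
qed

lemma LA_comp: "arr f ==> arr g ==> tgt f = src g ==> LA (g\<cdot>f) = LA g\<cdot>LA f" using loop arrD[of f] arrD[of g] unfolding is_functor_def by metis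

lemma LA_plus: "arr f ==> arr g ==> src f = src g ==> tgt f = tgt g ==> LA (f \<boxplus> g) = LA f \<boxplus> LA g"
 using loop_add arrD[of f] arrD[of g] unfolding additive_on_arrows_def by metis

lemma LA_zero [simp]: "X\<in>Obj C ==> Y\<in>Obj C ==> LA (Zero X Y) = Zero (LO X) (LO Y)"
 using LA_plus[of "Zero X Y" "Zero X Y"] idem_plus_zero[of "LA (Zero X Y)"] by simp

lemma LA_iso: "iso f g ==> iso (LA f) (LA g)" unfolding iso_def using LA_comp[of f g] LA_comp[of g f] by auto

definition complex where
 "complex h f g \<longleftrightarrow> arr h \<and> arr f \<and> arr g \<and> src h = LO (tgt g) \<and> tgt h = src f \<and> tgt f = src g \<and>
   g\<cdot>f = Zero (src f) (tgt g) \<and> f\<cdot>h = Zero (src h) (tgt f) \<and> h\<cdot>LA g = Zero (LO (src g)) (tgt h)"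

text \<open>Three weak kernel conditions: the Hom functors out of all objects turn the sequence,
  continued to the left by \<open>LA g\<close>, into one that is exact at \<open>src g\<close>,
  \<open>src f\<close> and \<open>src h\<close>. Writing \<open>k = l \<boxplus> f\<cdot>x\<close>
  spares a notation for negatives.\<close>

definition exact where
 "exact h f g \<longleftrightarrow> complex h f g \<and>
  (\<forall>k l. arr k \<and> arr l \<and> src k = src l \<and> tgt k = src g \<and> tgt l = src g \<and> g\<cdot>k = g\<cdot>l \<longrightarrow>
    (\<exists>x. arr x \<and> src x = src l \<and> tgt x = src f \<and> k = l \<boxplus> f\<cdot>x)) \<and>
  (\<forall>k l. arr k \<and> arr l \<and> src k = src l \<and> tgt k = src f \<and> tgt l = src f \<and> f\<cdot>k = f\<cdot>l \<longrightarrow>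
    (\<exists>x. arr x \<and> src x = src l \<and> tgt x = src h \<and> k = l \<boxplus> h\<cdot>x)) \<and>
  (\<forall>k l. arr k \<and> arr l \<and> src k = src l \<and> tgt k = src h \<and> tgt l = src h \<and> h\<cdot>k = h\<cdot>l \<longrightarrow>
    (\<exists>x. arr x \<and> src x = src l \<and> tgt x = LO (src g) \<and> k = l \<boxplus> LA g\<cdot>x))"

text \<open>The data of a direct sum of trivial triangles; they are preserved by additive looped functors.\<close>

definition splitting where
 "splitting h f g r s t \<longleftrightarrow> complex h f g \<and> arr r \<and> arr s \<and> arr t \<and>
   src r = tgt f \<and> tgt r = src f \<and> src s = tgt g \<and> tgt s = src g \<and> src t = tgt h \<and> tgt t = src h \<and>
   h\<cdot>t \<boxplus> r\<cdot>f = ide (src f) \<and> f\<cdot>r \<boxplus> s\<cdot>g = ide (src g) \<and>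
   t\<cdot>h \<boxplus> LA (g\<cdot>s) = ide (src h)"

lemma exactD:
 assumes "exact h f g"
 shows "complex h f g"
  "[|arr k; arr l; src k = src l; tgt k = src g; tgt l = src g; g\<cdot>k = g\<cdot>l|] ==>
    \<exists>x. arr x \<and> src x = src l \<and> tgt x = src f \<and> k = l \<boxplus> f\<cdot>x"
  "[|arr k; arr l; src k = src l; tgt k = src f; tgt l = src f; f\<cdot>k = f\<cdot>l|] ==>
    \<exists>x. arr x \<and> src x = src l \<and> tgt x = src h \<and> k = l \<boxplus> h\<cdot>x"
  "[|arr k; arr l; src k = src l; tgt k = src h; tgt l = src h; h\<cdot>k = h\<cdot>l|] ==>
    \<exists>x. arr x \<and> src x = src l \<and> tgt x = LO (src g) \<and> k = l \<boxplus> LA g\<cdot>x" using assms unfolding exact_def by blast+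

text \<open>Regularity makes \<open>s\<cdot>g\<close> idempotent, so exactness at the middle yields
  \<open>r\<close>, and exactness at the next place yields a first candidate for \<open>t\<close>.
  Exactness at the loop object then shows that this candidate is wrong only by something in the
  image of \<open>LA g\<close>.\<close>

lemma splitting_if_regular:
 assumes ex: "exact h f g" and s: "arr s" "src s = tgt g" "tgt s = src g" and reg: "g\<cdot>(s\<cdot>g) = g"
 shows "\<exists>r t. splitting h f g r s t"
proof -
 have cx: "complex h f g" using exactD(1)[OF ex] .
 hence [simp]: "arr h" "arr f" "arr g" "src h = LO (tgt g)" "tgt h = src f" "tgt f = src g" by (auto simp: complex_def)
 have gf: "g\<cdot>f = Zero (src f) (tgt g)" and fh: "f\<cdot>h = Zero (src h) (tgt f)"
  and hg: "h\<cdot>LA g = Zero (LO (src g)) (tgt h)" using cx by (auto simp: complex_def)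
 note [simp] = s
 have "g\<cdot>ide (src g) = g\<cdot>(s\<cdot>g)" using reg by simp
 then obtain r where r [simp]: "arr r" "src r = src g" "tgt r = src f" and "ide (src g) = s\<cdot>g \<boxplus> f\<cdot>r"
  using exactD(2)[OF ex, of "ide (src g)" "s\<cdot>g"] by auto
 hence fr: "f\<cdot>r \<boxplus> s\<cdot>g = ide (src g)" by (simp add: plus_comm[of "f\<cdot>r"])
 have "f\<cdot>(r\<cdot>f) = (f\<cdot>r)\<cdot>f \<boxplus> (s\<cdot>g)\<cdot>f" using gf by (simp add: comp_assoc)
 also have "\<dots> = f" using fr by (simp flip: plus_comp)
 finally have frf: "f\<cdot>(r\<cdot>f) = f" .
 hence "f\<cdot>ide (src f) = f\<cdot>(r\<cdot>f)" by simp
 then obtain t where t [simp]: "arr t" "src t = src f" "tgt t = LO (tgt g)" and rt: "ide (src f) = r\<cdot>f \<boxplus> h\<cdot>t"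
  using exactD(3)[OF ex, of "ide (src f)" "r\<cdot>f"] by auto
 let ?e = "LA (g\<cdot>s)"
 have e: "?e = LA g\<cdot>LA s" by (simp add: LA_comp)
 have he: "h\<cdot>(?e\<cdot>x) = Zero (src x) (src f)" if [simp]: "arr x" "tgt x = LO (tgt g)" for x
 proof -
  have "h\<cdot>(?e\<cdot>x) = (h\<cdot>LA g)\<cdot>(LA s\<cdot>x)" by (simp add: e comp_assoc)
  thus ?thesis using hg by simp
 qed
 have "h = (r\<cdot>f \<boxplus> h\<cdot>t)\<cdot>h" by (simp flip: rt)
 also have "\<dots> = r\<cdot>(f\<cdot>h) \<boxplus> h\<cdot>(t\<cdot>h)" by (simp add: plus_comp comp_assoc)
 also have "\<dots> = h\<cdot>(t\<cdot>h)" by (simp add: fh)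
 finally have "h\<cdot>ide (src h) = h\<cdot>(t\<cdot>h)" by simp
 then obtain y where y [simp]: "arr y" "src y = LO (tgt g)" "tgt y = LO (src g)"
  and th: "ide (src h) = t\<cdot>h \<boxplus> LA g\<cdot>y" using exactD(4)[OF ex, of "ide (src h)" "t\<cdot>h"] by auto
 \<comment> \<open>Removing from \<open>t\<close> its part in the image of the idempotent
   \<open>?e\<close> leaves \<open>h\<cdot>t\<close> unchanged, as \<open>h\<close> kills that
   image, and makes \<open>t'\<cdot>h\<close> complementary to \<open>?e\<close>.\<close>
 obtain t' where t' [simp]: "arr t'" "src t' = src f" "tgt t' = LO (tgt g)" and tt': "t = ?e\<cdot>t \<boxplus> t'" using diff_ex[of t "?e\<cdot>t"] by auto
 have "h\<cdot>t = h\<cdot>(?e\<cdot>t) \<boxplus> h\<cdot>t'" by (subst tt') (simp add: comp_plus)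
 hence ht': "h\<cdot>t' = h\<cdot>t" by (simp add: he)
 have eg: "?e\<cdot>LA g = LA g" using LA_comp[of g "g\<cdot>s"] reg by (simp add: comp_assoc)
 have "?e = ?e\<cdot>(t\<cdot>h \<boxplus> LA g\<cdot>y)" by (simp flip: th)
 also have "\<dots> = ?e\<cdot>(t\<cdot>h) \<boxplus> (?e\<cdot>LA g)\<cdot>y" by (simp add: comp_plus comp_assoc)
 finally have e2: "?e = ?e\<cdot>(t\<cdot>h) \<boxplus> LA g\<cdot>y" by (simp add: eg)
 have "t'\<cdot>h \<boxplus> ?e = t'\<cdot>h \<boxplus> (?e\<cdot>(t\<cdot>h) \<boxplus> LA g\<cdot>y)" using e2 by simp
 also have "\<dots> = (?e\<cdot>t \<boxplus> t')\<cdot>h \<boxplus> LA g\<cdot>y" using plus_comm[of "t'\<cdot>h" "?e\<cdot>(t\<cdot>h)"] by (simp add: plus_comp comp_assoc flip: plus_assoc)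
 also have "\<dots> = ide (src h)" using tt' th by simp
 finally have "t'\<cdot>h \<boxplus> ?e = ide (src h)" .
 hence "splitting h f g r s t'" using cx fr rt by (simp add: splitting_def ht' plus_comm[of "h\<cdot>t"])
 thus ?thesis by blast
qed

text \<open>All data are conjugated by the three isomorphisms; at the loop object the conjugation is
  by \<open>LA c\<close>.\<close>

lemma splitting_iso:
 assumes sp: "splitting h' f' g' r' s' t'"
  and isos: "iso a a'" "iso b b'" "iso c c'"
  and ends: "tgt a = src f'" "tgt b = src g'" "tgt c = tgt g'"
  and arrs: "arr h" "arr f" "arr g" "src h = LO (tgt g)" "tgt h = src f" "tgt f = src g"
  and ends': "src a = src f" "src b = src g" "src c = tgt g"
  and sq: "a\<cdot>h = h'\<cdot>LA c" "b\<cdot>f = f'\<cdot>a" "c\<cdot>g = g'\<cdot>b"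
 shows "\<exists>r s t. splitting h f g r s t"
proof -
 have [simp]: "arr h'" "arr f'" "arr g'" "src h' = LO (tgt g')" "tgt h' = src f'" "tgt f' = src g'"
  "arr r'" "arr s'" "arr t'" "src r' = src g'" "tgt r' = src f'" "src s' = tgt g'" "tgt s' = src g'"
  "src t' = src f'" "tgt t' = LO (tgt g')" using sp by (auto simp: splitting_def complex_def)
 have z: "g'\<cdot>f' = Zero (src f') (tgt g')" "f'\<cdot>h' = Zero (src h') (tgt f')"
  "h'\<cdot>LA g' = Zero (LO (src g')) (tgt h')"
  "h'\<cdot>t' \<boxplus> r'\<cdot>f' = ide (src f')" "f'\<cdot>r' \<boxplus> s'\<cdot>g' = ide (src g')"
   "t'\<cdot>h' \<boxplus> LA (g'\<cdot>s') = ide (src h')" using sp by (auto simp: splitting_def complex_def)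
 note [simp] = arrs ends ends'
 have [simp]: "arr a" "arr b" "arr c" "arr a'" "arr b'" "arr c'"
  "src a' = src f'" "src b' = src g'" "src c' = tgt g'" "tgt a' = src f" "tgt b' = src g" "tgt c' = tgt g" using isos by (auto simp: iso_def)
 note canc = iso_cancel_left[OF isos(1)] iso_cancel_left[OF isos(2)] iso_cancel_left[OF isos(3)]
  iso_cancel_left[OF iso_sym[OF isos(1)]] iso_cancel_left[OF iso_sym[OF isos(2)]] iso_cancel_left[OF iso_sym[OF isos(3)]]
  iso_cancel_left[OF LA_iso[OF isos(3)]] iso_cancel_left[OF iso_sym[OF LA_iso[OF isos(3)]]]
 have h: "h = a'\<cdot>(h'\<cdot>LA c)" using canc(1)[of h] sq(1) by simp
 have f: "f = b'\<cdot>(f'\<cdot>a)" using canc(2)[of f] sq(2) by simp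
 have g: "g = c'\<cdot>(g'\<cdot>b)" using canc(3)[of g] sq(3) by simp
 have ids: "a'\<cdot>a = ide (src f)" "b'\<cdot>b = ide (src g)" "LA c'\<cdot>LA c = ide (LO (tgt g))" using isos(1,2) LA_iso[OF isos(3)] by (auto simp: iso_def)
 define r s t where rst: "r = a'\<cdot>(r'\<cdot>b)" "s = b'\<cdot>(s'\<cdot>c)" "t = LA c'\<cdot>(t'\<cdot>a)"
 have [simp]: "arr r" "arr s" "arr t" "src r = src g" "tgt r = src f" "src s = tgt g" "tgt s = src g"
  "src t = src f" "tgt t = LO (tgt g)" by (auto simp: rst)
 have 1: "g\<cdot>f = c'\<cdot>((g'\<cdot>f')\<cdot>a)"
  apply (subst g, subst f) using canc(5) by (simp add: comp_assoc)
 have 2: "f\<cdot>h = b'\<cdot>((f'\<cdot>h')\<cdot>LA c)"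
  apply (subst f, subst h) using canc(4) by (simp add: comp_assoc)
 have LAg: "LA g = LA c'\<cdot>(LA g'\<cdot>LA b)" by (subst g) (simp add: LA_comp)
 have 3: "h\<cdot>LA g = a'\<cdot>((h'\<cdot>LA g')\<cdot>LA b)"
  apply (subst LAg, subst h) using canc(8) by (simp add: comp_assoc)
 have 4: "h\<cdot>t \<boxplus> r\<cdot>f = a'\<cdot>((h'\<cdot>t' \<boxplus> r'\<cdot>f')\<cdot>a)"
 proof -
  have "h\<cdot>t = a'\<cdot>((h'\<cdot>t')\<cdot>a)"
   apply (subst h, subst rst(3)) using canc(8) by (simp add: comp_assoc)
  moreover have "r\<cdot>f = a'\<cdot>((r'\<cdot>f')\<cdot>a)"
   apply (subst f, subst rst(1)) using canc(5) by (simp add: comp_assoc)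
  ultimately show ?thesis by (simp add: plus_comp comp_plus)
 qed
 have 5: "f\<cdot>r \<boxplus> s\<cdot>g = b'\<cdot>((f'\<cdot>r' \<boxplus> s'\<cdot>g')\<cdot>b)"
 proof -
  have "f\<cdot>r = b'\<cdot>((f'\<cdot>r')\<cdot>b)"
   apply (subst f, subst rst(1)) using canc(4) by (simp add: comp_assoc)
  moreover have "s\<cdot>g = b'\<cdot>((s'\<cdot>g')\<cdot>b)"
   apply (subst g, subst rst(2)) using canc(6) by (simp add: comp_assoc)
  ultimately show ?thesis by (simp add: plus_comp comp_plus)
 qed
 have 6: "t\<cdot>h \<boxplus> LA (g\<cdot>s) = LA c'\<cdot>((t'\<cdot>h' \<boxplus> LA (g'\<cdot>s'))\<cdot>LA c)"
 proof -
  have "t\<cdot>h = LA c'\<cdot>((t'\<cdot>h')\<cdot>LA c)"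
   apply (subst h, subst rst(3)) using canc(4) by (simp add: comp_assoc)
  moreover have "g\<cdot>s = c'\<cdot>((g'\<cdot>s')\<cdot>c)"
   apply (subst g, subst rst(2)) using canc(5) by (simp add: comp_assoc)
  ultimately show ?thesis by (simp add: plus_comp comp_plus LA_comp)
 qed
 have "splitting h f g r s t" unfolding splitting_def complex_def 1 2 3 4 5 6 z by (simp add: ids)
 thus ?thesis by blast
qed

text \<open>The comparison is the five lemma, for the functors represented by \<open>src f'\<close> and \<open>src f\<close>.\<close>

lemma splitting_compare:
 assumes sp: "splitting h f g r s t" and ex: "exact h' f' g'"
  and b: "iso b b'" "src b = src g" "tgt b = src g'" and gb: "g = g'\<cdot>b"
 shows "\<exists>a a'. iso a a' \<and> src a = src f \<and> tgt a = src f' \<and> a\<cdot>h = h' \<and> b\<cdot>f = f'\<cdot>a"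
proof -
 have cx: "complex h' f' g'" using exactD(1)[OF ex] .
 have [simp]: "arr h" "arr f" "arr g" "tgt h = src f" "tgt f = src g"
  "arr r" "arr s" "arr t" "src r = src g" "tgt r = src f" "src s = tgt g" "tgt s = src g"
  "src t = src f" "arr h'" "arr f'" "arr g'" "src h' = LO (tgt g')" "tgt h' = src f'" "tgt f' = src g'"
  using sp cx by (auto simp: splitting_def complex_def)
 have [simp]: "arr b" "arr b'" "src b' = src g'" "tgt b' = src g" using b by (auto simp: iso_def)
 note [simp] = b(2,3)
 have [simp]: "tgt g = tgt g'" using gb by simp
 have [simp]: "src h = LO (tgt g')" "tgt t = LO (tgt g')" using sp by (auto simp: splitting_def complex_def)
 have z: "g\<cdot>f = Zero (src f) (tgt g')" "f\<cdot>h = Zero (LO (tgt g')) (src g)"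
  "h\<cdot>LA g = Zero (LO (src g)) (src f)"
  "h\<cdot>t \<boxplus> r\<cdot>f = ide (src f)" "f\<cdot>r \<boxplus> s\<cdot>g = ide (src g)"
  "t\<cdot>h \<boxplus> LA (g\<cdot>s) = ide (LO (tgt g'))"
  and z': "g'\<cdot>f' = Zero (src f') (tgt g')" "f'\<cdot>h' = Zero (LO (tgt g')) (src g')"
  "h'\<cdot>LA g' = Zero (LO (src g')) (src f')" using sp cx by (auto simp: splitting_def complex_def)
 have "(g'\<cdot>b)\<cdot>f = Zero (src f) (tgt g')" using z(1) by (simp only: gb[symmetric])
 hence "g'\<cdot>(b\<cdot>f) = g'\<cdot>Zero (src f) (src g')" by (simp add: comp_assoc)
 then obtain p where p [simp]: "arr p" "src p = src f" "tgt p = src f'" and "b\<cdot>f = Zero (src f) (src g') \<boxplus> f'\<cdot>p"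
  using exactD(2)[OF ex, of "b\<cdot>f" "Zero (src f) (src g')"] by auto
 hence fp: "f'\<cdot>p = b\<cdot>f" by simp
 \<comment> \<open>The map \<open>p\<close> over \<open>b\<close> is determined only up to maps
   through \<open>h'\<close>. This choice uses \<open>p\<close> on the part \<open>r\<cdot>f\<close>
   of the splitting and \<open>h'\<close> on the part \<open>h\<cdot>t\<close>, which forces
   \<open>a\<cdot>h = h'\<close>.\<close>
 define a where "a = p\<cdot>(r\<cdot>f) \<boxplus> h'\<cdot>t"
 have [simp]: "arr a" "src a = src f" "tgt a = src f'" by (auto simp: a_def)
 have "f\<cdot>(r\<cdot>f) = (f\<cdot>r)\<cdot>f \<boxplus> (s\<cdot>g)\<cdot>f" using z(1) by (simp add: comp_assoc)
 also have "\<dots> = f" using z(5) by (simp flip: plus_comp)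
 finally have frf: "f\<cdot>(r\<cdot>f) = f" .
 have "f'\<cdot>a = (f'\<cdot>p)\<cdot>(r\<cdot>f) \<boxplus> (f'\<cdot>h')\<cdot>t" by (simp add: a_def comp_plus comp_assoc)
 also have "\<dots> = b\<cdot>f" by (simp add: fp z' comp_assoc frf)
 finally have fa: "f'\<cdot>a = b\<cdot>f" .
 have hgs: "h'\<cdot>LA (g\<cdot>s) = Zero (LO (tgt g')) (src f')"
 proof -
  have "LA (g\<cdot>s) = LA g'\<cdot>(LA b\<cdot>LA s)" by (subst gb) (simp add: LA_comp comp_assoc)
  hence "h'\<cdot>LA (g\<cdot>s) = (h'\<cdot>LA g')\<cdot>(LA b\<cdot>LA s)" by (simp add: comp_assoc)
  thus ?thesis by (simp add: z')
 qed
 have "h' = h'\<cdot>(t\<cdot>h \<boxplus> LA (g\<cdot>s))" using z(6) by simp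
 also have "\<dots> = h'\<cdot>(t\<cdot>h)" by (simp add: comp_plus hgs)
 finally have hth: "h'\<cdot>(t\<cdot>h) = h'" by simp
 have ah: "a\<cdot>h = h'" using hth by (simp add: a_def plus_comp comp_assoc z(2))
 have "g\<cdot>(b'\<cdot>f') = g'\<cdot>(b\<cdot>(b'\<cdot>f'))" by (subst gb) (simp add: comp_assoc)
 also have "\<dots> = Zero (src f') (tgt g')" using iso_cancel_left[OF iso_sym[OF b(1)], of f'] z' by simp
 finally have gbf: "g\<cdot>(b'\<cdot>f') = Zero (src f') (tgt g')" .
 define x where "x = r\<cdot>(b'\<cdot>f')"
 have [simp]: "arr x" "src x = src f'" "tgt x = src f" by (auto simp: x_def)
 have "f\<cdot>x = (f\<cdot>r)\<cdot>(b'\<cdot>f') \<boxplus> (s\<cdot>g)\<cdot>(b'\<cdot>f')" using gbf by (simp add: x_def comp_assoc)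
 also have "\<dots> = b'\<cdot>f'" using z(5) by (simp flip: plus_comp)
 finally have fx: "f\<cdot>x = b'\<cdot>f'" .
 have "f'\<cdot>(a\<cdot>x) = b\<cdot>(f\<cdot>x)" using fa by (simp flip: comp_assoc)
 also have "\<dots> = f'" using fx iso_cancel_left[OF iso_sym[OF b(1)], of f'] by simp
 finally have "f'\<cdot>ide (src f') = f'\<cdot>(a\<cdot>x)" by simp
 then obtain w where w [simp]: "arr w" "src w = src f'" "tgt w = LO (tgt g')"
  and aw: "ide (src f') = a\<cdot>x \<boxplus> h'\<cdot>w" using exactD(3)[OF ex, of "ide (src f')" "a\<cdot>x"] by auto
 \<comment> \<open>\<open>x\<close> is a right inverse of \<open>a\<close> up to a map through
   \<open>h'\<close>; because \<open>a\<cdot>h = h'\<close>, adding \<open>h\<cdot>w\<close> removes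
   the defect.\<close>
 define q where "q = x \<boxplus> h\<cdot>w"
 have [simp]: "arr q" "src q = src f'" "tgt q = src f" by (auto simp: q_def)
 have aq: "a\<cdot>q = ide (src f')" using aw ah by (simp add: q_def comp_plus flip: comp_assoc)
 \<comment> \<open>Cancelling \<open>a\<close> on the left suffices, because
   \<open>a\<cdot>(q\<cdot>a)\<close> equals \<open>a\<close>. Both components of \<open>y\<close>
   in the splitting can be recovered from \<open>a\<cdot>y\<close>: the first because
   \<open>b\<close> is invertible, the second up to a map through \<open>LA g'\<close>, whose
   contribution \<open>h\<close> kills.\<close>
 have inj: "y = y'" if [simp]: "arr y" "arr y'" "src y = src y'" "tgt y = src f" "tgt y' = src f"
  and eq: "a\<cdot>y = a\<cdot>y'" for y y'
 proof -
  have ay: "a\<cdot>v = p\<cdot>(r\<cdot>(f\<cdot>v)) \<boxplus> h'\<cdot>(t\<cdot>v)" if "arr v" "tgt v = src f" for v using that by (simp add: a_def plus_comp comp_assoc)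
  have dec: "v = h\<cdot>(t\<cdot>v) \<boxplus> r\<cdot>(f\<cdot>v)" if "arr v" "tgt v = src f" for v
  proof -
   have "v = (h\<cdot>t \<boxplus> r\<cdot>f)\<cdot>v" using that z(4) by simp
   thus ?thesis using that by (simp add: plus_comp comp_assoc)
  qed
  have "b\<cdot>(f\<cdot>y) = b\<cdot>(f\<cdot>y')" using arg_cong[OF eq, of "\<lambda>v. f'\<cdot>v"] fa by (simp flip: comp_assoc)
  hence "b'\<cdot>(b\<cdot>(f\<cdot>y)) = b'\<cdot>(b\<cdot>(f\<cdot>y'))" by simp
  hence fy: "f\<cdot>y = f\<cdot>y'" using iso_cancel_left[OF b(1), of "f\<cdot>y"] iso_cancel_left[OF b(1), of "f\<cdot>y'"] by simp
  have "h'\<cdot>(t\<cdot>y) \<boxplus> p\<cdot>(r\<cdot>(f\<cdot>y)) = h'\<cdot>(t\<cdot>y') \<boxplus> p\<cdot>(r\<cdot>(f\<cdot>y))" using eq ay[of y] ay[of y'] fy by (simp add: plus_comm[of "h'\<cdot>_"])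
  hence "h'\<cdot>(t\<cdot>y) = h'\<cdot>(t\<cdot>y')" by (rule plus_cancel[rotated -1]) auto
  then obtain u where u [simp]: "arr u" "src u = src y'" "tgt u = LO (src g')" and ty: "t\<cdot>y = t\<cdot>y' \<boxplus> LA g'\<cdot>u"
   using exactD(4)[OF ex, of "t\<cdot>y" "t\<cdot>y'"] by auto
  have "LA g' = LA g\<cdot>LA b'"
  proof -
   have "LA g\<cdot>LA b' = LA g'\<cdot>(LA b\<cdot>LA b')" by (subst gb) (simp add: LA_comp comp_assoc)
   thus ?thesis using LA_iso[OF b(1)] by (simp add: iso_def)
  qed
  hence "h\<cdot>(LA g'\<cdot>u) = (h\<cdot>LA g)\<cdot>(LA b'\<cdot>u)" by (simp add: comp_assoc)
  hence "h\<cdot>(LA g'\<cdot>u) = Zero (src y') (src f)" by (simp add: z)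
  hence "h\<cdot>(t\<cdot>y) = h\<cdot>(t\<cdot>y')" unfolding ty by (simp add: comp_plus)
  thus "y = y'" using dec[of y] dec[of y'] fy by simp
 qed
 have "q\<cdot>a = ide (src f)"
 proof (rule inj)
  show "a\<cdot>(q\<cdot>a) = a\<cdot>ide (src f)" using aq comp_assoc[of a q a] by simp
 qed auto
 hence "iso a q" using aq by (simp add: iso_def)
 thus ?thesis using ah fa by (intro exI[of _ a] exI[of _ q]) simp
qed

end

section \<open>Stable module categories\<close>

lemma fg_modD: "M\<in>fg_mod R ==> left_module R M" by (simp add: fg_mod_def)

lemma steq_homs: "stably_equal R M N f g ==> f\<in>mod_hom R M N \<and> g\<in>mod_hom R M N" by (simp add: stably_equal_def)

text \<open>Closure of finitely generated modules under submodules keeps syzygies inside the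
  category; centrality of the scalars makes scalar multiples of homomorphisms linear.\<close>

locale stable_modules = ring R for R :: "'a ring" (structure) +
 fixes \<rho> :: "'k::field => 'a" and P :: "('a, 'm) module => ('a, 'm) module" and \<pi> :: "('a, 'm) module => 'm => 'm"
 assumes covers: "projective_covers R P \<pi>"
  and sub_fg: "!!M N. (M :: ('a, 'm) module)\<in>fg_mod R ==> submodule N R M ==> M\<lparr>carrier := N\<rparr>\<in>fg_mod R"
  and \<rho>_closed: "\<rho> c\<in>car R"
  and \<rho>_central: "a\<in>car R ==> \<rho> c\<otimes>a = a\<otimes>\<rho> c"
begin

abbreviation fg :: "('a, 'm) module set" where "fg \<equiv> fg_mod R"
abbreviation hom where "hom \<equiv> mod_hom R"
abbreviation steq where "steq \<equiv> stably_equal R"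
abbreviation cl where "cl \<equiv> st_class R"
abbreviation Syz where "Syz \<equiv> syzygy P \<pi>"
abbreviation D where "D \<equiv> stmod R \<rho> P \<pi>"

lemma cover:
 assumes "M\<in>fg"
 shows cover_fg: "P M\<in>fg" and cover_projective: "projective R (P M)"
  and cover_hom: "\<pi> M\<in>hom (P M) M" and cover_surj: "\<pi> M ` car (P M) = car M"
 using covers assms unfolding projective_covers_def projective_cover_def by auto

lemma lift_projective:
 assumes "projective R Q" "M\<in>fg" "N\<in>fg" "p\<in>hom M N" "p ` car M = car N" "f\<in>hom (Q :: ('a, 'm) module) N"
 shows "\<exists>g\<in>hom Q M. \<forall>x\<in>car Q. p (g x) = f x" by (rule assms(1)[unfolded projective_def, rule_format, OF assms(2-6)])

text \<open>A map from any projective module to \<open>N\<close> lifts along the cover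
  \<open>\<pi> N\<close>, so a factorisation through some projective module can be replaced by one
  through \<open>P N\<close>. The difference is moved to the other side, which turns stable equality
  into a formula with a single witness.\<close>

lemma steq_iff:
 assumes M: "M\<in>fg" and N: "N\<in>fg" and f: "f\<in>hom M N" and g: "g\<in>hom M N"
 shows "steq M N f g \<longleftrightarrow> (\<exists>a\<in>hom M (P N). \<forall>x\<in>car M. f x = g x \<oplus>\<^sub>N \<pi> N (a x))"
proof
 interpret N: left_module R N by (rule fg_modD[OF N])
 note [simp] = hom_closed[OF f] hom_closed[OF g]
 {
  assume "steq M N f g"
  then obtain Q a b where Q: "Q\<in>fg" "projective R Q" and a: "a\<in>hom M Q" and b: "b\<in>hom Q N"
   and eq: "\<forall>x\<in>car M. f x \<ominus>\<^bsub>N\<^esub> g x = b (a x)" unfolding stably_equal_def by blast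
  obtain c where c: "c\<in>hom Q (P N)" "!!x. x\<in>car Q ==> \<pi> N (c x) = b x"
   using lift_projective[OF Q(2) cover_fg[OF N] N cover_hom[OF N] cover_surj[OF N] b] by blast
  have "cmps M c a\<in>hom M (P N)" using a c(1) fg_modD[OF M] by (rule hom_compose)
  moreover have "f x = g x \<oplus>\<^sub>N \<pi> N (cmps M c a x)" if "x\<in>car M" for x
   using that eq c(2)[OF hom_closed[OF a]] N.diff_add[of "f x" "g x"] by (simp add: compose_eq N.M.minus_eq)
  ultimately show "\<exists>a\<in>hom M (P N). \<forall>x\<in>car M. f x = g x \<oplus>\<^sub>N \<pi> N (a x)" by blast
 }
 {
  assume "\<exists>a\<in>hom M (P N). \<forall>x\<in>car M. f x = g x \<oplus>\<^sub>N \<pi> N (a x)"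
  then obtain a where a: "a\<in>hom M (P N)" and eq: "\<forall>x\<in>car M. f x = g x \<oplus>\<^sub>N \<pi> N (a x)" by blast
  have "f x \<ominus>\<^bsub>N\<^esub> g x = \<pi> N (a x)" if "x\<in>car M" for x
  proof -
   have c: "\<pi> N (a x)\<in>car N" using hom_closed[OF a that] hom_closed[OF cover_hom[OF N]] by blast
   have "f x \<ominus>\<^bsub>N\<^esub> g x = \<ominus>\<^sub>N g x \<oplus>\<^sub>N (g x \<oplus>\<^sub>N \<pi> N (a x))" using that eq c by (simp add: N.M.minus_eq N.M.a_ac)
   thus ?thesis using that c N.M.r_neg1 by simp
  qed
  thus "steq M N f g" unfolding stably_equal_def using f g a cover_fg[OF N] cover_projective[OF N] cover_hom[OF N] by blast
 }
qed

lemma steqI: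
 assumes M: "M\<in>fg" and N: "N\<in>fg" and f: "f\<in>hom M N" and g: "g\<in>hom M N"
  and Q: "Q\<in>fg" "projective R Q" and a: "a\<in>hom M Q" and b: "b\<in>hom Q N"
  and eq: "!!x. x\<in>car M ==> f x = g x \<oplus>\<^sub>N b (a x)"
 shows "steq M N f g"
proof -
 obtain c where c: "c\<in>hom Q (P N)" "!!x. x\<in>car Q ==> \<pi> N (c x) = b x"
  using lift_projective[OF Q(2) cover_fg[OF N] N cover_hom[OF N] cover_surj[OF N] b] by blast
 have "cmps M c a\<in>hom M (P N)" using a c(1) fg_modD[OF M] by (rule hom_compose)
 moreover have "f x = g x \<oplus>\<^sub>N \<pi> N (cmps M c a x)" if "x\<in>car M" for x
  using that eq c(2)[OF hom_closed[OF a]] by (simp add: compose_eq)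
 ultimately show ?thesis unfolding steq_iff[OF M N f g] by blast
qed

lemma steqE:
 assumes "steq M N f g" "M\<in>fg" "N\<in>fg"
 obtains a where "a\<in>hom M (P N)" "!!x. x\<in>car M ==> f x = g x \<oplus>\<^sub>N \<pi> N (a x)" using steq_iff[OF assms(2,3)] steq_homs[OF assms(1)] assms(1) by auto

lemma steq_refl:
 assumes M: "M\<in>fg" and N: "N\<in>fg" and f: "f\<in>hom M N"
 shows "steq M N f f"
proof (rule steqI[OF M N f f cover_fg[OF N] cover_projective[OF N] hom_zero_in cover_hom[OF N]])
 interpret N: left_module R N by (rule fg_modD[OF N])
 show "f x = f x \<oplus>\<^sub>N \<pi> N (hom_zero M (P N) x)" if "x\<in>car M" for x
  using that hom_closed[OF f] hom_zero[OF fg_modD[OF cover_fg[OF N]] fg_modD[OF N] cover_hom[OF N]] by simp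
qed (use M N cover_fg fg_modD in auto)

lemma steq_sym:
 assumes M: "M\<in>fg" and N: "N\<in>fg" and s: "steq M N f g"
 shows "steq M N g f"
proof -
 interpret N: left_module R N by (rule fg_modD[OF N])
 obtain a where a: "a\<in>hom M (P N)" and eq: "!!x. x\<in>car M ==> f x = g x \<oplus>\<^sub>N \<pi> N (a x)" using steqE[OF s M N] by blast
 have fg: "f\<in>hom M N" "g\<in>hom M N" using steq_homs[OF s] by auto
 note lm = fg_modD[OF M] fg_modD[OF cover_fg[OF N]] fg_modD[OF N]
 show ?thesis
 proof (rule steqI[OF M N fg(2,1) cover_fg[OF N] cover_projective[OF N] hom_minus_in[OF lm(1,2) a] cover_hom[OF N]])
  fix x assume x: "x\<in>car M"
  have c: "\<pi> N (a x)\<in>car N" "g x\<in>car N" "f x\<in>car N"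
   using hom_closed[OF a x] hom_closed[OF cover_hom[OF N]] hom_closed[OF fg(2) x] hom_closed[OF fg(1) x] by auto
  thus "g x = f x \<oplus>\<^sub>N \<pi> N (hom_minus M (P N) a x)" using x eq[OF x] hom_closed[OF a x]
   by (simp add: hom_minus[OF lm(2,3) cover_hom[OF N]] N.M.a_assoc N.M.r_neg)
 qed
qed

lemma steq_trans:
 assumes M: "M\<in>fg" and N: "N\<in>fg" and s: "steq M N f g" "steq M N g h"
 shows "steq M N f h"
proof -
 interpret N: left_module R N by (rule fg_modD[OF N])
 obtain a where a: "a\<in>hom M (P N)" and eq: "!!x. x\<in>car M ==> f x = g x \<oplus>\<^sub>N \<pi> N (a x)" using steqE[OF s(1) M N] by blast
 obtain b where b: "b\<in>hom M (P N)" and eq': "!!x. x\<in>car M ==> g x = h x \<oplus>\<^sub>N \<pi> N (b x)" using steqE[OF s(2) M N] by blast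
 have fg: "f\<in>hom M N" "h\<in>hom M N" using steq_homs[OF s(1)] steq_homs[OF s(2)] by auto
 note lm = fg_modD[OF M] fg_modD[OF cover_fg[OF N]] fg_modD[OF N]
 show ?thesis
 proof (rule steqI[OF M N fg cover_fg[OF N] cover_projective[OF N] hom_add_in[OF lm(1,2) b a] cover_hom[OF N]])
  fix x assume x: "x\<in>car M"
  have c: "\<pi> N (a x)\<in>car N" "\<pi> N (b x)\<in>car N" "h x\<in>car N"
   using hom_closed[OF a x] hom_closed[OF b x] hom_closed[OF cover_hom[OF N]] hom_closed[OF fg(2) x] by auto
  thus "f x = h x \<oplus>\<^sub>N \<pi> N (hom_add M (P N) b a x)" using x eq[OF x] eq'[OF x] hom_closed[OF a x] hom_closed[OF b x]
   by (simp add: hom_add[OF cover_hom[OF N]] N.M.a_assoc)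
 qed
qed

lemma steq_compose_left:
 assumes L: "L\<in>fg" and M: "M\<in>fg" and N: "N\<in>fg" and s: "steq L M f f'" and g: "g\<in>hom M N"
 shows "steq L N (cmps L g f) (cmps L g f')"
proof -
 obtain a where a: "a\<in>hom L (P M)" and eq: "!!x. x\<in>car L ==> f x = f' x \<oplus>\<^sub>M \<pi> M (a x)" using steqE[OF s L M] by blast
 have fg: "f\<in>hom L M" "f'\<in>hom L M" using steq_homs[OF s] by auto
 show ?thesis
 proof (rule steqI[OF L N _ _ cover_fg[OF M] cover_projective[OF M] a, of _ _ "cmps (P M) g (\<pi> M)"])
  show "cmps (P M) g (\<pi> M)\<in>hom (P M) N" using cover_hom[OF M] g fg_modD[OF cover_fg[OF M]] by (rule hom_compose)
  fix x assume x: "x\<in>car L"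
  thus "cmps L g f x = cmps L g f' x \<oplus>\<^sub>N cmps (P M) g (\<pi> M) (a x)"
   using hom_closed[OF a x] hom_closed[OF cover_hom[OF M]] hom_closed[OF fg(2) x] by (simp add: compose_eq eq hom_add[OF g])
 qed (use fg g fg_modD[OF L] hom_compose in blast)+
qed

lemma steq_compose_right:
 assumes L: "L\<in>fg" and M: "M\<in>fg" and N: "N\<in>fg" and f: "f\<in>hom L M" and s: "steq M N g g'"
 shows "steq L N (cmps L g f) (cmps L g' f)"
proof -
 obtain a where a: "a\<in>hom M (P N)" and eq: "!!x. x\<in>car M ==> g x = g' x \<oplus>\<^sub>N \<pi> N (a x)" using steqE[OF s M N] by blast
 have fg: "g\<in>hom M N" "g'\<in>hom M N" using steq_homs[OF s] by auto
 show ?thesis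
 proof (rule steqI[OF L N _ _ cover_fg[OF N] cover_projective[OF N] _ cover_hom[OF N], of _ _ "cmps L a f"])
  show "cmps L a f\<in>hom L (P N)" using f a fg_modD[OF L] by (rule hom_compose)
  fix x assume x: "x\<in>car L"
  thus "cmps L g f x = cmps L g' f x \<oplus>\<^sub>N \<pi> N (cmps L a f x)"
   using hom_closed[OF f x] by (simp add: compose_eq eq)
 qed (use fg f fg_modD[OF L] hom_compose in blast)+
qed

lemma steq_compose:
 assumes "L\<in>fg" "M\<in>fg" "N\<in>fg" "steq L M f f'" "steq M N g g'"
 shows "steq L N (cmps L g f) (cmps L g' f')"
 using steq_trans[OF assms(1,3) steq_compose_left[OF assms(1-4)] steq_compose_right[OF assms(1-3) _ assms(5)]]
  steq_homs[OF assms(4)] steq_homs[OF assms(5)] by blast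

lemma steq_add:
 assumes M: "M\<in>fg" and N: "N\<in>fg" and s: "steq M N f f'" "steq M N g g'"
 shows "steq M N (hom_add M N f g) (hom_add M N f' g')"
proof -
 interpret N: left_module R N by (rule fg_modD[OF N])
 obtain a where a: "a\<in>hom M (P N)" and eq: "!!x. x\<in>car M ==> f x = f' x \<oplus>\<^sub>N \<pi> N (a x)" using steqE[OF s(1) M N] by blast
 obtain b where b: "b\<in>hom M (P N)" and eq': "!!x. x\<in>car M ==> g x = g' x \<oplus>\<^sub>N \<pi> N (b x)" using steqE[OF s(2) M N] by blast
 have fg: "f\<in>hom M N" "f'\<in>hom M N" "g\<in>hom M N" "g'\<in>hom M N" using steq_homs[OF s(1)] steq_homs[OF s(2)] by auto
 note lm = fg_modD[OF M] fg_modD[OF cover_fg[OF N]] fg_modD[OF N]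
 show ?thesis
 proof (rule steqI[OF M N hom_add_in[OF lm(1,3) fg(1,3)] hom_add_in[OF lm(1,3) fg(2,4)]
    cover_fg[OF N] cover_projective[OF N] hom_add_in[OF lm(1,2) a b] cover_hom[OF N]])
  fix x assume x: "x\<in>car M"
  have c: "\<pi> N (a x)\<in>car N" "\<pi> N (b x)\<in>car N" "f' x\<in>car N" "g' x\<in>car N"
   using hom_closed[OF a x] hom_closed[OF b x] hom_closed[OF cover_hom[OF N]]
    hom_closed[OF fg(2) x] hom_closed[OF fg(4) x] by auto
  thus "hom_add M N f g x = hom_add M N f' g' x \<oplus>\<^sub>N \<pi> N (hom_add M (P N) a b x)"
   using x eq[OF x] eq'[OF x] hom_closed[OF a x] hom_closed[OF b x] by (simp add: hom_add[OF cover_hom[OF N]] N.M.a_ac)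
 qed
qed

definition hom_scale where
 "hom_scale M N c f = (\<lambda>x\<in>car M. \<rho> c\<odot>\<^sub>N f x)"

lemma hom_scale_apply [simp]: "x\<in>car M ==> hom_scale M N c f x = \<rho> c\<odot>\<^sub>N f x" by (simp add: hom_scale_def)

lemma hom_scale_in:
 assumes "left_module R M" "left_module R N" and f: "f\<in>hom M N"
 shows "hom_scale M N c f\<in>hom M N"
proof -
 interpret M: left_module R M by fact
 interpret N: left_module R N by fact
 note [simp] = hom_closed[OF f]
 show ?thesis unfolding hom_scale_def by (rule hom_restrictI) (simp_all add: assms \<rho>_closed N.lsmult_closed N.lsmult_r_distr
    hom_add[OF f] hom_smult[OF f] \<rho>_central flip: N.lsmult_assoc)
qed

lemma steq_scale:
 assumes M: "M\<in>fg" and N: "N\<in>fg" and s: "steq M N f g"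
 shows "steq M N (hom_scale M N c f) (hom_scale M N c g)"
proof -
 interpret N: left_module R N by (rule fg_modD[OF N])
 obtain a where a: "a\<in>hom M (P N)" and eq: "!!x. x\<in>car M ==> f x = g x \<oplus>\<^sub>N \<pi> N (a x)" using steqE[OF s M N] by blast
 have fg: "f\<in>hom M N" "g\<in>hom M N" using steq_homs[OF s] by auto
 note lm = fg_modD[OF M] fg_modD[OF cover_fg[OF N]] fg_modD[OF N]
 show ?thesis
 proof (rule steqI[OF M N hom_scale_in[OF lm(1,3) fg(1)] hom_scale_in[OF lm(1,3) fg(2)]
    cover_fg[OF N] cover_projective[OF N] hom_scale_in[OF lm(1,2) a] cover_hom[OF N]])
  fix x assume x: "x\<in>car M"
  have c: "\<pi> N (a x)\<in>car N" "g x\<in>car N" using hom_closed[OF a x] hom_closed[OF cover_hom[OF N]] hom_closed[OF fg(2) x] by auto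
  thus "hom_scale M N c f x = hom_scale M N c g x \<oplus>\<^sub>N \<pi> N (hom_scale M (P N) c a x)" using x eq[OF x] hom_closed[OF a x] \<rho>_closed
   by (simp add: hom_smult[OF cover_hom[OF N]] N.lsmult_r_distr)
 qed
qed

section \<open>Syzygies and lifts to projective covers\<close>

lemma syzygy_simps [simp]:
 "car (Syz M) = hom_ker (P M) M (\<pi> M)" "add (Syz M) = add (P M)" "zero (Syz M) = zero (P M)"
 "smult (Syz M) = smult (P M)" by (simp_all add: syzygy_def)

lemma in_syzygy: "x\<in>hom_ker (P M) M (\<pi> M) \<longleftrightarrow> x\<in>car (P M) \<and> \<pi> M x = \<zero>\<^sub>M" by (simp add: hom_ker_def)

lemma syzygy_submodule: "M\<in>fg ==> submodule (hom_ker (P M) M (\<pi> M)) R (P M)" by (intro hom_ker_submodule fg_modD cover_fg cover_hom)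

lemma syzygy_fg: "M\<in>fg ==> Syz M\<in>fg" unfolding syzygy_def by (intro sub_fg cover_fg syzygy_submodule)

definition syz_inc where "syz_inc M = (\<lambda>x\<in>hom_ker (P M) M (\<pi> M). x)"

lemma syz_inc: "M\<in>fg ==> syz_inc M\<in>hom (Syz M) (P M)" unfolding syz_inc_def syzygy_def by (intro hom_incl fg_modD cover_fg syzygy_submodule)

lemma hom_into_syzygy:
 assumes "M\<in>fg" "f\<in>hom L (P M)" "!!x. x\<in>car L ==> \<pi> M (f x) = \<zero>\<^sub>M"
 shows "f\<in>hom L (Syz M)" unfolding syzygy_def using assms hom_closed[OF assms(2)] by (intro hom_corestrict) (auto simp: in_syzygy)

lemma hom_from_syzygy:
 assumes "M\<in>fg" "f\<in>hom L (Syz M)"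
 shows "f\<in>hom L (P M)" using hom_corestrictD[where N = "P M" and H = "hom_ker (P M) M (\<pi> M)"] assms by (auto simp: syzygy_def hom_ker_def)

lemma syzygy_short_exact: "M\<in>fg ==> short_exact R (Syz M) (P M) M (syz_inc M) (\<pi> M)"
 unfolding short_exact_def using syz_inc[of M] cover_hom[of M] cover_surj[of M] by (auto simp: syz_inc_def inj_on_def)

lemma syzygy_factor:
 assumes L: "L\<in>fg" and M: "M\<in>fg" and p: "p\<in>hom L (P M)" and q: "q\<in>hom L (P M)"
  and eq: "!!w. w\<in>car L ==> \<pi> M (p w) = \<pi> M (q w)"
 obtains x where "x\<in>hom L (Syz M)" "!!w. w\<in>car L ==> p w = q w \<oplus>\<^sub>(P M) x w"
proof -
 obtain x where x: "x\<in>hom L (Syz M)" "!!w. w\<in>car L ==> p w = q w \<oplus>\<^sub>(P M) syz_inc M (x w)"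
  using short_exact_factor[OF fg_modD[OF L] fg_modD[OF syzygy_fg[OF M]] fg_modD[OF cover_fg[OF M]]
    fg_modD[OF M] syzygy_short_exact[OF M] p q eq] by blast
 have "p w = q w \<oplus>\<^sub>(P M) x w" if "w\<in>car L" for w using x(2)[OF that] hom_closed[OF x(1) that] by (simp add: syz_inc_def)
 with x(1) that show ?thesis by blast
qed

definition is_lift where
 "is_lift M N f l \<longleftrightarrow> l\<in>hom (P M) (P N) \<and> (\<forall>x\<in>car (P M). \<pi> N (l x) = f (\<pi> M x))"

lemma lift_ex:
 assumes M: "M\<in>fg" and N: "N\<in>fg" and f: "f\<in>hom M N"
 obtains l where "is_lift M N f l"
proof -
 have "cmps (P M) f (\<pi> M)\<in>hom (P M) N" using cover_hom[OF M] f fg_modD[OF cover_fg[OF M]] by (rule hom_compose)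
 from lift_projective[OF cover_projective[OF M] cover_fg[OF N] N cover_hom[OF N] cover_surj[OF N] this]
 obtain l where "l\<in>hom (P M) (P N)" "!!x. x\<in>car (P M) ==> \<pi> N (l x) = cmps (P M) f (\<pi> M) x" by blast
 hence "is_lift M N f l" by (auto simp: is_lift_def compose_eq)
 thus ?thesis by (rule that)
qed

lemma lift_restrict:
 assumes M: "M\<in>fg" and N: "N\<in>fg" and f: "f\<in>hom M N" and l: "is_lift M N f l"
 shows "restrict l (hom_ker (P M) M (\<pi> M))\<in>hom (Syz M) (Syz N)"
proof (rule hom_into_syzygy[OF N])
 have l: "l\<in>hom (P M) (P N)" "!!x. x\<in>car (P M) ==> \<pi> N (l x) = f (\<pi> M x)" using l by (auto simp: is_lift_def)
 show "restrict l (hom_ker (P M) M (\<pi> M))\<in>hom (Syz M) (P N)"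
  unfolding syzygy_def by (rule hom_restrict[OF fg_modD[OF cover_fg[OF M]] syzygy_submodule[OF M] l(1)])
 show "\<pi> N (restrict l (hom_ker (P M) M (\<pi> M)) x) = \<zero>\<^sub>N" if "x\<in>car (Syz M)" for x
  using that l(2) hom_zero[OF fg_modD[OF M] fg_modD[OF N] f] by (simp add: in_syzygy)
qed

text \<open>The two lifts differ by \<open>a\<close> after \<open>\<pi> M\<close>, which vanishes on
  the syzygy, and by a map \<open>P M \<rightarrow> \<Omega> N\<close>, whose restriction to the
  syzygy factors through the projective module \<open>P M\<close>.\<close>

lemma lift_unique:
 assumes M: "M\<in>fg" and N: "N\<in>fg" and s: "steq M N f f'" and l: "is_lift M N f l" and l': "is_lift M N f' l'"
 shows "steq (Syz M) (Syz N) (restrict l (hom_ker (P M) M (\<pi> M))) (restrict l' (hom_ker (P M) M (\<pi> M)))"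
proof -
 interpret N: left_module R N by (rule fg_modD[OF N])
 interpret PN: left_module R "P N" by (rule fg_modD[OF cover_fg[OF N]])
 obtain a where a: "a\<in>hom M (P N)" and eq: "!!x. x\<in>car M ==> f x = f' x \<oplus>\<^sub>N \<pi> N (a x)" using steqE[OF s M N] by blast
 have fg: "f\<in>hom M N" "f'\<in>hom M N" using steq_homs[OF s] by auto
 have lh: "l\<in>hom (P M) (P N)" "!!x. x\<in>car (P M) ==> \<pi> N (l x) = f (\<pi> M x)"
  "l'\<in>hom (P M) (P N)" "!!x. x\<in>car (P M) ==> \<pi> N (l' x) = f' (\<pi> M x)" using l l' by (auto simp: is_lift_def)
 note lm = fg_modD[OF cover_fg[OF M]] fg_modD[OF cover_fg[OF N]]
 have ap: "cmps (P M) a (\<pi> M)\<in>hom (P M) (P N)" using cover_hom[OF M] a lm(1) by (rule hom_compose)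
 have "\<pi> N (l w) = \<pi> N (hom_add (P M) (P N) l' (cmps (P M) a (\<pi> M)) w)" if "w\<in>car (P M)" for w
  using that hom_closed[OF cover_hom[OF M] that] hom_closed[OF a] hom_closed[OF lh(3)]
  by (simp add: lh eq compose_eq hom_add[OF cover_hom[OF N]])
 then obtain j where j: "j\<in>hom (P M) (Syz N)"
  "!!w. w\<in>car (P M) ==> l w = hom_add (P M) (P N) l' (cmps (P M) a (\<pi> M)) w \<oplus>\<^sub>(P N) j w"
  using syzygy_factor[OF cover_fg[OF M] N lh(1) hom_add_in[OF lm lh(3) ap]] by blast
 show ?thesis
 proof (rule steqI[OF syzygy_fg[OF M] syzygy_fg[OF N] lift_restrict[OF M N fg(1) l] lift_restrict[OF M N fg(2) l']
    cover_fg[OF M] cover_projective[OF M] syz_inc[OF M] j(1)])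
  fix x assume "x\<in>car (Syz M)"
  hence x: "x\<in>car (P M)" "\<pi> M x = \<zero>\<^sub>M" by (auto simp: in_syzygy)
  thus "restrict l (hom_ker (P M) M (\<pi> M)) x =
    restrict l' (hom_ker (P M) M (\<pi> M)) x \<oplus>\<^sub>(Syz N) j (syz_inc M x)"
   using j(2)[OF x(1)] hom_closed[OF lh(3) x(1)] hom_zero[OF fg_modD[OF M] lm(2) a] by (simp add: in_syzygy syz_inc_def compose_eq)
 qed
qed

section \<open>The stable category as a preadditive category with a loop functor\<close>

lemma D_simps [simp]:
 "Obj D = fg" "Arr D M N = cl M N ` hom M N" "Ident D M = cl M M (hom_id M)" "LoopO D = Syz" by (simp_all add: stmod_def stmod_base_def hom_id_def)

lemma cl_eq_iff:
 assumes "M\<in>fg" "N\<in>fg" "f\<in>hom M N" "g\<in>hom M N"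
 shows "cl M N f = cl M N g \<longleftrightarrow> steq M N f g"
proof
 assume "cl M N f = cl M N g"
 hence "{h. steq M N f h} = {h. steq M N g h}" by (simp add: st_class_def)
 moreover have "steq M N g g" using assms by (intro steq_refl)
 ultimately show "steq M N f g" by blast
next
 assume s: "steq M N f g"
 have "steq M N f h \<longleftrightarrow> steq M N g h" for h using steq_trans[OF assms(1,2) s] steq_trans[OF assms(1,2) steq_sym[OF assms(1,2) s]] by blast
 thus "cl M N f = cl M N g" by (simp add: st_class_def)
qed

lemma cl_eqI: "M\<in>fg ==> N\<in>fg ==> steq M N f g ==> cl M N f = cl M N g" using cl_eq_iff steq_homs by blast

lemma cl_ends [simp]: "fst (cl M N f) = M" "snd (snd (cl M N f)) = N" by (simp_all add: st_class_def)

text \<open>Composition of classes ranges over all representatives; as stable equality is a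
  congruence, one pair of representatives computes it. This lemma and its analogues for sums,
  scalars and loops move all later calculations to homomorphisms.\<close>

lemma Comp_cl:
 assumes "X\<in>fg" "Y\<in>fg" "Z\<in>fg" "f\<in>hom X Y" "g\<in>hom Y Z"
 shows "Comp D (cl Y Z g) (cl X Y f) = cl X Z (cmps X g f)"
proof -
 have "(\<exists>g'\<in>{g'. steq Y Z g g'}. \<exists>f'\<in>{f'. steq X Y f f'}. steq X Z (cmps X g' f') h) \<longleftrightarrow>
  steq X Z (cmps X g f) h" for h
 proof
  assume "steq X Z (cmps X g f) h"
  thus "\<exists>g'\<in>{g'. steq Y Z g g'}. \<exists>f'\<in>{f'. steq X Y f f'}. steq X Z (cmps X g' f') h" using steq_refl assms by blast
 next
  assume "\<exists>g'\<in>{g'. steq Y Z g g'}. \<exists>f'\<in>{f'. steq X Y f f'}. steq X Z (cmps X g' f') h"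
  thus "steq X Z (cmps X g f) h" using steq_compose steq_trans assms by (metis (no_types, lifting) mem_Collect_eq)
 qed
 thus ?thesis by (simp add: stmod_def stmod_base_def st_class_def)
qed

lemma Plus_cl:
 assumes "X\<in>fg" "Y\<in>fg" "f\<in>hom X Y" "g\<in>hom X Y"
 shows "Plus D (cl X Y f) (cl X Y g) = cl X Y (hom_add X Y f g)"
proof -
 have "(\<exists>f'\<in>{f'. steq X Y f f'}. \<exists>g'\<in>{g'. steq X Y g g'}. steq X Y (hom_add X Y f' g') h) \<longleftrightarrow>
  steq X Y (hom_add X Y f g) h" for h
 proof
  assume "steq X Y (hom_add X Y f g) h"
  thus "\<exists>f'\<in>{f'. steq X Y f f'}. \<exists>g'\<in>{g'. steq X Y g g'}. steq X Y (hom_add X Y f' g') h" using steq_refl assms by blast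
 next
  assume "\<exists>f'\<in>{f'. steq X Y f f'}. \<exists>g'\<in>{g'. steq X Y g g'}. steq X Y (hom_add X Y f' g') h"
  thus "steq X Y (hom_add X Y f g) h" using steq_add steq_trans assms by (metis (no_types, lifting) mem_Collect_eq)
 qed
 thus ?thesis by (simp add: stmod_def stmod_base_def st_class_def hom_add_def)
qed

lemma Scale_cl:
 assumes "X\<in>fg" "Y\<in>fg" "f\<in>hom X Y"
 shows "Scale D c (cl X Y f) = cl X Y (hom_scale X Y c f)"
proof -
 have "(\<exists>f'\<in>{f'. steq X Y f f'}. steq X Y (hom_scale X Y c f') h) \<longleftrightarrow>
  steq X Y (hom_scale X Y c f) h" for h
 proof
  assume "steq X Y (hom_scale X Y c f) h"
  thus "\<exists>f'\<in>{f'. steq X Y f f'}. steq X Y (hom_scale X Y c f') h" using steq_refl assms by blast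
 next
  assume "\<exists>f'\<in>{f'. steq X Y f f'}. steq X Y (hom_scale X Y c f') h"
  thus "steq X Y (hom_scale X Y c f) h" using steq_scale steq_trans assms by (metis (no_types, lifting) mem_Collect_eq)
 qed
 thus ?thesis by (simp add: stmod_def stmod_base_def st_class_def hom_scale_def)
qed

lemma LoopA_cl:
 assumes "M\<in>fg" "N\<in>fg" "f\<in>hom M N" "is_lift M N f l"
 shows "LoopA D (cl M N f) = cl (Syz M) (Syz N) (restrict l (hom_ker (P M) M (\<pi> M)))"
proof -
 let ?r = "\<lambda>l. restrict l (hom_ker (P M) M (\<pi> M))"
 have "(\<exists>f'\<in>{f'. steq M N f f'}. \<exists>l'\<in>hom (P M) (P N). (\<forall>x\<in>car (P M). \<pi> N (l' x) = f' (\<pi> M x)) \<and>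
     steq (Syz M) (Syz N) (?r l') h) \<longleftrightarrow> steq (Syz M) (Syz N) (?r l) h" for h
 proof
  assume "steq (Syz M) (Syz N) (?r l) h"
  thus "\<exists>f'\<in>{f'. steq M N f f'}. \<exists>l'\<in>hom (P M) (P N). (\<forall>x\<in>car (P M). \<pi> N (l' x) = f' (\<pi> M x)) \<and>
     steq (Syz M) (Syz N) (?r l') h" using steq_refl assms by (auto simp: is_lift_def)
 next
  assume "\<exists>f'\<in>{f'. steq M N f f'}. \<exists>l'\<in>hom (P M) (P N). (\<forall>x\<in>car (P M). \<pi> N (l' x) = f' (\<pi> M x)) \<and>
     steq (Syz M) (Syz N) (?r l') h"
  then obtain f' l' where f': "steq M N f f'" and l': "is_lift M N f' l'" and h: "steq (Syz M) (Syz N) (?r l') h" by (auto simp: is_lift_def)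
  show "steq (Syz M) (Syz N) (?r l) h" using steq_trans[OF syzygy_fg[OF assms(1)] syzygy_fg[OF assms(2)] lift_unique[OF assms(1,2) f' assms(4) l'] h] .
 qed
 thus ?thesis by (simp add: stmod_def stmod_base_def st_class_def st_syzygy_def)
qed

lemma lift_id: "M\<in>fg ==> is_lift M M (hom_id M) (hom_id (P M))"
 using cover_hom[of M] by (auto simp: is_lift_def hom_closed intro!: hom_id_in fg_modD cover_fg)

lemma lift_compose:
 assumes "L\<in>fg" "is_lift L M f l" "is_lift M N g k" "f\<in>hom L M"
 shows "is_lift L N (cmps L g f) (cmps (P L) k l)"
 using assms hom_compose[of l R "P L" "P M" k "P N"] hom_closed[OF cover_hom[OF assms(1)]]
  hom_closed[of l R "P L" "P M"] by (auto simp: is_lift_def compose_eq intro!: fg_modD cover_fg)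

lemma lift_add:
 assumes "L\<in>fg" "M\<in>fg" "is_lift L M f l" "is_lift L M g k"
 shows "is_lift L M (hom_add L M f g) (hom_add (P L) (P M) l k)" using assms hom_closed[OF cover_hom[OF assms(1)]]
  hom_closed[of l R "P L" "P M"] hom_closed[of k R "P L" "P M"]
 by (auto simp: is_lift_def hom_add[OF cover_hom[OF assms(2)]] intro!: fg_modD cover_fg hom_add_in)

abbreviation Zst where "Zst \<equiv> \<lambda>M N. cl M N (hom_zero M N)"

lemma preadditive_D: "preadditive D Zst"
proof
 show "is_category D" unfolding is_category_def
 proof (simp, intro conjI ballI)
  fix X :: "('a, 'm) module" assume X: "X\<in>fg"
  show "cl X X (hom_id X)\<in>cl X X ` hom X X" using hom_id_in[OF fg_modD[OF X]] by blast
 next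
  fix X Y :: "('a, 'm) module" and f assume X: "X\<in>fg" and Y: "Y\<in>fg" and f: "f\<in>hom X Y"
  have "cmps X f (hom_id X) = f" "cmps X (hom_id Y) f = f"
   by (rule hom_eqI[OF hom_compose[OF hom_id_in f] f] hom_eqI[OF hom_compose[OF f hom_id_in] f];
     simp add: compose_eq hom_closed[OF f] fg_modD X Y)+
  thus "Comp D (cl X Y f) (cl X X (hom_id X)) = cl X Y f" "Comp D (cl Y Y (hom_id Y)) (cl X Y f) = cl X Y f"
   using X Y f hom_id_in[OF fg_modD[OF X]] hom_id_in[OF fg_modD[OF Y]] by (simp_all add: Comp_cl)
 next
  fix X Y Z :: "('a, 'm) module" and f g assume "X\<in>fg" "Y\<in>fg" "Z\<in>fg" "f\<in>hom X Y" "g\<in>hom Y Z"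
  thus "Comp D (cl Y Z g) (cl X Y f)\<in>cl X Z ` hom X Z" by (simp add: Comp_cl imageI hom_compose fg_modD)
 next
  fix W X Y Z :: "('a, 'm) module" and f g h
  assume a: "W\<in>fg" "X\<in>fg" "Y\<in>fg" "Z\<in>fg" "f\<in>hom W X" "g\<in>hom X Y" "h\<in>hom Y Z"
  have "cmps W h (cmps W g f) = cmps W (cmps X h g) f"
   by (rule extensionalityI[of _ "car W"]) (use hom_closed[OF a(5)] in \<open>auto simp: compose_eq\<close>)
  thus "Comp D (cl Y Z h) (Comp D (cl X Y g) (cl W X f)) = Comp D (Comp D (cl Y Z h) (cl X Y g)) (cl W X f)"
   using a hom_compose[OF a(5,6) fg_modD] hom_compose[OF a(6,7) fg_modD] by (simp add: Comp_cl)
 qed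
next
 fix f and X Y :: "('a, 'm) module" assume "f\<in>Arr D X Y"
 thus "fst f = X \<and> snd (snd f) = Y" by auto
next
 fix X Y :: "('a, 'm) module" and f g h
 assume X: "X\<in>Obj D" and Y: "Y\<in>Obj D" and f: "f\<in>Arr D X Y" and g: "g\<in>Arr D X Y" and h: "h\<in>Arr D X Y"
 interpret Y: left_module R Y using Y fg_modD by simp
 obtain f' g' h' where r: "f'\<in>hom X Y" "g'\<in>hom X Y" "h'\<in>hom X Y" "f = cl X Y f'" "g = cl X Y g'" "h = cl X Y h'" using f g h by auto
 note ha = hom_add_in[OF fg_modD[of X R] fg_modD[of Y R]]
 have X': "X\<in>fg" and Y': "Y\<in>fg" using X Y by auto
 have e: "hom_add X Y (hom_add X Y f' g') h' = hom_add X Y f' (hom_add X Y g' h')"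
  "hom_add X Y f' g' = hom_add X Y g' f'" "hom_add X Y f' (hom_zero X Y) = f'"
  by (rule hom_eqI[of _ R X Y]; use X' Y' r fg_modD[OF X'] fg_modD[OF Y'] hom_closed[OF r(1)] hom_closed[OF r(2)] hom_closed[OF r(3)]
    in \<open>simp add: hom_add_in hom_zero_in Y.M.a_ac\<close>)+
 show "Plus D f g\<in>Arr D X Y" "Plus D (Plus D f g) h = Plus D f (Plus D g h)" "Plus D f g = Plus D g f" using X' Y' r e by (auto simp: Plus_cl ha)
next
 fix X Y :: "('a, 'm) module" assume X: "X\<in>Obj D" and Y: "Y\<in>Obj D"
 thus "cl X Y (hom_zero X Y)\<in>Arr D X Y" by (auto intro!: imageI hom_zero_in fg_modD)
 fix f assume f: "f\<in>Arr D X Y"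
 interpret Y: left_module R Y using Y fg_modD by simp
 obtain f' where r: "f'\<in>hom X Y" "f = cl X Y f'" using f by auto
 have X': "X\<in>fg" and Y': "Y\<in>fg" using X Y by auto
 note lm = fg_modD[OF X'] fg_modD[OF Y']
 have e: "hom_add X Y f' (hom_zero X Y) = f'" "hom_add X Y f' (hom_minus X Y f') = hom_zero X Y"
  by (rule hom_eqI[of _ R X Y]; use r lm hom_closed[OF r(1)]
    in \<open>simp add: hom_add_in hom_zero_in hom_minus_in Y.M.r_neg\<close>)+
 show "Plus D f (cl X Y (hom_zero X Y)) = f" using X' Y' r e lm by (simp add: Plus_cl hom_zero_in)
 show "\<exists>g\<in>Arr D X Y. Plus D f g = cl X Y (hom_zero X Y)"
  using X' Y' r e lm hom_minus_in[OF lm r(1)] by (intro bexI[of _ "cl X Y (hom_minus X Y f')"]) (auto simp: Plus_cl)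
next
 fix X Y Z :: "('a, 'm) module" and f g h
 assume X: "X\<in>Obj D" and Y: "Y\<in>Obj D" and Z: "Z\<in>Obj D" and f: "f\<in>Arr D X Y"
 have X': "X\<in>fg" and Y': "Y\<in>fg" and Z': "Z\<in>fg" using X Y Z by auto
 note lm = fg_modD[OF X'] fg_modD[OF Y'] fg_modD[OF Z']
 obtain f' where r: "f'\<in>hom X Y" "f = cl X Y f'" using f by auto
 {
  assume g: "g\<in>Arr D X Y" and h: "h\<in>Arr D Y Z"
  obtain g' h' where s: "g'\<in>hom X Y" "h'\<in>hom Y Z" "g = cl X Y g'" "h = cl Y Z h'" using g h by auto
  have "cmps X h' (hom_add X Y f' g') = hom_add X Z (cmps X h' f') (cmps X h' g')"
   by (rule hom_eqI[OF hom_compose[OF hom_add_in[OF lm(1,2) r(1) s(1)] s(2) lm(1)]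
      hom_add_in[OF lm(1,3) hom_compose[OF r(1) s(2) lm(1)] hom_compose[OF s(1,2) lm(1)]]])
    (simp add: compose_eq hom_closed[OF r(1)] hom_closed[OF s(1)] hom_add[OF s(2)])
  thus "Comp D h (Plus D f g) = Plus D (Comp D h f) (Comp D h g)"
   using X' Y' Z' r s lm(1) hom_add_in[OF lm(1,2) r(1) s(1)] hom_compose[OF r(1) s(2) lm(1)] hom_compose[OF s(1,2) lm(1)]
   by (simp add: Plus_cl Comp_cl)
 }
 {
  assume g: "g\<in>Arr D Y Z" and h: "h\<in>Arr D Y Z"
  obtain g' h' where s: "g'\<in>hom Y Z" "h'\<in>hom Y Z" "g = cl Y Z g'" "h = cl Y Z h'" using g h by auto
  have "cmps X (hom_add Y Z g' h') f' = hom_add X Z (cmps X g' f') (cmps X h' f')"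
   by (rule hom_eqI[OF hom_compose[OF r(1) hom_add_in[OF lm(2,3) s(1,2)] lm(1)]
      hom_add_in[OF lm(1,3) hom_compose[OF r(1) s(1) lm(1)] hom_compose[OF r(1) s(2) lm(1)]]])
    (simp add: compose_eq hom_closed[OF r(1)])
  thus "Comp D (Plus D g h) f = Plus D (Comp D g f) (Comp D h f)"
   using X' Y' Z' r s lm(1) hom_add_in[OF lm(2,3) s(1,2)] hom_compose[OF r(1) s(1) lm(1)] hom_compose[OF r(1) s(2) lm(1)]
   by (simp add: Plus_cl Comp_cl)
 }
qed

lemma loop_functor: "is_functor D D (LoopO D) (LoopA D)" unfolding is_functor_def
proof (intro conjI ballI)
 fix X assume X: "X\<in>Obj D"
 thus "LoopO D X\<in>Obj D" by (simp add: syzygy_fg)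
 have "restrict (hom_id (P X)) (hom_ker (P X) X (\<pi> X)) = hom_id (Syz X)" by (auto simp: hom_id_def hom_ker_def fun_eq_iff)
 thus "LoopA D (Ident D X) = Ident D (LoopO D X)"
  using X LoopA_cl[of X X "hom_id X" "hom_id (P X)"] hom_id_in[OF fg_modD, of X R] lift_id[of X] by simp
next
 fix X Y f assume X: "X\<in>Obj D" and Y: "Y\<in>Obj D" and f: "f\<in>Arr D X Y"
 obtain f' where r: "f'\<in>hom X Y" "f = cl X Y f'" using f by auto
 have X': "X\<in>fg" and Y': "Y\<in>fg" using X Y by auto
 obtain l where l: "is_lift X Y f' l" using lift_ex[OF X' Y' r(1)] .
 show "LoopA D f\<in>Arr D (LoopO D X) (LoopO D Y)" using r LoopA_cl[OF X' Y' r(1) l] lift_restrict[OF X' Y' r(1) l] by auto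
next
 fix X Y Z f g assume X: "X\<in>Obj D" and Y: "Y\<in>Obj D" and Z: "Z\<in>Obj D" and f: "f\<in>Arr D X Y" and g: "g\<in>Arr D Y Z"
 obtain f' g' where r: "f'\<in>hom X Y" "f = cl X Y f'" and s: "g'\<in>hom Y Z" "g = cl Y Z g'" using f g by auto
 have X': "X\<in>fg" and Y': "Y\<in>fg" and Z': "Z\<in>fg" using X Y Z by auto
 obtain l where l: "is_lift X Y f' l" using lift_ex[OF X' Y' r(1)] .
 obtain k where k: "is_lift Y Z g' k" using lift_ex[OF Y' Z' s(1)] .
 note lr = lift_restrict[OF X' Y' r(1) l]
 have "restrict (cmps (P X) k l) (hom_ker (P X) X (\<pi> X)) =
   cmps (Syz X) (restrict k (hom_ker (P Y) Y (\<pi> Y))) (restrict l (hom_ker (P X) X (\<pi> X)))"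
 proof
  fix x show "restrict (cmps (P X) k l) (hom_ker (P X) X (\<pi> X)) x =
   cmps (Syz X) (restrict k (hom_ker (P Y) Y (\<pi> Y))) (restrict l (hom_ker (P X) X (\<pi> X))) x"
   using hom_closed[OF lr, of x] by (auto simp: compose_def in_syzygy)
 qed
 thus "LoopA D (Comp D g f) = Comp D (LoopA D g) (LoopA D f)" using X' Y' Z' r s lr lift_restrict[OF Y' Z' s(1) k]
  by (simp add: Comp_cl LoopA_cl[OF X' Y' r(1) l] LoopA_cl[OF Y' Z' s(1) k] syzygy_fg
    LoopA_cl[OF X' Z' hom_compose[OF r(1) s(1) fg_modD[OF X']] lift_compose[OF X' l k r(1)]])
qed

lemma loop_additive: "additive_on_arrows D D (LoopA D)" unfolding additive_on_arrows_def
proof (intro ballI)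
 fix X Y f g assume X: "X\<in>Obj D" and Y: "Y\<in>Obj D" and f: "f\<in>Arr D X Y" and g: "g\<in>Arr D X Y"
 obtain f' g' where r: "f'\<in>hom X Y" "f = cl X Y f'" and s: "g'\<in>hom X Y" "g = cl X Y g'" using f g by auto
 have X': "X\<in>fg" and Y': "Y\<in>fg" using X Y by auto
 obtain l where l: "is_lift X Y f' l" using lift_ex[OF X' Y' r(1)] .
 obtain k where k: "is_lift X Y g' k" using lift_ex[OF X' Y' s(1)] .
 have "restrict (hom_add (P X) (P Y) l k) (hom_ker (P X) X (\<pi> X)) =
   hom_add (Syz X) (Syz Y) (restrict l (hom_ker (P X) X (\<pi> X))) (restrict k (hom_ker (P X) X (\<pi> X)))" by (auto simp: fun_eq_iff hom_add_def in_syzygy)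
 thus "LoopA D (Plus D f g) = Plus D (LoopA D f) (LoopA D g)" using X' Y' r s lift_restrict[OF X' Y' r(1) l] lift_restrict[OF X' Y' s(1) k]
  by (simp add: Plus_cl LoopA_cl[OF X' Y' r(1) l] LoopA_cl[OF X' Y' s(1) k] syzygy_fg
    LoopA_cl[OF X' Y' hom_add_in[OF fg_modD[OF X'] fg_modD[OF Y'] r(1) s(1)] lift_add[OF X' Y' l k]])
qed

sublocale st: looped_preadditive D Zst using preadditive_D loop_functor loop_additive
 by (simp add: looped_preadditive_def looped_preadditive_axioms_def)

end

section \<open>Triangles in stable module categories\<close>

context preadditive
begin

lemma iso_is_iso:
 assumes "iso f g" "src f = X" "tgt f = Y"
 shows "is_iso C X Y f"
proof -
 have "X\<in>Obj C" "Y\<in>Obj C" using assms unfolding iso_def arr_def by blast+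
 thus ?thesis using is_iso_iff assms by blast
qed

lemma iso_ide: "X\<in>Obj C ==> iso (ide X) (ide X)" by (simp add: iso_def)

end

context stable_modules
begin

declare D_simps(3) [simp del]

lemma arr_rep:
 assumes "st.arr k"
 obtains k0 where "k0\<in>hom (fst k) (snd (snd k))" "k = cl (fst k) (snd (snd k)) k0" using st.arrD(1)[OF assms] that by (auto simp: image_iff)

lemma cl_arr [simp]: "M\<in>fg ==> N\<in>fg ==> f\<in>hom M N ==> st.arr (cl M N f)" by (simp add: st.arr_def)

section \<open>The left triangle of a short exact sequence\<close>

context
 fixes X Y Z f g h s
 assumes X: "X\<in>fg" and Y: "Y\<in>fg" and Z: "Z\<in>fg" and ses: "short_exact R X Y Z f g"
  and h: "h\<in>hom (Syz Z) X" and s: "s\<in>hom (P Z) Y"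
  and gs: "!!x. x\<in>car (P Z) ==> g (s x) = \<pi> Z x"
  and fh: "!!x. x\<in>car (Syz Z) ==> f (h x) = s x"
begin

private lemma f: "f\<in>hom X Y" and g: "g\<in>hom Y Z" and f_inj: "inj_on f (car X)"
 and f_im: "f ` car X = hom_ker Y Z g" using ses by (auto simp: short_exact_def)

private lemma gf: "x\<in>car X ==> g (f x) = \<zero>\<^sub>Z" using f_im by (auto simp: hom_ker_def)

private lemmas lmX = fg_modD[OF X]
private lemmas lmY = fg_modD[OF Y]
private lemmas lmZ = fg_modD[OF Z]
private lemmas lmO = fg_modD[OF syzygy_fg]
private lemmas lmP = fg_modD[OF cover_fg]

private lemma factor:
 assumes "W\<in>fg" "p\<in>hom W Y" "q\<in>hom W Y" "!!w. w\<in>car W ==> g (p w) = g (q w)"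
 obtains x where "x\<in>hom W X" "!!w. w\<in>car W ==> p w = q w \<oplus>\<^sub>Y f (x w)"
 using short_exact_factor[OF fg_modD[OF assms(1)] lmX lmY lmZ ses assms(2-4)] by blast

text \<open>The cover \<open>\<pi> Y\<close> and the map \<open>s\<close> after \<open>m\<close>
  have the same composite with \<open>g\<close>, so they differ by a map into \<open>X\<close>. This
  \<open>u\<close> controls both the composite of \<open>h\<close> with the loop of \<open>g\<close>
  and exactness at \<open>X\<close>.\<close>

private lemma lift_defect:
 assumes m: "is_lift Y Z g m"
 obtains u where "u\<in>hom (P Y) X" "!!p. p\<in>car (P Y) ==> \<pi> Y p = s (m p) \<oplus>\<^sub>Y f (u p)"
proof -
 have m: "m\<in>hom (P Y) (P Z)" "!!x. x\<in>car (P Y) ==> \<pi> Z (m x) = g (\<pi> Y x)" using m by (auto simp: is_lift_def)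
 have sm: "cmps (P Y) s m\<in>hom (P Y) Y" using m(1) s lmP[OF Y] by (rule hom_compose)
 obtain u where "u\<in>hom (P Y) X" "!!p. p\<in>car (P Y) ==> \<pi> Y p = cmps (P Y) s m p \<oplus>\<^sub>Y f (u p)"
  using factor[OF cover_fg[OF Y] cover_hom[OF Y] sm] m hom_closed[OF m(1)] gs by (auto simp: compose_eq)
 thus ?thesis by (intro that[of u]) (auto simp: compose_eq)
qed

text \<open>If the composites with \<open>g\<close> differ by \<open>\<pi> Z\<close> after
  \<open>a\<close>, then \<open>l\<close> corrected by \<open>s\<close> after \<open>a\<close> has
  exactly the same composite with \<open>g\<close> as \<open>k\<close>. The rest factors through
  \<open>f\<close>, and the correction factors through \<open>P Z\<close>.\<close>

private lemma weak_kernel: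
 assumes W: "W\<in>fg" and k: "k\<in>hom W Y" and l: "l\<in>hom W Y"
  and eq: "steq W Z (cmps W g k) (cmps W g l)"
 shows "\<exists>x\<in>hom W X. steq W Y k (hom_add W Y l (cmps W f x))"
proof -
 interpret Y: left_module R Y by (rule lmY)
 interpret Z: left_module R Z by (rule lmZ)
 obtain a where a: "a\<in>hom W (P Z)" and e: "!!w. w\<in>car W ==> g (k w) = g (l w) \<oplus>\<^sub>Z \<pi> Z (a w)" using steqE[OF eq W Z] by (auto simp: compose_eq)
 note [simp] = hom_closed[OF a] hom_closed[OF s] hom_closed[OF f] hom_closed[OF k] hom_closed[OF l]
 have sa: "cmps W s a\<in>hom W Y" using a s fg_modD[OF W] by (rule hom_compose)
 obtain x where x: "x\<in>hom W X" "!!w. w\<in>car W ==> k w = hom_add W Y l (cmps W s a) w \<oplus>\<^sub>Y f (x w)"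
  by (rule factor[OF W k hom_add_in[OF fg_modD[OF W] lmY l sa]])
   (auto simp: e compose_eq gs hom_add[OF g])
 have fx: "cmps W f x\<in>hom W Y" using x(1) f fg_modD[OF W] by (rule hom_compose)
 have "steq W Y k (hom_add W Y l (cmps W f x))"
  by (rule steqI[OF W Y k hom_add_in[OF fg_modD[OF W] lmY l fx] cover_fg[OF Z] cover_projective[OF Z] a s])
   (simp add: x(2) compose_eq Y.M.a_ac hom_closed[OF x(1)])
 with x(1) show ?thesis by blast
qed

text \<open>The difference of the composites with \<open>f\<close> is \<open>\<pi> Y\<close> after
  \<open>a\<close>. By \<open>lift_defect\<close> it splits into \<open>s m a\<close> and
  \<open>f u a\<close>; since \<open>g f = 0\<close>, \<open>m a\<close> takes values in the syzygy
  of \<open>Z\<close>, where \<open>s\<close> is \<open>f h\<close>. Cancelling \<open>f\<close>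
  leaves \<open>h m a\<close> and a term through \<open>P Y\<close>.\<close>

private lemma weak_kernel':
 assumes W: "W\<in>fg" and k: "k\<in>hom W X" and l: "l\<in>hom W X"
  and eq: "steq W Y (cmps W f k) (cmps W f l)"
 shows "\<exists>z\<in>hom W (Syz Z). steq W X k (hom_add W X l (cmps W h z))"
proof -
 interpret X: left_module R X by (rule lmX)
 interpret Y: left_module R Y by (rule lmY)
 interpret Z: left_module R Z by (rule lmZ)
 obtain a where a: "a\<in>hom W (P Y)" and e: "!!w. w\<in>car W ==> f (k w) = f (l w) \<oplus>\<^sub>Y \<pi> Y (a w)" using steqE[OF eq W Y] by (auto simp: compose_eq)
 obtain m where m': "is_lift Y Z g m" using lift_ex[OF Y Z g] .
 hence m: "m\<in>hom (P Y) (P Z)" "!!x. x\<in>car (P Y) ==> \<pi> Z (m x) = g (\<pi> Y x)" by (auto simp: is_lift_def)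
 obtain u where u: "u\<in>hom (P Y) X" "!!p. p\<in>car (P Y) ==> \<pi> Y p = s (m p) \<oplus>\<^sub>Y f (u p)" using lift_defect[OF m'] by blast
 note [simp] = hom_closed[OF a] hom_closed[OF s] hom_closed[OF f] hom_closed[OF k] hom_closed[OF l]
  hom_closed[OF m(1)] hom_closed[OF u(1)] hom_closed[OF cover_hom[OF Y]] hom_closed[OF g]
 define z where "z = cmps W m a"
 have z0: "\<pi> Z (z w) = \<zero>\<^sub>Z" if w: "w\<in>car W" for w using arg_cong[OF e[OF w], of g] w by (simp add: z_def compose_eq m(2) gf hom_add[OF g])
 have z: "z\<in>hom W (Syz Z)" by (rule hom_into_syzygy[OF Z]) (use a m(1) fg_modD[OF W] z0 in \<open>auto simp: z_def intro: hom_compose\<close>)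
 note [simp] = hom_closed[OF h] hom_closed[OF z, simplified]
 have hz: "cmps W h z\<in>hom W X" using z h fg_modD[OF W] by (rule hom_compose)
 have "steq W X k (hom_add W X l (cmps W h z))"
 proof (rule steqI[OF W X k hom_add_in[OF fg_modD[OF W] lmX l hz] cover_fg[OF Y] cover_projective[OF Y] a u(1)])
  fix w assume w: "w\<in>car W"
  have zw: "h (z w)\<in>car X" using hom_closed[OF h] hom_closed[OF z w] by blast
  have "f (h (z w)) = s (m (a w))" using fh[OF hom_closed[OF z w]] w by (simp add: z_def compose_eq)
  hence "f (k w) = f (l w \<oplus>\<^sub>X h (z w) \<oplus>\<^sub>X u (a w))" using w zw e[OF w] u(2)[of "a w"] by (simp add: hom_add[OF f] Y.M.a_assoc)
  thus "k w = hom_add W X l (cmps W h z) w \<oplus>\<^sub>X u (a w)" using w zw f_inj by (auto simp: compose_eq dest!: inj_onD)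
 qed
 with z show ?thesis by blast
qed

text \<open>Lift \<open>s\<close> to \<open>\<sigma>\<close> and \<open>f\<close> to
  \<open>m0\<close> between projective covers. Stable equality of \<open>h k\<close> and
  \<open>h l\<close> says that \<open>\<sigma> k\<close> and \<open>\<sigma> l + m0 a\<close> agree
  after \<open>\<pi> Y\<close>, so they differ by a map \<open>y\<close> into the syzygy of
  \<open>Y\<close>. Applying \<open>m\<close> returns to \<open>k\<close> and \<open>l\<close> up to
  maps through projective modules.\<close>

private lemma weak_kernel'':
 assumes W: "W\<in>fg" and k: "k\<in>hom W (Syz Z)" and l: "l\<in>hom W (Syz Z)" and m': "is_lift Y Z g m"
  and eq: "steq W X (cmps W h k) (cmps W h l)"
 shows "\<exists>y\<in>hom W (Syz Y). steq W (Syz Z) k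
  (hom_add W (Syz Z) l (cmps W (restrict m (hom_ker (P Y) Y (\<pi> Y))) y))"
proof -
 interpret X: left_module R X by (rule lmX)
 interpret Y: left_module R Y by (rule lmY)
 interpret Z: left_module R Z by (rule lmZ)
 interpret PZ: left_module R "P Z" by (rule lmP[OF Z])
 interpret PY: left_module R "P Y" by (rule lmP[OF Y])
 interpret OZ: left_module R "Syz Z" by (rule lmO[OF Z])
 obtain a where a: "a\<in>hom W (P X)" and e: "!!w. w\<in>car W ==> h (k w) = h (l w) \<oplus>\<^sub>X \<pi> X (a w)" using steqE[OF eq W X] by (auto simp: compose_eq)
 have m: "m\<in>hom (P Y) (P Z)" "!!x. x\<in>car (P Y) ==> \<pi> Z (m x) = g (\<pi> Y x)" using m' by (auto simp: is_lift_def)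
 obtain m0 where "is_lift X Y f m0" using lift_ex[OF X Y f] .
 hence m0: "m0\<in>hom (P X) (P Y)" "!!x. x\<in>car (P X) ==> \<pi> Y (m0 x) = f (\<pi> X x)" by (auto simp: is_lift_def)
 obtain \<sigma> where \<sigma>: "\<sigma>\<in>hom (P Z) (P Y)" "!!x. x\<in>car (P Z) ==> \<pi> Y (\<sigma> x) = s x"
  using lift_projective[OF cover_projective[OF Z] cover_fg[OF Y] Y cover_hom[OF Y] cover_surj[OF Y] s] by blast
 note lmW = fg_modD[OF W]
 have kP: "k\<in>hom W (P Z)" and lP: "l\<in>hom W (P Z)" using hom_from_syzygy[OF Z] k l by auto
 have k0: "k w\<in>car (Syz Z)" "l w\<in>car (Syz Z)" "k w\<in>car (P Z)" "l w\<in>car (P Z)"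
  "\<pi> Z (k w) = \<zero>\<^sub>Z" "\<pi> Z (l w) = \<zero>\<^sub>Z" if "w\<in>car W" for w using hom_closed[OF k that] hom_closed[OF l that] by (auto simp: in_syzygy)
 note [simp] = hom_closed[OF a] hom_closed[OF s] hom_closed[OF f]
  hom_closed[OF m(1)] hom_closed[OF m0(1)] hom_closed[OF \<sigma>(1)]
  hom_closed[OF cover_hom[OF Y]] hom_closed[OF cover_hom[OF X]] hom_closed[OF g]
 define p where "p = cmps W \<sigma> k"
 define q where "q = hom_add W (P Y) (cmps W \<sigma> l) (cmps W m0 a)"
 have p: "p\<in>hom W (P Y)" unfolding p_def using kP \<sigma>(1) lmW by (rule hom_compose)
 have q: "q\<in>hom W (P Y)" unfolding q_def by (intro hom_add_in lmW lmP[OF Y] hom_compose[OF lP \<sigma>(1)] hom_compose[OF a m0(1)])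
 have "\<pi> Y (p w) = \<pi> Y (q w)" if w: "w\<in>car W" for w
 proof -
  have "s (k w) = s (l w) \<oplus>\<^sub>Y f (\<pi> X (a w))"
   using arg_cong[OF e[OF w], of f] w k0[OF w] fh[OF k0(1)[OF w]] fh[OF k0(2)[OF w]] hom_closed[OF h k0(2)[OF w]]
   by (simp add: hom_add[OF f])
  thus ?thesis using w k0[OF w] by (simp add: p_def q_def compose_eq \<sigma> m0(2) hom_add[OF cover_hom[OF Y]])
 qed
 then obtain y where y: "y\<in>hom W (Syz Y)" "!!w. w\<in>car W ==> p w = q w \<oplus>\<^sub>(P Y) y w" using syzygy_factor[OF W Y p q] by blast
 \<comment> \<open>\<open>m\<close> after \<open>\<sigma>\<close> lifts the identity of
   \<open>Z\<close>, so it is the identity plus a map \<open>j\<close> from \<open>P Z\<close> into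
   the syzygy; on the syzygy itself \<open>j\<close> is stably zero.\<close>
 have ms: "cmps (P Z) m \<sigma>\<in>hom (P Z) (P Z)" using \<sigma>(1) m(1) lmP[OF Z] by (rule hom_compose)
 obtain j where j: "j\<in>hom (P Z) (Syz Z)"
  "!!w. w\<in>car (P Z) ==> cmps (P Z) m \<sigma> w = hom_id (P Z) w \<oplus>\<^sub>(P Z) j w"
  by (rule syzygy_factor[OF cover_fg[OF Z] Z ms hom_id_in[OF lmP[OF Z]]]) (auto simp: compose_eq m \<sigma> gs)
 define n where "n = cmps (P X) m m0"
 have n: "n\<in>hom (P X) (Syz Z)" by (rule hom_into_syzygy[OF Z])
   (use hom_compose[OF m0(1) m(1) lmP[OF X]] in \<open>auto simp: n_def compose_eq m m0 gf\<close>)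
 let ?r = "restrict m (hom_ker (P Y) Y (\<pi> Y))"
 have r: "?r\<in>hom (Syz Y) (Syz Z)" using lift_restrict[OF Y Z g m'] .
 have y0: "y w\<in>car (Syz Y)" "y w\<in>car (P Y)" if "w\<in>car W" for w using hom_closed[OF y(1) that] by (auto simp: in_syzygy)
 note lO = lmO[OF Z]
 define v where "v = hom_add W (Syz Z) k (cmps W j k)"
 define c where "c = hom_add W (Syz Z) l (cmps W ?r y)"
 define d where "d = hom_add W (Syz Z) c (cmps W n a)"
 have v: "v\<in>hom W (Syz Z)" unfolding v_def by (intro hom_add_in lmW lO k hom_compose[OF kP j(1)])
 have c: "c\<in>hom W (Syz Z)" unfolding c_def by (intro hom_add_in lmW lO l hom_compose[OF y(1) r])
 have d: "d\<in>hom W (Syz Z)" unfolding d_def by (intro hom_add_in lmW lO c hom_compose[OF a n])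
 have jc: "j x\<in>car (P Z)" if "x\<in>car (P Z)" for x using hom_closed[OF j(1) that] by (simp add: in_syzygy)
 have vd: "v w = d w \<oplus>\<^sub>(P Z) j (l w)" if w: "w\<in>car W" for w
 proof -
  have "m (\<sigma> (k w)) = m (\<sigma> (l w)) \<oplus>\<^sub>(P Z) m (m0 (a w)) \<oplus>\<^sub>(P Z) m (y w)" using arg_cong[OF y(2)[OF w], of m] w k0[OF w] y0[OF w]
   by (simp add: p_def q_def compose_eq hom_add[OF m(1)])
  moreover have "m (\<sigma> x) = x \<oplus>\<^sub>(P Z) j x" if "x\<in>car (P Z)" for x using j(2)[OF that] that by (simp add: compose_eq)
  ultimately have "k w \<oplus>\<^sub>(P Z) j (k w) = l w \<oplus>\<^sub>(P Z) j (l w) \<oplus>\<^sub>(P Z) m (m0 (a w)) \<oplus>\<^sub>(P Z) m (y w)" using k0[OF w] by simp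
  thus ?thesis using w k0[OF w] y0[OF w] jc[of "l w"] by (simp add: v_def d_def c_def n_def compose_eq PZ.M.a_ac)
 qed
 have 1: "steq W (Syz Z) v k" by (rule steqI[OF W syzygy_fg[OF Z] v k cover_fg[OF Z] cover_projective[OF Z] kP j(1)])
   (simp add: v_def compose_eq)
 have 2: "steq W (Syz Z) v d" by (rule steqI[OF W syzygy_fg[OF Z] v d cover_fg[OF Z] cover_projective[OF Z] lP j(1)]) (simp add: vd)
 have 3: "steq W (Syz Z) d c" by (rule steqI[OF W syzygy_fg[OF Z] d c cover_fg[OF X] cover_projective[OF X] a n]) (simp add: d_def compose_eq)
 have "steq W (Syz Z) k c" using steq_trans[OF W syzygy_fg[OF Z] steq_sym[OF W syzygy_fg[OF Z] 1] steq_trans[OF W syzygy_fg[OF Z] 2 3]] .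
 thus ?thesis using y(1) by (auto simp: c_def)
qed

lemma short_exact_triangle: "st.exact (cl (Syz Z) X h) (cl X Y f) (cl Y Z g)"
proof -
 interpret X: left_module R X by (rule lmX)
 interpret Y: left_module R Y by (rule lmY)
 obtain m where m': "is_lift Y Z g m" using lift_ex[OF Y Z g] .
 hence m: "m\<in>hom (P Y) (P Z)" "!!x. x\<in>car (P Y) ==> \<pi> Z (m x) = g (\<pi> Y x)" by (auto simp: is_lift_def)
 let ?r = "restrict m (hom_ker (P Y) Y (\<pi> Y))"
 have r: "?r\<in>hom (Syz Y) (Syz Z)" using lift_restrict[OF Y Z g m'] .
 have LA: "LoopA D (cl Y Z g) = cl (Syz Y) (Syz Z) ?r" using LoopA_cl[OF Y Z g m'] .
 note [simp] = X Y Z f g h r syzygy_fg[OF Z] syzygy_fg[OF Y]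
 note [simp] = hom_closed[OF s] hom_closed[OF f] hom_closed[OF m(1)]
 have "st.complex (cl (Syz Z) X h) (cl X Y f) (cl Y Z g)"
 proof -
  have "cmps X g f = hom_zero X Z"
   by (rule hom_eqI[OF hom_compose[OF f g lmX] hom_zero_in[OF lmX lmZ]]) (simp add: compose_eq gf)
  moreover have "cl (Syz Z) Y (cmps (Syz Z) f h) = cl (Syz Z) Y (hom_zero (Syz Z) Y)" by (rule cl_eqI, simp, simp,
     rule steqI[OF _ _ hom_compose[OF h f lmO[OF Z]] hom_zero_in[OF lmO[OF Z] lmY] cover_fg[OF Z]
      cover_projective[OF Z] syz_inc[OF Z] s])
    (use fh in \<open>auto simp: compose_eq syz_inc_def in_syzygy\<close>)
  moreover have "cl (Syz Y) X (cmps (Syz Y) h ?r) = cl (Syz Y) X (hom_zero (Syz Y) X)"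
  proof (rule cl_eqI[OF _ _ steq_sym], simp_all)
   \<comment> \<open>On the syzygy of \<open>Y\<close> the cover \<open>\<pi> Y\<close> vanishes, so
     \<open>s m + f u\<close> is zero there. Injectivity of \<open>f\<close> gives
     \<open>h m = - u\<close>, and \<open>u\<close> is defined on all of \<open>P Y\<close>.\<close>
   obtain u where u: "u\<in>hom (P Y) X" "!!p. p\<in>car (P Y) ==> \<pi> Y p = s (m p) \<oplus>\<^sub>Y f (u p)" using lift_defect[OF m'] by blast
   show "steq (Syz Y) X (hom_zero (Syz Y) X) (compose (hom_ker (P Y) Y (\<pi> Y)) h ?r)"
   proof (rule steqI[OF _ _ hom_zero_in[OF lmO[OF Y] lmX] hom_compose[OF r h lmO[OF Y], simplified] cover_fg[OF Y]
      cover_projective[OF Y] syz_inc[OF Y] u(1)])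
    fix x assume x: "x\<in>car (Syz Y)"
    hence x': "x\<in>car (P Y)" "\<pi> Y x = \<zero>\<^sub>Y" by (auto simp: in_syzygy)
    have c: "h (m x)\<in>car X" "f (h (m x)) = s (m x)" using hom_closed[OF h hom_closed[OF r x]] fh[OF hom_closed[OF r x]] x by auto
    have "f (h (m x) \<oplus>\<^sub>X u x) = f \<zero>\<^sub>X" using u(2)[OF x'(1)] x' c hom_closed[OF u(1) x'(1)]
     by (simp add: hom_add[OF f] hom_zero[OF lmX lmY f])
    hence "h (m x) \<oplus>\<^sub>X u x = \<zero>\<^sub>X" using f_inj c hom_closed[OF u(1) x'(1)] by (auto dest!: inj_onD)
    thus "hom_zero (Syz Y) X x = compose (hom_ker (P Y) Y (\<pi> Y)) h ?r x \<oplus>\<^sub>X u (syz_inc Y x)" using x by (simp add: compose_eq syz_inc_def)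
   qed simp_all
  qed
  ultimately show ?thesis unfolding st.complex_def by (simp add: Comp_cl LA del: syzygy_simps)
 qed
 moreover have "\<exists>x. st.arr x \<and> st.src x = st.src l \<and> st.tgt x = X \<and> k = Plus D l (Comp D (cl X Y f) x)"
  if a: "st.arr k" "st.arr l" "st.src k = st.src l" "st.tgt k = Y" "st.tgt l = Y"
   "Comp D (cl Y Z g) k = Comp D (cl Y Z g) l" for k l
 proof -
  obtain k0 where k0: "k0\<in>hom (fst l) Y" "k = cl (fst l) Y k0" using arr_rep[OF a(1)] a by metis
  obtain l0 where l0: "l0\<in>hom (fst l) Y" "l = cl (fst l) Y l0" using arr_rep[OF a(2)] a by metis
  have W: "fst l\<in>fg" using st.arrD(2)[OF a(2)] by simp
  have "steq (fst l) Z (cmps (fst l) g k0) (cmps (fst l) g l0)"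
   using a(6) k0 l0 W hom_compose[OF k0(1) g fg_modD[OF W]] hom_compose[OF l0(1) g fg_modD[OF W]] by (metis Comp_cl Y Z g cl_eq_iff)
  from weak_kernel[OF W k0(1) l0(1) this] obtain x where x: "x\<in>hom (fst l) X"
   and e: "steq (fst l) Y k0 (hom_add (fst l) Y l0 (cmps (fst l) f x))" by blast
  have fx: "cmps (fst l) f x\<in>hom (fst l) Y" using x f fg_modD[OF W] by (rule hom_compose)
  have "k = Plus D l (Comp D (cl X Y f) (cl (fst l) X x))" using k0 l0 cl_eqI[OF W Y e] x fx W by (metis Comp_cl Plus_cl X Y f)
  with x W show ?thesis by (intro exI[of _ "cl (fst l) X x"]) simp
 qed
 moreover have "\<exists>x. st.arr x \<and> st.src x = st.src l \<and> st.tgt x = Syz Z \<and> k = Plus D l (Comp D (cl (Syz Z) X h) x)"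
  if a: "st.arr k" "st.arr l" "st.src k = st.src l" "st.tgt k = X" "st.tgt l = X"
   "Comp D (cl X Y f) k = Comp D (cl X Y f) l" for k l
 proof -
  obtain k0 where k0: "k0\<in>hom (fst l) X" "k = cl (fst l) X k0" using arr_rep[OF a(1)] a by metis
  obtain l0 where l0: "l0\<in>hom (fst l) X" "l = cl (fst l) X l0" using arr_rep[OF a(2)] a by metis
  have W: "fst l\<in>fg" using st.arrD(2)[OF a(2)] by simp
  have "steq (fst l) Y (cmps (fst l) f k0) (cmps (fst l) f l0)"
   using a(6) k0 l0 W hom_compose[OF k0(1) f fg_modD[OF W]] hom_compose[OF l0(1) f fg_modD[OF W]] by (metis Comp_cl X Y f cl_eq_iff)
  from weak_kernel'[OF W k0(1) l0(1) this] obtain x where x: "x\<in>hom (fst l) (Syz Z)"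
   and e: "steq (fst l) X k0 (hom_add (fst l) X l0 (cmps (fst l) h x))" by blast
  have hx: "cmps (fst l) h x\<in>hom (fst l) X" using x h fg_modD[OF W] by (rule hom_compose)
  have "k = Plus D l (Comp D (cl (Syz Z) X h) (cl (fst l) (Syz Z) x))"
   using k0 l0 cl_eqI[OF W X e] x hx W by (metis Comp_cl Plus_cl X syzygy_fg[OF Z] h)
  with x W show ?thesis by (intro exI[of _ "cl (fst l) (Syz Z) x"]) simp
 qed
 moreover have "\<exists>x. st.arr x \<and> st.src x = st.src l \<and> st.tgt x = Syz Y \<and> k = Plus D l (Comp D (cl (Syz Y) (Syz Z) ?r) x)"
  if a: "st.arr k" "st.arr l" "st.src k = st.src l" "st.tgt k = Syz Z" "st.tgt l = Syz Z"
   "Comp D (cl (Syz Z) X h) k = Comp D (cl (Syz Z) X h) l" for k l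
 proof -
  obtain k0 where k0: "k0\<in>hom (fst l) (Syz Z)" "k = cl (fst l) (Syz Z) k0" using arr_rep[OF a(1)] a by metis
  obtain l0 where l0: "l0\<in>hom (fst l) (Syz Z)" "l = cl (fst l) (Syz Z) l0" using arr_rep[OF a(2)] a by metis
  have W: "fst l\<in>fg" using st.arrD(2)[OF a(2)] by simp
  have "steq (fst l) X (cmps (fst l) h k0) (cmps (fst l) h l0)"
   using a(6) k0 l0 W hom_compose[OF k0(1) h fg_modD[OF W]] hom_compose[OF l0(1) h fg_modD[OF W]]
   by (metis Comp_cl X syzygy_fg[OF Z] h cl_eq_iff)
  from weak_kernel''[OF W k0(1) l0(1) m' this] obtain x where x: "x\<in>hom (fst l) (Syz Y)"
   and e: "steq (fst l) (Syz Z) k0 (hom_add (fst l) (Syz Z) l0 (cmps (fst l) ?r x))" by blast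
  have rx: "cmps (fst l) ?r x\<in>hom (fst l) (Syz Z)" using x r fg_modD[OF W] by (rule hom_compose)
  have "k = Plus D l (Comp D (cl (Syz Y) (Syz Z) ?r) (cl (fst l) (Syz Y) x))"
   using k0 l0 cl_eqI[OF W syzygy_fg[OF Z] e] x rx W by (metis Comp_cl Plus_cl syzygy_fg[OF Y] syzygy_fg[OF Z] r)
  with x W show ?thesis by (intro exI[of _ "cl (fst l) (Syz Y) x"]) simp
 qed
 ultimately show ?thesis unfolding st.exact_def by (simp add: LA del: syzygy_simps)
qed

end

lemma standard_triangleD:
 assumes "(X, Y, Z, h, f, g)\<in>standard_triangles R P \<pi>"
 shows "st.exact h f g" "st.src f = X" "st.tgt f = Y" "st.tgt g = Z" using assms short_exact_triangle unfolding standard_triangles_def by auto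

lemma base_is_iso: "is_iso (stmod_base R \<rho> P \<pi>) X Y a \<longleftrightarrow> is_iso D X Y a" by (simp add: is_iso_def inverse_arrows_def stmod_def)

lemma base_simps: "Obj (stmod_base R \<rho> P \<pi>) = Obj D" "Arr (stmod_base R \<rho> P \<pi>) = Arr D"
 "Comp (stmod_base R \<rho> P \<pi>) = Comp D" "LoopO (stmod_base R \<rho> P \<pi>) = LoopO D" "LoopA (stmod_base R \<rho> P \<pi>) = LoopA D"
 "Tri (stmod_base R \<rho> P \<pi>) = standard_triangles R P \<pi>" by (simp_all add: stmod_def) (simp add: stmod_base_def)

lemma Tri_D_iff:
 "(X, Y, Z, h, f, g)\<in>Tri D \<longleftrightarrow> X\<in>fg \<and> Y\<in>fg \<and> Z\<in>fg \<and>
   (st.arr h \<and> st.src h = Syz Z \<and> st.tgt h = X) \<and> (st.arr f \<and> st.src f = X \<and> st.tgt f = Y) \<and>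
   (st.arr g \<and> st.src g = Y \<and> st.tgt g = Z) \<and>
   (\<exists>X' Y' Z' h' f' g' a b c. (X', Y', Z', h', f', g')\<in>standard_triangles R P \<pi> \<and>
    is_iso D X X' a \<and> is_iso D Y Y' b \<and> is_iso D Z Z' c \<and>
    Comp D a h = Comp D h' (LoopA D c) \<and> Comp D b f = Comp D f' a \<and> Comp D c g = Comp D g' b)"
proof (cases "X\<in>fg \<and> Y\<in>fg \<and> Z\<in>fg")
 case True
 have A: "X\<in>fg ==> Y\<in>fg ==> f\<in>Arr D X Y \<longleftrightarrow> st.arr f \<and> st.src f = X \<and> st.tgt f = Y" for X Y f
  using st.arrI[of f X Y] st.in_Arr[of f X Y] unfolding D_simps(1) by blast
 have T: "Tri D = iso_closure (stmod_base R \<rho> P \<pi>)" by (simp add: stmod_def)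
 show ?thesis unfolding T iso_closure_def base_simps base_is_iso mem_Collect_eq prod.case
  using True by (simp only: A syzygy_fg D_simps(1,4) simp_thms)
next
 case False
 have T: "Tri D = iso_closure (stmod_base R \<rho> P \<pi>)" by (simp add: stmod_def)
 show ?thesis unfolding T iso_closure_def base_simps mem_Collect_eq prod.case D_simps(1) using False by blast
qed

text \<open>A left triangle is only isomorphic to a standard one, for which exactness is known.
  Regularity of \<open>g\<close> is conjugated to the standard triangle, the splitting is found
  there and conjugated back.\<close>

lemma Tri_splitting:
 assumes tri: "(X, Y, Z, h, f, g)\<in>Tri D"
  and s: "st.arr s" "st.src s = Z" "st.tgt s = Y" "Comp D g (Comp D s g) = g"
 shows "\<exists>r s t. st.splitting h f g r s t"
proof -
 obtain X' Y' Z' h' f' g' a b c where st: "(X', Y', Z', h', f', g')\<in>standard_triangles R P \<pi>"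
  and isos: "is_iso D X X' a" "is_iso D Y Y' b" "is_iso D Z Z' c"
  and sq: "Comp D a h = Comp D h' (LoopA D c)" "Comp D b f = Comp D f' a" "Comp D c g = Comp D g' b" using tri unfolding Tri_D_iff by blast
 have [simp]: "st.arr h" "st.arr f" "st.arr g" "st.src h = Syz Z" "st.tgt h = X" "st.src f = X" "st.tgt f = Y"
   "st.src g = Y" "st.tgt g = Z" "X\<in>fg" "Y\<in>fg" "Z\<in>fg" using tri unfolding Tri_D_iff by auto
 have ex: "st.exact h' f' g'" and [simp]: "st.src f' = X'" "st.tgt f' = Y'" "st.tgt g' = Z'" using standard_triangleD[OF st] by auto
 hence [simp]: "st.arr h'" "st.arr f'" "st.arr g'" "st.src g' = Y'" by (auto simp: st.exact_def st.complex_def)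
 have [simp]: "X'\<in>fg" "Y'\<in>fg" "Z'\<in>fg" using st.arrD[of f'] st.arrD[of g'] by auto
 obtain a' b' c' where i: "st.iso a a'" "st.iso b b'" "st.iso c c'"
  and [simp]: "st.src a = X" "st.tgt a = X'" "st.src b = Y" "st.tgt b = Y'" "st.src c = Z" "st.tgt c = Z'" using isos by (auto simp: st.is_iso_iff)
 hence [simp]: "st.arr a" "st.arr b" "st.arr c" "st.arr a'" "st.arr b'" "st.arr c'"
  "st.src b' = Y'" "st.tgt b' = Y" "st.src c' = Z'" "st.tgt c' = Z" by (auto simp: st.iso_def)
 note [simp] = s(1-3)
 define s' where "s' = Comp D b (Comp D s c')"
 have [simp]: "st.arr s'" "st.src s' = Z'" "st.tgt s' = Y'" by (auto simp: s'_def)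
 have g': "g' = Comp D c (Comp D g b')"
 proof -
  have "Comp D c (Comp D g b') = Comp D (Comp D c g) b'" by (simp add: st.comp_assoc)
  also have "\<dots> = Comp D g' (Comp D b b')" by (simp add: sq st.comp_assoc)
  also have "\<dots> = g'" using i(2) by (simp add: st.iso_def)
  finally show ?thesis by simp
 qed
 have "Comp D g' (Comp D s' g') = Comp D c (Comp D (Comp D g (Comp D s g)) b')" unfolding g' s'_def
  using st.iso_cancel_left[OF i(2)] st.iso_cancel_left[OF i(3)] by (simp add: st.comp_assoc)
 hence "Comp D g' (Comp D s' g') = g'" using s(4) g' by simp
 from st.splitting_if_regular[OF ex _ _ _ this]
 obtain r t where "st.splitting h' f' g' r s' t" by auto
 from st.splitting_iso[OF this i, of h f g] show ?thesis using sq by simp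
qed

end

section \<open>Direct sums, and split sequences as left triangles\<close>

definition is_biprod ::
  "'a ring => ('a, 'm) module => ('a, 'm) module => ('a, 'm) module => ('m => 'm) => ('m => 'm) =>
   ('m => 'm) => ('m => 'm) => bool" where
 "is_biprod R M N S u v p q \<longleftrightarrow> S\<in>fg_mod R \<and> u\<in>mod_hom R M S \<and> v\<in>mod_hom R N S \<and>
   p\<in>mod_hom R S M \<and> q\<in>mod_hom R S N \<and>
   (\<forall>x\<in>car M. p (u x) = x \<and> q (u x) = \<zero>\<^sub>N) \<and> (\<forall>y\<in>car N. p (v y) = \<zero>\<^sub>M \<and> q (v y) = y) \<and>
   (\<forall>z\<in>car S. z = u (p z) \<oplus>\<^sub>S v (q z))"

locale stable_modules_sums = stable_modules R \<rho> P \<pi>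
 for R :: "'a ring" (structure) and \<rho> :: "'k::field => 'a" and P :: "('a, 'm) module => ('a, 'm) module" and \<pi> +
 assumes biprod_ex: "(M :: ('a, 'm) module)\<in>fg_mod R ==> N\<in>fg_mod R ==> \<exists>S u v p q. is_biprod R M N S u v p q"
begin

text \<open>A representative of \<open>g\<close> need not be surjective, so no short exact sequence
  is at hand. Adding the projective cover of \<open>Z\<close> to \<open>Y\<close> changes nothing
  stably and makes the map surjective; the triangle of its kernel has the same last map up to
  isomorphism, and \<open>splitting_compare\<close> supplies the remaining isomorphism.\<close>

lemma splitting_Tri:
 assumes sp: "st.splitting h f g r s t"
 shows "(st.src f, st.tgt f, st.tgt g, h, f, g)\<in>Tri D"
proof -
 define X Y Z where XYZ: "X = st.src f" "Y = st.tgt f" "Z = st.tgt g"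
 have [simp]: "st.arr h" "st.arr f" "st.arr g" "st.src h = Syz Z" "st.tgt h = X" "st.src f = X" "st.tgt f = Y"
   "st.src g = Y" "st.tgt g = Z" using sp by (auto simp: st.splitting_def st.complex_def XYZ)
 have X: "X\<in>fg" and Y: "Y\<in>fg" and Z: "Z\<in>fg" using st.arrD(2,3)[of f] st.arrD(3)[of g] by auto
 note [simp] = X Y Z
 obtain g0 where g0: "g0\<in>hom Y Z" "g = cl Y Z g0" using arr_rep[of g] by auto
 obtain S u v p q where bp: "is_biprod R Y (P Z) S u v p q" using biprod_ex[OF Y cover_fg[OF Z]] by blast
 have S: "S\<in>fg" and u: "u\<in>hom Y S" and v: "v\<in>hom (P Z) S" and p: "p\<in>hom S Y" and q: "q\<in>hom S (P Z)"
  and pu: "!!x. x\<in>car Y ==> p (u x) = x" "!!x. x\<in>car Y ==> q (u x) = \<zero>\<^sub>(P Z)"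
  and pv: "!!x. x\<in>car (P Z) ==> p (v x) = \<zero>\<^sub>Y" "!!x. x\<in>car (P Z) ==> q (v x) = x"
  and dec: "!!z. z\<in>car S ==> z = u (p z) \<oplus>\<^sub>S v (q z)" using bp unfolding is_biprod_def by blast+
 note lmY = fg_modD[OF Y] and lmZ = fg_modD[OF Z] and lmS = fg_modD[OF S] and lmP = fg_modD[OF cover_fg[OF Z]]
 interpret Y: left_module R Y by (rule lmY)
 interpret Z: left_module R Z by (rule lmZ)
 interpret S: left_module R S by (rule lmS)
 note [simp] = hom_closed[OF u] hom_closed[OF v] hom_closed[OF p] hom_closed[OF q]
  hom_closed[OF g0(1)] hom_closed[OF cover_hom[OF Z]]
 \<comment> \<open>The map with components \<open>g0\<close> on \<open>Y\<close> and
   \<open>\<pi> Z\<close> on \<open>P Z\<close>; the second component makes it surjective.\<close>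
 define g1 where "g1 = hom_add S Z (cmps S g0 p) (cmps S (\<pi> Z) q)"
 have g1: "g1\<in>hom S Z" unfolding g1_def by (intro hom_add_in lmS lmZ hom_compose[OF p g0(1)] hom_compose[OF q cover_hom[OF Z]])
 have g1v: "g1 (v w) = \<pi> Z w" if "w\<in>car (P Z)" for w using that by (simp add: g1_def compose_eq pv hom_zero[OF lmY lmZ g0(1)])
 have g1u: "g1 (u y) = g0 y" if "y\<in>car Y" for y using that by (simp add: g1_def compose_eq pu hom_zero[OF lmP lmZ cover_hom[OF Z]])
 define K where "K = S\<lparr>carrier := hom_ker S Z g1\<rparr>"
 have ksub: "submodule (hom_ker S Z g1) R S" using lmS lmZ g1 by (rule hom_ker_submodule)
 have K: "K\<in>fg" unfolding K_def using S ksub by (rule sub_fg)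
 define i where "i = (\<lambda>x\<in>hom_ker S Z g1. x)"
 have i: "i\<in>hom K S" unfolding i_def K_def using lmS ksub by (rule hom_incl)
 have cK: "car K = hom_ker S Z g1" by (simp add: K_def)
 have ses: "short_exact R K S Z i g1" unfolding short_exact_def
 proof (intro conjI i g1)
  show "inj_on i (car K)" by (auto simp: inj_on_def i_def cK)
  show "i ` car K = hom_ker S Z g1" by (auto simp: i_def cK)
  have "z\<in>g1 ` car S" if z: "z\<in>car Z" for z
  proof -
   obtain w where "w\<in>car (P Z)" "z = \<pi> Z w" using cover_surj[OF Z] z by blast
   thus ?thesis using g1v[of w] by (intro image_eqI[of _ _ "v w"]) auto
  qed
  thus "g1 ` car S = car Z" using hom_closed[OF g1] by auto
 qed
 define h1 where "h1 = restrict v (hom_ker (P Z) Z (\<pi> Z))"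
 have h1: "h1\<in>hom (Syz Z) K" unfolding K_def
 proof (rule hom_corestrict)
  show "h1\<in>hom (Syz Z) S" unfolding h1_def syzygy_def using lmP syzygy_submodule[OF Z] v by (rule hom_restrict)
  show "h1 x\<in>hom_ker S Z g1" if "x\<in>car (Syz Z)" for x using that by (simp add: h1_def) (simp add: hom_ker_def g1v)
 qed
 have ih: "i (h1 x) = v x" if "x\<in>car (Syz Z)" for x using that hom_closed[OF h1 that] by (simp add: i_def cK) (simp add: h1_def)
 have std: "(K, S, Z, cl (Syz Z) K h1, cl K S i, cl S Z g1)\<in>standard_triangles R P \<pi>"
  unfolding standard_triangles_def using K S Z ses h1 v g1v ih by blast
 have ex: "st.exact (cl (Syz Z) K h1) (cl K S i) (cl S Z g1)" using standard_triangleD(1)[OF std] .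
 have 1: "cmps Y p u = hom_id Y" by (rule hom_eqI[OF hom_compose[OF u p lmY] hom_id_in[OF lmY]]) (simp add: compose_eq pu)
 \<comment> \<open>The defect of \<open>u p\<close> from the identity is \<open>v q\<close>, which
   factors through \<open>P Z\<close>; hence \<open>Y\<close> and \<open>S\<close> are stably
   isomorphic.\<close>
 have 2: "cl S S (cmps S u p) = cl S S (hom_id S)"
 proof (rule cl_eqI[OF S S steq_sym[OF S S]],
   rule steqI[OF S S hom_id_in[OF lmS] hom_compose[OF p u lmS] cover_fg[OF Z] cover_projective[OF Z] q v])
  fix x assume "x\<in>car S"
  thus "hom_id S x = cmps S u p x \<oplus>\<^sub>S v (q x)" using dec[of x] by (simp add: compose_eq)
 qed
 have b: "st.iso (cl Y S u) (cl S Y p)" using Y S u p 1 2 by (simp add: st.iso_def Comp_cl D_simps(3))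
 have "cmps Y g1 u = g0" by (rule hom_eqI[OF hom_compose[OF u g1 lmY] g0(1)]) (simp add: compose_eq g1u)
 hence gb: "g = Comp D (cl S Z g1) (cl Y S u)" using S u g1 g0 by (simp add: Comp_cl)
 from st.splitting_compare[OF sp ex b _ _ gb]
 obtain a a' where a: "st.iso a a'" "st.src a = X" "st.tgt a = K" "Comp D a h = cl (Syz Z) K h1"
  "Comp D (cl Y S u) f = Comp D (cl K S i) a" by auto
 have "is_iso D X K a" "is_iso D Y S (cl Y S u)" "is_iso D Z Z (Ident D Z)"
  using st.iso_is_iso[OF a(1)] st.iso_is_iso[OF b] st.iso_is_iso[OF st.iso_ide[of Z]] a(2,3) by simp_all
 moreover have "Comp D a h = Comp D (cl (Syz Z) K h1) (LoopA D (Ident D Z))"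
  using a(4) st.LA_ide[of Z] st.comp_ide(1)[of "cl (Syz Z) K h1"] K h1 syzygy_fg[OF Z] by simp
 moreover have "Comp D (Ident D Z) g = Comp D (cl S Z g1) (cl Y S u)" by (rule trans[OF st.comp_ide(2) gb]) simp_all
 moreover note std a(5)
 ultimately have ex: "\<exists>X' Y' Z' h' f' g' a b c. (X', Y', Z', h', f', g')\<in>standard_triangles R P \<pi> \<and>
    is_iso D X X' a \<and> is_iso D Y Y' b \<and> is_iso D Z Z' c \<and>
    Comp D a h = Comp D h' (LoopA D c) \<and> Comp D b f = Comp D f' a \<and> Comp D c g = Comp D g' b" by (intro exI conjI)
 have 3: "st.arr h \<and> st.src h = Syz Z \<and> st.tgt h = X" "st.arr f \<and> st.src f = X \<and> st.tgt f = Y"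
  "st.arr g \<and> st.src g = Y \<and> st.tgt g = Z" by simp_all
 have "(X, Y, Z, h, f, g)\<in>Tri D" unfolding Tri_D_iff by (intro conjI[OF X] conjI[OF Y] conjI[OF Z] conjI[OF 3(1)] conjI[OF 3(2)] conjI[OF 3(3)] ex)
 thus ?thesis unfolding XYZ .
qed

end

section \<open>Path algebras\<close>

context wf_digraph
begin

lemma Nil_in_paths [simp]: "(u, [])\<in>paths G \<longleftrightarrow> u\<in>verts G" by (auto simp: paths_def awalk_def)

lemma Cons_in_paths [simp]: "(u, a # as)\<in>paths G \<longleftrightarrow> a\<in>arcs G \<and> tail G a = u \<and> (head G a, as)\<in>paths G" by (auto simp: paths_def awalk_def)

lemma path_target_Nil [simp]: "path_target G (u, []) = u" by (simp add: path_target_def)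

lemma path_target_Cons [simp]: "path_target G (u, a # as) = path_target G (head G a, as)" by (simp add: path_target_def)

lemma path_target_append [simp]: "path_target G (u, as @ bs) = path_target G (path_target G (u, as), bs)" by (induction as arbitrary: u) auto

lemma append_in_paths: "(u, as @ bs)\<in>paths G \<longleftrightarrow> (u, as)\<in>paths G \<and> (path_target G (u, as), bs)\<in>paths G"
proof (induction as arbitrary: u)
 case Nil
 have "(u, bs)\<in>paths G ==> u\<in>verts G" by (cases bs) auto
 thus ?case by auto
qed auto

lemma path_target_verts: "p\<in>paths G ==> path_target G p\<in>verts G"
proof -
 have "(u, as)\<in>paths G ==> path_target G (u, as)\<in>verts G" for u as by (induction as arbitrary: u) auto
 thus "p\<in>paths G ==> path_target G p\<in>verts G" by (cases p) auto
qed

lemma path_source_verts: "p\<in>paths G ==> fst p\<in>verts G" by (cases p; cases "snd p") auto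

lemma path_arcs: "(u, as)\<in>paths G ==> set as \<subseteq> arcs G" by (induction as arbitrary: u) auto

end

text \<open>Cutting a path after \<open>i\<close> arrows: \<open>path_lo\<close> is the part
  traversed first, hence the right factor of the product, and \<open>path_hi\<close> is the left
  factor.\<close>

definition path_lo where "path_lo r i = (fst r, take i (snd r))"

definition path_hi where "path_hi G r i = (path_target G (path_lo r i), drop i (snd r))"

context wf_digraph
begin

lemma path_lo_in: "r\<in>paths G ==> path_lo r i\<in>paths G" using append_in_paths[of "fst r" "take i (snd r)" "drop i (snd r)"] by (simp add: path_lo_def)

lemma path_hi_in: "r\<in>paths G ==> path_hi G r i\<in>paths G"
 using append_in_paths[of "fst r" "take i (snd r)" "drop i (snd r)"] by (simp add: path_lo_def path_hi_def)

text \<open>A factorisation of \<open>r\<close> is determined by the length of its right factor, so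
  the sum over pairs of paths becomes a convolution over the cut points of \<open>r\<close>.\<close>

lemma path_alg_mult:
 assumes r: "r\<in>paths G"
 shows "mult (path_alg G) f g r = (\<Sum>i\<le>length (snd r). f (path_hi G r i) * g (path_lo r i))"
proof -
 let ?S = "{(p, q). p\<in>paths G \<and> q\<in>paths G \<and> fst p = path_target G q \<and> (fst q, snd q @ snd p) = r}"
 have "mult (path_alg G) f g r = (\<Sum>(p, q)\<in>?S. f p * g q)" by (simp add: path_alg_def)
 also have "\<dots> = (\<Sum>i\<in>{..length (snd r)}. case (path_hi G r i, path_lo r i) of (p, q) => f p * g q)"
 proof (rule sum.reindex_bij_witness[of _ "\<lambda>i. (path_hi G r i, path_lo r i)" "\<lambda>pq. length (snd (snd pq))"])
  fix pq assume pq: "pq\<in>?S"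
  thus "(path_hi G r (length (snd (snd pq))), path_lo r (length (snd (snd pq)))) = pq"
   "length (snd (snd pq))\<in>{..length (snd r)}" by (auto simp: path_hi_def path_lo_def)
  thus "(case (path_hi G r (length (snd (snd pq))), path_lo r (length (snd (snd pq)))) of (p, q) => f p * g q) =
   (case pq of (p, q) => f p * g q)" by simp
 next
  fix i assume "i\<in>{..length (snd r)}"
  thus "length (snd (snd (path_hi G r i, path_lo r i))) = i" "(path_hi G r i, path_lo r i)\<in>?S"
   using r path_lo_in[OF r, of i] path_hi_in[OF r, of i] by (auto simp: path_lo_def path_hi_def)
 qed
 finally show ?thesis by simp
qed

lemma path_alg_mult_outside:
 assumes r: "r \<notin> paths G"
 shows "mult (path_alg G) f g r = 0"
proof -
 have "{(p, q). p\<in>paths G \<and> q\<in>paths G \<and> fst p = path_target G q \<and> (fst q, snd q @ snd p) = r} = {}" using r append_in_paths by fastforce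
 thus ?thesis unfolding path_alg_def by (simp only: monoid.select_convs sum.empty)
qed

lemma path_hi_0 [simp]: "path_hi G r 0 = r" by (simp add: path_hi_def path_lo_def)

lemma path_lo_length [simp]: "path_lo r (length (snd r)) = r" by (simp add: path_lo_def)

lemma path_hi_length [simp]: "path_hi G r (length (snd r)) = (path_target G r, [])" by (simp add: path_hi_def path_lo_def)

lemma path_lo_lo: "i \<le> k ==> path_lo (path_lo r k) i = path_lo r i" by (simp add: path_lo_def min_def)

lemma path_hi_hi: "path_hi G (path_hi G r i) j = path_hi G r (i + j)"
 by (simp add: path_hi_def path_lo_def take_add add.commute flip: path_target_append)

lemma path_lo_hi: "path_lo (path_hi G r i) j = path_hi G (path_lo r (i + j)) i" by (simp add: path_hi_def path_lo_def drop_take)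

text \<open>Both sides sum over all pairs of cut points of \<open>r\<close>: one side uses the first
  cut \<open>i\<close> and the distance \<open>j\<close> to the second, the other side the second
  cut \<open>k\<close> and then \<open>i\<close>.\<close>

lemma path_alg_mult_assoc:
 "mult (path_alg G) (mult (path_alg G) f g) h = mult (path_alg G) f (mult (path_alg G) g h)"
proof
 fix r
 show "mult (path_alg G) (mult (path_alg G) f g) h r = mult (path_alg G) f (mult (path_alg G) g h) r"
 proof (cases "r\<in>paths G")
  case True
  let ?n = "length (snd r)"
  let ?t = "\<lambda>i j. f (path_hi G r (i + j)) * g (path_hi G (path_lo r (i + j)) i) * h (path_lo r i)"
  have "mult (path_alg G) (mult (path_alg G) f g) h r = (\<Sum>i\<le>?n. \<Sum>j\<le>?n - i. ?t i j)"
   using True by (simp add: path_alg_mult path_hi_in path_hi_hi path_lo_hi sum_distrib_right)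
    (simp add: path_hi_def)
  also have "\<dots> = (\<Sum>(i, j)\<in>(SIGMA i:{..?n}. {..?n - i}). ?t i j)" by (subst sum.Sigma) auto
  also have "\<dots> = (\<Sum>(k, i)\<in>(SIGMA k:{..?n}. {..k}). ?t i (k - i))"
   by (rule sum.reindex_bij_witness[of _ "\<lambda>(k, i). (i, k - i)" "\<lambda>(i, j). (i + j, i)"]) auto
  also have "\<dots> = (\<Sum>k\<le>?n. \<Sum>i\<le>k. ?t i (k - i))" by (subst sum.Sigma) auto
  also have "\<dots> = (\<Sum>k\<le>?n. f (path_hi G r k) * (\<Sum>i\<le>k. g (path_hi G (path_lo r k) i) * h (path_lo r i)))" by (simp add: sum_distrib_left mult.assoc)
  also have "\<dots> = (\<Sum>k\<le>?n. f (path_hi G r k) * mult (path_alg G) g h (path_lo r k))"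
  proof (intro sum.cong refl arg_cong2[where f = "(*)"])
   fix k assume "k\<in>{..?n}"
   hence "length (snd (path_lo r k)) = k" by (simp add: path_lo_def)
   thus "(\<Sum>i\<le>k. g (path_hi G (path_lo r k) i) * h (path_lo r i)) = mult (path_alg G) g h (path_lo r k)"
    using True by (simp add: path_alg_mult path_lo_in path_lo_lo)
  qed
  finally show ?thesis using True by (simp add: path_alg_mult)
 qed (simp add: path_alg_mult_outside)
qed

end

lemma path_alg_simps [simp]:
 "add (path_alg G) = (\<lambda>f g p. f p + g p)" "zero (path_alg G) = (\<lambda>p. 0)"
 "one (path_alg G) = (\<lambda>p. if p\<in>paths G \<and> snd p = [] then 1 else 0)" by (simp_all add: path_alg_def)

lemma path_alg_carrier: "f\<in>car (path_alg G) \<longleftrightarrow> finite {p. f p \<noteq> 0} \<and> (\<forall>p. f p \<noteq> 0 \<longrightarrow> p\<in>paths G)" by (auto simp: path_alg_def)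

lemma path_alg_outside: "f\<in>car (path_alg G) ==> r \<notin> paths G ==> f r = 0" unfolding path_alg_carrier by blast

context fin_digraph
begin

lemma path_alg_mult_closed:
 assumes f: "f\<in>car (path_alg G)" and g: "g\<in>car (path_alg G)"
 shows "mult (path_alg G) f g\<in>car (path_alg G)"
proof -
 have "{r. mult (path_alg G) f g r \<noteq> 0} \<subseteq> (\<lambda>(p, q). (fst q, snd q @ snd p)) ` ({p. f p \<noteq> 0} \<times> {p. g p \<noteq> 0})"
 proof
  fix r assume "r\<in>{r. mult (path_alg G) f g r \<noteq> 0}"
  hence r: "mult (path_alg G) f g r \<noteq> 0" by simp
  hence "r\<in>paths G" using path_alg_mult_outside by blast
  with r obtain i where "f (path_hi G r i) * g (path_lo r i) \<noteq> 0"
   unfolding path_alg_mult[OF \<open>r\<in>paths G\<close>] by (elim sum.not_neutral_contains_not_neutral)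
  thus "r\<in>(\<lambda>(p, q). (fst q, snd q @ snd p)) ` ({p. f p \<noteq> 0} \<times> {p. g p \<noteq> 0})"
  proof (intro image_eqI[of _ _ "(path_hi G r i, path_lo r i)"])
   show "r = (\<lambda>(p, q). (fst q, snd q @ snd p)) (path_hi G r i, path_lo r i)" by (simp add: path_hi_def path_lo_def)
  qed simp
 qed
 hence "finite {r. mult (path_alg G) f g r \<noteq> 0}" by (rule finite_subset) (use f g in \<open>auto simp: path_alg_carrier\<close>)
 thus ?thesis using path_alg_mult_outside by (auto simp: path_alg_carrier)
qed

lemma path_alg_ring: "ring (path_alg G :: ('a \<times> 'b list => 'k::field) ring)"
proof (rule ringI)
 let ?R = "path_alg G :: ('a \<times> 'b list => 'k) ring"
 show "abelian_group ?R"
 proof (rule abelian_groupI)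
  fix f :: "'a \<times> 'b list => 'k" assume "f\<in>car ?R"
  thus "\<exists>g\<in>car ?R. g \<oplus>\<^sub>?R f = \<zero>\<^sub>?R" by (intro bexI[of _ "\<lambda>p. - f p"]) (auto simp: path_alg_carrier)
 next
  fix f g :: "'a \<times> 'b list => 'k" assume "f\<in>car ?R" "g\<in>car ?R"
  hence "finite ({p. f p \<noteq> 0} \<union> {p. g p \<noteq> 0})" "!!p. f p + g p \<noteq> 0 ==> p\<in>paths G" unfolding path_alg_carrier by (blast, metis add.right_neutral)
  moreover have "{p. f p + g p \<noteq> 0} \<subseteq> {p. f p \<noteq> 0} \<union> {p. g p \<noteq> 0}" by auto
  ultimately show "f \<oplus>\<^sub>?R g\<in>car ?R" unfolding path_alg_simps path_alg_carrier using finite_subset by blast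
 qed (auto simp: path_alg_carrier add.assoc add.commute)
next
 let ?R = "path_alg G :: ('a \<times> 'b list => 'k) ring"
 have one: "(one ?R :: 'a \<times> 'b list => 'k)\<in>car ?R"
 proof -
  have "{p. (one ?R :: 'a \<times> 'b list => 'k) p \<noteq> 0} \<subseteq> (\<lambda>v. (v, [])) ` verts G" by auto
  hence "finite {p. one ?R p \<noteq> 0}" by (rule finite_subset) simp
  thus ?thesis unfolding path_alg_carrier by auto
 qed
 show "Group.monoid ?R"
 proof (rule monoidI)
  fix f :: "'a \<times> 'b list => 'k" assume f: "f\<in>car ?R"
  show "\<one>\<^sub>?R\<otimes>\<^sub>?R f = f"
  proof
   fix r show "(\<one>\<^sub>?R\<otimes>\<^sub>?R f) r = f r"
   proof (cases "r\<in>paths G")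
    case True
    have "(\<one>\<^sub>?R\<otimes>\<^sub>?R f) r = (\<Sum>i\<le>length (snd r). if i = length (snd r) then f r else 0)" unfolding path_alg_mult[OF True]
     by (rule sum.cong) (use True in \<open>auto simp: path_hi_in, auto simp: path_hi_def path_target_verts\<close>)
    thus ?thesis by simp
   qed (use path_alg_outside[OF f] in \<open>simp add: path_alg_mult_outside\<close>)
  qed
  show "f\<otimes>\<^sub>?R \<one>\<^sub>?R = f"
  proof
   fix r show "(f\<otimes>\<^sub>?R \<one>\<^sub>?R) r = f r"
   proof (cases "r\<in>paths G")
    case True
    have "(f\<otimes>\<^sub>?R \<one>\<^sub>?R) r = (\<Sum>i\<le>length (snd r). if i = 0 then f r else 0)" unfolding path_alg_mult[OF True]
     by (rule sum.cong) (use True path_source_verts[OF True] in \<open>auto simp: path_lo_in, auto simp: path_lo_def\<close>)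
    thus ?thesis by simp
   qed (use path_alg_outside[OF f] in \<open>simp add: path_alg_mult_outside\<close>)
  qed
 qed (auto simp: path_alg_mult_closed one path_alg_mult_assoc simp del: path_alg_simps)
next
 let ?R = "path_alg G :: ('a \<times> 'b list => 'k) ring"
 fix f g h :: "'a \<times> 'b list => 'k"
 show "(f \<oplus>\<^sub>?R g)\<otimes>\<^sub>?R h = f\<otimes>\<^sub>?R h \<oplus>\<^sub>?R g\<otimes>\<^sub>?R h"
 proof
  fix r show "((f \<oplus>\<^sub>?R g)\<otimes>\<^sub>?R h) r = (f\<otimes>\<^sub>?R h \<oplus>\<^sub>?R g\<otimes>\<^sub>?R h) r"
   by (cases "r\<in>paths G") (simp_all add: path_alg_mult path_alg_mult_outside sum.distrib distrib_right)
 qed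
 show "h\<otimes>\<^sub>?R (f \<oplus>\<^sub>?R g) = h\<otimes>\<^sub>?R f \<oplus>\<^sub>?R h\<otimes>\<^sub>?R g"
 proof
  fix r show "(h\<otimes>\<^sub>?R (f \<oplus>\<^sub>?R g)) r = (h\<otimes>\<^sub>?R f \<oplus>\<^sub>?R h\<otimes>\<^sub>?R g) r"
   by (cases "r\<in>paths G") (simp_all add: path_alg_mult path_alg_mult_outside sum.distrib distrib_left)
 qed
qed

end

section \<open>Quadratic monomial algebras\<close>

definition good_path :: "('v, 'e) pre_digraph => ('v, 'e) path set => ('v, 'e) path => bool" where
 "good_path G F p \<longleftrightarrow> p\<in>paths G \<and> successively (\<lambda>a b. (tail G a, [a, b]) \<notin> F) (snd p)"

text \<open>The ideal is given by vanishing coefficients instead of generators, so that membership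
  can be checked path by path. \<open>monomial_ideal_generated\<close> identifies it with the ideal
  generated by paths of length two.\<close>

definition monomial_ideal :: "('v, 'e) pre_digraph => ('v, 'e) path set => (('v, 'e) path => 'k::field) set" where
 "monomial_ideal G F = {f\<in>car (path_alg G). \<forall>p. good_path G F p \<longrightarrow> f p = 0}"

context fin_digraph
begin

lemma good_path_paths: "good_path G F p ==> p\<in>paths G" by (simp add: good_path_def)

lemma good_path_lo: assumes "good_path G F p" shows "good_path G F (path_lo p i)"
proof -
 have "successively (\<lambda>a b. (tail G a, [a, b]) \<notin> F) (take i (snd p) @ drop i (snd p))" using assms by (simp add: good_path_def)
 hence "successively (\<lambda>a b. (tail G a, [a, b]) \<notin> F) (take i (snd p))" unfolding successively_append_iff by blast
 thus ?thesis using assms path_lo_in[of p i] by (simp add: good_path_def) (simp add: path_lo_def)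
qed

lemma good_path_hi: assumes "good_path G F p" shows "good_path G F (path_hi G p i)"
proof -
 have "successively (\<lambda>a b. (tail G a, [a, b]) \<notin> F) (take i (snd p) @ drop i (snd p))" using assms by (simp add: good_path_def)
 hence "successively (\<lambda>a b. (tail G a, [a, b]) \<notin> F) (drop i (snd p))" unfolding successively_append_iff by blast
 thus ?thesis using assms path_hi_in[of p i] by (simp add: good_path_def) (simp add: path_hi_def)
qed

text \<open>A coefficient of a product at a path in \<open>U\<close> is a sum of products of
  coefficients at its left and right factors, and these lie in \<open>U\<close> again. The lemma
  serves for good paths and, to describe the arrow ideal, for trivial paths.\<close>

lemma vanishing_ideal:
 assumes U: "!!p i. U p ==> U (path_lo p i)" "!!p i. U p ==> U (path_hi G p i)" "!!p. U p ==> p\<in>paths G"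
 shows "ideal {f\<in>car (path_alg G). \<forall>p. U p \<longrightarrow> f p = (0::'k::field)} (path_alg G)" (is "ideal ?I ?kQ")
proof -
 interpret kQ: ring ?kQ by (rule path_alg_ring)
 show ?thesis
 proof (rule idealI)
  show "ring ?kQ" by (rule path_alg_ring)
  show "subgroup ?I (add_monoid ?kQ)"
  proof
   fix f assume f: "f\<in>?I"
   hence c: "f\<in>car ?kQ" by simp
   have "\<ominus>\<^sub>?kQ f = (\<lambda>p. - f p)" using c by (intro kQ.minus_equality) (auto simp: path_alg_carrier)
   hence "inv\<^bsub>add_monoid ?kQ\<^esub> f = (\<lambda>p. - f p)" "(\<lambda>p. - f p)\<in>car ?kQ" using kQ.a_inv_closed[OF c] by (simp_all only: a_inv_def)
   thus "inv\<^bsub>add_monoid ?kQ\<^esub> f\<in>?I" using f by simp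
  next
   fix f g assume "f\<in>?I" "g\<in>?I"
   thus "f\<otimes>\<^sub>(add_monoid ?kQ) g\<in>?I" using kQ.add.m_closed[of f g] by auto
  next
   show "\<one>\<^sub>(add_monoid ?kQ)\<in>?I" by (auto simp: path_alg_carrier)
  qed auto
 next
  fix f g assume f: "f\<in>?I" and g: "g\<in>car ?kQ"
  have z: "f (path_lo p i) = 0" "f (path_hi G p i) = 0" if "U p" for p i using f U(1,2)[OF that] by blast+
  have c: "f\<in>car ?kQ" using f by simp
  show "g\<otimes>\<^sub>?kQ f\<in>?I" "f\<otimes>\<^sub>?kQ g\<in>?I" using z c g path_alg_mult_closed U(3) by (auto simp: path_alg_mult)
 qed
qed

lemma monomial_ideal_ideal: "ideal (monomial_ideal G F :: ('a \<times> 'b list => 'k::field) set) (path_alg G)"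
 unfolding monomial_ideal_def by (rule vanishing_ideal) (rule good_path_lo good_path_hi good_path_paths; assumption)+

lemma path_elt_in: "p\<in>paths G ==> path_elt p\<in>car (path_alg G)" by (auto simp: path_alg_carrier path_elt_def)

end

section \<open>The quotient algebra, described by coefficients at good paths\<close>

locale monomial_algebra = fin_digraph Q for Q :: "('v, 'e) pre_digraph" +
 fixes F :: "('v, 'e) path set" and I :: "(('v, 'e) path => 'k::field) set" and d :: nat
 assumes I_eq: "I = monomial_ideal Q F"
  and long_bad: "!!p. good_path Q F p ==> length (snd p) < d"
begin

abbreviation A where "A \<equiv> quiver_alg Q I"
abbreviation kQ :: "(('v, 'e) path => 'k) ring" where "kQ \<equiv> path_alg Q"
abbreviation good where "good \<equiv> good_path Q F"

lemmas good_paths = good_path_paths[of F] and good_lo = good_path_lo[of F] and good_hi = good_path_hi[of F]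

lemma finite_good: "finite {p. good p}"
proof -
 have "{p. good p} \<subseteq> verts Q \<times> {as. set as \<subseteq> arcs Q \<and> length as \<le> d}"
 proof
  fix p assume "p\<in>{p. good p}"
  thus "p\<in>verts Q \<times> {as. set as \<subseteq> arcs Q \<and> length as \<le> d}" using long_bad[of p] path_source_verts[of p] path_arcs[of "fst p" "snd p"]
   by (cases p) (auto simp: good_path_def)
 qed
 thus ?thesis by (rule finite_subset) (intro finite_cartesian_product finite_lists_length_le finite_verts finite_arcs)
qed

sublocale kQ: ring kQ by (rule path_alg_ring)

lemma ideal_I: "ideal I kQ" unfolding I_eq by (rule monomial_ideal_ideal)

sublocale idl: ideal I kQ by (rule ideal_I)

sublocale A: ring A unfolding quiver_alg_def by (rule idl.quotient_is_ring)

abbreviation res :: "(('v, 'e) path => 'k) => (('v, 'e) path => 'k) set" where "res \<equiv> residue Q I"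

lemma res_ring_hom: "res\<in>ring_hom kQ A"
proof -
 have "residue Q I = (+>\<^bsub>kQ\<^esub>) I" by (simp add: residue_def fun_eq_iff)
 thus ?thesis using idl.rcos_ring_hom by (simp add: quiver_alg_def)
qed

lemmas res_closed = ring_hom_closed[OF res_ring_hom] and res_mult = ring_hom_mult[OF res_ring_hom]
 and res_add = ring_hom_add[OF res_ring_hom] and res_one = ring_hom_one[OF res_ring_hom]

lemma carrier_A: "a\<in>car A \<longleftrightarrow> (\<exists>f\<in>car kQ. a = res f)" by (auto simp: quiver_alg_def FactRing_def A_RCOSETS_def' residue_def)

lemma mem_res: "f\<in>car kQ ==> h\<in>res f ==> good p ==> h p = f p"
proof -
 assume f: "f\<in>car kQ" "h\<in>res f" "good p"
 then obtain i where "i\<in>I" "h = i \<oplus>\<^sub>kQ f" unfolding residue_def a_r_coset_def' by blast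
 moreover have "i p = 0" using \<open>i\<in>I\<close> f(3) unfolding I_eq monomial_ideal_def by blast
 ultimately show "h p = f p" by simp
qed

lemma self_in_res: "f\<in>car kQ ==> f\<in>res f" unfolding residue_def using idl.a_rcos_self by blast

abbreviation cf :: "(('v, 'e) path => 'k) set => ('v, 'e) path => 'k" where "cf \<equiv> residue_coeff"

text \<open>Elements of the ideal vanish at good paths, so all members of a residue class have the
  same coefficient there; this gives the description operator in \<open>residue_coeff\<close> its
  value.\<close>

lemma cf_res: "f\<in>car kQ ==> good p ==> cf (res f) p = f p" unfolding residue_coeff_def
proof (rule the_equality)
 assume f: "f\<in>car kQ" "good p"
 show "\<forall>h\<in>res f. h p = f p" using mem_res[OF f(1) _ f(2)] by blast
 show "c = f p" if "\<forall>h\<in>res f. h p = c" for c using that self_in_res[OF f(1)] by auto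
qed

text \<open>Vanishing at good paths is the definition of the ideal, so these coefficients separate
  residue classes. Identities in the algebra are proved by comparing coefficients from here
  on.\<close>

lemma A_eqI:
 assumes "a\<in>car A" "b\<in>car A" "!!p. good p ==> cf a p = cf b p"
 shows "a = b"
proof -
 obtain f g where fg: "f\<in>car kQ" "g\<in>car kQ" "a = res f" "b = res g" using assms by (auto simp: carrier_A)
 have m: "\<ominus>\<^sub>kQ g = (\<lambda>p. - g p)" using fg by (intro kQ.minus_equality) (auto simp: path_alg_carrier)
 have "f \<ominus>\<^bsub>kQ\<^esub> g\<in>I" unfolding I_eq monomial_ideal_def using fg assms(3) cf_res kQ.minus_closed[of f g] by (auto simp: kQ.minus_eq m)
 thus ?thesis using kQ.quotient_eq_iff_same_a_r_cos[OF ideal_I fg(1,2)] \<open>f \<ominus>\<^bsub>kQ\<^esub> g\<in>I\<close> by (simp add: residue_def fg)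
qed

lemma cf_add [simp]:
 assumes "a\<in>car A" "b\<in>car A" "good p"
 shows "cf (a \<oplus>\<^sub>A b) p = cf a p + cf b p"
proof -
 obtain f g where fg: "f\<in>car kQ" "g\<in>car kQ" "a = res f" "b = res g" using assms by (auto simp: carrier_A)
 hence "a \<oplus>\<^sub>A b = res (f \<oplus>\<^sub>kQ g)" by (simp add: res_add del: path_alg_simps)
 thus ?thesis using fg assms(3) kQ.add.m_closed[of f g] by (simp add: cf_res)
qed

lemma cf_mult:
 assumes "a\<in>car A" "b\<in>car A" "good p"
 shows "cf (a\<otimes>\<^sub>A b) p = (\<Sum>i\<le>length (snd p). cf a (path_hi Q p i) * cf b (path_lo p i))"
proof -
 obtain f g where fg: "f\<in>car kQ" "g\<in>car kQ" "a = res f" "b = res g" using assms by (auto simp: carrier_A)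
 hence "a\<otimes>\<^sub>A b = res (f\<otimes>\<^sub>kQ g)" by (simp add: res_mult)
 thus ?thesis using fg assms(3) by (simp add: cf_res good_lo good_hi path_alg_mult[OF good_paths])
qed

lemma cf_one [simp]: "good p ==> cf \<one>\<^sub>A p = (if snd p = [] then 1 else 0)"
 using cf_res[OF kQ.one_closed, of p] good_paths[of p] by (simp add: res_one[symmetric])

lemma cf_zero [simp]: "good p ==> cf \<zero>\<^sub>A p = 0" using cf_add[OF A.zero_closed A.zero_closed, of p]
 by (simp only: A.l_zero[OF A.zero_closed] add_cancel_right_right)

lemma cf_minus [simp]: "a\<in>car A ==> good p ==> cf (\<ominus>\<^sub>A a) p = - cf a p" using cf_add[of "\<ominus>\<^sub>A a" a p] by (simp add: A.l_neg eq_neg_iff_add_eq_0)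

text \<open>Any prescription of coefficients at good paths is realised, because there are only
  finitely many of them. This is how elements are later truncated or divided by an arrow.\<close>

definition mk :: "(('v, 'e) path => 'k) => (('v, 'e) path => 'k) set" where
 "mk c = res (\<lambda>p. if good p then c p else 0)"

lemma mk_carrier: "(\<lambda>p. if good p then c p else 0)\<in>car kQ"
proof -
 have "{p. (if good p then c p else 0) \<noteq> 0} \<subseteq> {p. good p}" by auto
 thus ?thesis unfolding path_alg_carrier using finite_subset[OF _ finite_good] good_paths by metis
qed

lemma mk [simp]: "mk c\<in>car A" "good p ==> cf (mk c) p = c p" using mk_carrier[of c] by (auto simp: mk_def cf_res res_closed)

abbreviation sc :: "'k => (('v, 'e) path => 'k) set" where "sc \<equiv> scalar Q I"

lemma sc_carrier: "(\<lambda>p. c * one kQ p)\<in>car kQ"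
proof -
 have "finite {p. one kQ p \<noteq> (0::'k)}" "\<forall>p. one kQ p \<noteq> (0::'k) \<longrightarrow> p\<in>paths Q" using kQ.one_closed unfolding path_alg_carrier by blast+
 moreover have "{p. c * one kQ p \<noteq> 0} \<subseteq> {p. one kQ p \<noteq> 0}" by auto
 ultimately show ?thesis unfolding path_alg_carrier using finite_subset by blast
qed

lemma sc [simp]: "sc c\<in>car A" "good p ==> cf (sc c) p = (if snd p = [] then c else 0)"
 using sc_carrier[of c] good_paths[of p] by (auto simp: scalar_def res_closed cf_res simp del: path_alg_simps)
  (auto simp: path_alg_simps)

definition bas :: "('v, 'e) path => (('v, 'e) path => 'k) set" where
 "bas p = res (path_elt p)"

lemma path_elt_carrier: "p\<in>paths Q ==> path_elt p\<in>car kQ" by (rule path_elt_in)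

lemma bas [simp]: "p\<in>paths Q ==> bas p\<in>car A"
 "p\<in>paths Q ==> good q ==> cf (bas p) q = (if q = p then 1 else 0)" using path_elt_carrier[of p] by (auto simp: bas_def res_closed cf_res path_elt_def)

lemma cf_bas_mult:
 assumes q: "q\<in>paths Q" and b: "b\<in>car A" and p: "good p"
 shows "cf (bas q\<otimes>\<^sub>A b) p = (if length (snd q) \<le> length (snd p) \<and> path_hi Q p (length (snd p) - length (snd q)) = q
   then cf b (path_lo p (length (snd p) - length (snd q))) else 0)"
proof -
 let ?n = "length (snd p)" and ?m = "length (snd q)"
 have "cf (bas q\<otimes>\<^sub>A b) p = (\<Sum>i\<le>?n. if i = ?n - ?m then (if ?m \<le> ?n \<and> path_hi Q p (?n - ?m) = q
   then cf b (path_lo p (?n - ?m)) else 0) else 0)" unfolding cf_mult[OF bas(1)[OF q] b p]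
 proof (rule sum.cong[OF refl])
  fix i assume "i\<in>{..?n}"
  hence i: "i \<le> ?n" by simp
  hence "path_hi Q p i = q ==> i = ?n - ?m \<and> ?m \<le> ?n" by (auto simp: path_hi_def)
  thus "cf (bas q) (path_hi Q p i) * cf b (path_lo p i) = (if i = ?n - ?m then (if ?m \<le> ?n \<and> path_hi Q p (?n - ?m) = q
   then cf b (path_lo p (?n - ?m)) else 0) else 0)" using q p good_hi[OF p, of i] by (cases "path_hi Q p i = q") auto
 qed
 thus ?thesis by simp
qed

lemma cf_mult_bas:
 assumes q: "q\<in>paths Q" and b: "b\<in>car A" and p: "good p"
 shows "cf (b\<otimes>\<^sub>A bas q) p = (if length (snd q) \<le> length (snd p) \<and> path_lo p (length (snd q)) = q
   then cf b (path_hi Q p (length (snd q))) else 0)"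
proof -
 let ?n = "length (snd p)" and ?m = "length (snd q)"
 have "cf (b\<otimes>\<^sub>A bas q) p = (\<Sum>i\<le>?n. if i = ?m then (if ?m \<le> ?n \<and> path_lo p ?m = q
   then cf b (path_hi Q p ?m) else 0) else 0)" unfolding cf_mult[OF b bas(1)[OF q] p]
 proof (rule sum.cong[OF refl])
  fix i assume "i\<in>{..?n}"
  hence "path_lo p i = q ==> i = ?m \<and> ?m \<le> ?n" by (auto simp: path_lo_def)
  thus "cf b (path_hi Q p i) * cf (bas q) (path_lo p i) = (if i = ?m then (if ?m \<le> ?n \<and> path_lo p ?m = q
   then cf b (path_hi Q p ?m) else 0) else 0)" using q p good_lo[OF p, of i] by (cases "path_lo p i = q") auto
 qed
 thus ?thesis by simp
qed

lemma cf_sc_mult [simp]: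
 assumes a: "a\<in>car A" and p: "good p"
 shows "cf (sc c\<otimes>\<^sub>A a) p = c * cf a p" "cf (a\<otimes>\<^sub>A sc c) p = cf a p * c"
proof -
 have "cf (sc c\<otimes>\<^sub>A a) p = (\<Sum>i\<le>length (snd p). if i = length (snd p) then c * cf a p else 0)" unfolding cf_mult[OF sc(1) a p]
  by (rule sum.cong) (use p in \<open>auto simp: good_hi\<close>, auto simp: path_hi_def)
 thus "cf (sc c\<otimes>\<^sub>A a) p = c * cf a p" by simp
 have "cf (a\<otimes>\<^sub>A sc c) p = (\<Sum>i\<le>length (snd p). if i = 0 then cf a p * c else 0)" unfolding cf_mult[OF a sc(1) p]
  by (rule sum.cong) (use p in \<open>auto simp: good_lo\<close>, auto simp: path_lo_def)
 thus "cf (a\<otimes>\<^sub>A sc c) p = cf a p * c" by simp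
qed

abbreviation e :: "'v => (('v, 'e) path => 'k) set" where "e v \<equiv> bas (v, [])"
abbreviation ar :: "'e => (('v, 'e) path => 'k) set" where "ar a \<equiv> bas (tail Q a, [a])"

lemma good_Nil [simp]: "good (v, []) \<longleftrightarrow> v\<in>verts Q" by (simp add: good_path_def)

lemma good_single [simp]: "good (v, [a]) \<longleftrightarrow> a\<in>arcs Q \<and> v = tail Q a" by (auto simp: good_path_def)

lemma arc_path [simp]: "a\<in>arcs Q ==> (tail Q a, [a])\<in>paths Q" by simp

lemma cf_e_mult [simp]:
 assumes "v\<in>verts Q" "b\<in>car A" "good p"
 shows "cf (e v\<otimes>\<^sub>A b) p = (if path_target Q p = v then cf b p else 0)"
  "cf (b\<otimes>\<^sub>A e v) p = (if fst p = v then cf b p else 0)"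
 using assms by (simp_all add: cf_bas_mult cf_mult_bas) (simp_all add: path_lo_def prod_eq_iff)

text \<open>A left factor \<open>a\<close> is the arrow traversed last, hence \<open>last\<close>
  and \<open>butlast\<close>; for a right factor, as in \<open>cf_mult_ar_Cons\<close>, it is the
  head of the list.\<close>

lemma cf_ar_mult:
 assumes "a\<in>arcs Q" "b\<in>car A" "good p"
 shows "cf (ar a\<otimes>\<^sub>A b) p = (if snd p \<noteq> [] \<and> last (snd p) = a then cf b (fst p, butlast (snd p)) else 0)"
proof -
 obtain u as where p: "p = (u, as)" by (cases p)
 show ?thesis
 proof (cases as rule: rev_cases)
  case (snoc bs x)
  have "path_hi Q p (length bs) = (tail Q x, [x])" using good_paths[OF assms(3)] by (auto simp: p snoc path_hi_def path_lo_def append_in_paths)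
  thus ?thesis using assms by (auto simp: cf_bas_mult p snoc) (auto simp: path_lo_def)
 qed (use assms in \<open>auto simp: cf_bas_mult p\<close>)
qed

lemma cf_ar_mult_snoc:
 assumes "a\<in>arcs Q" "b\<in>car A" "good (u, as @ [x])"
 shows "cf (ar a\<otimes>\<^sub>A b) (u, as @ [x]) = (if x = a then cf b (u, as) else 0)" using cf_ar_mult[OF assms] by simp

lemma cf_mult_ar_Cons:
 assumes "a\<in>arcs Q" "b\<in>car A" "good (u, x # as)"
 shows "cf (b\<otimes>\<^sub>A ar a) (u, x # as) = (if x = a then cf b (head Q a, as) else 0)"
 using assms good_paths[OF assms(3)] by (auto simp: cf_mult_bas path_lo_def path_hi_def)

lemma cf_mult_ar_Nil:
 assumes "a\<in>arcs Q" "b\<in>car A" "good (u, [])"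
 shows "cf (b\<otimes>\<^sub>A ar a) (u, []) = 0" using assms good_paths[OF assms(3)] by (auto simp: cf_mult_bas)

lemma sc_central: "a\<in>car A ==> sc c\<otimes>\<^sub>A a = a\<otimes>\<^sub>A sc c" by (rule A_eqI) auto

lemma sc_mult: "sc (c * c') = sc c\<otimes>\<^sub>A sc c'" by (rule A_eqI) auto

lemma sc_add: "sc (c + c') = sc c \<oplus>\<^sub>A sc c'" by (rule A_eqI) auto

lemma sc_one: "sc 1 = \<one>\<^sub>A" by (rule A_eqI) auto

lemma sc_zero: "sc 0 = \<zero>\<^sub>A" by (rule A_eqI) auto

lemma sc_minus: "sc (- c) = \<ominus>\<^sub>A sc c" by (rule A_eqI) auto

lemma good_append: "good (u, as @ bs) ==> good (u, as)" "good (u, as @ bs) ==> good (path_target Q (u, as), bs)"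
 using good_lo[of "(u, as @ bs)" "length as"] good_hi[of "(u, as @ bs)" "length as"] by (simp_all add: path_lo_def path_hi_def)

lemma good_Cons: "good (u, a # as) ==> good (head Q a, as)" using good_append(2)[of u "[a]" as] by simp

lemma bas_snoc: "good (u, as @ [a]) ==> bas (u, as @ [a]) = ar a\<otimes>\<^sub>A bas (u, as)"
proof (rule A_eqI)
 assume g: "good (u, as @ [a])"
 hence pth: "(u, as @ [a])\<in>paths Q" by (rule good_paths)
 hence a: "a\<in>arcs Q" "(u, as)\<in>paths Q" by (auto simp: append_in_paths)
 show "bas (u, as @ [a])\<in>car A" "ar a\<otimes>\<^sub>A bas (u, as)\<in>car A" using pth a by auto
 fix p assume p: "good p"
 obtain v bs where pv: "p = (v, bs)" by (cases p)
 show "cf (bas (u, as @ [a])) p = cf (ar a\<otimes>\<^sub>A bas (u, as)) p"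
 proof (cases bs rule: rev_cases)
  case Nil
  thus ?thesis using a p pth by (auto simp: pv cf_ar_mult)
 next
  case (snoc cs x)
  thus ?thesis using a p pth good_append(1)[of v cs "[x]"] by (auto simp: pv cf_ar_mult_snoc)
 qed
qed

text \<open>Good paths are obtained from vertices by multiplying arrows on the left, and an element
  is a finite sum of multiples of them. Closure and linearity thus need to be tested only on
  scalars, vertices and arrows.\<close>

lemma A_induct [consumes 1, case_names zero add vertex arrow]:
 assumes a: "a\<in>car A"
  and zero: "U \<zero>\<^sub>A" and add: "!!a b. a\<in>car A ==> b\<in>car A ==> U a ==> U b ==> U (a \<oplus>\<^sub>A b)"
  and e: "!!c v. v\<in>verts Q ==> U (sc c\<otimes>\<^sub>A e v)"
  and ar: "!!s a. s\<in>arcs Q ==> a\<in>car A ==> U a ==> U (ar s\<otimes>\<^sub>A a)"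
 shows "U a"
proof -
 have b: "U (sc c\<otimes>\<^sub>A bas (u, as))" if "good (u, as)" for c u as using that
 proof (induction as rule: rev_induct)
  case Nil
  thus ?case using e by simp
 next
  case (snoc x xs)
  have g: "good (u, xs)" using good_append(1)[OF snoc.prems] .
  have x: "x\<in>arcs Q" using good_paths[OF snoc.prems] by (auto simp: append_in_paths)
  have c: "bas (u, xs)\<in>car A" "ar x\<in>car A" using good_paths[OF g] x by auto
  have "sc c\<otimes>\<^sub>A bas (u, xs @ [x]) = ar x\<otimes>\<^sub>A (sc c\<otimes>\<^sub>A bas (u, xs))"
   using c sc_central[of "ar x" c] by (simp add: bas_snoc[OF snoc.prems] flip: A.m_assoc)
  thus ?case using ar[OF x _ snoc.IH[OF g]] c by simp
 qed
 have "U a" if "finite S" "a\<in>car A" "!!p. good p ==> p \<notin> S ==> cf a p = 0" for S a using that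
 proof (induction S arbitrary: a)
  case empty
  hence "a = \<zero>\<^sub>A" by (intro A_eqI) auto
  thus ?case using zero by simp
 next
  case (insert q S)
  show ?case
  proof (cases "good q")
   case True
   let ?a' = "mk (\<lambda>p. if p = q then 0 else cf a p)"
   have bq: "bas q\<in>car A" using good_paths[OF True] by simp
   have "a = ?a' \<oplus>\<^sub>A sc (cf a q)\<otimes>\<^sub>A bas q" by (rule A_eqI) (use insert.prems bq good_paths[OF True] in auto)
   moreover have "U ?a'" by (rule insert.IH) (use insert.prems in auto)
   moreover have "U (sc (cf a q)\<otimes>\<^sub>A bas q)" using b[of "fst q" "snd q"] True by simp
   ultimately show ?thesis using add[of ?a' "sc (cf a q)\<otimes>\<^sub>A bas q"] bq by simp
  next
   case False
   thus ?thesis using insert by (metis insertE)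
  qed
 qed
 from this[OF finite_good a] show ?thesis by simp
qed

end

section \<open>Finitely generated modules over quadratic monomial algebras\<close>

lemma fg_modE:
 assumes "M\<in>fg_mod R"
 obtains X where "finite X" "X \<subseteq> car M" "!!L. submodule L R M ==> X \<subseteq> L ==> L = car M"
proof -
 have "\<exists>X. finite X \<and> X \<subseteq> car M \<and> (\<forall>N. submodule N R M \<and> X \<subseteq> N \<longrightarrow> N = car M)" using assms by (simp add: fg_mod_def finitely_generated_def)
 then obtain X where X: "finite X" "X \<subseteq> car M" "\<forall>N. submodule N R M \<and> X \<subseteq> N \<longrightarrow> N = car M" by (elim exE conjE)
 show ?thesis by (rule that[OF X(1,2)]) (simp add: X(3))
qed

lemma fg_modI:
 assumes "left_module R M" "finite X" "X \<subseteq> car M" "!!L. submodule L R M ==> X \<subseteq> L ==> L = car M"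
 shows "M\<in>fg_mod R" unfolding fg_mod_def finitely_generated_def mem_Collect_eq by (intro conjI exI[of _ X] allI impI assms) simp_all

text \<open>The direct sum must have elements of the type \<open>'m\<close> again, so the
  componentwise structure on pairs is transported along the injection \<open>j\<close>.\<close>

lemma biprod_of_encoding:
 fixes M N :: "('a, 'm) module" and j :: "'m \<times> 'm => 'm"
 assumes M: "M\<in>fg_mod R" and N: "N\<in>fg_mod R" and j: "inj_on j (car M \<times> car N)"
 shows "\<exists>S u v p q. is_biprod R M N S u v p q"
proof -
 interpret M: left_module R M by (rule fg_modD[OF M])
 interpret N: left_module R N by (rule fg_modD[OF N])
 define i where "i = inv_into (car M \<times> car N) j"
 have ij [simp]: "i (j (x, y)) = (x, y)" if "x\<in>car M" "y\<in>car N" for x y using j that by (simp add: i_def)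
 define S :: "('a, 'm) module" where "S = \<lparr>carrier = j ` (car M \<times> car N), mult = undefined, one = undefined,
  zero = j (\<zero>\<^sub>M, \<zero>\<^sub>N),
  add = (\<lambda>s t. j (fst (i s) \<oplus>\<^sub>M fst (i t), snd (i s) \<oplus>\<^sub>N snd (i t))),
  smult = (\<lambda>a s. j (a\<odot>\<^sub>M fst (i s), a\<odot>\<^sub>N snd (i s)))\<rparr>"
 have S [simp]: "car S = j ` (car M \<times> car N)" "\<zero>\<^sub>S = j (\<zero>\<^sub>M, \<zero>\<^sub>N)"
  "s \<oplus>\<^sub>S t = j (fst (i s) \<oplus>\<^sub>M fst (i t), snd (i s) \<oplus>\<^sub>N snd (i t))"
  "a\<odot>\<^sub>S s = j (a\<odot>\<^sub>M fst (i s), a\<odot>\<^sub>N snd (i s))" for s t a by (simp_all add: S_def)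
 have "abelian_group S"
 proof (rule abelian_groupI)
  fix s assume "s\<in>car S"
  then obtain x y where "s = j (x, y)" "x\<in>car M" "y\<in>car N" by auto
  thus "\<exists>t\<in>car S. t \<oplus>\<^sub>S s = \<zero>\<^sub>S" by (intro bexI[of _ "j (\<ominus>\<^sub>M x, \<ominus>\<^sub>N y)"]) (auto simp: M.M.l_neg N.M.l_neg)
 qed (auto simp: M.M.a_ac N.M.a_ac)
 hence lm: "left_module R S" by (auto simp: left_module_def left_module_axioms_def M.ring_axioms M.lsmult_closed N.lsmult_closed
    M.lsmult_l_distr M.lsmult_r_distr N.lsmult_l_distr N.lsmult_r_distr M.lsmult_assoc N.lsmult_assoc
    M.lsmult_one N.lsmult_one)
 interpret S: left_module R S by (rule lm)
 define u where "u = (\<lambda>x\<in>car M. j (x, \<zero>\<^sub>N))"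
 define v where "v = (\<lambda>y\<in>car N. j (\<zero>\<^sub>M, y))"
 define p where "p = (\<lambda>s\<in>car S. fst (i s))"
 define q where "q = (\<lambda>s\<in>car S. snd (i s))"
 have u: "u\<in>mod_hom R M S" unfolding u_def by (rule hom_restrictI[OF fg_modD[OF M]]) (auto simp: N.lsmult_zero)
 have v: "v\<in>mod_hom R N S" unfolding v_def by (rule hom_restrictI[OF fg_modD[OF N]]) (auto simp: M.lsmult_zero)
 have p: "p\<in>mod_hom R S M" unfolding p_def by (rule hom_restrictI[OF lm]) (auto simp: M.lsmult_closed N.lsmult_closed)
 have q: "q\<in>mod_hom R S N" unfolding q_def by (rule hom_restrictI[OF lm]) (auto simp: M.lsmult_closed N.lsmult_closed)
 obtain X where X: "finite X" "X \<subseteq> car M" "!!L. submodule L R M ==> X \<subseteq> L ==> L = car M" by (rule fg_modE[OF M]) (rule that)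
 obtain Y where Y: "finite Y" "Y \<subseteq> car N" "!!L. submodule L R N ==> Y \<subseteq> L ==> L = car N" by (rule fg_modE[OF N]) (rule that)
 have dec: "z = u (p z) \<oplus>\<^sub>S v (q z)" if zS: "z\<in>car S" for z
 proof -
  obtain x y where xy: "z = j (x, y)" "x\<in>car M" "y\<in>car N" using zS by auto
  hence "p z = x" "q z = y" using zS by (simp_all only: p_def q_def restrict_apply' ij fst_conv snd_conv)
  thus ?thesis using xy by (simp add: u_def v_def)
 qed
 have gen: "L = car S" if L: "submodule L R S" "u ` X \<union> v ` Y \<subseteq> L" for L
 proof
  show "L \<subseteq> car S" using S.lsubmoduleD(1)[OF L(1)] .
  have "submodule {x\<in>car M. u x\<in>L} R M" using S.lsubmoduleD[OF L(1)] hom_zero[OF fg_modD[OF M] lm u]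
   by (intro M.lsubmoduleI) (auto simp del: S simp: hom_add[OF u] hom_smult[OF u] M.lsmult_closed)
  moreover have "X \<subseteq> {x\<in>car M. u x\<in>L}" using X(2) L(2) by auto
  ultimately have 1: "{x\<in>car M. u x\<in>L} = car M" by (rule X(3))
  have "submodule {y\<in>car N. v y\<in>L} R N" using S.lsubmoduleD[OF L(1)] hom_zero[OF fg_modD[OF N] lm v]
   by (intro N.lsubmoduleI) (auto simp del: S simp: hom_add[OF v] hom_smult[OF v] N.lsmult_closed)
  moreover have "Y \<subseteq> {y\<in>car N. v y\<in>L}" using Y(2) L(2) by auto
  ultimately have 2: "{y\<in>car N. v y\<in>L} = car N" by (rule Y(3))
  show "car S \<subseteq> L"
  proof
   fix z assume z: "z\<in>car S"
   have "u (p z)\<in>L" "v (q z)\<in>L" using 1 2 hom_closed[OF p z] hom_closed[OF q z] by auto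
   thus "z\<in>L" using dec[OF z] S.lsubmoduleD(3)[OF L(1), of "u (p z)" "v (q z)"] by (simp del: S)
  qed
 qed
 have "finite (u ` X \<union> v ` Y)" "u ` X \<union> v ` Y \<subseteq> car S" using X(1,2) Y(1,2) hom_closed[OF u] hom_closed[OF v] by (auto simp del: S)
 hence "S\<in>fg_mod R" by (rule fg_modI[OF lm _ _ gen])
 moreover have "\<forall>x\<in>car M. p (u x) = x \<and> q (u x) = \<zero>\<^sub>N" "\<forall>y\<in>car N. p (v y) = \<zero>\<^sub>M \<and> q (v y) = y" by (auto simp: u_def v_def p_def q_def)
 ultimately show ?thesis unfolding is_biprod_def using u v p q dec by blast
qed

text \<open>The same transport for a single module over another element type; it provides a copy of
  the regular module among the modules of the category.\<close>

lemma transport_module: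
 fixes M :: "('a, 'n) module" and j :: "'n => 'm"
 assumes M: "M\<in>fg_mod R" and j: "inj_on j (car M)"
 shows "\<exists>M' :: ('a, 'm) module. M'\<in>fg_mod R \<and> (\<exists>f. f\<in>mod_iso R M' M)"
proof -
 interpret M: left_module R M by (rule fg_modD[OF M])
 define i where "i = inv_into (car M) j"
 have ij [simp]: "i (j x) = x" if "x\<in>car M" for x using j that by (simp add: i_def)
 define S :: "('a, 'm) module" where "S = \<lparr>carrier = j ` car M, mult = undefined, one = undefined,
  zero = j \<zero>\<^sub>M, add = (\<lambda>s t. j (i s \<oplus>\<^sub>M i t)), smult = (\<lambda>a s. j (a\<odot>\<^sub>M i s))\<rparr>"
 have S [simp]: "car S = j ` car M" "\<zero>\<^sub>S = j \<zero>\<^sub>M" "s \<oplus>\<^sub>S t = j (i s \<oplus>\<^sub>M i t)"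
  "a\<odot>\<^sub>S s = j (a\<odot>\<^sub>M i s)" for s t a by (simp_all add: S_def)
 have "abelian_group S"
 proof (rule abelian_groupI)
  fix s assume "s\<in>car S"
  then obtain x where "s = j x" "x\<in>car M" by auto
  thus "\<exists>t\<in>car S. t \<oplus>\<^sub>S s = \<zero>\<^sub>S" by (intro bexI[of _ "j (\<ominus>\<^sub>M x)"]) (auto simp: M.M.l_neg)
 qed (auto simp: M.M.a_ac)
 hence lm: "left_module R S" by (auto simp: left_module_def left_module_axioms_def M.ring_axioms M.lsmult_closed
    M.lsmult_l_distr M.lsmult_r_distr M.lsmult_assoc M.lsmult_one)
 interpret S: left_module R S by (rule lm)
 define f where "f = (\<lambda>s\<in>car S. i s)"
 define g where "g = (\<lambda>x\<in>car M. j x)"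
 have f: "f\<in>mod_hom R S M" unfolding f_def by (rule hom_restrictI[OF lm]) (auto simp: M.lsmult_closed)
 have g: "g\<in>mod_hom R M S" unfolding g_def by (rule hom_restrictI[OF fg_modD[OF M]]) auto
 have "bij_betw f (car S) (car M)" by (rule bij_betwI[of _ _ _ g]) (auto simp: f_def g_def)
 hence iso: "f\<in>mod_iso R S M" using f by (simp add: mod_iso_def)
 obtain X where X: "finite X" "X \<subseteq> car M" "!!L. submodule L R M ==> X \<subseteq> L ==> L = car M" by (rule fg_modE[OF M]) (rule that)
 have gen: "L = car S" if L: "submodule L R S" "j ` X \<subseteq> L" for L
 proof -
  have "submodule {x\<in>car M. g x\<in>L} R M" using S.lsubmoduleD[OF L(1)] hom_zero[OF fg_modD[OF M] lm g]
   by (intro M.lsubmoduleI) (auto simp del: S simp: hom_add[OF g] hom_smult[OF g] M.lsmult_closed)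
  moreover have "X \<subseteq> {x\<in>car M. g x\<in>L}" using X(2) L(2) by (auto simp: g_def)
  ultimately have "{x\<in>car M. g x\<in>L} = car M" by (rule X(3))
  hence "g x\<in>L" if "x\<in>car M" for x using that by blast
  hence "j x\<in>L" if "x\<in>car M" for x using that by (simp add: g_def)
  hence "car S \<subseteq> L" by auto
  thus ?thesis using S.lsubmoduleD(1)[OF L(1)] by blast
 qed
 have "finite (j ` X)" "j ` X \<subseteq> car S" using X(1,2) by auto
 hence "S\<in>fg_mod R" by (rule fg_modI[OF lm _ _ gen])
 with iso show ?thesis by blast
qed

context monomial_algebra
begin

lemma ar_bas:
 assumes a: "a\<in>arcs Q" and p: "(u, as)\<in>paths Q"
 shows "ar a\<otimes>\<^sub>A bas (u, as) = (if good (u, as @ [a]) then bas (u, as @ [a]) else \<zero>\<^sub>A)"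
proof (cases "good (u, as @ [a])")
 case False
 have "ar a\<otimes>\<^sub>A bas (u, as) = \<zero>\<^sub>A"
 proof (rule A_eqI)
  fix q assume q: "good q"
  obtain v bs where qv: "q = (v, bs)" by (cases q)
  show "cf (ar a\<otimes>\<^sub>A bas (u, as)) q = cf \<zero>\<^sub>A q"
  proof (cases bs rule: rev_cases)
   case Nil
   thus ?thesis using a p q by (auto simp: qv cf_ar_mult)
  next
   case (snoc cs x)
   thus ?thesis using False a p q good_append(1)[of v cs "[x]"] by (auto simp: qv cf_ar_mult_snoc)
  qed
 qed (use a p in auto)
 with False show ?thesis by simp
qed (simp add: bas_snoc)

lemma e_bas:
 assumes v: "v\<in>verts Q" and p: "p\<in>paths Q"
 shows "e v\<otimes>\<^sub>A bas p = (if path_target Q p = v then bas p else \<zero>\<^sub>A)" by (rule A_eqI) (use v p in auto)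

lemma e_ar: "a\<in>arcs Q ==> e (head Q a)\<otimes>\<^sub>A ar a = ar a" using e_bas[of "head Q a" "(tail Q a, [a])"] by simp

lemma ar_e: "a\<in>arcs Q ==> ar a\<otimes>\<^sub>A e (tail Q a) = ar a" using ar_bas[of a "tail Q a" "[]"] by simp

lemma e_e: "v\<in>verts Q ==> w\<in>verts Q ==> e v\<otimes>\<^sub>A e w = (if v = w then e v else \<zero>\<^sub>A)" using e_bas[of v "(w, [])"] by auto

lemma ar_ar:
 assumes "a\<in>arcs Q" "b\<in>arcs Q" "\<not> good (tail Q b, [b, a])"
 shows "ar a\<otimes>\<^sub>A ar b = \<zero>\<^sub>A" using ar_bas[of a "tail Q b" "[b]"] assms by simp

end

section \<open>Modules as vector spaces over the field\<close>

locale monomial_module = monomial_algebra Q F I d + left_module "quiver_alg Q I" M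
 for Q :: "('v, 'e) pre_digraph" and F and I :: "(('v, 'e) path => 'k::field) set" and d
  and M :: "((('v, 'e) path => 'k) set, 'm) module" (structure)
begin

lemma sc_closed [simp]: "x\<in>car M ==> sc c\<odot>x\<in>car M" by (simp add: lsmult_closed)

lemma e_closed [simp]: "v\<in>verts Q ==> x\<in>car M ==> e v\<odot>x\<in>car M" by (simp add: lsmult_closed)

lemma ar_closed [simp]: "a\<in>arcs Q ==> x\<in>car M ==> ar a\<odot>x\<in>car M" by (simp add: lsmult_closed)

lemma sc_smult_commute:
 "a\<in>car A ==> x\<in>car M ==> a\<odot>(sc c\<odot>x) = sc c\<odot>(a\<odot>x)" by (simp add: sc_central flip: lsmult_assoc)

lemma sc_1 [simp]: "x\<in>car M ==> sc 1\<odot>x = x" by (simp add: sc_one lsmult_one)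

lemma sc_0 [simp]: "x\<in>car M ==> sc 0\<odot>x = \<zero>" by (simp add: sc_zero zero_lsmult)

lemma sc_sc [simp]: "x\<in>car M ==> sc c\<odot>(sc c'\<odot>x) = sc (c * c')\<odot>x" by (simp add: sc_mult lsmult_assoc)

lemma sc_plus: "x\<in>car M ==> sc (c + c')\<odot>x = sc c\<odot>x \<oplus> sc c'\<odot>x" by (simp add: sc_add lsmult_l_distr)

lemma sc_neg: "x\<in>car M ==> sc (- c)\<odot>x = \<ominus> (sc c\<odot>x)" by (simp add: sc_minus minus_lsmult)

lemma e_e_smult: "v\<in>verts Q ==> w\<in>verts Q ==> x\<in>car M ==>
  e v\<odot>(e w\<odot>x) = (if v = w then e v\<odot>x else \<zero>)" by (simp add: e_e zero_lsmult flip: lsmult_assoc)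

lemma e_ar_smult: "a\<in>arcs Q ==> x\<in>car M ==> e (head Q a)\<odot>(ar a\<odot>x) = ar a\<odot>x" by (simp add: e_ar flip: lsmult_assoc)

lemma ar_e_smult: "a\<in>arcs Q ==> x\<in>car M ==> ar a\<odot>(e (tail Q a)\<odot>x) = ar a\<odot>x" by (simp add: ar_e flip: lsmult_assoc)

lemma submodule_test:
 assumes N: "N \<subseteq> car M" and "\<zero>\<in>N" "!!x y. x\<in>N ==> y\<in>N ==> x \<oplus> y\<in>N"
  and sc: "!!c x. x\<in>N ==> sc c\<odot>x\<in>N" and e: "!!v x. v\<in>verts Q ==> x\<in>N ==> e v\<odot>x\<in>N"
  and ar: "!!a x. a\<in>arcs Q ==> x\<in>N ==> ar a\<odot>x\<in>N"
 shows "submodule N A M"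
proof (rule lsubmoduleI[OF assms(1-3)])
 fix a x assume a: "a\<in>car A" and x: "x\<in>N"
 have xM: "x\<in>car M" using x N by auto
 show "a\<odot>x\<in>N" using a
 proof (induction a rule: A_induct)
  case (arrow g a)
  thus ?case using ar xM by (simp add: lsmult_assoc)
 qed (use assms x xM in \<open>auto simp: zero_lsmult lsmult_l_distr lsmult_assoc\<close>)
qed

lemma smult_hom_test:
 assumes N: "left_module A N" and f: "!!x. x\<in>car M ==> f x\<in>car N"
  and add: "!!x y. x\<in>car M ==> y\<in>car M ==> f (x \<oplus> y) = f x \<oplus>\<^sub>N f y"
  and sc: "!!c x. x\<in>car M ==> f (sc c\<odot>x) = sc c\<odot>\<^sub>N f x"
  and e: "!!v x. v\<in>verts Q ==> x\<in>car M ==> f (e v\<odot>x) = e v\<odot>\<^sub>N f x"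
  and ar: "!!a x. a\<in>arcs Q ==> x\<in>car M ==> f (ar a\<odot>x) = ar a\<odot>\<^sub>N f x"
  and a: "a\<in>car A" and x: "x\<in>car M"
 shows "f (a\<odot>x) = a\<odot>\<^sub>N f x"
proof -
 interpret N: left_module A N by fact
 have f0: "f \<zero> = \<zero>\<^sub>N" using add[of "\<zero>" "\<zero>"] f[of "\<zero>"] by (simp add: N.M.add.l_cancel_one)
 show ?thesis using a
 proof (induction a rule: A_induct)
  case (arrow g a)
  thus ?case using ar[of g "a\<odot>x"] x f by (simp add: lsmult_assoc N.lsmult_assoc lsmult_closed)
 next
  case (vertex c v)
  thus ?case using sc[of "e v\<odot>x" c] e[of v x] x f by (simp add: lsmult_assoc N.lsmult_assoc)
 qed (use x f f0 in \<open>simp_all add: zero_lsmult N.zero_lsmult lsmult_l_distr N.lsmult_l_distr add lsmult_closed\<close>)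
qed

definition kspace where
 "kspace N \<longleftrightarrow> N \<subseteq> car M \<and> \<zero>\<in>N \<and> (\<forall>x\<in>N. \<forall>y\<in>N. x \<oplus> y\<in>N) \<and> (\<forall>c. \<forall>x\<in>N. sc c\<odot>x\<in>N)"

lemma kspace_submodule: "submodule N A M ==> kspace N" unfolding kspace_def using lsubmoduleD[of N] by simp

primrec lspan where
 "lspan [] = {\<zero>}"
| "lspan (x # xs) = {sc c\<odot>x \<oplus> y |c y. y\<in>lspan xs}"

lemma lspan_closed: "set xs \<subseteq> car M ==> lspan xs \<subseteq> car M" by (induction xs) auto

lemma lspan_kspace: "set xs \<subseteq> car M ==> kspace (lspan xs)"
proof (induction xs)
 case Nil
 thus ?case by (auto simp: kspace_def lsmult_zero)
next
 case (Cons x xs)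
 hence ks: "kspace (lspan xs)" and x: "x\<in>car M" by auto
 have cl: "y\<in>car M" if "y\<in>lspan xs" for y using ks that by (auto simp: kspace_def)
 show ?case unfolding kspace_def
 proof (intro conjI ballI allI)
  show "lspan (x # xs) \<subseteq> car M" using Cons.prems by (rule lspan_closed)
  show "\<zero>\<in>lspan (x # xs)" using ks x by (auto simp: kspace_def intro!: exI[of _ 0] exI[of _ "\<zero>"])
  fix s t c assume "s\<in>lspan (x # xs)" "t\<in>lspan (x # xs)"
  then obtain b b' y y' where s: "s = sc b\<odot>x \<oplus> y" "y\<in>lspan xs" and t: "t = sc b'\<odot>x \<oplus> y'" "y'\<in>lspan xs" by auto
  have "s \<oplus> t = sc (b + b')\<odot>x \<oplus> (y \<oplus> y')" using s t x cl by (simp add: sc_plus M.a_ac)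
  moreover have "y \<oplus> y'\<in>lspan xs" using ks s t by (auto simp: kspace_def)
  ultimately show "s \<oplus> t\<in>lspan (x # xs)" by auto
 next
  fix s c assume "s\<in>lspan (x # xs)"
  then obtain b y where s: "s = sc b\<odot>x \<oplus> y" "y\<in>lspan xs" by auto
  have "sc c\<odot>s = sc (c * b)\<odot>x \<oplus> sc c\<odot>y" using s x cl by (simp add: lsmult_r_distr)
  moreover have "sc c\<odot>y\<in>lspan xs" using ks s by (auto simp: kspace_def)
  ultimately show "sc c\<odot>s\<in>lspan (x # xs)" by auto
 qed
qed

lemma lspan_superset: "set xs \<subseteq> car M ==> set xs \<subseteq> lspan xs"
proof (induction xs)
 case (Cons x xs)
 have ks: "kspace (lspan xs)" using Cons.prems lspan_kspace by simp
 show ?case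
 proof
  fix y assume "y\<in>set (x # xs)"
  then consider "y = x" | "y\<in>lspan xs" using Cons by auto
  thus "y\<in>lspan (x # xs)"
  proof cases
   case 1
   thus ?thesis using ks Cons.prems by (auto simp: kspace_def intro!: exI[of _ 1] exI[of _ "\<zero>"])
  next
   case 2
   thus ?thesis using ks Cons.prems by (auto simp: kspace_def intro!: exI[of _ 0] exI[of _ y])
  qed
 qed
qed simp

lemma lspan_least: "kspace N ==> set xs \<subseteq> N ==> lspan xs \<subseteq> N" by (induction xs) (auto simp: kspace_def)

text \<open>Multiplying finitely many generators by the finitely many good paths gives a spanning
  list: an arrow or a vertex sends a product \<open>bas p\<odot>x\<close> to another such product or
  to zero.\<close>

lemma fg_lspan:
 assumes fg: "finitely_generated A M"
 obtains xs where "set xs \<subseteq> car M" "lspan xs = car M"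
proof -
 obtain X where X: "finite X" "X \<subseteq> car M" "!!L. submodule L A M ==> X \<subseteq> L ==> L = car M" using fg unfolding finitely_generated_def by blast
 have "finite ((\<lambda>(p, x). bas p\<odot>x) ` ({p. good p} \<times> X))" using X(1) finite_good by auto
 then obtain xs where xs: "set xs = (\<lambda>(p, x). bas p\<odot>x) ` ({p. good p} \<times> X)" using finite_list by blast
 have xsM: "set xs \<subseteq> car M" unfolding xs using X(2) good_paths by (auto intro!: lsmult_closed)
 have ks: "kspace (lspan xs)" using lspan_kspace[OF xsM] .
 have cl: "y\<in>car M" if "y\<in>lspan xs" for y using ks that by (auto simp: kspace_def)
 have step: "a\<odot>y\<in>lspan xs" if a: "a\<in>car A" and b: "!!p x. good p ==> x\<in>X ==> a\<odot>(bas p\<odot>x)\<in>lspan xs"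
  and y: "y\<in>lspan xs" for a y
 proof -
  have "kspace {y\<in>car M. a\<odot>y\<in>lspan xs}" using ks a by (auto simp: kspace_def lsmult_zero lsmult_r_distr sc_smult_commute)
  moreover have "set xs \<subseteq> {y\<in>car M. a\<odot>y\<in>lspan xs}" using b xs xsM by auto
  ultimately show ?thesis using lspan_least y by blast
 qed
 have ein: "bas p\<odot>x\<in>lspan xs" if "good p" "x\<in>X" for p x using lspan_superset[OF xsM] xs that by auto
 have 0: "\<zero>\<in>lspan xs" using ks by (auto simp: kspace_def)
 have ar: "ar a\<odot>y\<in>lspan xs" if "a\<in>arcs Q" "y\<in>lspan xs" for a y
 proof (rule step[OF _ _ that(2)])
  fix p x assume p: "good p" "x\<in>X"
  hence "ar a\<odot>(bas p\<odot>x) = (ar a\<otimes>\<^sub>A bas p)\<odot>x" using that X(2) good_paths by (subst lsmult_assoc) auto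
  thus "ar a\<odot>(bas p\<odot>x)\<in>lspan xs" using ar_bas[OF that(1), of "fst p" "snd p"] p X(2) ein[of "(fst p, snd p @ [a])"] 0 good_paths[OF p(1)]
   by (auto simp: zero_lsmult)
 qed (use that in auto)
 have e: "e v\<odot>y\<in>lspan xs" if "v\<in>verts Q" "y\<in>lspan xs" for v y
 proof (rule step[OF _ _ that(2)])
  fix p x assume p: "good p" "x\<in>X"
  hence "e v\<odot>(bas p\<odot>x) = (e v\<otimes>\<^sub>A bas p)\<odot>x" using that X(2) good_paths by (subst lsmult_assoc) auto
  thus "e v\<odot>(bas p\<odot>x)\<in>lspan xs" using e_bas[OF that(1) good_paths[OF p(1)]] p X(2) ein[OF p] 0 by (auto simp: zero_lsmult)
 qed (use that in auto)
 have sub: "submodule (lspan xs) A M" by (rule submodule_test) (use ks ar e in \<open>auto simp: kspace_def\<close>)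
 \<comment> \<open>A generator is the multiple of itself by the unit; it need not occur in the list,
   since the trivial paths contribute only its components.\<close>
 have "x\<in>lspan xs" if x: "x\<in>X" for x
 proof -
  have "a\<odot>x\<in>lspan xs" if "a\<in>car A" for a using that
  proof (induction a rule: A_induct)
   case (arrow g a)
   thus ?case using ar x X(2) by (auto simp: lsmult_assoc)
  next
   case (vertex c v)
   thus ?case using ein[of "(v, [])" x] x X(2) ks by (auto simp: lsmult_assoc kspace_def)
  next
   case zero
   thus ?case using x X(2) 0 by (auto simp: zero_lsmult)
  next
   case (add a b)
   thus ?case using x X(2) ks by (auto simp: lsmult_l_distr kspace_def)
  qed
  from this[of "\<one>\<^sub>A"] show ?thesis using x X(2) by (auto simp: lsmult_one)
 qed
 hence "lspan xs = car M" using sub X(3) by blast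
 with xsM show ?thesis using that by blast
qed

text \<open>Elimination of one vector at a time: if \<open>N\<close> is not inside the span of
  \<open>xs\<close>, some \<open>z\<close> in \<open>N\<close> has a nonzero coefficient at
  \<open>x\<close>, and subtracting multiples of \<open>z\<close> moves all of \<open>N\<close> into
  that span.\<close>

lemma kspace_lspan:
 "set xs \<subseteq> car M ==> kspace N ==> N \<subseteq> lspan xs ==> \<exists>ys. set ys \<subseteq> N \<and> lspan ys = N"
proof (induction xs arbitrary: N)
 case Nil
 hence "N = {\<zero>}" by (auto simp: kspace_def)
 thus ?case by (intro exI[of _ "[]"]) auto
next
 case (Cons x xs)
 have x: "x\<in>car M" and xs: "set xs \<subseteq> car M" using Cons.prems by auto
 have kx: "kspace (lspan xs)" using lspan_kspace[OF xs] .
 have "kspace (N \<inter> lspan xs)" using Cons.prems(2) kx by (auto simp: kspace_def)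
 from Cons.IH[OF xs this] obtain ys where ys: "set ys \<subseteq> N \<inter> lspan xs" "lspan ys = N \<inter> lspan xs" by auto
 show ?case
 proof (cases "N \<subseteq> lspan xs")
  case True
  thus ?thesis using ys by (intro exI[of _ ys]) auto
 next
  case False
  then obtain z where z: "z\<in>N" "z \<notin> lspan xs" by auto
  then obtain c y where zc: "z = sc c\<odot>x \<oplus> y" "y\<in>lspan xs" using Cons.prems(3) by auto
  have yM: "y\<in>car M" using zc kx by (auto simp: kspace_def)
  have c: "c \<noteq> 0" using z zc x yM by auto
  have "n\<in>lspan (z # ys)" if n: "n\<in>N" for n
  proof -
   obtain b w where nb: "n = sc b\<odot>x \<oplus> w" "w\<in>lspan xs" using n Cons.prems(3) by auto
   have wM: "w\<in>car M" using nb kx by (auto simp: kspace_def)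
   define m where "m = n \<oplus> sc (- (b / c))\<odot>z"
   have zM: "z\<in>car M" "n\<in>car M" using z n Cons.prems(2) by (auto simp: kspace_def)
   have "m = sc b\<odot>x \<oplus> w \<oplus> (sc (- b)\<odot>x \<oplus> sc (- (b / c))\<odot>y)" using x yM wM c by (simp add: m_def nb(1) zc(1) lsmult_r_distr)
   also have "\<dots> = sc b\<odot>x \<oplus> sc (- b)\<odot>x \<oplus> (w \<oplus> sc (- (b / c))\<odot>y)" using x yM wM by (simp add: M.a_ac)
   also have "\<dots> = w \<oplus> sc (- (b / c))\<odot>y" using x yM wM by (simp flip: sc_plus)
   finally have "m\<in>lspan xs" using kx nb(2) zc(2) by (auto simp: kspace_def)
   moreover have "m\<in>N" using Cons.prems(2) n z by (auto simp: kspace_def m_def)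
   ultimately have "m\<in>lspan ys" using ys by auto
   moreover have "n = sc (b / c)\<odot>z \<oplus> m"
   proof -
    have "sc (b / c)\<odot>z \<oplus> m = n \<oplus> (sc (b / c)\<odot>z \<oplus> sc (- (b / c))\<odot>z)" using zM by (simp add: m_def M.a_ac)
    thus ?thesis using zM by (simp flip: sc_plus)
   qed
   ultimately show ?thesis by auto
  qed
  moreover have "lspan (z # ys) \<subseteq> N" using lspan_least[OF Cons.prems(2), of "z # ys"] z ys by auto
  ultimately show ?thesis using z ys by (intro exI[of _ "z # ys"]) auto
 qed
qed

text \<open>Finite dimension passes to subspaces, and a finite spanning list generates; this
  replaces a chain condition.\<close>

lemma submodule_fg:
 assumes fg: "finitely_generated A M" and N: "submodule N A M"
 shows "M\<lparr>carrier := N\<rparr>\<in>fg_mod A"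
proof -
 obtain xs where xs: "set xs \<subseteq> car M" "lspan xs = car M" using fg_lspan[OF fg] .
 obtain ys where ys: "set ys \<subseteq> N" "lspan ys = N" using kspace_lspan[OF xs(1) kspace_submodule[OF N]] xs(2) lsubmoduleD(1)[OF N] by auto
 interpret N: left_module A "M\<lparr>carrier := N\<rparr>" by (rule lsubmodule_is_left_module[OF N])
 have "L = N" if L: "submodule L A (M\<lparr>carrier := N\<rparr>)" "set ys \<subseteq> L" for L
 proof -
  have "kspace L" unfolding kspace_def using N.lsubmoduleD[OF L(1)] lsubmoduleD(1)[OF N] by auto
  thus ?thesis using lspan_least[OF _ L(2)] ys N.lsubmoduleD(1)[OF L(1)] by auto
 qed
 thus ?thesis unfolding fg_mod_def finitely_generated_def using N.left_module_axioms ys(1) by (auto intro!: exI[of _ "set ys"])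
qed

text \<open>A choice of coordinates; injectivity is enough, linearity is not asked for. All codes
  have the same length, so that two concatenated codes can be separated again when direct sums are
  encoded.\<close>

lemma lspan_encoding:
 "set xs \<subseteq> car M ==> \<exists>\<phi> :: 'm => 'k list. inj_on \<phi> (lspan xs) \<and> (\<forall>m. length (\<phi> m) = length xs)"
proof (induction xs)
 case (Cons x xs)
 then obtain \<phi> :: "'m => 'k list" where \<phi>: "inj_on \<phi> (lspan xs)" "\<forall>m. length (\<phi> m) = length xs" by auto
 have "\<exists>c y. m\<in>lspan (x # xs) \<longrightarrow> y\<in>lspan xs \<and> m = sc c\<odot>x \<oplus> y" for m by auto
 then obtain c y where cy: "!!m. m\<in>lspan (x # xs) ==> y m\<in>lspan xs \<and> m = sc (c m)\<odot>x \<oplus> y m" by metis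
 have "inj_on (\<lambda>m. c m # \<phi> (y m)) (lspan (x # xs))"
 proof (rule inj_onI)
  fix m m' assume m: "m\<in>lspan (x # xs)" "m'\<in>lspan (x # xs)" "c m # \<phi> (y m) = c m' # \<phi> (y m')"
  hence "y m = y m'" "c m = c m'" using \<phi>(1) cy by (auto dest: inj_onD)
  thus "m = m'" using cy[OF m(1)] cy[OF m(2)] by metis
 qed
 thus ?case using \<phi>(2) by (intro exI[of _ "\<lambda>m. c m # \<phi> (y m)"]) auto
qed (auto intro!: exI[of _ "\<lambda>_. []"])

end

context monomial_algebra
begin

lemma monomial_module: "left_module A M ==> monomial_module Q F I d M" by (simp add: monomial_module_def monomial_algebra_axioms)

lemma sub_fg: "M\<in>fg_mod A ==> submodule N A M ==> M\<lparr>carrier := N\<rparr>\<in>fg_mod A"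
 using monomial_module.submodule_fg[OF monomial_module] by (auto simp: fg_mod_def)

lemma fg_encoding:
 fixes M :: "((('v, 'e) path => 'k) set, 'm) module"
 assumes "M\<in>fg_mod A"
 obtains \<phi> :: "'m => 'k list" and n where "inj_on \<phi> (car M)" "!!m. length (\<phi> m) = n"
proof -
 interpret M: monomial_module Q F I d M using assms by (intro monomial_module) (simp add: fg_mod_def)
 obtain xs where xs: "set xs \<subseteq> car M" "M.lspan xs = car M" using M.fg_lspan assms by (auto simp: fg_mod_def)
 from M.lspan_encoding[OF xs(1)] that show ?thesis by (auto simp: xs(2))
qed

lemma biprod_exists:
 fixes M N :: "((('v, 'e) path => 'k) set, 'm) module"
 assumes M: "M\<in>fg_mod A" and N: "N\<in>fg_mod A" and \<iota>: "inj (\<iota> :: 'k list => 'm)"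
 shows "\<exists>S u v p q. is_biprod A M N S u v p q"
proof -
 obtain \<phi> :: "'m => 'k list" and m where \<phi>: "inj_on \<phi> (car M)" "!!x. length (\<phi> x) = m" using fg_encoding[OF M] by blast
 obtain \<psi> :: "'m => 'k list" and n where \<psi>: "inj_on \<psi> (car N)" "!!x. length (\<psi> x) = n" using fg_encoding[OF N] by blast
 have "inj_on (\<lambda>(x, y). \<iota> (\<phi> x @ \<psi> y)) (car M \<times> car N)"
 proof (rule inj_onI, clarify)
  fix x y x' y' assume xy: "x\<in>car M" "y\<in>car N" "x'\<in>car M" "y'\<in>car N"
   "\<iota> (\<phi> x @ \<psi> y) = \<iota> (\<phi> x' @ \<psi> y')"
  hence "\<phi> x @ \<psi> y = \<phi> x' @ \<psi> y'" using \<iota> by (auto dest: injD)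
  hence "\<phi> x = \<phi> x'" "\<psi> y = \<psi> y'" using \<phi>(2) by (simp_all add: append_eq_append_conv)
  thus "x = x' \<and> y = y'" using xy \<phi>(1) \<psi>(1) by (auto dest: inj_onD)
 qed
 thus ?thesis using biprod_of_encoding[OF M N] by blast
qed

lemma stable_modules_sums:
 assumes "projective_covers A P \<pi>" and "\<exists>\<iota> :: 'k list => 'm. inj \<iota>"
 shows "stable_modules_sums A sc (P :: ((('v, 'e) path => 'k) set, 'm) module => _) \<pi>"
 by unfold_locales (use assms sub_fg biprod_exists sc_central in auto)

end

section \<open>Finite sums and the decomposition of the unit into vertices\<close>

context left_module
begin

lemma finsum_smult:
 assumes "a\<in>car R" "f\<in>X \<rightarrow> car M"
 shows "a\<odot>\<^sub>M finsum M f X = finsum M (\<lambda>i. a\<odot>\<^sub>M f i) X"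
proof (cases "finite X")
 case True
 thus ?thesis using assms(2)
 proof (induction X)
  case (insert x X)
  hence "f\<in>X \<rightarrow> car M" "f x\<in>car M" by auto
  with insert show ?case using assms(1) by (subst M.finsum_insert, simp, simp, simp, simp)
    (subst M.finsum_insert, auto simp: lsmult_r_distr lsmult_closed Pi_iff)
 qed (simp add: lsmult_zero assms)
next
 case False
 thus ?thesis using assms(1) by (simp add: M.add.finprod_infinite lsmult_zero)
qed

lemma smult_finsum:
 assumes "finite X" "x\<in>car M" "f\<in>X \<rightarrow> car R"
 shows "finsum R f X\<odot>\<^sub>M x = finsum M (\<lambda>i. f i\<odot>\<^sub>M x) X" using assms(1,3)
proof (induction X)
 case (insert i X)
 hence "f\<in>X \<rightarrow> car R" "f i\<in>car R" by auto
 with insert show ?case using assms(2) by (subst finsum_insert, simp, simp, simp, simp)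
   (subst M.finsum_insert, auto simp: lsmult_l_distr lsmult_closed Pi_iff)
qed (simp add: zero_lsmult assms)

lemma submodule_finsum:
 assumes "submodule H R M" "!!i. i\<in>X ==> f i\<in>H"
 shows "finsum M f X\<in>H"
proof (cases "finite X")
 case True
 thus ?thesis using assms(2)
 proof (induction X)
  case (insert x X)
  hence "f\<in>X \<rightarrow> car M" "f x\<in>car M" using lsubmoduleD(1)[OF assms(1)] by auto
  with insert show ?case using lsubmoduleD(3)[OF assms(1)] by simp
 qed (simp add: lsubmoduleD(2)[OF assms(1)])
next
 case False
 thus ?thesis by (simp add: M.add.finprod_infinite lsubmoduleD(2)[OF assms(1)])
qed

lemma finsum_delta:
 assumes "finite X" "j\<in>X" "x\<in>car M"
 shows "finsum M (\<lambda>i. if i = j then x else \<zero>\<^sub>M) X = x" using M.finsum_singleton[of j X "\<lambda>_. x"] assms by (simp add: eq_commute)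

end

lemma hom_finsum:
 assumes M: "left_module R M" and N: "left_module R N"
  and cl: "!!x. x\<in>car M ==> f x\<in>car N"
  and add: "!!x y. x\<in>car M ==> y\<in>car M ==> f (x \<oplus>\<^sub>M y) = f x \<oplus>\<^sub>N f y"
  and g: "g\<in>X \<rightarrow> car M"
 shows "f (finsum M g X) = finsum N (\<lambda>i. f (g i)) X"
proof -
 interpret M: left_module R M by fact
 interpret N: left_module R N by fact
 have f0: "f \<zero>\<^sub>M = \<zero>\<^sub>N" using add[of "\<zero>\<^sub>M" "\<zero>\<^sub>M"] cl[of "\<zero>\<^sub>M"] by (simp add: N.M.add.l_cancel_one)
 show ?thesis
 proof (cases "finite X")
  case True
  thus ?thesis using g
  proof (induction X)
   case (insert x X)
   hence "g\<in>X \<rightarrow> car M" "g x\<in>car M" by auto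
   with insert show ?case by (subst M.M.finsum_insert, simp, simp, simp, simp)
     (subst N.M.finsum_insert, auto simp: add cl Pi_iff)
  qed (simp add: f0)
 next
  case False
  thus ?thesis using f0 by (simp add: M.M.add.finprod_infinite N.M.add.finprod_infinite)
 qed
qed

context monomial_algebra
begin

lemma cf_finsum:
 assumes "f\<in>X \<rightarrow> car A" "good p" "finite X"
 shows "cf (finsum A f X) p = (\<Sum>i\<in>X. cf (f i) p)" using assms(3,1)
proof (induction X)
 case (insert x X)
 hence "f\<in>X \<rightarrow> car A" "f x\<in>car A" by auto
 with insert show ?case using assms(2) by (subst A.finsum_insert, simp, simp, simp, simp) simp
qed (simp add: assms(2))

lemma one_decomp: "finsum A e (verts Q) = \<one>\<^sub>A"
proof (rule A_eqI)
 have e: "e\<in>verts Q \<rightarrow> car A" by auto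
 show "finsum A e (verts Q)\<in>car A" using e by simp
 fix p assume p: "good p"
 obtain u as where pu: "p = (u, as)" by (cases p)
 have "(\<Sum>v\<in>verts Q. cf (e v) p) = (\<Sum>v\<in>verts Q. if v = u then (if as = [] then 1 else 0) else 0)" using p by (intro sum.cong) (auto simp: pu)
 thus "cf (finsum A e (verts Q)) p = cf \<one>\<^sub>A p" using p path_source_verts[OF good_paths[OF p]] by (simp add: cf_finsum[OF e] pu finite_verts)
qed simp

end

context monomial_module
begin

text \<open>The unit is the sum of the vertex idempotents, so \<open>x\<close> is the sum of its
  components \<open>e v\<odot>x\<close>.\<close>

lemma kspace_homogeneous:
 assumes U: "kspace U" and x: "x\<in>car M" and "!!v. v\<in>verts Q ==> e v\<odot>x\<in>U"
 shows "x\<in>U"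
proof -
 have "finsum M (\<lambda>v. e v\<odot>x) V\<in>U" if "finite V" "V \<subseteq> verts Q" for V using that
 proof (induction V)
  case (insert v V)
  hence "(\<lambda>v. e v\<odot>x)\<in>V \<rightarrow> car M" "e v\<odot>x\<in>car M" using x by auto
  with insert assms(3)[of v] U show ?case by (simp add: kspace_def)
 qed (use U in \<open>simp add: kspace_def\<close>)
 from this[OF finite_verts] have "finsum M (\<lambda>v. e v\<odot>x) (verts Q)\<in>U" by simp
 moreover have "finsum M (\<lambda>v. e v\<odot>x) (verts Q) = x" using smult_finsum[of "verts Q" x e] x by (simp add: one_decomp lsmult_one)
 ultimately show ?thesis by simp
qed

section \<open>The radical, maximal submodules and linear functionals\<close>

abbreviation arsum where "arsum m \<equiv> finsum M (\<lambda>\<gamma>. ar \<gamma>\<odot>m \<gamma>) (arcs Q)"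

text \<open>This is the product of the arrow ideal with the module; sorting products by their
  leftmost arrow leaves one module element for each arrow.\<close>

definition rad where
 "rad = {arsum m |m. m\<in>arcs Q \<rightarrow> car M}"

lemma ar_in_rad: "\<delta>\<in>arcs Q ==> y\<in>car M ==> ar \<delta>\<odot>y\<in>rad"
proof -
 assume d: "\<delta>\<in>arcs Q" and y: "y\<in>car M"
 have "finsum M (\<lambda>g. ar g\<odot>(if g = \<delta> then y else \<zero>)) (arcs Q) =
   finsum M (\<lambda>g. if g = \<delta> then ar \<delta>\<odot>y else \<zero>) (arcs Q)" using d y by (intro M.finsum_cong') (auto simp: lsmult_zero)
 also have "\<dots> = ar \<delta>\<odot>y" using d y by (intro finsum_delta) auto
 finally show ?thesis unfolding rad_def using y by (intro CollectI exI[of _ "\<lambda>g. if g = \<delta> then y else \<zero>"]) auto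
qed

lemma rad_closed: "rad \<subseteq> car M" unfolding rad_def by (auto simp: Pi_iff intro!: M.finsum_closed)

lemma rad_submodule: "submodule rad A M"
proof (rule submodule_test)
 show "rad \<subseteq> car M" by (rule rad_closed)
 show "\<zero>\<in>rad"
 proof -
  have "finsum M (\<lambda>s. ar s\<odot>\<zero>) (arcs Q) = finsum M (\<lambda>s. \<zero>) (arcs Q)" by (intro M.finsum_cong') (auto simp: Pi_iff lsmult_zero)
  thus ?thesis unfolding rad_def by (intro CollectI exI[of _ "\<lambda>_. \<zero>"] conjI) (auto simp: Pi_iff)
 qed
next
 fix x y assume "x\<in>rad" "y\<in>rad"
 then obtain m n where m: "m\<in>arcs Q \<rightarrow> car M" "x = arsum m"
  and n: "n\<in>arcs Q \<rightarrow> car M" "y = arsum n" by (auto simp: Pi_iff rad_def)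
 have "finsum M (\<lambda>s. ar s\<odot>(m s \<oplus> n s)) (arcs Q) =
  finsum M (\<lambda>s. ar s\<odot>m s \<oplus> ar s\<odot>n s) (arcs Q)" using m n by (intro M.finsum_cong') (auto simp: Pi_iff lsmult_r_distr)
 also have "\<dots> = x \<oplus> y" using m n by (subst M.finsum_addf) (auto simp: Pi_iff)
 finally show "x \<oplus> y\<in>rad" unfolding rad_def using m n by (intro CollectI exI[of _ "\<lambda>s. m s \<oplus> n s"]) (auto simp: Pi_iff)
next
 fix c x assume "x\<in>rad"
 then obtain m where m: "m\<in>arcs Q \<rightarrow> car M" "x = arsum m" by (auto simp: Pi_iff rad_def)
 have "sc c\<odot>x = finsum M (\<lambda>s. sc c\<odot>(ar s\<odot>m s)) (arcs Q)" unfolding m(2) using m(1) by (intro finsum_smult) (auto simp: Pi_iff)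
 also have "\<dots> = finsum M (\<lambda>s. ar s\<odot>(sc c\<odot>m s)) (arcs Q)" using m(1) by (intro M.finsum_cong') (auto simp: Pi_iff sc_smult_commute)
 finally show "sc c\<odot>x\<in>rad" unfolding rad_def using m by (intro CollectI exI[of _ "\<lambda>s. sc c\<odot>m s"]) (auto simp: Pi_iff)
next
 fix v x assume v: "v\<in>verts Q" and "x\<in>rad"
 then obtain m where m: "m\<in>arcs Q \<rightarrow> car M" "x = arsum m" by (auto simp: Pi_iff rad_def)
 have "e v\<odot>x = finsum M (\<lambda>s. e v\<odot>(ar s\<odot>m s)) (arcs Q)" unfolding m(2) using m(1) v by (intro finsum_smult) (auto simp: Pi_iff)
 also have "\<dots> = finsum M (\<lambda>s. ar s\<odot>(if head Q s = v then m s else \<zero>)) (arcs Q)"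
 proof (intro M.finsum_cong' refl)
  fix s assume g: "s\<in>arcs Q"
  hence mg: "m s\<in>car M" using m(1) by auto
  show "e v\<odot>(ar s\<odot>m s) = ar s\<odot>(if head Q s = v then m s else \<zero>)"
   using e_e_smult[of v "head Q s" "ar s\<odot>m s"] g mg v e_ar_smult[OF g mg] by (auto simp: Pi_iff lsmult_zero)
 qed (use m(1) in \<open>auto simp: Pi_iff\<close>)
 finally show "e v\<odot>x\<in>rad" unfolding rad_def using m by (intro CollectI exI[of _ "\<lambda>s. if head Q s = v then m s else \<zero>"]) (auto simp: Pi_iff)
next
 fix a x assume "a\<in>arcs Q" "x\<in>rad"
 thus "ar a\<odot>x\<in>rad" using ar_in_rad rad_closed by auto
qed

text \<open>Take \<open>N\<close> maximal among the submodules above \<open>N0\<close> that avoid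
  \<open>x\<close>. As arrows send everything into \<open>N0\<close>, a homogeneous \<open>y\<close>
  outside \<open>N\<close> enlarges it only by its scalar multiples, so maximality puts
  \<open>x\<close> into \<open>N\<close> plus the multiples of \<open>y\<close>; solving for
  \<open>y\<close> gives the claim.\<close>

lemma maximal_submodule:
 assumes N0: "submodule N0 A M" and rad: "!!g y. g\<in>arcs Q ==> y\<in>car M ==> ar g\<odot>y\<in>N0"
  and x: "x\<in>car M" "x \<notin> N0"
 shows "\<exists>N. submodule N A M \<and> N0 \<subseteq> N \<and> x \<notin> N \<and> (\<forall>y\<in>car M. \<exists>c. y \<oplus> sc c\<odot>x\<in>N)"
proof -
 let ?S = "{N. submodule N A M \<and> N0 \<subseteq> N \<and> x \<notin> N}"
 have "\<exists>N\<in>?S. \<forall>X\<in>?S. N \<subseteq> X \<longrightarrow> X = N"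
 proof (rule subset_Zorn_nonempty)
  show "?S \<noteq> {}" using N0 x by auto
  fix \<C> assume ne: "\<C> \<noteq> {}" and ch: "subset.chain ?S \<C>"
  hence s: "!!N. N\<in>\<C> ==> submodule N A M \<and> N0 \<subseteq> N \<and> x \<notin> N"
   and lin: "!!N N'. N\<in>\<C> ==> N'\<in>\<C> ==> N \<subseteq> N' \<or> N' \<subseteq> N" by (auto simp: subset.chain_def)
  have "submodule (\<Union>\<C>) A M"
  proof (rule lsubmoduleI)
   show "\<Union>\<C> \<subseteq> car M" using s lsubmoduleD(1) by blast
   show "\<zero>\<in>\<Union>\<C>" using s ne lsubmoduleD(2) by blast
   show "y \<oplus> z\<in>\<Union>\<C>" if yz: "y\<in>\<Union>\<C>" "z\<in>\<Union>\<C>" for y z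
   proof -
    obtain N N' where "N\<in>\<C>" "y\<in>N" "N'\<in>\<C>" "z\<in>N'" using yz by blast
    then obtain L where "L\<in>\<C>" "y\<in>L" "z\<in>L" using lin[of N N'] by blast
    thus ?thesis using s[of L] lsubmoduleD(3)[of L y z] by blast
   qed
   show "a\<odot>y\<in>\<Union>\<C>" if "a\<in>car A" "y\<in>\<Union>\<C>" for a y using that s lsubmoduleD(4) by blast
  qed
  thus "\<Union>\<C>\<in>?S" using s ne by blast
 qed
 then obtain N where NS: "N\<in>?S" and mx: "\<forall>X\<in>?S. N \<subseteq> X \<longrightarrow> X = N" by (elim bexE)
 from NS have N: "submodule N A M" "N0 \<subseteq> N" "x \<notin> N" by simp_all
 have max: "X = N" if "submodule X A M" "N \<subseteq> X" "x \<notin> X" for X using mx[rule_format, of X] that N(2) by simp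
 note ND = lsubmoduleD[OF N(1)]
 have NM: "n\<in>car M" if "n\<in>N" for n using ND(1) that by auto
 \<comment> \<open>The elements that become multiples of \<open>x\<close> modulo \<open>N\<close>.
   They form a linear subspace, so homogeneous elements suffice.\<close>
 define U where "U = {y\<in>car M. \<exists>c. y \<oplus> sc c\<odot>x\<in>N}"
 have "kspace U" unfolding kspace_def
 proof (intro conjI ballI allI)
  show "U \<subseteq> car M" by (auto simp: U_def)
  show "\<zero>\<in>U" using ND(2) x by (auto simp: U_def intro!: exI[of _ 0])
  fix y z assume "y\<in>U" "z\<in>U"
  then obtain c c' where c: "y\<in>car M" "z\<in>car M" "y \<oplus> sc c\<odot>x\<in>N" "z \<oplus> sc c'\<odot>x\<in>N" by (auto simp: U_def)
  have "(y \<oplus> z) \<oplus> sc (c + c')\<odot>x = (y \<oplus> sc c\<odot>x) \<oplus> (z \<oplus> sc c'\<odot>x)" using c x by (simp add: sc_plus M.a_ac)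
  hence "(y \<oplus> z) \<oplus> sc (c + c')\<odot>x\<in>N" using ND(3)[OF c(3,4)] by simp
  thus "y \<oplus> z\<in>U" using c by (auto simp: U_def)
 next
  fix b y assume "y\<in>U"
  then obtain c where c: "y\<in>car M" "y \<oplus> sc c\<odot>x\<in>N" by (auto simp: U_def)
  have "sc b\<odot>y \<oplus> sc (b * c)\<odot>x = sc b\<odot>(y \<oplus> sc c\<odot>x)" using c x by (simp add: lsmult_r_distr)
  hence "sc b\<odot>y \<oplus> sc (b * c)\<odot>x\<in>N" using ND(4)[OF _ c(2), of "sc b"] by simp
  thus "sc b\<odot>y\<in>U" using c by (auto simp: U_def)
 qed
 moreover have hom: "y\<in>U" if y: "y\<in>car M" and w: "w\<in>verts Q" "e w\<odot>y = y" for y w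
 proof (cases "y\<in>N")
  case True
  thus ?thesis using y x by (auto simp: U_def intro!: exI[of _ 0])
 next
  case False
  let ?X = "{n \<oplus> sc b\<odot>y |n b. n\<in>N}"
  have "submodule ?X A M"
  proof (rule submodule_test)
   show "?X \<subseteq> car M" using y NM by auto
   show "\<zero>\<in>?X" using ND(2) y by (auto intro!: exI[of _ "\<zero>"] exI[of _ 0])
   show "s \<oplus> t\<in>?X" if st: "s\<in>?X" "t\<in>?X" for s t
   proof -
    obtain n b n' b' where s: "s = n \<oplus> sc b\<odot>y" "n\<in>N" and t: "t = n' \<oplus> sc b'\<odot>y" "n'\<in>N" using st by blast
    have "s \<oplus> t = (n \<oplus> n') \<oplus> sc (b + b')\<odot>y" using s t NM[of n] NM[of n'] y by (simp add: sc_plus M.a_ac)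
    thus ?thesis using ND(3)[OF s(2) t(2)] by blast
   qed
   show "sc c\<odot>s\<in>?X" if st: "s\<in>?X" for c s
   proof -
    obtain n b where s: "s = n \<oplus> sc b\<odot>y" "n\<in>N" using st by blast
    have "sc c\<odot>s = sc c\<odot>n \<oplus> sc (c * b)\<odot>y" using s NM[of n] y by (simp add: lsmult_r_distr)
    thus ?thesis using ND(4)[OF _ s(2), of "sc c"] by auto
   qed
   show "e v\<odot>s\<in>?X" if v: "v\<in>verts Q" and st: "s\<in>?X" for v s
   proof -
    obtain n b where s: "s = n \<oplus> sc b\<odot>y" "n\<in>N" using st by blast
    have "e v\<odot>(sc b\<odot>y) = sc b\<odot>(e v\<odot>(e w\<odot>y))" using v y w(2) by (simp add: sc_smult_commute)
    also have "\<dots> = sc (if v = w then b else 0)\<odot>y" using v w y by (subst e_e_smult) (auto simp: lsmult_zero)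
    finally have "e v\<odot>s = e v\<odot>n \<oplus> sc (if v = w then b else 0)\<odot>y" using s NM[of n] y v by (simp add: lsmult_r_distr)
    thus ?thesis using ND(4)[OF _ s(2), of "e v"] v by auto
   qed
   show "ar a\<odot>s\<in>?X" if a: "a\<in>arcs Q" and "s\<in>?X" for a s
   proof -
    have "s\<in>car M" using that(2) y NM by auto
    hence "ar a\<odot>s\<in>N" using rad[OF a] N(2) by blast
    moreover from this have "ar a\<odot>s = ar a\<odot>s \<oplus> sc 0\<odot>y" using NM y by simp
    ultimately show ?thesis by blast
   qed
  qed
  moreover have "N \<subseteq> ?X"
  proof
   fix n assume n: "n\<in>N"
   hence "n = n \<oplus> sc 0\<odot>y" using NM y by simp
   with n show "n\<in>?X" by blast
  qed
  moreover have "y\<in>?X"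
  proof -
   have "y = \<zero> \<oplus> sc 1\<odot>y" using y by simp
   with ND(2) show ?thesis by blast
  qed
  ultimately have "x\<in>?X" using max[of ?X] False by blast
  then obtain n b where nb: "x = n \<oplus> sc b\<odot>y" "n\<in>N" by blast
  have b: "b \<noteq> 0" using nb N(3) NM[of n] y by auto
  define m where "m = sc (- (1 / b))\<odot>n"
  have nM: "n\<in>car M" "m\<in>car M" using NM[OF nb(2)] by (auto simp: m_def)
  have "sc (- (1 / b))\<odot>x = m \<oplus> sc (- 1)\<odot>y" unfolding nb(1) m_def using nM(1) y b by (simp add: lsmult_r_distr)
  also have "\<dots> = m \<oplus> \<ominus> y" using y by (simp add: sc_neg)
  finally have "y \<oplus> sc (- (1 / b))\<odot>x = y \<oplus> (m \<oplus> \<ominus> y)" by simp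
  also have "\<dots> = m \<oplus> (y \<oplus> \<ominus> y)" using y nM(2) by (intro M.a_lcomm) auto
  also have "\<dots> = sc (- (1 / b))\<odot>n" using y nM(2) by (simp add: M.r_neg m_def[symmetric])
  finally have "y \<oplus> sc (- (1 / b))\<odot>x\<in>N" using ND(4)[OF _ nb(2), of "sc (- (1 / b))"] by simp
  thus ?thesis using y by (auto simp: U_def)
 qed
 ultimately have "y\<in>U" if y: "y\<in>car M" for y
 proof (intro kspace_homogeneous[OF _ y])
  fix v assume v: "v\<in>verts Q"
  show "e v\<odot>y\<in>U" by (rule hom[OF _ v]) (use v y in \<open>simp_all add: e_e_smult\<close>)
 qed
 thus ?thesis using N by (intro exI[of _ N]) (auto simp: U_def)
qed

text \<open>An element \<open>x\<close> of \<open>K\<close> outside the radical would leave a proper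
  submodule \<open>N\<close> that together with the multiples of \<open>x\<close> is everything, so
  \<open>N\<close> and \<open>K\<close> would span the module.\<close>

lemma superfluous_in_rad:
 assumes K: "submodule K A M" and sup: "!!N. submodule N A M ==> N <+> K = car M ==> N = car M"
 shows "K \<subseteq> rad"
proof
 fix x assume x: "x\<in>K"
 hence xM: "x\<in>car M" using lsubmoduleD(1)[OF K] by auto
 show "x\<in>rad"
 proof (rule ccontr)
  assume "x \<notin> rad"
  from maximal_submodule[OF rad_submodule ar_in_rad xM this]
  obtain N where N: "submodule N A M" "x \<notin> N" "!!y. y\<in>car M ==> \<exists>c. y \<oplus> sc c\<odot>x\<in>N" by blast
  have "N <+> K = car M"
  proof
   show "N <+> K \<subseteq> car M" using lsubmoduleD(1)[OF N(1)] lsubmoduleD(1)[OF K] by (auto simp: set_add_def')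
   show "car M \<subseteq> N <+> K"
   proof
    fix y assume y: "y\<in>car M"
    then obtain c where c: "y \<oplus> sc c\<odot>x\<in>N" using N(3) by blast
    have "y = (y \<oplus> sc c\<odot>x) \<oplus> sc (- c)\<odot>x" using y xM by (simp add: M.a_assoc flip: sc_plus)
    moreover have "sc (- c)\<odot>x\<in>K" using lsubmoduleD(4)[OF K _ x] by simp
    ultimately show "y\<in>N <+> K" using c unfolding set_add_def' by blast
   qed
  qed
  thus False using sup[OF N(1)] N(2) xM by blast
 qed
qed

definition killed where "killed \<longleftrightarrow> (\<forall>\<gamma>\<in>arcs Q. \<forall>x\<in>car M. ar \<gamma>\<odot>x = \<zero>)"

text \<open>If arrows act as zero, \<open>maximal_submodule\<close> applies to every
  \<open>N0\<close> and gives an \<open>N\<close> of codimension one complementary to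
  \<open>x\<close>; the value of \<open>l\<close> is the coordinate along \<open>x\<close>.\<close>

lemma functional:
 assumes k: killed and N0: "submodule N0 A M" and x: "x\<in>car M" "x \<notin> N0"
  and i: "i\<in>verts Q" "e i\<odot>x = x"
 shows "\<exists>l :: 'm => 'k. (\<forall>y\<in>car M. \<forall>z\<in>car M. l (y \<oplus> z) = l y + l z) \<and>
  (\<forall>c. \<forall>y\<in>car M. l (sc c\<odot>y) = c * l y) \<and>
  (\<forall>v\<in>verts Q. \<forall>y\<in>car M. l (e v\<odot>y) = (if v = i then l y else 0)) \<and> (\<forall>y\<in>N0. l y = 0) \<and> l x = 1"
proof -
 have "ar g\<odot>y\<in>N0" if "g\<in>arcs Q" "y\<in>car M" for g y using k that lsubmoduleD(2)[OF N0] by (simp add: killed_def)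
 from maximal_submodule[OF N0 this x] obtain N where N: "submodule N A M" "N0 \<subseteq> N" "x \<notin> N"
  and ex: "!!y. y\<in>car M ==> \<exists>c. y \<oplus> sc c\<odot>x\<in>N" by blast
 note ND = lsubmoduleD[OF N(1)]
 define l where "l y = - (SOME c. y \<oplus> sc c\<odot>x\<in>N)" for y
 have l: "y \<oplus> sc (- l y)\<odot>x\<in>N" if "y\<in>car M" for y using someI_ex[OF ex[OF that]] by (simp add: l_def)
 have uniq: "l y = c" if y: "y\<in>car M" "y \<oplus> sc (- c)\<odot>x\<in>N" for y c
 proof (rule ccontr)
  assume ne: "l y \<noteq> c"
  have "(y \<oplus> sc (- c)\<odot>x) \<oplus> sc (- 1)\<odot>(y \<oplus> sc (- l y)\<odot>x) =
   (sc 1\<odot>y \<oplus> sc (- 1)\<odot>y) \<oplus> (sc (l y)\<odot>x \<oplus> sc (- c)\<odot>x)" using y(1) x(1) by (simp add: lsmult_r_distr M.a_ac)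
  also have "\<dots> = sc (l y - c)\<odot>x" using y(1) x(1) by (simp flip: sc_plus del: sc_1)
  finally have "sc (l y - c)\<odot>x\<in>N" using ND(3)[OF y(2) ND(4)[OF _ l[OF y(1)], of "sc (- 1)"]] by simp
  from ND(4)[OF _ this, of "sc (1 / (l y - c))"] have "x\<in>N" using x(1) ne by simp
  thus False using N(3) by blast
 qed
 have "l (y \<oplus> z) = l y + l z" if yz: "y\<in>car M" "z\<in>car M" for y z
 proof (rule uniq)
  have "y \<oplus> z \<oplus> sc (- (l y + l z))\<odot>x = (y \<oplus> sc (- l y)\<odot>x) \<oplus> (z \<oplus> sc (- l z)\<odot>x)" using yz x(1) sc_plus[of x "- l y" "- l z"] by (simp add: M.a_ac)
  thus "y \<oplus> z \<oplus> sc (- (l y + l z))\<odot>x\<in>N" using ND(3)[OF l[OF yz(1)] l[OF yz(2)]] by simp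
 qed (use yz in auto)
 moreover have "l (sc c\<odot>y) = c * l y" if y: "y\<in>car M" for c y
 proof (rule uniq)
  have "sc c\<odot>y \<oplus> sc (- (c * l y))\<odot>x = sc c\<odot>(y \<oplus> sc (- l y)\<odot>x)" using y x(1) by (simp add: lsmult_r_distr)
  thus "sc c\<odot>y \<oplus> sc (- (c * l y))\<odot>x\<in>N" using ND(4)[OF _ l[OF y]] by simp
 qed (use y in auto)
 moreover have "l (e v\<odot>y) = (if v = i then l y else 0)" if v: "v\<in>verts Q" and y: "y\<in>car M" for v y
 proof (rule uniq)
  have "e v\<odot>(sc (- l y)\<odot>x) = sc (- l y)\<odot>(e v\<odot>(e i\<odot>x))" using v x(1) i by (simp add: sc_smult_commute)
  also have "\<dots> = sc (- (if v = i then l y else 0))\<odot>x" using v i x(1) by (subst e_e_smult) (auto simp: lsmult_zero)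
  finally have "e v\<odot>y \<oplus> sc (- (if v = i then l y else 0))\<odot>x = e v\<odot>(y \<oplus> sc (- l y)\<odot>x)" using v y x(1) by (simp add: lsmult_r_distr)
  thus "e v\<odot>y \<oplus> sc (- (if v = i then l y else 0))\<odot>x\<in>N" using ND(4)[OF _ l[OF y], of "e v"] v by simp
 qed (use v y in auto)
 moreover have "l y = 0" if "y\<in>N0" for y using that N(2) ND(1) x(1) uniq[of y 0] by (simp add: subset_iff)
 moreover have "l x = 1" using x(1) ND(2) sc_plus[of x 1 "- 1"] by (intro uniq) auto
 ultimately show ?thesis by (intro exI[of _ l]) blast
qed

end

section \<open>Semisimple modules over algebras with radical square zero\<close>

context monomial_module
begin

lemma kspace_finsum:
 assumes U: "kspace U" and f: "!!i. i\<in>X ==> f i\<in>U"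
 shows "finsum M f X\<in>U"
proof (cases "finite X")
 case True
 thus ?thesis using f
 proof (induction X)
  case (insert x X)
  hence "f\<in>X \<rightarrow> car M" "f x\<in>car M" using U by (auto simp: kspace_def)
  with insert show ?case using U by (simp add: kspace_def)
 qed (use U in \<open>simp add: kspace_def\<close>)
next
 case False
 thus ?thesis using U by (simp add: M.add.finprod_infinite kspace_def)
qed

lemma smult_annihilated:
 assumes i: "i\<in>verts Q" and x: "x\<in>car M" "e i\<odot>x = x" "!!g. g\<in>arcs Q ==> ar g\<odot>x = \<zero>"
  and a: "a\<in>car A"
 shows "a\<odot>x = sc (cf a (i, []))\<odot>x" using a
proof (induction a rule: A_induct)
 case zero
 thus ?case using x i by (simp add: zero_lsmult)
next
 case (add a b)
 thus ?case using x i by (simp add: lsmult_l_distr sc_plus)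
next
 case (vertex c v)
 have "e v\<odot>x = (if v = i then x else \<zero>)" using e_e_smult[of v i x] vertex i x(1,2) by auto
 thus ?case using vertex x i by (simp add: lsmult_assoc lsmult_zero)
next
 case (arrow g a)
 have "(ar g\<otimes>\<^sub>A a)\<odot>x = sc (cf a (i, []))\<odot>(ar g\<odot>x)" using arrow x by (simp add: lsmult_assoc sc_smult_commute)
 thus ?case using arrow x i by (simp add: lsmult_zero cf_ar_mult)
qed

end

lemma
 assumes "f\<in>mod_iso R M N"
 shows mod_iso_hom: "f\<in>mod_hom R M N" and mod_iso_bij: "bij_betw f (car M) (car N)" using assms by (auto simp: mod_iso_def)

context monomial_algebra
begin

lemma cover_ker_rad:
 assumes M: "left_module A M" and pc: "projective_cover A P p M"
 shows "hom_ker P M p \<subseteq> monomial_module.rad Q I P"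
proof -
 have P: "left_module A P" and p: "p\<in>mod_hom A P M" using pc by (auto simp: projective_cover_def fg_mod_def)
 interpret P: monomial_module Q F I d P using P by (rule monomial_module)
 show ?thesis by (rule P.superfluous_in_rad[OF hom_ker_submodule[OF P M p]]) (use pc in \<open>auto simp: projective_cover_def\<close>)
qed

end

locale rad_square_zero = monomial_algebra Q F I 2 for Q :: "('v, 'e) pre_digraph" and F and I :: "(('v, 'e) path => 'k::field) set" +
 fixes S :: "'v => ((('v, 'e) path => 'k) set, 'm) module" and \<sigma> :: "'v => 'm => 'k"
 assumes simple_fg: "\<alpha>\<in>verts Q ==> S \<alpha>\<in>fg_mod (quiver_alg Q I)"
  and simple_iso: "\<alpha>\<in>verts Q ==> \<sigma> \<alpha>\<in>mod_iso (quiver_alg Q I) (S \<alpha>) (vertex_simple \<alpha>)"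
begin

lemma ar_ar_zero: "a\<in>arcs Q ==> b\<in>arcs Q ==> ar a\<otimes>\<^sub>A ar b = \<zero>\<^sub>A" using long_bad[of "(tail Q b, [b, a])"] by (intro ar_ar) auto

abbreviation is_killed where "is_killed M \<equiv> monomial_module.killed Q I M"

lemma killed_iff:
 assumes "left_module A M"
 shows "is_killed M \<longleftrightarrow> (\<forall>g\<in>arcs Q. \<forall>x\<in>car M. ar g\<odot>\<^sub>M x = \<zero>\<^sub>M)" using monomial_module.killed_def[OF monomial_module[OF assms]] .

lemma ar_ar_smult:
 assumes M: "left_module A M" and "a\<in>arcs Q" "b\<in>arcs Q" "x\<in>car M"
 shows "ar a\<odot>\<^sub>M (ar b\<odot>\<^sub>M x) = \<zero>\<^sub>M"
proof -
 interpret M: left_module A M by fact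
 show ?thesis using assms by (simp add: ar_ar_zero M.zero_lsmult flip: M.lsmult_assoc)
qed

text \<open>The elements killed by all arrows form a submodule \<open>T\<close>, and
  \<open>T\<close> contains every simple submodule \<open>K\<close>: if an arrow moves some
  \<open>x\<close> in \<open>K\<close>, the result is a nonzero element of both \<open>K\<close> and
  \<open>T\<close>, because two arrows multiply to zero. Conversely, if arrows act as zero, every
  nonzero homogeneous element spans a simple submodule.\<close>

lemma semisimple_iff_killed:
 assumes M: "left_module A M"
 shows "semisimple_module A M \<longleftrightarrow> is_killed M"
proof
 interpret M: monomial_module Q F I 2 M using M by (rule monomial_module)
 {
  assume ss: "semisimple_module A M"
  define T where "T = {x\<in>car M. \<forall>u\<in>arcs Q. ar u\<odot>\<^sub>M x = \<zero>\<^sub>M}"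
  have T: "submodule T A M"
  proof (rule M.submodule_test)
   fix v x assume v: "v\<in>verts Q" and x: "x\<in>T"
   hence "ar u\<odot>\<^sub>M (e v\<odot>\<^sub>M x) = \<zero>\<^sub>M" if "u\<in>arcs Q" for u using that ar_e[OF that] M.lsmult_assoc[of "ar u" "e v" x] e_e[of "tail Q u" v]
     A.m_assoc[of "ar u" "e (tail Q u)" "e v"] by (auto simp: T_def M.zero_lsmult split: if_splits)
   thus "e v\<odot>\<^sub>M x\<in>T" using v x by (auto simp: T_def)
  qed (auto simp: T_def M.lsmult_zero M.lsmult_r_distr M.sc_smult_commute ar_ar_smult[OF M])
  have "K \<subseteq> T" if K: "submodule K A M" "simple_module A (M\<lparr>carrier := K\<rparr>)" for K
  proof -
   interpret K: monomial_module Q F I 2 "M\<lparr>carrier := K\<rparr>" by (rule monomial_module) (rule M.lsubmodule_is_left_module[OF K(1)])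
   have KM: "x\<in>car M" if "x\<in>K" for x using M.lsubmoduleD(1)[OF K(1)] that by auto
   have "submodule (K \<inter> T) A (M\<lparr>carrier := K\<rparr>)" using M.lsubmoduleD[OF K(1)] M.lsubmoduleD[OF T] by (intro K.lsubmoduleI) auto
   hence *: "K \<inter> T = {\<zero>\<^sub>M} \<or> K \<inter> T = K" using K(2) by (auto simp: simple_module_def)
   show ?thesis
   proof
    fix x assume x: "x\<in>K"
    show "x\<in>T"
    proof (rule ccontr)
     assume nT: "x \<notin> T"
     then obtain u where g: "u\<in>arcs Q" "ar u\<odot>\<^sub>M x \<noteq> \<zero>\<^sub>M" using KM[OF x] by (auto simp: T_def)
     have "ar u\<odot>\<^sub>M x\<in>K \<inter> T" using M.lsubmoduleD(4)[OF K(1) _ x] g KM[OF x] ar_ar_smult[OF M] by (auto simp: T_def)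
     hence "K \<inter> T = K" using * g(2) by blast
     thus False using x nT by blast
    qed
   qed
  qed
  hence "T = car M" using ss T unfolding semisimple_module_def by blast
  thus "is_killed M" unfolding M.killed_def by (auto simp: T_def)
 }
 {
  assume k: "is_killed M"
  have "N = car M" if N: "submodule N A M"
   and simp: "!!K. submodule K A M ==> simple_module A (M\<lparr>carrier := K\<rparr>) ==> K \<subseteq> N" for N
  proof
   show "N \<subseteq> car M" using M.lsubmoduleD(1)[OF N] .
   show "car M \<subseteq> N"
   proof
    fix x assume x: "x\<in>car M"
    show "x\<in>N"
    proof (rule M.kspace_homogeneous[OF M.kspace_submodule[OF N] x])
     fix v assume v: "v\<in>verts Q"
     define y where "y = e v\<odot>\<^sub>M x"
     have y: "y\<in>car M" "e v\<odot>\<^sub>M y = y" "!!u. u\<in>arcs Q ==> ar u\<odot>\<^sub>M y = \<zero>\<^sub>M" using v x k by (auto simp: y_def M.e_e_smult M.killed_def)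
     show "e v\<odot>\<^sub>M x\<in>N"
     proof (cases "y = \<zero>\<^sub>M")
      case True
      thus ?thesis using M.lsubmoduleD(2)[OF N] by (simp add: y_def)
     next
      case False
      let ?K = "{sc c\<odot>\<^sub>M y |c. True}"
      have K: "submodule ?K A M"
      proof (rule M.lsubmoduleI)
       show "?K \<subseteq> car M" using y by auto
       show "\<zero>\<^sub>M\<in>?K" using y by (auto intro!: exI[of _ 0])
       show "s \<oplus>\<^sub>M t\<in>?K" if st: "s\<in>?K" "t\<in>?K" for s t
       proof -
        obtain c c' where "s = sc c\<odot>\<^sub>M y" "t = sc c'\<odot>\<^sub>M y" using st by blast
        hence "s \<oplus>\<^sub>M t = sc (c + c')\<odot>\<^sub>M y" using y by (simp add: M.sc_plus)
        thus ?thesis by blast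
       qed
       show "a\<odot>\<^sub>M s\<in>?K" if a: "a\<in>car A" and s: "s\<in>?K" for a s
       proof -
        obtain c where "s = sc c\<odot>\<^sub>M y" using s by blast
        hence "a\<odot>\<^sub>M s = sc c\<odot>\<^sub>M (sc (cf a (v, []))\<odot>\<^sub>M y)" by (simp only: M.sc_smult_commute[OF a y(1)] M.smult_annihilated[OF v y a])
        also have "\<dots> = sc (c * cf a (v, []))\<odot>\<^sub>M y" using y(1) by simp
        finally have "a\<odot>\<^sub>M s = sc (c * cf a (v, []))\<odot>\<^sub>M y" .
        thus ?thesis by blast
       qed
      qed
      have "y\<in>?K" using y by (auto intro!: exI[of _ 1])
      interpret K: left_module A "M\<lparr>carrier := ?K\<rparr>" by (rule M.lsubmodule_is_left_module[OF K])
      have "simple_module A (M\<lparr>carrier := ?K\<rparr>)" unfolding simple_module_def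
      proof (intro conjI allI impI)
       show "car (M\<lparr>carrier := ?K\<rparr>) \<noteq> {\<zero>\<^sub>(M\<lparr>carrier := ?K\<rparr>)}" using False \<open>y\<in>?K\<close> by auto
       fix L assume L: "submodule L A (M\<lparr>carrier := ?K\<rparr>)"
       note LD = K.lsubmoduleD[OF L]
       show "L = {\<zero>\<^sub>(M\<lparr>carrier := ?K\<rparr>)} \<or> L = car (M\<lparr>carrier := ?K\<rparr>)"
       proof (cases "\<exists>c. c \<noteq> 0 \<and> sc c\<odot>\<^sub>M y\<in>L")
        case True
        then obtain c where c: "c \<noteq> 0" "sc c\<odot>\<^sub>M y\<in>L" by blast
        have "sc b\<odot>\<^sub>M y\<in>L" for b using LD(4)[of "sc (b / c)", OF _ c(2)] y c(1) by simp
        hence "?K \<subseteq> L" by blast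
        with LD(1) have "L = ?K" by simp
        thus ?thesis by simp
       next
        case False
        have "t = \<zero>\<^sub>M" if t: "t\<in>L" for t
        proof -
         have "t\<in>?K" using LD(1) t by (simp add: subset_iff)
         then obtain c where c: "t = sc c\<odot>\<^sub>M y" by blast
         with False t have "c = 0" by blast
         thus ?thesis using c y(1) by simp
        qed
        moreover have "\<zero>\<^sub>M\<in>L" using LD(2) by simp
        ultimately have "L = {\<zero>\<^sub>M}" by blast
        thus ?thesis by simp
       qed
      qed (rule K.left_module_axioms)
      from simp[OF K this] show ?thesis using \<open>y\<in>?K\<close> by (auto simp: y_def)
     qed
    qed
   qed
  qed
  thus "semisimple_module A M" unfolding semisimple_module_def using M by blast
 }
qed

lemma simple_lm: "i\<in>verts Q ==> left_module A (S i)" using simple_fg by (auto simp: fg_mod_def)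

lemma \<sigma>_add: "i\<in>verts Q ==> s\<in>car (S i) ==> t\<in>car (S i) ==> \<sigma> i (s \<oplus>\<^sub>(S i) t) = \<sigma> i s + \<sigma> i t"
 using hom_add[OF mod_iso_hom[OF simple_iso]] by (simp add: vertex_simple_def)

lemma \<sigma>_smult: "i\<in>verts Q ==> s\<in>car (S i) ==> a\<in>car A ==> \<sigma> i (a\<odot>\<^sub>(S i) s) = cf a (i, []) * \<sigma> i s"
 using hom_smult[OF mod_iso_hom[OF simple_iso]] by (simp add: vertex_simple_def)

lemma \<sigma>_bij: "i\<in>verts Q ==> bij_betw (\<sigma> i) (car (S i)) UNIV" using mod_iso_bij[OF simple_iso] by (simp add: vertex_simple_def)

definition \<sigma>_inv where "\<sigma>_inv \<alpha> = inv_into (car (S \<alpha>)) (\<sigma> \<alpha>)"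

lemma \<sigma>_inv: "i\<in>verts Q ==> \<sigma>_inv i c\<in>car (S i)" "i\<in>verts Q ==> \<sigma> i (\<sigma>_inv i c) = c"
 using \<sigma>_bij[of i] by (auto simp: \<sigma>_inv_def bij_betw_def inv_into_into f_inv_into_f)

lemma \<sigma>_eqD: "i\<in>verts Q ==> s\<in>car (S i) ==> t\<in>car (S i) ==> \<sigma> i s = \<sigma> i t ==> s = t" using \<sigma>_bij[of i] by (auto simp: bij_betw_def dest: inj_onD)

lemma \<sigma>_zero: "i\<in>verts Q ==> \<sigma> i \<zero>\<^sub>(S i) = 0"
proof -
 assume a: "i\<in>verts Q"
 interpret S: left_module A "S i" by (rule simple_lm[OF a])
 have "\<sigma> i (\<zero>\<^sub>(S i) \<oplus>\<^sub>(S i) \<zero>\<^sub>(S i)) = \<sigma> i \<zero>\<^sub>(S i) + \<sigma> i \<zero>\<^sub>(S i)" by (rule \<sigma>_add[OF a]) auto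
 thus ?thesis by (simp only: S.M.l_zero[OF S.M.zero_closed] add_cancel_right_right)
qed

lemma simple_killed: "i\<in>verts Q ==> is_killed (S i)"
proof -
 assume a: "i\<in>verts Q"
 interpret S: monomial_module Q F I 2 "S i" using simple_lm[OF a] by (rule monomial_module)
 show ?thesis unfolding S.killed_def
 proof (intro ballI)
  fix g x assume "g\<in>arcs Q" "x\<in>car (S i)"
  thus "ar g\<odot>\<^sub>(S i) x = \<zero>\<^sub>(S i)" using a by (intro \<sigma>_eqD[OF a]) (auto simp: \<sigma>_smult \<sigma>_zero)
 qed
qed

lemma e_simple: "i\<in>verts Q ==> x\<in>car (S i) ==> e i\<odot>\<^sub>(S i) x = x"
proof -
 assume a: "i\<in>verts Q" and x: "x\<in>car (S i)"
 interpret S: monomial_module Q F I 2 "S i" using simple_lm[OF a] by (rule monomial_module)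
 show ?thesis using a x by (intro \<sigma>_eqD[OF a]) (auto simp: \<sigma>_smult)
qed

definition from_simple where
 "from_simple M \<alpha> x = (\<lambda>s\<in>car (S \<alpha>). sc (\<sigma> \<alpha> s)\<odot>\<^sub>M x)"

lemma from_simple:
 assumes M: "left_module A M" and i: "i\<in>verts Q"
  and x: "x\<in>car M" "e i\<odot>\<^sub>M x = x" "!!g. g\<in>arcs Q ==> ar g\<odot>\<^sub>M x = \<zero>\<^sub>M"
 shows "from_simple M i x\<in>mod_hom A (S i) M"
proof -
 interpret M: monomial_module Q F I 2 M using M by (rule monomial_module)
 show ?thesis unfolding from_simple_def
 proof (rule hom_restrictI[OF simple_lm[OF i]])
  fix a s assume a: "a\<in>car A" and s: "s\<in>car (S i)"
  have "a\<odot>\<^sub>M (sc (\<sigma> i s)\<odot>\<^sub>M x) = sc (\<sigma> i s)\<odot>\<^sub>M (sc (cf a (i, []))\<odot>\<^sub>M x)"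
   using a x(1) by (simp only: M.sc_smult_commute M.smult_annihilated[OF i x a])
  thus "sc (\<sigma> i (a\<odot>\<^sub>(S i) s))\<odot>\<^sub>M x = a\<odot>\<^sub>M (sc (\<sigma> i s)\<odot>\<^sub>M x)" using a s x(1) i by (simp add: \<sigma>_smult mult.commute)
 qed (use x i in \<open>auto simp: \<sigma>_add M.sc_plus\<close>)
qed

lemma hom_from_simple:
 assumes M: "left_module A M" and i: "i\<in>verts Q" and f: "f\<in>mod_hom A (S i) M"
 shows "f = from_simple M i (f (\<sigma>_inv i 1))" "f (\<sigma>_inv i 1)\<in>car M"
  "e i\<odot>\<^sub>M f (\<sigma>_inv i 1) = f (\<sigma>_inv i 1)" "g\<in>arcs Q ==> ar g\<odot>\<^sub>M f (\<sigma>_inv i 1) = \<zero>\<^sub>M"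
proof -
 interpret M: monomial_module Q F I 2 M using M by (rule monomial_module)
 interpret S: monomial_module Q F I 2 "S i" using simple_lm[OF i] by (rule monomial_module)
 note s1 = \<sigma>_inv[OF i, of 1]
 show c: "f (\<sigma>_inv i 1)\<in>car M" using hom_closed[OF f] s1 by blast
 show e: "e i\<odot>\<^sub>M f (\<sigma>_inv i 1) = f (\<sigma>_inv i 1)" using hom_smult[OF f, of "e i" "\<sigma>_inv i 1"] s1 i by (simp add: e_simple)
 show k: "ar g\<odot>\<^sub>M f (\<sigma>_inv i 1) = \<zero>\<^sub>M" if "g\<in>arcs Q" for g using hom_smult[OF f, of "ar g" "\<sigma>_inv i 1"] s1 i that simple_killed[OF i]
   hom_zero[OF simple_lm[OF i] M f] by (simp add: S.killed_def)
 show "f = from_simple M i (f (\<sigma>_inv i 1))"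
 proof (rule hom_eqI[OF f from_simple[OF M i c e k]])
  fix s assume s: "s\<in>car (S i)"
  have "s = sc (\<sigma> i s)\<odot>\<^sub>(S i) \<sigma>_inv i 1" using s s1 i by (intro \<sigma>_eqD[OF i]) (auto simp: \<sigma>_smult)
  hence "f s = sc (\<sigma> i s)\<odot>\<^sub>M f (\<sigma>_inv i 1)" using hom_smult[OF f, of "sc (\<sigma> i s)" "\<sigma>_inv i 1"] s1 by simp
  thus "f s = from_simple M i (f (\<sigma>_inv i 1)) s" using s by (simp add: from_simple_def)
 qed
qed

text \<open>The functional that separates \<open>x\<close> from \<open>N\<close>, read as a map into
  the one-dimensional module at the vertex of \<open>x\<close>.\<close>

lemma to_simple:
 assumes M: "left_module A M" and k: "is_killed M" and i: "i\<in>verts Q"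
  and N: "submodule N A M" and x: "x\<in>car M" "x \<notin> N" "e i\<odot>\<^sub>M x = x"
 shows "\<exists>p\<in>mod_hom A M (S i). (\<forall>y\<in>N. p y = \<zero>\<^sub>(S i)) \<and> p x = \<sigma>_inv i 1"
proof -
 interpret M: monomial_module Q F I 2 M using M by (rule monomial_module)
 interpret S: monomial_module Q F I 2 "S i" using simple_lm[OF i] by (rule monomial_module)
 from M.functional[OF k N x(1,2) i x(3)] obtain l where
  l: "!!y z. y\<in>car M ==> z\<in>car M ==> l (y \<oplus>\<^sub>M z) = l y + l z"
   "!!c y. y\<in>car M ==> l (sc c\<odot>\<^sub>M y) = c * l y"
   "!!v y. v\<in>verts Q ==> y\<in>car M ==> l (e v\<odot>\<^sub>M y) = (if v = i then l y else 0)"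
   "!!y. y\<in>N ==> l y = 0" "l x = 1" by blast
 define p where "p y = \<sigma>_inv i (l y)" for y
 have pc: "p y\<in>car (S i)" "\<sigma> i (p y) = l y" for y using \<sigma>_inv[OF i] by (auto simp: p_def)
 have add: "p (y \<oplus>\<^sub>M z) = p y \<oplus>\<^sub>(S i) p z" if "y\<in>car M" "z\<in>car M" for y z using that pc by (intro \<sigma>_eqD[OF i]) (auto simp: \<sigma>_add[OF i] l)
 have l0: "l \<zero>\<^sub>M = 0" using l(2)[of "\<zero>\<^sub>M" 0] by simp
 have ar0: "p (ar a\<odot>\<^sub>M y) = ar a\<odot>\<^sub>(S i) p y" if "a\<in>arcs Q" "y\<in>car M" for a y using that k pc simple_killed[OF i]
  by (intro \<sigma>_eqD[OF i]) (auto simp: M.killed_def S.killed_def l0 \<sigma>_zero[OF i])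
 have "(\<lambda>y\<in>car M. p y)\<in>mod_hom A M (S i)"
 proof (rule hom_restrictI[OF M])
  fix a y assume a: "a\<in>car A" "y\<in>car M"
  show "p (a\<odot>\<^sub>M y) = a\<odot>\<^sub>(S i) p y"
  proof (rule M.smult_hom_test[OF S.left_module_axioms pc(1) add _ _ ar0 a])
   show "p (sc c\<odot>\<^sub>M x) = sc c\<odot>\<^sub>(S i) p x" if "x\<in>car M" for c x using that pc i by (intro \<sigma>_eqD[OF i]) (auto simp: \<sigma>_smult[OF i] l)
   show "p (e v\<odot>\<^sub>M x) = e v\<odot>\<^sub>(S i) p x" if "v\<in>verts Q" "x\<in>car M" for v x using that pc i by (intro \<sigma>_eqD[OF i]) (auto simp: \<sigma>_smult[OF i] l)
  qed
 qed (use pc add in auto)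
 moreover have "p y = \<zero>\<^sub>(S i)" if "y\<in>N" for y using pc l(4)[OF that] by (intro \<sigma>_eqD[OF i]) (auto simp: \<sigma>_zero[OF i])
 ultimately show ?thesis using x(1) l(5) M.lsubmoduleD(1)[OF N] by (intro bexI[of _ "\<lambda>y\<in>car M. p y"]) (auto simp: p_def subset_iff)
qed

text \<open>Finite sums of maps through simple modules; the inductive form lets statements about
  them be proved by adding one simple module at a time, with no direct sum decomposition
  chosen.\<close>

inductive_set simple_sums :: "((('v, 'e) path => 'k) set, 'm) module => ((('v, 'e) path => 'k) set, 'm) module => ('m => 'm) set"
 for M N where
 zero: "hom_zero M N\<in>simple_sums M N"
| add: "[|f\<in>simple_sums M N; \<alpha>\<in>verts Q; p\<in>mod_hom A M (S \<alpha>); v\<in>mod_hom A (S \<alpha>) N|] ==>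
  hom_add M N f (cmps M v p)\<in>simple_sums M N"

lemma simple_sums_hom:
 "f\<in>simple_sums M N ==> left_module A M ==> left_module A N ==> f\<in>mod_hom A M N"
 by (induction rule: simple_sums.induct) (auto intro!: hom_zero_in hom_add_in intro: hom_compose)

text \<open>The partial inverse is improved one homogeneous generator at a time. If \<open>s\<close>
  does not yet work for \<open>y\<close>, the vector \<open>g y\<close> is separated from all
  vectors fixed by \<open>g s\<close>, and a map through a simple module sends it to the missing
  difference of \<open>y\<close> and \<open>s (g y)\<close>.\<close>

lemma regular:
 assumes Y: "Y\<in>fg_mod A" "is_killed Y" and Z: "left_module A Z" "is_killed Z" and g: "g\<in>mod_hom A Y Z"
 shows "\<exists>s\<in>simple_sums Z Y. \<forall>y\<in>car Y. g (s (g y)) = g y"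
proof -
 have lmY: "left_module A Y" using Y by (simp add: fg_mod_def)
 interpret Y: monomial_module Q F I 2 Y using lmY by (rule monomial_module)
 interpret Z: monomial_module Q F I 2 Z using Z(1) by (rule monomial_module)
 note [simp] = hom_closed[OF g]
 have step: "\<exists>s\<in>simple_sums Z Y. \<forall>y\<in>set ys. g (s (g y)) = g y"
  if "\<forall>y\<in>set ys. y\<in>car Y \<and> (\<exists>i\<in>verts Q. e i\<odot>\<^sub>Y y = y)" for ys using that
 proof (induction ys)
  case Nil
  thus ?case using simple_sums.zero by auto
 next
  case (Cons y ys)
  then obtain s where s: "s\<in>simple_sums Z Y" and sy: "\<forall>y\<in>set ys. g (s (g y)) = g y" by auto
  have sh: "s\<in>mod_hom A Z Y" using simple_sums_hom[OF s Z(1) lmY] .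
  note [simp] = hom_closed[OF sh]
  obtain i where y: "y\<in>car Y" "i\<in>verts Q" "e i\<odot>\<^sub>Y y = y" using Cons.prems by auto
  \<comment> \<open>The vectors on which \<open>g s\<close> is already the identity; a map that
    vanishes on \<open>N\<close> cannot disturb the generators treated before.\<close>
  define N where "N = {z\<in>car Z. g (s z) = z}"
  have N: "submodule N A Z" by (rule Z.lsubmoduleI) (auto simp: N_def hom_add[OF sh] hom_add[OF g] hom_smult[OF sh]
     hom_smult[OF g] hom_zero[OF Z(1) lmY sh] hom_zero[OF lmY Z(1) g] Z.lsmult_closed)
  show ?case
  proof (cases "g y\<in>N")
   case True
   thus ?thesis using s sy by (auto simp: N_def)
  next
   case False
   have ge: "e i\<odot>\<^sub>Z g y = g y" using hom_smult[OF g, of "e i" y] y by simp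
   obtain p where p: "p\<in>mod_hom A Z (S i)" "\<forall>z\<in>N. p z = \<zero>\<^sub>(S i)" "p (g y) = \<sigma>_inv i 1" using to_simple[OF Z y(2) N _ False ge] y(1) by auto
   define x where "x = y \<oplus>\<^sub>Y \<ominus>\<^sub>Y s (g y)"
   have x: "x\<in>car Y" "e i\<odot>\<^sub>Y x = x" "!!t. t\<in>arcs Q ==> ar t\<odot>\<^sub>Y x = \<zero>\<^sub>Y" using y Y(2) hom_smult[OF sh, of "e i" "g y"] ge
    by (auto simp: x_def Y.lsmult_r_distr Y.lsmult_minus Y.killed_def)
   define v where "v = from_simple Y i x"
   have v: "v\<in>mod_hom A (S i) Y" unfolding v_def using from_simple[OF lmY y(2) x] .
   let ?s = "hom_add Z Y s (cmps Z v p)"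
   have "?s\<in>simple_sums Z Y" using simple_sums.add[OF s y(2) p(1) v] .
   moreover have "g (?s (g y')) = g y'" if y': "y'\<in>set ys" for y'
   proof -
    have c: "y'\<in>car Y" using Cons.prems y' by auto
    hence "g y'\<in>N" using sy y' by (auto simp: N_def)
    hence "v (p (g y')) = \<zero>\<^sub>Y" using p(2) hom_zero[OF simple_lm[OF y(2)] lmY v] by simp
    thus ?thesis using c sy y' by (simp add: compose_eq)
   qed
   moreover have "g (?s (g y)) = g y"
   proof -
    have "v (p (g y)) = x" using p(3) x(1) \<sigma>_inv[OF y(2)] by (simp add: v_def from_simple_def)
    hence "?s (g y) = y" using y(1) Y.diff_add[of y "s (g y)"] by (simp add: compose_eq x_def)
    thus ?thesis by simp
   qed
   ultimately show ?thesis by (intro bexI[of _ ?s]) auto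
  qed
 qed
 obtain X where X: "finite X" "X \<subseteq> car Y" "!!L. submodule L A Y ==> X \<subseteq> L ==> L = car Y" by (rule fg_modE[OF Y(1)]) (rule that)
 have "finite ((\<lambda>(v, x). e v\<odot>\<^sub>Y x) ` (verts Q \<times> X))" using X(1) finite_verts by auto
 then obtain ys where ys: "set ys = (\<lambda>(v, x). e v\<odot>\<^sub>Y x) ` (verts Q \<times> X)" using finite_list by blast
 have "y\<in>car Y \<and> (\<exists>i\<in>verts Q. e i\<odot>\<^sub>Y y = y)" if y: "y\<in>set ys" for y
 proof -
  obtain v x where vx: "v\<in>verts Q" "x\<in>car Y" "y = e v\<odot>\<^sub>Y x" using y ys X(2) by auto
  thus ?thesis by (auto simp: Y.e_e_smult intro!: bexI[of _ v])
 qed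
 then obtain s where s: "s\<in>simple_sums Z Y" and sy: "\<forall>y\<in>set ys. g (s (g y)) = g y" using step[of ys] by blast
 have sh: "s\<in>mod_hom A Z Y" using simple_sums_hom[OF s Z(1) lmY] .
 define L where "L = {y\<in>car Y. g (s (g y)) = g y}"
 have L: "submodule L A Y" by (rule Y.lsubmoduleI) (auto simp: L_def hom_add[OF sh] hom_add[OF g] hom_smult[OF sh]
    hom_smult[OF g] hom_zero[OF Z(1) lmY sh] hom_zero[OF lmY Z(1) g] Y.lsmult_closed hom_closed[OF sh])
 have "x\<in>L" if x: "x\<in>X" for x
 proof (rule Y.kspace_homogeneous[OF Y.kspace_submodule[OF L]])
  show "x\<in>car Y" using x X(2) by auto
  fix v assume v: "v\<in>verts Q"
  hence "e v\<odot>\<^sub>Y x\<in>set ys" using x ys by auto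
  thus "e v\<odot>\<^sub>Y x\<in>L" using sy v \<open>x\<in>car Y\<close> by (auto simp: L_def)
 qed
 hence "L = car Y" using X(3)[OF L] by blast
 thus ?thesis using s by (intro bexI[of _ s]) (auto simp: L_def)
qed

text \<open>Regularity of the identity forces \<open>s\<close> to be the identity.\<close>

lemma id_simple_sum:
 assumes "X\<in>fg_mod A" "is_killed X"
 shows "hom_id X\<in>simple_sums X X"
proof -
 have lm: "left_module A X" using assms by (simp add: fg_mod_def)
 obtain s where s: "s\<in>simple_sums X X" "\<forall>y\<in>car X. hom_id X (s (hom_id X y)) = hom_id X y"
  using regular[OF assms lm assms(2) hom_id_in[OF lm]] by blast
 have sh: "s\<in>mod_hom A X X" using simple_sums_hom[OF s(1) lm lm] .
 have "s = hom_id X" by (rule hom_eqI[OF sh hom_id_in[OF lm]]) (use s(2) hom_closed[OF sh] in auto)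
 thus ?thesis using s(1) by simp
qed

section \<open>Projective covers and syzygies of simple modules\<close>

lemma rad_annihilated:
 assumes M: "left_module A M" and x: "x\<in>monomial_module.rad Q I M" and g: "s\<in>arcs Q"
 shows "ar s\<odot>\<^sub>M x = \<zero>\<^sub>M"
proof -
 interpret M: monomial_module Q F I 2 M using M by (rule monomial_module)
 obtain m where m: "m\<in>arcs Q \<rightarrow> car M" "x = finsum M (\<lambda>s. ar s\<odot>\<^sub>M m s) (arcs Q)" using x by (auto simp: M.rad_def)
 have "ar s\<odot>\<^sub>M x = finsum M (\<lambda>\<delta>. ar s\<odot>\<^sub>M (ar \<delta>\<odot>\<^sub>M m \<delta>)) (arcs Q)" unfolding m(2) using m(1) g by (intro M.finsum_smult) (auto simp: Pi_iff)
 also have "\<dots> = finsum M (\<lambda>_. \<zero>\<^sub>M) (arcs Q)" using m(1) g by (intro M.M.finsum_cong') (auto simp: Pi_iff ar_ar_smult[OF M])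
 finally show ?thesis by simp
qed

lemma simple_cover_generator:
 assumes i: "i\<in>verts Q" and pc: "projective_cover A P p (S i)"
  and z: "z\<in>car P" "e i\<odot>\<^sub>P z = z" "p z = \<sigma>_inv i 1" and y: "y\<in>car P"
 shows "\<exists>a\<in>car A. y = a\<odot>\<^sub>P z"
proof -
 have P: "left_module A P" and p: "p\<in>mod_hom A P (S i)" using pc by (auto simp: projective_cover_def fg_mod_def)
 interpret P: monomial_module Q F I 2 P using P by (rule monomial_module)
 interpret S: monomial_module Q F I 2 "S i" using simple_lm[OF i] by (rule monomial_module)
 let ?N = "{a\<odot>\<^sub>P z |a. a\<in>car A}"
 have N: "submodule ?N A P"
 proof (rule P.lsubmoduleI)
  show "\<zero>\<^sub>P\<in>?N" using z(1) P.zero_lsmult[of z] by (metis (mono_tags, lifting) A.zero_closed mem_Collect_eq)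
  show "s \<oplus>\<^sub>P t\<in>?N" if st: "s\<in>?N" "t\<in>?N" for s t
  proof -
   obtain a b where "a\<in>car A" "b\<in>car A" "s = a\<odot>\<^sub>P z" "t = b\<odot>\<^sub>P z" using st by blast
   thus ?thesis using z(1) by (intro CollectI exI[of _ "a \<oplus>\<^sub>A b"]) (simp add: P.lsmult_l_distr)
  qed
  show "b\<odot>\<^sub>P s\<in>?N" if b: "b\<in>car A" and s: "s\<in>?N" for b s
  proof -
   obtain a where "a\<in>car A" "s = a\<odot>\<^sub>P z" using s by blast
   thus ?thesis using z(1) b by (intro CollectI exI[of _ "b\<otimes>\<^sub>A a"]) (simp add: P.lsmult_assoc)
  qed
 qed (use z(1) in \<open>auto simp: P.lsmult_closed\<close>)
 have "?N <+>\<^bsub>P\<^esub> hom_ker P (S i) p = car P"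
 proof
  show "?N <+>\<^bsub>P\<^esub> hom_ker P (S i) p \<subseteq> car P" using z(1) by (auto simp: set_add_def' hom_ker_def P.lsmult_closed)
  show "car P \<subseteq> ?N <+>\<^bsub>P\<^esub> hom_ker P (S i) p"
  proof
   fix y assume y: "y\<in>car P"
   let ?c = "\<sigma> i (p y)"
   let ?k = "y \<oplus>\<^sub>P \<ominus>\<^sub>P (sc ?c\<odot>\<^sub>P z)"
   have py: "p y\<in>car (S i)" using hom_closed[OF p y] .
   have "p y = sc ?c\<odot>\<^sub>(S i) \<sigma>_inv i 1" using py \<sigma>_inv[OF i] i by (intro \<sigma>_eqD[OF i]) (auto simp: \<sigma>_smult[OF i])
   hence "p ?k = \<zero>\<^sub>(S i)" using y z py by (simp add: hom_add[OF p] hom_minus[OF P S.left_module_axioms p] hom_smult[OF p] S.M.r_neg)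
   hence "?k\<in>hom_ker P (S i) p" using y z by (simp add: hom_ker_def)
   moreover have "y = sc ?c\<odot>\<^sub>P z \<oplus>\<^sub>P ?k" using y z P.diff_add[of y "sc ?c\<odot>\<^sub>P z"] by simp
   ultimately show "y\<in>?N <+>\<^bsub>P\<^esub> hom_ker P (S i) p" unfolding set_add_def' using sc(1) by blast
  qed
 qed
 hence "?N = car P" using pc N by (auto simp: projective_cover_def)
 thus ?thesis using y by blast
qed

lemma simple_cover_top:
 assumes i: "i\<in>verts Q" and pc: "projective_cover A P p (S i)"
 obtains z where "z\<in>car P" "e i\<odot>\<^sub>P z = z" "p z = \<sigma>_inv i 1"
proof -
 have P: "left_module A P" and p: "p\<in>mod_hom A P (S i)" "p ` car P = car (S i)" using pc by (auto simp: projective_cover_def fg_mod_def)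
 interpret P: monomial_module Q F I 2 P using P by (rule monomial_module)
 have "\<sigma>_inv i 1\<in>p ` car P" using \<sigma>_inv[OF i] p(2) by simp
 then obtain z0 where z0: "z0\<in>car P" "p z0 = \<sigma>_inv i 1" by auto
 show ?thesis
 proof (rule that[of "e i\<odot>\<^sub>P z0"])
  show "p (e i\<odot>\<^sub>P z0) = \<sigma>_inv i 1" using hom_smult[OF p(1), of "e i" z0] z0 i \<sigma>_inv[OF i] by (simp add: e_simple)
 qed (use z0 i in \<open>auto simp: P.e_e_smult\<close>)
qed

text \<open>The syzygy lies in the radical of the cover, the cover is generated by \<open>z\<close>,
  and products of two arrows vanish; so \<open>w\<close> is a combination of arrows applied to
  \<open>z\<close>. Only arrows from \<open>i\<close> to \<open>j\<close> survive multiplication by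
  the two vertices, and \<open>par\<close> allows at most one.\<close>

lemma simple_syzygy_element:
 assumes i: "i\<in>verts Q" and j: "j\<in>verts Q" and pc: "projective_cover A P p (S i)"
  and z: "z\<in>car P" "e i\<odot>\<^sub>P z = z" "p z = \<sigma>_inv i 1"
  and w: "w\<in>hom_ker P (S i) p" "e j\<odot>\<^sub>P w = w"
  and par: "!!s. s\<in>arcs Q ==> tail Q s = i ==> head Q s = j ==> s = s0"
 shows "w = \<zero>\<^sub>P \<or> s0\<in>arcs Q \<and> tail Q s0 = i \<and> head Q s0 = j \<and> (\<exists>c. w = sc c\<odot>\<^sub>P (ar s0\<odot>\<^sub>P z))"
proof -
 have P: "left_module A P" and p: "p\<in>mod_hom A P (S i)" using pc by (auto simp: projective_cover_def fg_mod_def)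
 interpret P: monomial_module Q F I 2 P using P by (rule monomial_module)
 have "w\<in>P.rad" using cover_ker_rad[OF simple_lm[OF i] pc] w(1) by blast
 then obtain m where m: "m\<in>arcs Q \<rightarrow> car P" "w = finsum P (\<lambda>s. ar s\<odot>\<^sub>P m s) (arcs Q)" by (auto simp: P.rad_def)
 let ?ok = "s0\<in>arcs Q \<and> tail Q s0 = i \<and> head Q s0 = j"
 \<comment> \<open>Zero is listed separately because there may be no arrow from \<open>i\<close> to
   \<open>j\<close> at all.\<close>
 define V where "V = {y\<in>car P. y = \<zero>\<^sub>P \<or> (?ok \<and> (\<exists>c. y = sc c\<odot>\<^sub>P (ar s0\<odot>\<^sub>P z)))}"
 have V: "P.kspace V" unfolding P.kspace_def
 proof (intro conjI ballI allI)
  show "V \<subseteq> car P" "\<zero>\<^sub>P\<in>V" by (auto simp: V_def)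
  show "x \<oplus>\<^sub>P y\<in>V" if xy: "x\<in>V" "y\<in>V" for x y
  proof (cases "x = \<zero>\<^sub>P \<or> y = \<zero>\<^sub>P")
   case True
   have "x\<in>car P" "y\<in>car P" using xy by (simp_all add: V_def)
   with True show ?thesis by (elim disjE) (use xy in simp_all)
  next
   case False
   then obtain c c' where ok: ?ok and "x = sc c\<odot>\<^sub>P (ar s0\<odot>\<^sub>P z)" "y = sc c'\<odot>\<^sub>P (ar s0\<odot>\<^sub>P z)" using xy by (auto simp: V_def)
   moreover have "ar s0\<odot>\<^sub>P z\<in>car P" using ok z(1) P.ar_closed by blast
   ultimately have "x \<oplus>\<^sub>P y = sc (c + c')\<odot>\<^sub>P (ar s0\<odot>\<^sub>P z)" by (simp only: P.sc_plus)
   moreover have "x\<in>car P" "y\<in>car P" using xy by (simp_all add: V_def)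
   ultimately show ?thesis using ok P.M.a_closed[of x y] unfolding V_def by blast
  qed
  show "sc c\<odot>\<^sub>P x\<in>V" if x: "x\<in>V" for c x using x z(1) by (auto simp: V_def P.lsmult_zero)
 qed
 have az: "e j\<odot>\<^sub>P (ar s\<odot>\<^sub>P (a\<odot>\<^sub>P z))\<in>V" if g: "s\<in>arcs Q" and a: "a\<in>car A" for s a using a
 proof (induction a rule: A_induct)
  case zero
  thus ?case using g j z V by (simp add: P.zero_lsmult P.lsmult_zero P.kspace_def)
 next
  case (add a b)
  thus ?case using g j z V by (simp add: P.lsmult_l_distr P.lsmult_r_distr P.lsmult_closed P.kspace_def)
 next
  case (arrow \<delta> a)
  thus ?case using g j z V by (simp add: P.lsmult_assoc ar_ar_smult[OF P] P.lsmult_closed P.lsmult_zero P.kspace_def)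
 next
  case (vertex c v)
  have "e v\<odot>\<^sub>P z = (if v = i then z else \<zero>\<^sub>P)" using P.e_e_smult[of v i z] vertex i z by (auto split: if_splits)
  moreover have "ar s\<odot>\<^sub>P z = (if tail Q s = i then ar s\<odot>\<^sub>P z else \<zero>\<^sub>P)"
   using P.e_e_smult[of "tail Q s" i z] i z g P.ar_e_smult[OF g z(1)] by (auto simp: P.lsmult_zero)
  moreover have "e j\<odot>\<^sub>P (ar s\<odot>\<^sub>P z) = (if head Q s = j then ar s\<odot>\<^sub>P z else \<zero>\<^sub>P)"
   using P.e_e_smult[of j "head Q s" "ar s\<odot>\<^sub>P z"] j z g P.e_ar_smult[OF g z(1)] by auto
  ultimately have eq: "e j\<odot>\<^sub>P (ar s\<odot>\<^sub>P (e v\<odot>\<^sub>P z)) =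
    (if v = i \<and> tail Q s = i \<and> head Q s = j then ar s\<odot>\<^sub>P z else \<zero>\<^sub>P)" using g j by (auto simp: P.lsmult_zero)
  have "ar s\<odot>\<^sub>P z\<in>V" if "tail Q s = i" "head Q s = j" using par[OF g that] that g z(1) by (auto simp: V_def intro!: exI[of _ 1])
  hence "e j\<odot>\<^sub>P (ar s\<odot>\<^sub>P (e v\<odot>\<^sub>P z))\<in>V" using V unfolding eq by (auto simp: P.kspace_def)
  hence "sc c\<odot>\<^sub>P (e j\<odot>\<^sub>P (ar s\<odot>\<^sub>P (e v\<odot>\<^sub>P z)))\<in>V" using V by (simp add: P.kspace_def)
  thus ?case using vertex g j z by (simp add: P.lsmult_assoc P.sc_smult_commute)
 qed
 have "e j\<odot>\<^sub>P w = finsum P (\<lambda>s. e j\<odot>\<^sub>P (ar s\<odot>\<^sub>P m s)) (arcs Q)" unfolding m(2) using m(1) j by (intro P.finsum_smult) (auto simp: Pi_iff)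
 also have "\<dots>\<in>V"
 proof (rule P.kspace_finsum[OF V])
  fix s assume g: "s\<in>arcs Q"
  hence "m s\<in>car P" using m(1) by auto
  then obtain a where "a\<in>car A" "m s = a\<odot>\<^sub>P z" using simple_cover_generator[OF i pc z] by blast
  thus "e j\<odot>\<^sub>P (ar s\<odot>\<^sub>P m s)\<in>V" using az[OF g] by simp
 qed
 finally show ?thesis using w(2) by (auto simp: V_def)
qed

end

section \<open>Submodules of torsionless modules\<close>

lemma hom_image_submodule:
 assumes M: "left_module R M" and N: "left_module R N" and f: "f\<in>mod_hom R M N"
 shows "submodule (f ` car M) R N"
proof -
 interpret M: left_module R M by fact
 interpret N: left_module R N by fact
 show ?thesis
 proof (rule N.lsubmoduleI)
  show "\<zero>\<^sub>N\<in>f ` car M" using hom_zero[OF M N f] by (metis M.M.zero_closed imageI)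
  show "x \<oplus>\<^sub>N y\<in>f ` car M" if xy: "x\<in>f ` car M" "y\<in>f ` car M" for x y
  proof -
   obtain s t where "x = f s" "y = f t" "s\<in>car M" "t\<in>car M" using xy by auto
   thus ?thesis using hom_add[OF f, of s t] by (intro image_eqI[of _ _ "s \<oplus>\<^sub>M t"]) auto
  qed
  show "a\<odot>\<^sub>N x\<in>f ` car M" if ax: "a\<in>car R" "x\<in>f ` car M" for a x
  proof -
   obtain s where "x = f s" "s\<in>car M" using ax by auto
   thus ?thesis using ax hom_smult[OF f, of a s] M.lsmult_closed by (intro image_eqI[of _ _ "a\<odot>\<^sub>M s"]) auto
  qed
 qed (auto simp: hom_closed[OF f])
qed

text \<open>By \<open>ind\<close> the image of \<open>u\<close> meets \<open>N\<close> only in zero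
  and \<open>u\<close> is injective, so the two components of \<open>k\<close> are unique;
  uniqueness makes the chosen components linear.\<close>

lemma internal_biprod:
 fixes K L :: "('a, 'm) module"
 assumes K: "K\<in>fg_mod R" and L: "L\<in>fg_mod R" and u: "u\<in>mod_hom R L K"
  and N: "submodule N R K" and Nfg: "K\<lparr>carrier := N\<rparr>\<in>fg_mod R"
  and dec: "!!k. k\<in>car K ==> \<exists>x\<in>car L. \<exists>n\<in>N. k = u x \<oplus>\<^sub>K n"
  and ind: "!!x. x\<in>car L ==> u x\<in>N ==> x = \<zero>\<^sub>L"
 shows "\<exists>v p q. is_biprod R L (K\<lparr>carrier := N\<rparr>) K u v p q"
proof -
 have lmK: "left_module R K" and lmL: "left_module R L" using K L by (auto simp: fg_mod_def)
 interpret K: left_module R K by (rule lmK)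
 interpret L: left_module R L by (rule lmL)
 note ND = K.lsubmoduleD[OF N]
 have NK: "n\<in>car K" if "n\<in>N" for n using that ND(1) by auto
 note [simp] = hom_closed[OF u]
 have uniq: "x = x' \<and> n = n'" if xn: "x\<in>car L" "x'\<in>car L" "n\<in>N" "n'\<in>N" "u x \<oplus>\<^sub>K n = u x' \<oplus>\<^sub>K n'" for x x' n n'
 proof -
  have "u (x \<oplus>\<^sub>L \<ominus>\<^sub>L x') = u x \<oplus>\<^sub>K \<ominus>\<^sub>K u x'" using xn by (simp add: hom_add[OF u] hom_minus[OF lmL lmK u])
  also have "\<dots> = (u x \<oplus>\<^sub>K n) \<oplus>\<^sub>K \<ominus>\<^sub>K n \<oplus>\<^sub>K \<ominus>\<^sub>K u x'" using xn(1-4) NK by (simp add: K.M.a_assoc K.M.r_neg)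
  also have "\<dots> = n' \<oplus>\<^sub>K \<ominus>\<^sub>K n"
  proof -
   have "(u x' \<oplus>\<^sub>K n') \<oplus>\<^sub>K \<ominus>\<^sub>K n \<oplus>\<^sub>K \<ominus>\<^sub>K u x' = (n' \<oplus>\<^sub>K \<ominus>\<^sub>K n) \<oplus>\<^sub>K (u x' \<oplus>\<^sub>K \<ominus>\<^sub>K u x')" using xn(1-4) NK by (simp add: K.M.a_ac)
   thus ?thesis using xn(1-4) NK by (simp add: xn(5) K.M.r_neg)
  qed
  finally have "u (x \<oplus>\<^sub>L \<ominus>\<^sub>L x')\<in>N" using ND(3)[OF xn(4) ND(5)[OF xn(3)]] by simp
  hence "x \<oplus>\<^sub>L \<ominus>\<^sub>L x' = \<zero>\<^sub>L" using xn by (intro ind) auto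
  hence "x = x'" using xn(1,2) L.diff_add[of x x'] by simp
  thus ?thesis using xn NK by simp
 qed
 define pq where "pq k = (SOME xn. fst xn\<in>car L \<and> snd xn\<in>N \<and> k = u (fst xn) \<oplus>\<^sub>K snd xn)" for k
 have pq: "fst (pq k)\<in>car L \<and> snd (pq k)\<in>N \<and> k = u (fst (pq k)) \<oplus>\<^sub>K snd (pq k)" if "k\<in>car K" for k
  unfolding pq_def by (rule someI_ex) (use dec[OF that] in auto)
 have pq1: "fst (pq k)\<in>car L" "snd (pq k)\<in>N" if "k\<in>car K" for k using pq[OF that] by auto
 have pqI: "pq (u x \<oplus>\<^sub>K n) = (x, n)" if "x\<in>car L" "n\<in>N" for x n
  using pq[of "u x \<oplus>\<^sub>K n"] that NK uniq[of "fst (pq (u x \<oplus>\<^sub>K n))" x "snd (pq (u x \<oplus>\<^sub>K n))" n] by (simp add: prod_eq_iff)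
 let ?N = "K\<lparr>carrier := N\<rparr>"
 interpret N: left_module R ?N by (rule K.lsubmodule_is_left_module[OF N])
 define p where "p = (\<lambda>k\<in>car K. fst (pq k))"
 define q where "q = (\<lambda>k\<in>car K. snd (pq k))"
 define v where "v = (\<lambda>n\<in>N. n)"
 have add: "pq (k \<oplus>\<^sub>K l) = (fst (pq k) \<oplus>\<^sub>L fst (pq l), snd (pq k) \<oplus>\<^sub>K snd (pq l))"
  if k: "k\<in>car K" "l\<in>car K" for k l
 proof -
  have "k \<oplus>\<^sub>K l = (u (fst (pq k)) \<oplus>\<^sub>K snd (pq k)) \<oplus>\<^sub>K (u (fst (pq l)) \<oplus>\<^sub>K snd (pq l))" using pq[OF k(1)] pq[OF k(2)] by simp
  also have "\<dots> = u (fst (pq k) \<oplus>\<^sub>L fst (pq l)) \<oplus>\<^sub>K (snd (pq k) \<oplus>\<^sub>K snd (pq l))"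
   using pq1[OF k(1)] pq1[OF k(2)] NK by (simp add: hom_add[OF u] K.M.a_ac)
  finally show ?thesis using pqI pq1[OF k(1)] pq1[OF k(2)] ND(3) by simp
 qed
 have smult: "pq (a\<odot>\<^sub>K k) = (a\<odot>\<^sub>L fst (pq k), a\<odot>\<^sub>K snd (pq k))"
  if k: "a\<in>car R" "k\<in>car K" for a k
 proof -
  have "a\<odot>\<^sub>K k = a\<odot>\<^sub>K (u (fst (pq k)) \<oplus>\<^sub>K snd (pq k))" using pq[OF k(2)] by simp
  also have "\<dots> = u (a\<odot>\<^sub>L fst (pq k)) \<oplus>\<^sub>K (a\<odot>\<^sub>K snd (pq k))" using pq1[OF k(2)] NK k by (simp add: hom_smult[OF u] K.lsmult_r_distr)
  finally show ?thesis using pqI pq1[OF k(2)] ND(4) k L.lsmult_closed by simp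
 qed
 have p: "p\<in>mod_hom R K L" unfolding p_def by (rule hom_restrictI[OF lmK]) (use pq add smult in auto)
 have q: "q\<in>mod_hom R K ?N" unfolding q_def by (rule hom_restrictI[OF lmK]) (use pq add smult in auto)
 have v: "v\<in>mod_hom R ?N K" unfolding v_def by (rule hom_incl[OF lmK N])
 have "pq (u x) = (x, \<zero>\<^sub>K)" if "x\<in>car L" for x using pqI[OF that ND(2)] that by simp
 moreover have "pq n = (\<zero>\<^sub>L, n)" if "n\<in>N" for n using pqI[OF L.M.zero_closed that] hom_zero[OF lmL lmK u] NK[OF that] by simp
 ultimately have "is_biprod R L ?N K u v p q" unfolding is_biprod_def using K u v p q NK pq by (auto simp: p_def q_def v_def)
 thus ?thesis by blast
qed

context monomial_algebra
begin

definition reg :: "((('v, 'e) path => 'k) set, (('v, 'e) path => 'k) set) module" where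
 "reg = \<lparr>carrier = car A, mult = mult A, one = one A, zero = zero A, add = add A, smult = mult A\<rparr>"

lemma reg_simps [simp]: "car reg = car A" "zero reg = zero A" "add reg = add A" "smult reg = mult A" by (simp_all add: reg_def)

lemma reg_left_module: "left_module A reg"
proof -
 have "abelian_group reg" by (rule abelian_groupI) (auto simp: A.a_ac intro: A.l_neg A.a_inv_closed)
 thus ?thesis by (auto simp: left_module_def left_module_axioms_def A.ring_axioms A.l_distr A.r_distr A.m_assoc)
qed

lemma finsum_reg: "finite X ==> f\<in>X \<rightarrow> car A ==> finsum reg f X = finsum A f X"
proof (induction X rule: finite_induct)
 interpret reg: left_module A reg by (rule reg_left_module)
 case empty
 thus ?case by (simp add: reg.M.finsum_empty)
next
 interpret reg: left_module A reg by (rule reg_left_module)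
 case (insert x X)
 hence "f\<in>X \<rightarrow> car A" "f x\<in>car A" by auto
 with insert show ?case using reg.M.finsum_insert[of X x f] A.finsum_insert[of X x f] by simp
qed

lemma reg_fg: "reg\<in>fg_mod A"
proof (rule fg_modI[OF reg_left_module, of "{\<one>\<^sub>A}"])
 interpret reg: left_module A reg by (rule reg_left_module)
 fix L assume L: "submodule L A reg" "{\<one>\<^sub>A} \<subseteq> L"
 have "a\<in>L" if "a\<in>car A" for a using reg.lsubmoduleD(4)[OF L(1) that, of "\<one>\<^sub>A"] L(2) that by simp
 thus "L = car reg" using reg.lsubmoduleD(1)[OF L(1)] by auto
qed auto

definition torsionless where
 "torsionless T \<longleftrightarrow> (\<forall>x\<in>car T. x \<noteq> \<zero>\<^sub>T \<longrightarrow> (\<exists>\<phi>\<in>mod_hom A T reg. \<phi> x \<noteq> \<zero>\<^sub>A))"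

lemma torsionless_inj:
 assumes M: "left_module A M" and N: "left_module A N" and f: "f\<in>mod_hom A M N" "inj_on f (car M)" and t: "torsionless N"
 shows "torsionless M" unfolding torsionless_def
proof (intro ballI impI)
 interpret M: left_module A M by fact
 interpret N: left_module A N by fact
 fix x assume x: "x\<in>car M" "x \<noteq> \<zero>\<^sub>M"
 have "f x \<noteq> \<zero>\<^sub>N" using inj_onD[OF f(2), of x "\<zero>\<^sub>M"] x hom_zero[OF M N f(1)] by auto
 then obtain \<phi> where "\<phi>\<in>mod_hom A N reg" "\<phi> (f x) \<noteq> \<zero>\<^sub>A" using t x hom_closed[OF f(1)] unfolding torsionless_def by blast
 thus "\<exists>\<phi>\<in>mod_hom A M reg. \<phi> x \<noteq> \<zero>\<^sub>A"
  using hom_compose[OF f(1) _ M, of \<phi> reg] x by (intro bexI[of _ "cmps M \<phi> f"]) (auto simp: compose_eq)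
qed

lemma torsionless_reg: "torsionless reg"
 unfolding torsionless_def using hom_id_in[OF reg_left_module] by (intro ballI impI bexI[of _ "hom_id reg"]) auto

lemma torsionless_biprod:
 assumes M: "M\<in>fg_mod A" and N: "N\<in>fg_mod A" and bp: "is_biprod A M N S u v p q" and t: "torsionless M" "torsionless N"
 shows "torsionless S" unfolding torsionless_def
proof (intro ballI impI)
 fix x assume x: "x\<in>car S" "x \<noteq> \<zero>\<^sub>S"
 have S: "left_module A S" and u: "u\<in>mod_hom A M S" and v: "v\<in>mod_hom A N S"
  and p: "p\<in>mod_hom A S M" and q: "q\<in>mod_hom A S N"
  and dec: "!!z. z\<in>car S ==> z = u (p z) \<oplus>\<^sub>S v (q z)" using bp unfolding is_biprod_def by (blast dest: fg_modD)+
 interpret S: left_module A S by (rule S)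
 have "p x \<noteq> \<zero>\<^sub>M \<or> q x \<noteq> \<zero>\<^sub>N"
 proof (rule ccontr)
  assume "\<not> ?thesis"
  hence "x = \<zero>\<^sub>S \<oplus>\<^sub>S \<zero>\<^sub>S" using dec[OF x(1)] hom_zero[OF fg_modD[OF M] S u] hom_zero[OF fg_modD[OF N] S v] by simp
  thus False using x(2) by simp
 qed
 thus "\<exists>\<phi>\<in>mod_hom A S reg. \<phi> x \<noteq> \<zero>\<^sub>A"
 proof
  assume "p x \<noteq> \<zero>\<^sub>M"
  then obtain \<phi> where "\<phi>\<in>mod_hom A M reg" "\<phi> (p x) \<noteq> \<zero>\<^sub>A" using t(1) hom_closed[OF p x(1)] unfolding torsionless_def by blast
  thus ?thesis using hom_compose[OF p _ S, of \<phi> reg] x(1) by (intro bexI[of _ "cmps S \<phi> p"]) (auto simp: compose_eq)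
 next
  assume "q x \<noteq> \<zero>\<^sub>N"
  then obtain \<phi> where "\<phi>\<in>mod_hom A N reg" "\<phi> (q x) \<noteq> \<zero>\<^sub>A" using t(2) hom_closed[OF q x(1)] unfolding torsionless_def by blast
  thus ?thesis using hom_compose[OF q _ S, of \<phi> reg] x(1) by (intro bexI[of _ "cmps S \<phi> q"]) (auto simp: compose_eq)
 qed
qed

lemma torsionless_cover:
 fixes X :: "((('v, 'e) path => 'k) set, 'm) module"
 assumes X: "X\<in>fg_mod A" and \<iota>: "inj (\<iota> :: 'k list => 'm)"
 shows "\<exists>G\<in>fg_mod A. \<exists>g\<in>mod_hom A G X. torsionless (G :: ((('v, 'e) path => 'k) set, 'm) module) \<and> g ` car G = car X"
proof -
 have lmX: "left_module A X" using X by (rule fg_modD)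
 interpret X: left_module A X by (rule lmX)
 obtain enc :: "(('v, 'e) path => 'k) set => 'k list" and n where "inj_on enc (car reg)" "!!m. length (enc m) = n"
  using fg_encoding[OF reg_fg] by blast
 hence "inj_on (\<iota> \<circ> enc) (car reg)" using \<iota> by (intro comp_inj_on) (auto intro: inj_on_subset)
 from transport_module[OF reg_fg this] obtain R' :: "((('v, 'e) path => 'k) set, 'm) module" and f
  where R': "R'\<in>fg_mod A" "f\<in>mod_iso A R' reg" by blast
 have lmR: "left_module A R'" using R'(1) by (rule fg_modD)
 have f: "f\<in>mod_hom A R' reg" "bij_betw f (car R') (car A)" using R'(2) by (auto simp: mod_iso_def)
 have tR: "torsionless R'" by (rule torsionless_inj[OF lmR reg_left_module f(1) _ torsionless_reg]) (use f(2) in \<open>simp add: bij_betw_def\<close>)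
 have "\<exists>G\<in>fg_mod A. \<exists>g\<in>mod_hom A G X. torsionless (G :: ((('v, 'e) path => 'k) set, 'm) module) \<and> set xs \<subseteq> g ` car G"
  if "set xs \<subseteq> car X" for xs using that
 proof (induction xs)
  case Nil
  have "torsionless (X\<lparr>carrier := {\<zero>\<^sub>X}\<rparr>)" by (simp add: torsionless_def)
  thus ?case using sub_fg[OF X X.zero_lsubmodule] hom_incl[OF lmX X.zero_lsubmodule] by (auto intro!: bexI)
 next
  case (Cons x xs)
  then obtain G g where G: "(G :: ((('v, 'e) path => 'k) set, 'm) module)\<in>fg_mod A" "g\<in>mod_hom A G X" "torsionless G" "set xs \<subseteq> g ` car G"
   by auto
  have x: "x\<in>car X" using Cons.prems by simp
  obtain S u v p q where bp: "is_biprod A R' G S u v p q" using biprod_exists[OF R'(1) G(1) \<iota>] by blast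
  hence S: "S\<in>fg_mod A" and u: "u\<in>mod_hom A R' S" and v: "v\<in>mod_hom A G S"
   and p: "p\<in>mod_hom A S R'" and q: "q\<in>mod_hom A S G"
   and pu: "!!x. x\<in>car R' ==> p (u x) = x" "!!x. x\<in>car R' ==> q (u x) = \<zero>\<^sub>G"
   and pv: "!!x. x\<in>car G ==> p (v x) = \<zero>\<^sub>R'" "!!x. x\<in>car G ==> q (v x) = x" unfolding is_biprod_def by blast+
  note lmS = fg_modD[OF S] and lmG = fg_modD[OF G(1)]
  define r where "r = (\<lambda>y\<in>car R'. f y\<odot>\<^sub>X x)"
  have fc: "f y\<in>car A" if "y\<in>car R'" for y using hom_closed[OF f(1) that] by simp
  have r: "r\<in>mod_hom A R' X" unfolding r_def by (rule hom_restrictI[OF lmR])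
    (use x fc in \<open>auto simp: X.lsmult_closed hom_add[OF f(1)] hom_smult[OF f(1)] X.lsmult_l_distr X.lsmult_assoc\<close>)
  define g' where "g' = hom_add S X (cmps S r p) (cmps S g q)"
  have g': "g'\<in>mod_hom A S X" unfolding g'_def by (intro hom_add_in lmS lmX hom_compose[OF p r lmS] hom_compose[OF q G(2) lmS])
  have "y\<in>g' ` car S" if y: "y\<in>set (x # xs)" for y
  proof (cases "y = x")
   case True
   have "\<one>\<^sub>A\<in>f ` car R'" using f(2) by (simp add: bij_betw_def)
   then obtain o1 where o1: "o1\<in>car R'" "f o1 = \<one>\<^sub>A" by auto
   have "g' (u o1) = x" using o1 x hom_closed[OF u o1(1)] by (simp add: g'_def compose_eq pu r_def X.lsmult_one hom_zero[OF lmG lmX G(2)])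
   thus ?thesis using True hom_closed[OF u o1(1)] by (intro image_eqI[of _ _ "u o1"]) auto
  next
   case False
   then obtain t where t: "t\<in>car G" "y = g t" using y G(4) by auto
   have "g' (v t) = y" using t hom_closed[OF v t(1)] hom_closed[OF G(2) t(1)]
    by (simp add: g'_def compose_eq pv hom_zero[OF lmR lmX r])
   thus ?thesis using hom_closed[OF v t(1)] by (intro image_eqI[of _ _ "v t"]) auto
  qed
  hence "set (x # xs) \<subseteq> g' ` car S" by blast
  thus ?case using S g' torsionless_biprod[OF R'(1) G(1) bp tR G(3)] by blast
 qed
 moreover obtain W where W: "finite W" "W \<subseteq> car X" "!!L. submodule L A X ==> W \<subseteq> L ==> L = car X" by (rule fg_modE[OF X]) (rule that)
 moreover obtain xs where "set xs = W" using finite_list[OF W(1)] by blast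
 ultimately obtain G g where G: "(G :: ((('v, 'e) path => 'k) set, 'm) module)\<in>fg_mod A" "g\<in>mod_hom A G X" "torsionless G" "W \<subseteq> g ` car G"
  by metis
 have "g ` car G = car X" using W(3)[OF hom_image_submodule[OF fg_modD[OF G(1)] lmX G(2)] G(4)] .
 thus ?thesis using G by blast
qed

text \<open>Projectivity splits the surjection from a torsionless module, so \<open>X\<close> embeds
  into that module. The test modules in the definition of projectivity have elements of type
  \<open>'m\<close>, which is why the cover was built there.\<close>

lemma projective_torsionless:
 fixes X :: "((('v, 'e) path => 'k) set, 'm) module"
 assumes X: "X\<in>fg_mod A" "projective A X" and \<iota>: "\<exists>\<iota> :: 'k list => 'm. inj \<iota>"
 shows "torsionless X"
proof -
 obtain G g where G: "(G :: ((('v, 'e) path => 'k) set, 'm) module)\<in>fg_mod A" "g\<in>mod_hom A G X" "torsionless G" "g ` car G = car X"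
  using torsionless_cover[OF X(1)] \<iota> by blast
 have "\<exists>s\<in>mod_hom A X G. \<forall>x\<in>car X. g (s x) = hom_id X x"
  by (rule X(2)[unfolded projective_def, rule_format, OF G(1) X(1) G(2) G(4) hom_id_in[OF fg_modD[OF X(1)]]])
 then obtain s where s: "s\<in>mod_hom A X G" "\<forall>x\<in>car X. g (s x) = x" by auto
 have "inj_on s (car X)" using s(2) by (auto intro: inj_on_inverseI)
 thus ?thesis using torsionless_inj[OF fg_modD[OF X(1)] fg_modD[OF G(1)] s(1) _ G(3)] by blast
qed

text \<open>Relations have length two, so only the new junction has to be checked. The arguments on
  \<open>A\<alpha>\<close> and on second syzygies use the quadratic hypothesis through this
  fact.\<close>

lemma good_extend:
 assumes "good (u, as @ [t])" "good (tail Q t, [t, \<delta>])"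
 shows "good (u, as @ [t, \<delta>])" using assms by (auto simp: good_path_def append_in_paths successively_append_iff)

text \<open>Left division by an arrow: the paths of \<open>a\<close> that end in
  \<open>\<epsilon>\<close>, with \<open>\<epsilon>\<close> removed. Together with the trivial paths
  these quotients recover \<open>a\<close>.\<close>

definition sub where
 "sub a \<epsilon> = mk (\<lambda>p. if good (fst p, snd p @ [\<epsilon>]) then cf a (fst p, snd p @ [\<epsilon>]) else 0)"

lemma sub [simp]: "sub a t\<in>car A"
 "good (u, as) ==> cf (sub a t) (u, as) = (if good (u, as @ [t]) then cf a (u, as @ [t]) else 0)" by (simp_all add: sub_def)

lemma expand_A:
 assumes a: "a\<in>car A" and v: "v\<in>verts Q"
 shows "a\<otimes>\<^sub>A e v = sc (cf a (v, []))\<otimes>\<^sub>A e v \<oplus>\<^sub>A finsum A (\<lambda>t. ar t\<otimes>\<^sub>A (sub a t\<otimes>\<^sub>A e v)) (arcs Q)"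
proof -
 have ev: "e v\<in>car A" using v by simp
 have f: "(\<lambda>t. ar t\<otimes>\<^sub>A (sub a t\<otimes>\<^sub>A e v))\<in>arcs Q \<rightarrow> car A" using ev by auto
 show ?thesis
 proof (rule A_eqI)
  fix p assume p: "good p"
  obtain u as where pu: "p = (u, as)" by (cases p)
  show "cf (a\<otimes>\<^sub>A e v) p = cf (sc (cf a (v, []))\<otimes>\<^sub>A e v \<oplus>\<^sub>A
    finsum A (\<lambda>t. ar t\<otimes>\<^sub>A (sub a t\<otimes>\<^sub>A e v)) (arcs Q)) p"
  proof (cases as rule: rev_cases)
   case Nil
   have "(\<Sum>t\<in>arcs Q. cf (ar t\<otimes>\<^sub>A (sub a t\<otimes>\<^sub>A e v)) p) = 0" using p ev by (intro sum.neutral) (auto simp: pu Nil cf_ar_mult)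
   hence "cf (finsum A (\<lambda>t. ar t\<otimes>\<^sub>A (sub a t\<otimes>\<^sub>A e v)) (arcs Q)) p = 0" using cf_finsum[OF f p finite_arcs] by simp
   thus ?thesis using a v p A.finsum_closed[OF f] by (auto simp: pu Nil)
  next
   case (snoc bs x)
   have g: "good (u, bs)" using p good_append(1)[of u bs "[x]"] by (simp add: pu snoc)
   have x: "x\<in>arcs Q" using good_paths[OF p] by (auto simp: pu snoc append_in_paths)
   have "(\<Sum>t\<in>arcs Q. cf (ar t\<otimes>\<^sub>A (sub a t\<otimes>\<^sub>A e v)) p) =
    (\<Sum>t\<in>arcs Q. if t = x then (if u = v then cf a p else 0) else 0)" using p ev v g by (intro sum.cong) (auto simp: pu snoc cf_ar_mult_snoc)
   also have "\<dots> = (if u = v then cf a p else 0)" using x by (simp add: finite_arcs)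
   finally have "cf (finsum A (\<lambda>t. ar t\<otimes>\<^sub>A (sub a t\<otimes>\<^sub>A e v)) (arcs Q)) p = (if u = v then cf a p else 0)"
    using cf_finsum[OF f p finite_arcs] by simp
   thus ?thesis using a v p A.finsum_closed[OF f] by (auto simp: pu snoc)
  qed
 qed (use a ev f in auto)
qed

text \<open>Every factor contributes at least one arrow, so the power contains only paths of length
  at least \<open>n\<close>.\<close>

lemma cf_pow:
 assumes z: "z\<in>car A" "!!v. v\<in>verts Q ==> cf z (v, []) = 0"
 shows "good p ==> length (snd p) < n ==> cf (z [^]\<^bsub>A\<^esub> (n::nat)) p = 0"
proof (induction n arbitrary: p)
 case (Suc n)
 have "cf (z [^]\<^bsub>A\<^esub> n) (path_hi Q p i) * cf z (path_lo p i) = 0" if i: "i \<le> length (snd p)" for i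
 proof (cases i)
  case 0
  thus ?thesis using z(2) path_source_verts[OF good_paths[OF Suc.prems(1)]] by (simp add: path_lo_def)
 next
  case (Suc j)
  have "length (snd (path_hi Q p i)) < n" using Suc Suc.prems(2) i by (simp add: path_hi_def)
  thus ?thesis using Suc.IH[OF good_hi[OF Suc.prems(1)]] by simp
 qed
 hence "(\<Sum>i\<le>length (snd p). cf (z [^]\<^bsub>A\<^esub> n) (path_hi Q p i) * cf z (path_lo p i)) = 0" by (intro sum.neutral) blast
 thus ?case using z(1) Suc.prems(1) by (simp add: cf_mult)
qed simp

end

section \<open>Nilpotent elements and division by arrows on modules\<close>

context monomial_module
begin

text \<open>Morally \<open>1 + z\<close> is invertible. Instead of its inverse, the induction uses
  that \<open>1 - (- z) ^ n\<close> is a multiple of \<open>1 + z\<close>, and then that the power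
  of \<open>z\<close> with exponent \<open>d\<close> vanishes.\<close>

lemma nilpotent_absorb:
 assumes K: "submodule K A M" and x: "x\<in>car M"
  and z: "z\<in>car A" "!!v. v\<in>verts Q ==> cf z (v, []) = 0" and xz: "x \<oplus> z\<odot>x\<in>K"
 shows "x\<in>K"
proof -
 note KD = lsubmoduleD[OF K]
 have zn: "z [^]\<^bsub>A\<^esub> n\<in>car A" for n :: nat using z(1) by simp
 have "x \<oplus> sc (- ((- 1) ^ n))\<odot>(z [^]\<^bsub>A\<^esub> n\<odot>x)\<in>K" for n
 proof (induction n)
  case 0
  have "x \<oplus> sc (- 1)\<odot>x = \<zero>" using sc_plus[of x 1 "- 1"] x by simp
  thus ?case using x KD(2) by (simp add: lsmult_one)
 next
  case (Suc n)
  let ?s = "(- 1) ^ n :: 'k"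
  define w where "w = z [^]\<^bsub>A\<^esub> n\<odot>x"
  define w' where "w' = z [^]\<^bsub>A\<^esub> Suc n\<odot>x"
  have c: "w\<in>car M" "w'\<in>car M" using x zn[of n] zn[of "Suc n"] by (auto simp: w_def w'_def lsmult_closed simp del: A.nat_pow_Suc)
  have "z [^]\<^bsub>A\<^esub> n\<odot>(x \<oplus> z\<odot>x) = w \<oplus> w'" using x z(1) zn[of n] by (simp add: w_def w'_def lsmult_r_distr lsmult_closed lsmult_assoc)
  hence "w \<oplus> w'\<in>K" using KD(4)[OF zn[of n] xz] by simp
  hence 1: "sc ?s\<odot>(w \<oplus> w')\<in>K" using KD(4) by simp
  have "(x \<oplus> sc (- ?s)\<odot>w) \<oplus> sc ?s\<odot>(w \<oplus> w') =
   x \<oplus> sc ?s\<odot>w' \<oplus> (sc (- ?s)\<odot>w \<oplus> sc ?s\<odot>w)" using x c by (simp add: lsmult_r_distr M.a_ac)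
  also have "\<dots> = x \<oplus> sc ?s\<odot>w'" using sc_plus[of w "- ?s" ?s] x c by simp
  finally have "x \<oplus> sc ?s\<odot>w'\<in>K" using KD(3)[OF Suc[folded w_def] 1] by simp
  thus ?case by (simp add: w'_def)
 qed
 moreover have "z [^]\<^bsub>A\<^esub> d = \<zero>\<^sub>A" by (rule A_eqI) (use z cf_pow[OF z] long_bad in auto)
 ultimately have "x \<oplus> sc (- ((- 1) ^ d))\<odot>(\<zero>\<^sub>A\<odot>x)\<in>K" by metis
 thus ?thesis using x by (simp add: zero_lsmult lsmult_zero)
qed

lemma expand_smult:
 assumes a: "a\<in>car A" and v: "v\<in>verts Q" and x: "x\<in>car M" "e v\<odot>x = x"
 shows "a\<odot>x = sc (cf a (v, []))\<odot>x \<oplus> finsum M (\<lambda>t. ar t\<odot>(sub a t\<odot>x)) (arcs Q)"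
proof -
 have ev: "e v\<in>car A" using v by simp
 have f: "(\<lambda>t. ar t\<otimes>\<^sub>A (sub a t\<otimes>\<^sub>A e v))\<in>arcs Q \<rightarrow> car A" using ev by auto
 have be: "(b\<otimes>\<^sub>A e v)\<odot>x = b\<odot>x" if "b\<in>car A" for b using that ev x by (simp add: lsmult_assoc)
 have "a\<odot>x = (sc (cf a (v, []))\<otimes>\<^sub>A e v \<oplus>\<^sub>A finsum A (\<lambda>t. ar t\<otimes>\<^sub>A (sub a t\<otimes>\<^sub>A e v)) (arcs Q))\<odot>x"
  unfolding expand_A[OF a v, symmetric] using be[OF a] by simp
 also have "\<dots> = (sc (cf a (v, []))\<otimes>\<^sub>A e v)\<odot>x \<oplus> finsum A (\<lambda>t. ar t\<otimes>\<^sub>A (sub a t\<otimes>\<^sub>A e v)) (arcs Q)\<odot>x"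
  using ev x f A.finsum_closed[OF f] by (intro lsmult_l_distr) auto
 also have "\<dots> = sc (cf a (v, []))\<odot>x \<oplus> finsum M (\<lambda>t. (ar t\<otimes>\<^sub>A (sub a t\<otimes>\<^sub>A e v))\<odot>x) (arcs Q)"
  using be[of "sc (cf a (v, []))"] smult_finsum[OF finite_arcs x(1) f] by simp
 also have "finsum M (\<lambda>t. (ar t\<otimes>\<^sub>A (sub a t\<otimes>\<^sub>A e v))\<odot>x) (arcs Q) =
   finsum M (\<lambda>t. ar t\<odot>(sub a t\<odot>x)) (arcs Q)" using ev x be by (intro M.finsum_cong') (auto simp: lsmult_assoc lsmult_closed)
 finally show ?thesis .
qed

end

section \<open>Sums over arrows in torsionless modules\<close>

context monomial_module
begin

lemma functional_finsum:
 assumes \<phi>: "\<phi>\<in>mod_hom A M reg" and m: "m\<in>arcs Q \<rightarrow> car M"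
 shows "\<phi> (arsum m) = finsum A (\<lambda>g. ar g\<otimes>\<^sub>A \<phi> (m g)) (arcs Q)"
proof -
 have c: "\<phi> x\<in>car A" if "x\<in>car M" for x using hom_closed[OF \<phi> that] by simp
 have arm: "(\<lambda>g. ar g\<odot>m g)\<in>arcs Q \<rightarrow> car M" using m by (auto simp: Pi_iff)
 have "\<phi> (arsum m) = finsum reg (\<lambda>g. \<phi> (ar g\<odot>m g)) (arcs Q)"
  by (rule hom_finsum[OF left_module_axioms reg_left_module _ _ arm]) (use c hom_add[OF \<phi>] in auto)
 also have "\<dots> = finsum A (\<lambda>g. \<phi> (ar g\<odot>m g)) (arcs Q)" by (rule finsum_reg[OF finite_arcs]) (use arm c in \<open>auto simp: Pi_iff\<close>)
 also have "\<dots> = finsum A (\<lambda>g. ar g\<otimes>\<^sub>A \<phi> (m g)) (arcs Q)" by (rule A.finsum_cong') (use m c hom_smult[OF \<phi>] in \<open>auto simp: Pi_iff\<close>)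
 finally show ?thesis .
qed

text \<open>Paths ending in \<open>t\<close> occur in the summand of \<open>t\<close> only; the
  right ideals generated by different arrows are independent.\<close>

lemma cf_arrow_sum:
 assumes w: "w\<in>arcs Q \<rightarrow> car A" and p: "good (u, as @ [t])"
 shows "cf (finsum A (\<lambda>g. ar g\<otimes>\<^sub>A w g) (arcs Q)) (u, as @ [t]) = cf (w t) (u, as)"
proof -
 have f: "(\<lambda>g. ar g\<otimes>\<^sub>A w g)\<in>arcs Q \<rightarrow> car A" using w by (auto simp: Pi_iff)
 have t: "t\<in>arcs Q" using good_paths[OF p] by (auto simp: append_in_paths)
 have "cf (finsum A (\<lambda>g. ar g\<otimes>\<^sub>A w g) (arcs Q)) (u, as @ [t]) = (\<Sum>g\<in>arcs Q. cf (ar g\<otimes>\<^sub>A w g) (u, as @ [t]))" by (rule cf_finsum[OF f p finite_arcs])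
 also have "\<dots> = (\<Sum>g\<in>arcs Q. if g = t then cf (w t) (u, as) else 0)" using w p by (intro sum.cong) (auto simp: Pi_iff cf_ar_mult_snoc)
 also have "\<dots> = cf (w t) (u, as)" using t by (simp add: finite_arcs)
 finally show ?thesis .
qed

lemma arrow_mult_zeroI:
 assumes t: "t\<in>arcs Q" and a: "a\<in>car A" and "!!u as. good (u, as @ [t]) ==> cf a (u, as) = 0"
 shows "ar t\<otimes>\<^sub>A a = \<zero>\<^sub>A"
proof (rule A_eqI)
 fix p assume p: "good p"
 obtain u as where pu: "p = (u, as)" by (cases p)
 show "cf (ar t\<otimes>\<^sub>A a) p = cf \<zero>\<^sub>A p"
 proof (cases as rule: rev_cases)
  case Nil
  thus ?thesis using p a t by (auto simp: pu cf_ar_mult)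
 next
  case (snoc bs x)
  thus ?thesis using p a t assms(3) by (auto simp: pu cf_ar_mult_snoc)
 qed
qed (use t a in auto)

text \<open>A functional into the algebra turns the relation into one between multiples of different
  arrows, where the terms have no path in common. Torsionlessness provides a functional that would
  detect a nonzero term.\<close>

lemma arrow_sum_zero:
 assumes t: "torsionless M" and m: "m\<in>arcs Q \<rightarrow> car M"
  and z: "arsum m = \<zero>" and w: "w\<in>arcs Q"
 shows "ar w\<odot>m w = \<zero>"
proof (rule ccontr)
 assume "ar w\<odot>m w \<noteq> \<zero>"
 moreover have c: "m w\<in>car M" using m w by auto
 ultimately obtain \<phi> where \<phi>: "\<phi>\<in>mod_hom A M reg" "\<phi> (ar w\<odot>m w) \<noteq> \<zero>\<^sub>A" using t w unfolding torsionless_def by (meson ar_closed)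
 have \<phi>c: "(\<lambda>g. \<phi> (m g))\<in>arcs Q \<rightarrow> car A" using m hom_closed[OF \<phi>(1)] by (auto simp: Pi_iff)
 have s0: "finsum A (\<lambda>g. ar g\<otimes>\<^sub>A \<phi> (m g)) (arcs Q) = \<zero>\<^sub>A"
  using functional_finsum[OF \<phi>(1) m] z hom_zero[OF left_module_axioms reg_left_module \<phi>(1)] by simp
 have "ar w\<otimes>\<^sub>A \<phi> (m w) = \<zero>\<^sub>A"
 proof (rule arrow_mult_zeroI[OF w])
  fix u as assume p: "good (u, as @ [w])"
  show "cf (\<phi> (m w)) (u, as) = 0" using cf_arrow_sum[OF \<phi>c p] s0 p by simp
 qed (use \<phi>c w in auto)
 thus False using \<phi> hom_smult[OF \<phi>(1), of "ar w" "m w"] w c by simp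
qed

text \<open>If \<open>\<delta> w\<close> is not a relation, appending \<open>\<delta>\<close> keeps
  every good path ending in \<open>w\<close> good, so in the algebra no such path is lost under
  multiplication by \<open>\<delta>\<close>. A functional transfers this to the module.\<close>

lemma arrow_annihilates_part:
 assumes t: "torsionless M" and m: "m\<in>arcs Q \<rightarrow> car M" and \<delta>: "\<delta>\<in>arcs Q"
  and z: "ar \<delta>\<odot>arsum m = \<zero>"
  and w: "w\<in>arcs Q" "good (tail Q w, [w, \<delta>])"
 shows "ar w\<odot>m w = \<zero>"
proof (rule ccontr)
 assume "ar w\<odot>m w \<noteq> \<zero>"
 moreover have c: "m w\<in>car M" using m w by auto
 ultimately obtain \<phi> where \<phi>: "\<phi>\<in>mod_hom A M reg" "\<phi> (ar w\<odot>m w) \<noteq> \<zero>\<^sub>A" using t w unfolding torsionless_def by (meson ar_closed)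
 have \<phi>c: "(\<lambda>g. \<phi> (m g))\<in>arcs Q \<rightarrow> car A" using m hom_closed[OF \<phi>(1)] by (auto simp: Pi_iff)
 let ?s = "finsum A (\<lambda>g. ar g\<otimes>\<^sub>A \<phi> (m g)) (arcs Q)"
 have sc: "?s\<in>car A" using \<phi>c by (intro A.finsum_closed) (auto simp: Pi_iff)
 have "arsum m\<in>car M" using m by (intro M.finsum_closed) (auto simp: Pi_iff)
 hence s0: "ar \<delta>\<otimes>\<^sub>A ?s = \<zero>\<^sub>A" using functional_finsum[OF \<phi>(1) m] z hom_zero[OF left_module_axioms reg_left_module \<phi>(1)]
   hom_smult[OF \<phi>(1), of "ar \<delta>" "arsum m"] \<delta> by simp
 have "ar w\<otimes>\<^sub>A \<phi> (m w) = \<zero>\<^sub>A"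
 proof (rule arrow_mult_zeroI[OF w(1)])
  fix u as assume p: "good (u, as @ [w])"
  have p': "good (u, (as @ [w]) @ [\<delta>])" using good_extend[OF p w(2)] by simp
  have "cf (ar \<delta>\<otimes>\<^sub>A ?s) (u, (as @ [w]) @ [\<delta>]) = cf ?s (u, as @ [w])" using cf_ar_mult_snoc[OF \<delta> sc p'] by simp
  thus "cf (\<phi> (m w)) (u, as) = 0" using cf_arrow_sum[OF \<phi>c p] s0 p' by simp
 qed (use \<phi>c w in auto)
 thus False using \<phi> hom_smult[OF \<phi>(1), of "ar w" "m w"] w c by simp
qed

lemma arrow_sum_cong:
 assumes t: "torsionless M" and m: "m\<in>arcs Q \<rightarrow> car M" and n: "n\<in>arcs Q \<rightarrow> car M"
  and eq: "arsum m = arsum n" and s: "s\<in>arcs Q"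
 shows "ar s\<odot>m s = ar s\<odot>n s"
proof -
 let ?k = "\<lambda>g. m g \<oplus> sc (- 1)\<odot>n g"
 have mc: "m g\<in>car M" "n g\<in>car M" if "g\<in>arcs Q" for g using m n that by auto
 let ?S = "arsum n"
 have S: "?S\<in>car M" using mc by (intro M.finsum_closed) auto
 have "arsum ?k =
   finsum M (\<lambda>g. ar g\<odot>m g \<oplus> sc (- 1)\<odot>(ar g\<odot>n g)) (arcs Q)"
  using mc by (intro M.finsum_cong') (auto simp: lsmult_r_distr sc_smult_commute[of "ar _"])
 also have "\<dots> = arsum m \<oplus> finsum M (\<lambda>g. sc (- 1)\<odot>(ar g\<odot>n g)) (arcs Q)" using mc by (intro M.finsum_addf) auto
 also have "finsum M (\<lambda>g. sc (- 1)\<odot>(ar g\<odot>n g)) (arcs Q) = sc (- 1)\<odot>?S" using mc by (intro finsum_smult[symmetric]) auto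
 also have "arsum m \<oplus> sc (- 1)\<odot>?S = \<zero>" unfolding eq using S by (simp add: sc_neg M.r_neg)
 finally have "ar s\<odot>?k s = \<zero>" using mc by (intro arrow_sum_zero[OF t _ _ s]) auto
 hence "ar s\<odot>m s \<oplus> \<ominus> (ar s\<odot>n s) = \<zero>" using mc[OF s] s by (simp add: lsmult_r_distr sc_neg lsmult_minus)
 thus ?thesis using mc[OF s] s diff_add[of "ar s\<odot>m s" "ar s\<odot>n s"] by simp
qed

section \<open>Minimal generating families and the relations between them\<close>

text \<open>Generating families of elements of the form \<open>\<gamma> q\<close> are indexed by the pairs \<open>(\<gamma>, q)\<close>.\<close>

definition el where "el y = ar (fst y)\<odot>snd y"

definition lc where "lc a Y = finsum M (\<lambda>y. a y\<odot>el y) Y"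

definition gen where "gen Y = {lc a Y |a. a\<in>Y \<rightarrow> car A}"

lemma el_closed: "y\<in>arcs Q \<times> car M ==> el y\<in>car M" by (auto simp: el_def)

lemma el_head: "y\<in>arcs Q \<times> car M ==> e (head Q (fst y))\<odot>el y = el y" by (auto simp: el_def e_ar_smult)

lemma lc_fun:
 "Y \<subseteq> arcs Q \<times> car M ==> a\<in>Y \<rightarrow> car A ==> (\<lambda>y. a y\<odot>el y)\<in>Y \<rightarrow> car M" using el_closed by (auto simp: Pi_iff intro!: lsmult_closed)

lemma lc_closed: "Y \<subseteq> arcs Q \<times> car M ==> a\<in>Y \<rightarrow> car A ==> lc a Y\<in>car M" unfolding lc_def using lc_fun by (rule M.finsum_closed)

lemma lc_insert:
 assumes "finite Y" "y \<notin> Y" "insert y Y \<subseteq> arcs Q \<times> car M" "a\<in>insert y Y \<rightarrow> car A"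
 shows "lc a (insert y Y) = a y\<odot>el y \<oplus> lc a Y" unfolding lc_def using lc_fun[OF assms(3,4)] assms(1,2) by (intro M.finsum_insert) (auto simp: Pi_iff)

lemma gen_submodule:
 assumes Y: "Y \<subseteq> arcs Q \<times> car M"
 shows "submodule (gen Y) A M"
proof (rule lsubmoduleI)
 show "gen Y \<subseteq> car M" using lc_closed[OF Y] by (auto simp: gen_def)
 have "lc (\<lambda>_. \<zero>\<^sub>A) Y = finsum M (\<lambda>_. \<zero>) Y" unfolding lc_def using Y el_closed by (intro M.finsum_cong') (auto simp: zero_lsmult subset_iff)
 hence "\<zero> = lc (\<lambda>_. \<zero>\<^sub>A) Y" by simp
 thus "\<zero>\<in>gen Y" unfolding gen_def by (intro CollectI exI[of _ "\<lambda>_. \<zero>\<^sub>A"]) auto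
next
 fix s t assume "s\<in>gen Y" "t\<in>gen Y"
 then obtain a b where ab: "a\<in>Y \<rightarrow> car A" "b\<in>Y \<rightarrow> car A" "s = lc a Y" "t = lc b Y" by (auto simp: gen_def)
 have elc: "el y\<in>car M" "a y\<in>car A" "b y\<in>car A" if "y\<in>Y" for y using Y el_closed ab that by auto
 have "lc (\<lambda>y. a y \<oplus>\<^sub>A b y) Y = finsum M (\<lambda>y. a y\<odot>el y \<oplus> b y\<odot>el y) Y"
  unfolding lc_def using elc by (intro M.finsum_cong') (auto simp: lsmult_l_distr lsmult_closed)
 also have "\<dots> = s \<oplus> t" unfolding ab lc_def using elc by (intro M.finsum_addf) (auto simp: lsmult_closed)
 finally show "s \<oplus> t\<in>gen Y" unfolding gen_def using elc by (intro CollectI exI[of _ "\<lambda>y. a y \<oplus>\<^sub>A b y"]) auto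
next
 fix c s assume c: "c\<in>car A" and "s\<in>gen Y"
 then obtain a where a: "a\<in>Y \<rightarrow> car A" "s = lc a Y" by (auto simp: gen_def)
 have elc: "el y\<in>car M" "a y\<in>car A" if "y\<in>Y" for y using Y el_closed a that by auto
 have "c\<odot>s = finsum M (\<lambda>y. c\<odot>(a y\<odot>el y)) Y" unfolding a lc_def using c elc by (intro finsum_smult) (auto simp: lsmult_closed)
 also have "\<dots> = lc (\<lambda>y. c\<otimes>\<^sub>A a y) Y" unfolding lc_def using c elc by (intro M.finsum_cong') (auto simp: lsmult_assoc lsmult_closed)
 finally show "c\<odot>s\<in>gen Y" unfolding gen_def using c elc by (intro CollectI exI[of _ "\<lambda>y. c\<otimes>\<^sub>A a y"]) auto
qed

lemma el_gen:
 assumes Y: "Y \<subseteq> arcs Q \<times> car M" "finite Y" and y: "y\<in>Y"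
 shows "el y\<in>gen Y"
proof -
 have elc: "el y\<in>car M" if "y\<in>Y" for y using Y el_closed that by auto
 have "lc (\<lambda>x. if x = y then \<one>\<^sub>A else \<zero>\<^sub>A) Y = finsum M (\<lambda>x. if x = y then el y else \<zero>) Y"
  unfolding lc_def using elc by (intro M.finsum_cong') (auto simp: zero_lsmult lsmult_one)
 also have "\<dots> = el y" using Y(2) y elc by (intro finsum_delta) auto
 finally show ?thesis unfolding gen_def by (intro CollectI exI[of _ "\<lambda>x. if x = y then \<one>\<^sub>A else \<zero>\<^sub>A"]) auto
qed

lemma gen_least:
 assumes "submodule N A M" "!!y. y\<in>Y ==> el y\<in>N"
 shows "gen Y \<subseteq> N"
proof
 fix x assume "x\<in>gen Y"
 then obtain a where a: "a\<in>Y \<rightarrow> car A" "x = lc a Y" by (auto simp: gen_def)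
 show "x\<in>N" unfolding a(2) lc_def by (rule submodule_finsum[OF assms(1)]) (use a(1) assms(2) lsubmoduleD(4)[OF assms(1)] in \<open>auto simp: Pi_iff\<close>)
qed

text \<open>Each coefficient is split into its scalar part and its left quotients by arrows, and all
  terms are sorted by leftmost arrow. The scalar part of the coefficient of \<open>y\<close> is
  counted under \<open>fst y\<close>, since \<open>el y\<close> already begins with that arrow on
  the left; the quotient by \<open>t\<close> is counted under \<open>t\<close>.\<close>

lemma expand_lc:
 assumes "finite Y" "Y \<subseteq> arcs Q \<times> car M" "a\<in>Y \<rightarrow> car A"
 shows "\<exists>z\<in>arcs Q \<rightarrow> car M. lc a Y = arsum z \<and>
  (\<forall>t\<in>arcs Q. ar t\<odot>z t = finsum M (\<lambda>y. if fst y = t then sc (cf (a y) (head Q (fst y), []))\<odot>el y else \<zero>) Y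
    \<oplus> ar t\<odot>lc (\<lambda>y. sub (a y) t) Y)" using assms
proof (induction Y)
 case empty
 have "finsum M (\<lambda>t. ar t\<odot>\<zero>) (arcs Q) = finsum M (\<lambda>_. \<zero>) (arcs Q)" by (intro M.finsum_cong') (auto simp: lsmult_zero)
 thus ?case by (intro bexI[of _ "\<lambda>_. \<zero>"]) (auto simp: lc_def lsmult_zero)
next
 case (insert y Y)
 let ?c = "cf (a y) (head Q (fst y), [])"
 have yin: "fst y\<in>arcs Q" "snd y\<in>car M" "y\<in>arcs Q \<times> car M" and Y: "Y \<subseteq> arcs Q \<times> car M"
  and a: "a y\<in>car A" "a\<in>Y \<rightarrow> car A" using insert.prems by auto
 have elY: "el x\<in>car M" if "x\<in>insert y Y" for x using el_closed insert.prems(1) that by auto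
 obtain z where z: "z\<in>arcs Q \<rightarrow> car M" "lc a Y = arsum z"
  "!!t. t\<in>arcs Q ==> ar t\<odot>z t = finsum M (\<lambda>y. if fst y = t then sc (cf (a y) (head Q (fst y), []))\<odot>el y else \<zero>) Y
    \<oplus> ar t\<odot>lc (\<lambda>y. sub (a y) t) Y" using insert.IH[OF Y a(2)] by blast
 define x1 where "x1 t = (if t = fst y then sc ?c\<odot>snd y else \<zero>)" for t
 define x2 where "x2 t = sub (a y) t\<odot>el y" for t
 have xc: "x1 t\<in>car M" "x2 t\<in>car M" for t using yin elY by (auto simp: x1_def x2_def lsmult_closed)
 have zc: "z t\<in>car M" if "t\<in>arcs Q" for t using z(1) that by auto
 have c1: "sc ?c\<odot>el y = ar (fst y)\<odot>(sc ?c\<odot>snd y)" using yin by (simp add: el_def sc_smult_commute)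
 have arx1: "ar t\<odot>x1 t = (if t = fst y then sc ?c\<odot>el y else \<zero>)" if "t\<in>arcs Q" for t using that c1 by (simp add: x1_def lsmult_zero)
 have "arsum x1 = finsum M (\<lambda>t. if t = fst y then sc ?c\<odot>el y else \<zero>) (arcs Q)" using arx1 elY by (intro M.finsum_cong') auto
 also have "\<dots> = sc ?c\<odot>el y" using yin elY by (intro finsum_delta) auto
 finally have s1: "sc ?c\<odot>el y = arsum x1" by simp
 have ay: "a y\<odot>el y = sc ?c\<odot>el y \<oplus> arsum x2" unfolding x2_def using yin(1) elY by (intro expand_smult[OF a(1) _ _ el_head[OF yin(3)]]) auto
 define z' where "z' t = (x1 t \<oplus> x2 t) \<oplus> z t" for t
 have ar': "ar t\<odot>z' t = (ar t\<odot>x1 t \<oplus> ar t\<odot>x2 t) \<oplus> ar t\<odot>z t" if "t\<in>arcs Q" for t using that xc zc by (simp add: z'_def lsmult_r_distr)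
 have "arsum z' =
   finsum M (\<lambda>t. (ar t\<odot>x1 t \<oplus> ar t\<odot>x2 t) \<oplus> ar t\<odot>z t) (arcs Q)" using ar' xc zc by (intro M.finsum_cong') auto
 also have "\<dots> = finsum M (\<lambda>t. ar t\<odot>x1 t \<oplus> ar t\<odot>x2 t) (arcs Q) \<oplus> arsum z" using xc zc by (intro M.finsum_addf) auto
 also have "finsum M (\<lambda>t. ar t\<odot>x1 t \<oplus> ar t\<odot>x2 t) (arcs Q) =
   arsum x1 \<oplus> arsum x2" using xc by (intro M.finsum_addf) auto
 finally have "arsum z' = a y\<odot>el y \<oplus> lc a Y" by (simp only: ay s1[symmetric] z(2)[symmetric])
 hence eq: "lc a (insert y Y) = arsum z'" using lc_insert[OF insert.hyps insert.prems] by simp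
 have "ar t\<odot>z' t = finsum M (\<lambda>y. if fst y = t then sc (cf (a y) (head Q (fst y), []))\<odot>el y else \<zero>) (insert y Y)
    \<oplus> ar t\<odot>lc (\<lambda>y. sub (a y) t) (insert y Y)" if t: "t\<in>arcs Q" for t
 proof -
  let ?f = "\<lambda>y. if fst y = t then sc (cf (a y) (head Q (fst y), []))\<odot>el y else \<zero>"
  have fc: "?f x\<in>car M" if "x\<in>insert y Y" for x using elY[OF that] by simp
  have f1: "?f y = ar t\<odot>x1 t" using arx1[OF t] by auto
  have 1: "finsum M ?f (insert y Y) = ar t\<odot>x1 t \<oplus> finsum M ?f Y" unfolding f1[symmetric] using insert.hyps fc by (intro M.finsum_insert) auto
  have lcc: "lc (\<lambda>y. sub (a y) t) Y\<in>car M" by (rule lc_closed[OF Y]) auto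
  have 2: "ar t\<odot>lc (\<lambda>y. sub (a y) t) (insert y Y) = ar t\<odot>x2 t \<oplus> ar t\<odot>lc (\<lambda>y. sub (a y) t) Y"
   using lc_insert[OF insert.hyps insert.prems(1), of "\<lambda>y. sub (a y) t"] xc(2) lcc t by (simp add: x2_def lsmult_r_distr)
  have fY: "finsum M ?f Y\<in>car M" using fc by (intro M.finsum_closed) auto
  show ?thesis unfolding ar'[OF t] z(3)[OF t] 1 2 using xc fY lcc t by (simp add: M.a_ac)
 qed
 thus ?case using eq xc zc by (intro bexI[of _ z']) (auto simp: z'_def)
qed

text \<open>If \<open>c j\<close> were nonzero, dividing by it would place \<open>el j\<close> plus
  a nilpotent multiple of \<open>el j\<close> into the submodule generated by the other elements. By
  \<open>nilpotent_absorb\<close> it would contain \<open>el j\<close>, against minimality.\<close>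

lemma minimal_coefficient:
 assumes Y: "finite Y" "Y \<subseteq> arcs Q \<times> car M" and min: "el j \<notin> gen (Y - {j})" and j: "j\<in>Y"
  and b: "b\<in>Y \<rightarrow> car A"
  and z: "finsum M (\<lambda>y. if fst y = fst j then sc (c y)\<odot>el y else \<zero>) Y \<oplus> ar (fst j)\<odot>lc b Y = \<zero>"
 shows "c j = 0"
proof (rule ccontr)
 assume c: "c j \<noteq> 0"
 let ?K = "gen (Y - {j})"
 have Y': "Y - {j} \<subseteq> arcs Q \<times> car M" "finite (Y - {j})" using Y by auto
 have K: "submodule ?K A M" by (rule gen_submodule[OF Y'(1)])
 note KD = lsubmoduleD[OF K]
 have elY: "el x\<in>car M" if "x\<in>Y" for x using el_closed Y that by auto
 have jin: "fst j\<in>arcs Q" using Y j by auto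
 let ?f = "\<lambda>y. if fst y = fst j then sc (c y)\<odot>el y else \<zero>"
 have Yj: "insert j (Y - {j}) = Y" using j by auto
 have "finsum M ?f (insert j (Y - {j})) = ?f j \<oplus> finsum M ?f (Y - {j})" using Y' elY j by (intro M.finsum_insert) auto
 hence 1: "finsum M ?f Y = sc (c j)\<odot>el j \<oplus> finsum M ?f (Y - {j})" by (simp only: Yj simp_thms if_True)
 have fK: "finsum M ?f (Y - {j})\<in>?K" by (rule submodule_finsum[OF K]) (use KD(2,4) el_gen[OF Y'] in auto)
 have 2: "lc b Y = b j\<odot>el j \<oplus> lc b (Y - {j})" by (rule lc_insert[of "Y - {j}" j b, unfolded Yj]) (use Y' Y b in auto)
 have bK: "lc b (Y - {j})\<in>?K" unfolding gen_def using b by auto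
 define r where "r = finsum M ?f (Y - {j}) \<oplus> ar (fst j)\<odot>lc b (Y - {j})"
 have r: "r\<in>?K" unfolding r_def using KD(3)[OF fK KD(4)[OF _ bK, of "ar (fst j)"]] jin by simp
 have bj: "b j\<in>car A" using b j by auto
 define x where "x = sc (c j)\<odot>el j \<oplus> ar (fst j)\<odot>(b j\<odot>el j)"
 have cl: "finsum M ?f (Y - {j})\<in>car M" "lc b (Y - {j})\<in>car M" "r\<in>car M" "x\<in>car M"
  using fK bK r KD(1) elY[OF j] bj jin by (auto simp: x_def lsmult_closed)
 have c4: "sc (c j)\<odot>el j\<in>car M" "b j\<odot>el j\<in>car M" using elY[OF j] bj by (auto simp: lsmult_closed)
 hence c5: "ar (fst j)\<odot>(b j\<odot>el j)\<in>car M" "ar (fst j)\<odot>lc b (Y - {j})\<in>car M" using cl jin by (auto simp: lsmult_closed)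
 have "x \<oplus> r = (sc (c j)\<odot>el j \<oplus> finsum M ?f (Y - {j})) \<oplus>
   (ar (fst j)\<odot>(b j\<odot>el j) \<oplus> ar (fst j)\<odot>lc b (Y - {j}))" unfolding x_def r_def using c4(1) c5 cl(1) by (simp only: M.a_ac M.a_closed)
 also have d: "ar (fst j)\<odot>(b j\<odot>el j) \<oplus> ar (fst j)\<odot>lc b (Y - {j}) =
   ar (fst j)\<odot>(b j\<odot>el j \<oplus> lc b (Y - {j}))" by (rule lsmult_r_distr[OF _ c4(2) cl(2), symmetric]) (simp add: jin)
 also note z[unfolded 1 2]
 finally have "x \<oplus> r = \<zero>" .
 hence "x = \<ominus> r" using M.minus_equality[of x r] cl by simp
 hence "x\<in>?K" using KD(5)[OF r] by simp
 hence "sc (1 / c j)\<odot>x\<in>?K" using KD(4) by simp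
 \<comment> \<open>All paths in \<open>w\<close> end in the arrow \<open>fst j\<close>; hence it has
   no trivial paths and \<open>nilpotent_absorb\<close> applies.\<close>
 moreover define w where "w = sc (1 / c j)\<otimes>\<^sub>A (ar (fst j)\<otimes>\<^sub>A b j)"
 have "sc (1 / c j)\<odot>x = el j \<oplus> w\<odot>el j" using elY[OF j] bj jin c by (simp add: x_def w_def lsmult_r_distr lsmult_assoc lsmult_closed)
 ultimately have wK: "el j \<oplus> w\<odot>el j\<in>?K" by simp
 have "el j\<in>?K" by (rule nilpotent_absorb[OF K elY[OF j] _ _ wK]) (use bj jin in \<open>auto simp: w_def cf_ar_mult\<close>)
 thus False using min by blast
qed

text \<open>The induction strips the leftmost arrow \<open>s\<close> from all coefficients. Of the
  remaining combination one does not know that it vanishes, only that \<open>s\<close> kills it,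
  hence that its \<open>\<delta>\<close>-parts vanish for those \<open>\<delta>\<close> with
  \<open>s \<delta>\<close> not a relation. The statement is therefore about a single arrow part of
  a possibly nonzero combination, and \<open>m\<close> bounds the lengths of the paths in the
  coefficients.\<close>

lemma independence:
 assumes t: "torsionless M" and Y: "finite Y" "Y \<subseteq> arcs Q \<times> car M"
  and min: "!!y. y\<in>Y ==> el y \<notin> gen (Y - {y})"
 shows "[|a\<in>Y \<rightarrow> car A; !!y p. y\<in>Y ==> good p ==> m \<le> length (snd p) ==> cf (a y) p = 0;
   z\<in>arcs Q \<rightarrow> car M; lc a Y = arsum z;
   s\<in>arcs Q; ar s\<odot>z s = \<zero>; y\<in>Y; good (u, as @ [s])|] ==>
   cf (a y\<otimes>\<^sub>A ar (fst y)) (u, as @ [s]) = 0"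
proof (induction m arbitrary: a z s y u as)
 case 0
 have "a y = \<zero>\<^sub>A" using 0 by (intro A_eqI) auto
 thus ?case using 0 Y(2) by auto
next
 case (Suc m)
 note a = Suc.prems(1) and deg = Suc.prems(2) and z = Suc.prems(3) and lcz = Suc.prems(4) and s = Suc.prems(5)
  and z0 = Suc.prems(6) and y = Suc.prems(7) and gp = Suc.prems(8)
 let ?c = "\<lambda>y. cf (a y) (head Q (fst y), [])"
 let ?b = "\<lambda>y. sub (a y) s"
 have b: "?b\<in>Y \<rightarrow> car A" by auto
 obtain z' where z': "z'\<in>arcs Q \<rightarrow> car M" "lc a Y = arsum z'"
  "ar s\<odot>z' s = finsum M (\<lambda>y. if fst y = s then sc (?c y)\<odot>el y else \<zero>) Y \<oplus> ar s\<odot>lc ?b Y" using expand_lc[OF Y a] s by blast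
 have "ar s\<odot>z' s = ar s\<odot>z s" using arrow_sum_cong[OF t z'(1) z _ s] lcz z'(2) by simp
 hence eq0: "finsum M (\<lambda>y. if fst y = s then sc (?c y)\<odot>el y else \<zero>) Y \<oplus> ar s\<odot>lc ?b Y = \<zero>" using z0 z'(3) by simp
 \<comment> \<open>Minimality removes the scalar parts, so the \<open>s\<close>-part of the relation
   is \<open>s\<close> times the combination of quotients.\<close>
 have c0: "?c j = 0" if "j\<in>Y" "fst j = s" for j using minimal_coefficient[OF Y min[OF that(1)] that(1) b, of ?c] eq0 that(2) by simp
 have elY: "el x\<in>car M" if "x\<in>Y" for x using el_closed Y that by auto
 have "finsum M (\<lambda>y. if fst y = s then sc (?c y)\<odot>el y else \<zero>) Y = finsum M (\<lambda>_. \<zero>) Y" using c0 elY by (intro M.finsum_cong') auto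
 moreover have lcb: "lc ?b Y\<in>car M" by (rule lc_closed[OF Y(2) b])
 ultimately have w0: "ar s\<odot>lc ?b Y = \<zero>" using eq0 s by simp
 obtain z2 where z2: "z2\<in>arcs Q \<rightarrow> car M" "lc ?b Y = arsum z2" using expand_lc[OF Y b] by blast
 have yin: "fst y\<in>arcs Q" "a y\<in>car A" using Y(2) y a by auto
 show ?case
 proof (cases as)
  case Nil
  thus ?thesis using cf_mult_ar_Cons[OF yin, of u s "[]"] gp c0[OF y] by auto
 next
  case (Cons g bs)
  show ?thesis
  proof (cases "g = fst y")
   case False
   thus ?thesis using cf_mult_ar_Cons[OF yin, of u g "bs @ [s]"] gp Cons by simp
  next
   case True
   have gp': "good (u, fst y # bs @ [s])" using gp Cons True by simp
   have gbs: "good (head Q (fst y), bs @ [s])" using good_Cons[OF gp'] .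
   have gub: "good (u, fst y # bs)" using good_append(1)[of u "fst y # bs" "[s]"] gp' by simp
   \<comment> \<open>\<open>\<delta>\<close> is the arrow traversed just before \<open>s\<close>; it
     is \<open>fst y\<close> itself if \<open>bs\<close> is empty.\<close>
   obtain cs \<delta> where cs: "fst y # bs = cs @ [\<delta>]" by (metis rev_exhaust list.discI)
   have g2: "good (u, cs @ [\<delta>, s])" using gp' cs by (metis append_Cons append_assoc append_Nil)
   have \<delta>: "\<delta>\<in>arcs Q" using good_paths[OF gub] cs by (auto simp: append_in_paths)
   have "good (tail Q \<delta>, [\<delta>, s])" using good_append(2)[OF g2] good_paths[OF good_append(2)[OF g2]] by simp
   hence d0: "ar \<delta>\<odot>z2 \<delta> = \<zero>" using arrow_annihilates_part[OF t z2(1) s _ \<delta>] w0 z2(2) by simp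
   have "cf (?b y\<otimes>\<^sub>A ar (fst y)) (u, cs @ [\<delta>]) = 0"
   proof (rule Suc.IH[OF b _ z2 \<delta> d0 y])
    show "good (u, cs @ [\<delta>])" using gub cs by simp
    fix x p assume x: "x\<in>Y" and p: "good p" "m \<le> length (snd p)"
    obtain v ds where pv: "p = (v, ds)" by (cases p)
    show "cf (sub (a x) s) p = 0" using deg[OF x, of "(v, ds @ [s])"] p by (simp add: pv)
   qed
   moreover have "cf (?b y\<otimes>\<^sub>A ar (fst y)) (u, fst y # bs) = cf (a y) (head Q (fst y), bs @ [s])"
    using cf_mult_ar_Cons[OF yin(1) _ gub, of "?b y"] good_Cons[OF gub] gbs by simp
   moreover have "cf (a y\<otimes>\<^sub>A ar (fst y)) (u, fst y # bs @ [s]) = cf (a y) (head Q (fst y), bs @ [s])" using cf_mult_ar_Cons[OF yin gp'] by simp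
   moreover have "as @ [s] = fst y # bs @ [s]" using Cons True by simp
   ultimately show ?thesis by (simp only: cs)
  qed
 qed
qed

text \<open>For a vanishing combination all arrow parts can be taken to be zero, and
  \<open>d\<close> exceeds the length of every good path, so \<open>independence\<close> applies for
  each last arrow \<open>s\<close>.\<close>

lemma independent:
 assumes t: "torsionless M" and Y: "finite Y" "Y \<subseteq> arcs Q \<times> car M"
  and min: "!!y. y\<in>Y ==> el y \<notin> gen (Y - {y})"
  and a: "a\<in>Y \<rightarrow> car A" and z: "lc a Y = \<zero>" and y: "y\<in>Y"
 shows "a y\<otimes>\<^sub>A ar (fst y) = \<zero>\<^sub>A"
proof (rule A_eqI)
 have yin: "fst y\<in>arcs Q" "a y\<in>car A" using Y(2) y a by auto
 thus "a y\<otimes>\<^sub>A ar (fst y)\<in>car A" by simp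
 fix p assume p: "good p"
 obtain u as where pu: "p = (u, as)" by (cases p)
 show "cf (a y\<otimes>\<^sub>A ar (fst y)) p = cf \<zero>\<^sub>A p"
 proof (cases as rule: rev_cases)
  case Nil
  thus ?thesis using cf_mult_ar_Nil[OF yin] p by (simp add: pu)
 next
  case (snoc bs s)
  have s: "s\<in>arcs Q" using good_paths[OF p] by (auto simp: pu snoc append_in_paths)
  have "finsum M (\<lambda>s. ar s\<odot>\<zero>) (arcs Q) = finsum M (\<lambda>_. \<zero>) (arcs Q)" by (intro M.finsum_cong') (auto simp: lsmult_zero)
  hence "cf (a y\<otimes>\<^sub>A ar (fst y)) (u, bs @ [s]) = 0" using independence[OF t Y min a _ _ _ s _ y, of d "\<lambda>_. \<zero>" u bs] long_bad p z s
   by (force simp: pu snoc lsmult_zero)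
  thus ?thesis using p by (simp add: pu snoc)
 qed
qed simp

lemma minimal_generators:
 assumes K: "submodule K A M" "finitely_generated A (M\<lparr>carrier := K\<rparr>)" and rad: "K \<subseteq> rad"
  and hom: "!!m s. m\<in>arcs Q \<rightarrow> car M ==> arsum m\<in>K ==> s\<in>arcs Q ==>
   ar s\<odot>m s\<in>K"
 shows "\<exists>Y. finite Y \<and> Y \<subseteq> arcs Q \<times> car M \<and> gen Y = K \<and> (\<forall>y\<in>Y. el y \<notin> gen (Y - {y}))"
proof -
 note KD = lsubmoduleD[OF K(1)]
 interpret K: left_module A "M\<lparr>carrier := K\<rparr>" by (rule lsubmodule_is_left_module[OF K(1)])
 have "M\<lparr>carrier := K\<rparr>\<in>fg_mod A" using K(2) K.left_module_axioms by (simp add: fg_mod_def)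
 then obtain X where X: "finite X" "X \<subseteq> K" "!!L. submodule L A (M\<lparr>carrier := K\<rparr>) ==> X \<subseteq> L ==> L = K" by (rule fg_modE) simp
 have "\<forall>x\<in>X. \<exists>m. m\<in>arcs Q \<rightarrow> car M \<and> x = arsum m" using X(2) rad by (auto simp: rad_def)
 from bchoice[OF this] obtain m
  where m: "!!x. x\<in>X ==> m x\<in>arcs Q \<rightarrow> car M \<and> x = arsum (m x)" by blast
 define Y0 where "Y0 = (\<lambda>(x, s). (s, m x s)) ` (X \<times> arcs Q)"
 have Y0: "finite Y0" "Y0 \<subseteq> arcs Q \<times> car M" using X(1) m by (auto simp: Y0_def finite_arcs Pi_iff)
 have elK: "el y\<in>K" if y: "y\<in>Y0" for y
 proof -
  obtain x s where "x\<in>X" "s\<in>arcs Q" "y = (s, m x s)" using y by (auto simp: Y0_def)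
  thus ?thesis using hom[of "m x" s] m[of x] X(2) by (auto simp: el_def)
 qed
 have g0: "gen Y0 \<subseteq> K" using gen_least[OF K(1) elK] .
 note gD = lsubmoduleD[OF gen_submodule[OF Y0(2)]]
 have "gen Y0 = K"
 proof (rule X(3))
  show "submodule (gen Y0) A (M\<lparr>carrier := K\<rparr>)" using gD g0 by (intro K.lsubmoduleI) auto
  show "X \<subseteq> gen Y0"
  proof
   fix x assume x: "x\<in>X"
   have "arsum (m x)\<in>gen Y0"
   proof (rule submodule_finsum[OF gen_submodule[OF Y0(2)]])
    fix s assume "s\<in>arcs Q"
    hence "(s, m x s)\<in>Y0" using x by (auto simp: Y0_def)
    from el_gen[OF Y0(2,1) this] show "ar s\<odot>m x s\<in>gen Y0" by (simp add: el_def)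
   qed
   thus "x\<in>gen Y0" using m[OF x] by simp
  qed
 qed
 hence "\<exists>Y. finite Y \<and> Y \<subseteq> arcs Q \<times> car M \<and> gen Y = K" using Y0 by blast
 then obtain Y where "finite Y \<and> Y \<subseteq> arcs Q \<times> car M \<and> gen Y = K"
  and least: "!!Z. finite Z \<and> Z \<subseteq> arcs Q \<times> car M \<and> gen Z = K ==> card Y \<le> card Z"
  using ex_has_least_nat[of "\<lambda>Y. finite Y \<and> Y \<subseteq> arcs Q \<times> car M \<and> gen Y = K" _ card] by metis
 hence Y: "finite Y" "Y \<subseteq> arcs Q \<times> car M" "gen Y = K" by auto
 have "el y \<notin> gen (Y - {y})" if y: "y\<in>Y" for y
 proof
  assume el: "el y\<in>gen (Y - {y})"
  have Y': "Y - {y} \<subseteq> arcs Q \<times> car M" "finite (Y - {y})" using Y by auto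
  have "el x\<in>gen (Y - {y})" if "x\<in>Y" for x using el el_gen[OF Y', of x] that by (cases "x = y") auto
  hence "gen Y \<subseteq> gen (Y - {y})" by (rule gen_least[OF gen_submodule[OF Y'(1)]])
  moreover have "gen (Y - {y}) \<subseteq> gen Y" by (rule gen_least[OF gen_submodule[OF Y(2)]]) (use el_gen[OF Y(2,1)] in auto)
  ultimately have "gen (Y - {y}) = K" using Y(3) by simp
  hence "card Y \<le> card (Y - {y})" using least Y' by blast
  thus False using card_Diff1_less[OF Y(1) y] by simp
 qed
 thus ?thesis using Y by blast
qed

text \<open>The image of the sum is a vanishing sum over arrows in a torsionless module, so each of
  its terms vanishes.\<close>

lemma syzygy_homogeneous:
 assumes N: "left_module A N" "torsionless N" and f: "f\<in>mod_hom A M N"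
  and m: "m\<in>arcs Q \<rightarrow> car M" "arsum m\<in>hom_ker M N f" and g: "g\<in>arcs Q"
 shows "ar g\<odot>m g\<in>hom_ker M N f"
proof -
 interpret N: monomial_module Q F I d N using N(1) by (rule monomial_module)
 have fm: "(\<lambda>g. f (m g))\<in>arcs Q \<rightarrow> car N" using m(1) hom_closed[OF f] by (auto simp: Pi_iff)
 have arm: "(\<lambda>g. ar g\<odot>m g)\<in>arcs Q \<rightarrow> car M" using m by (auto simp: Pi_iff)
 have "f (arsum m) = finsum N (\<lambda>g. f (ar g\<odot>m g)) (arcs Q)"
  by (rule hom_finsum[OF left_module_axioms N(1) _ _ arm]) (auto simp: hom_closed[OF f] hom_add[OF f])
 also have "\<dots> = finsum N (\<lambda>g. ar g\<odot>\<^sub>N f (m g)) (arcs Q)" by (rule N.M.finsum_cong') (use m fm hom_smult[OF f] in \<open>auto simp: Pi_iff\<close>)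
 finally have "ar g\<odot>\<^sub>N f (m g) = \<zero>\<^sub>N" using N.arrow_sum_zero[OF N(2) fm _ g] m(2) by (simp add: hom_ker_def)
 thus ?thesis using m(1) g hom_smult[OF f, of "ar g" "m g"] by (auto simp: hom_ker_def Pi_iff)
qed

end

section \<open>Presentations by quadratic monomial relations\<close>

lemma path_elt_self [simp]: "path_elt p p = 1" "q \<noteq> p ==> path_elt p q = 0" by (auto simp: path_elt_def)

context fin_digraph
begin

lemma path_elt_scaled_in: "p\<in>paths G ==> (\<lambda>q. c * path_elt p q)\<in>car (path_alg G)"
proof -
 assume p: "p\<in>paths G"
 have "{q. c * path_elt p q \<noteq> 0} \<subseteq> {p}" by (auto simp: path_elt_def)
 hence "finite {q. c * path_elt p q \<noteq> 0}" by (rule finite_subset) simp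
 thus ?thesis using p by (auto simp: path_alg_carrier path_elt_def)
qed

lemma path_elt_split:
 fixes c :: "'k::field"
 assumes p: "p\<in>paths G" and i: "i \<le> length (snd p)"
 shows "(\<lambda>q. c * path_elt p q) = mult (path_alg G) (\<lambda>q. c * path_elt (path_hi G p i) q) (path_elt (path_lo p i))"
proof
 fix r
 show "c * path_elt p r = mult (path_alg G) (\<lambda>q. c * path_elt (path_hi G p i) q) (path_elt (path_lo p i)) r"
 proof (cases "r\<in>paths G")
  case True
  have eq: "j = i \<and> r = p" if j: "j \<le> length (snd r)" "path_hi G r j = path_hi G p i" "path_lo r j = path_lo p i" for j
  proof -
   have "length (snd (path_lo r j)) = length (snd (path_lo p i))" using j(3) by simp
   hence ji: "j = i" using i j(1) by (simp add: path_lo_def)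
   have "take i (snd r) = take i (snd p)" "drop i (snd r) = drop i (snd p)" "fst r = fst p"
    using j unfolding ji by (simp_all add: path_lo_def path_hi_def)
   hence "snd r = snd p" by (metis append_take_drop_id)
   thus ?thesis using ji \<open>fst r = fst p\<close> by (simp add: prod_eq_iff)
  qed
  have "(\<Sum>j\<le>length (snd r). c * path_elt (path_hi G p i) (path_hi G r j) * path_elt (path_lo p i) (path_lo r j)) =
    (\<Sum>j\<le>length (snd r). if j = i then (if r = p then c else 0) else 0)" using eq by (intro sum.cong) (auto simp: path_elt_def)
  also have "\<dots> = c * path_elt p r" using i by (auto simp: path_elt_def)
  finally show ?thesis unfolding path_alg_mult[OF True] by simp
 next
  case False
  hence "r \<noteq> p" using p by auto
  thus ?thesis using False by (simp add: path_alg_mult_outside)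
 qed
qed

lemma path_elt_prod:
 assumes "p\<in>paths G" "i \<le> length (snd p)"
 shows "path_elt p = mult (path_alg G) (path_elt (path_hi G p i)) (path_elt (path_lo p i))" using path_elt_split[OF assms, of 1] by simp

text \<open>An element is a finite sum of multiples of paths. Multiplication by a scalar is obtained
  inside the ring, as multiplication by a multiple of the trivial path at the target.\<close>

lemma ideal_supported:
 fixes J :: "('a \<times> 'b list => 'k::field) set"
 assumes J: "ideal J (path_alg G)" and f: "f\<in>car (path_alg G)"
  and sup: "!!p. p\<in>paths G ==> f p \<noteq> 0 ==> path_elt p\<in>J"
 shows "f\<in>J"
proof -
 interpret J: ideal J "path_alg G" by (rule J)
 have scaled: "(\<lambda>q. c * path_elt p q)\<in>J" if p: "p\<in>paths G" "path_elt p\<in>J" for c p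
 proof -
  have "(path_target G p, [])\<in>paths G" using path_target_verts[OF p(1)] by simp
  from J.I_l_closed[OF p(2) path_elt_scaled_in[OF this, of c]]
  show ?thesis using path_elt_split[OF p(1) order_refl, of c] by simp
 qed
 have "h\<in>J" if "finite T" "h\<in>car (path_alg G)" "{p. h p \<noteq> 0} \<subseteq> T" "{p. h p \<noteq> 0} \<subseteq> {p. f p \<noteq> 0}" for T h using that
 proof (induction T arbitrary: h)
  case empty
  hence "h = \<zero>\<^sub>(path_alg G)" by auto
  thus ?case using additive_subgroup.zero_closed[OF J.is_additive_subgroup] by simp
 next
  case (insert p T)
  show ?case
  proof (cases "h p = 0")
   case True
   thus ?thesis using insert by blast
  next
   case False
   hence p: "p\<in>paths G" "path_elt p\<in>J" using insert.prems sup[of p] unfolding path_alg_carrier by blast+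
   let ?h = "\<lambda>q. if q = p then 0 else h q"
   have sub: "{q. ?h q \<noteq> 0} \<subseteq> {q. h q \<noteq> 0}" by auto
   hence "?h\<in>car (path_alg G)" using insert.prems(1) finite_subset[OF sub] unfolding path_alg_carrier by auto
   hence "?h\<in>J" by (rule insert.IH) (use insert.prems in auto)
   from additive_subgroup.a_closed[OF J.is_additive_subgroup this scaled[OF p, of "h p"]]
   have "?h \<oplus>\<^sub>(path_alg G) (\<lambda>q. h p * path_elt p q)\<in>J" .
   moreover have "?h \<oplus>\<^sub>(path_alg G) (\<lambda>q. h p * path_elt p q) = h" by (auto simp: path_elt_def)
   ultimately show ?thesis by simp
  qed
 qed
 thus ?thesis using f unfolding path_alg_carrier by blast
qed

lemma length_two_path: "x\<in>paths G ==> length (snd x) = 2 ==> \<exists>a b. x = (tail G a, [a, b])" by (cases x) (auto simp: length_Suc_conv numeral_2_eq_2)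

lemma good_path_not_elt:
 assumes X: "X \<subseteq> {p\<in>paths G. length (snd p) = 2}" and x: "x\<in>X" and p: "good_path G X p"
 shows "p \<noteq> x"
proof
 assume "p = x"
 moreover obtain a b where "x = (tail G a, [a, b])" using length_two_path x X by blast
 ultimately show False using p x by (simp add: good_path_def)
qed

text \<open>A path that is not good has two consecutive arrows forming an element of
  \<open>X\<close>, so it is a product with that element as a factor.\<close>

lemma monomial_ideal_generated:
 assumes X: "X \<subseteq> {p\<in>paths G. length (snd p) = 2}"
 shows "Idl\<^bsub>path_alg G\<^esub> (path_elt ` X) = (monomial_ideal G X :: ('a \<times> 'b list => 'k::field) set)"
proof
 interpret kQ: ring "path_alg G :: ('a \<times> 'b list => 'k) ring" by (rule path_alg_ring)
 let ?J = "Idl\<^bsub>path_alg G\<^esub> (path_elt ` X) :: ('a \<times> 'b list => 'k) set"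
 have sub: "path_elt ` X \<subseteq> car (path_alg G)" using X path_elt_in by blast
 show "?J \<subseteq> monomial_ideal G X"
 proof (rule kQ.genideal_minimal[OF monomial_ideal_ideal])
  show "path_elt ` X \<subseteq> monomial_ideal G X" using sub good_path_not_elt[OF X] unfolding monomial_ideal_def by (auto simp: path_elt_def)
 qed
 have J: "ideal ?J (path_alg G)" by (rule kQ.genideal_ideal[OF sub])
 interpret J: ideal ?J "path_alg G" by (rule J)
 show "monomial_ideal G X \<subseteq> ?J"
 proof
  fix f :: "'a \<times> 'b list => 'k" assume f: "f\<in>monomial_ideal G X"
  show "f\<in>?J"
  proof (rule ideal_supported[OF J])
   show "f\<in>car (path_alg G)" using f by (simp add: monomial_ideal_def)
   fix p assume p: "p\<in>paths G" "f p \<noteq> 0"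
   hence "\<not> successively (\<lambda>a b. (tail G a, [a, b]) \<notin> X) (snd p)" using f unfolding monomial_ideal_def good_path_def by blast
   then obtain i where i: "Suc i < length (snd p)" and x: "(tail G (snd p ! i), [snd p ! i, snd p ! Suc i])\<in>X"
    unfolding successively_conv_nth by blast
   \<comment> \<open>The initial part of \<open>p\<close> up to and including the forbidden pair;
     cutting it at \<open>i\<close> isolates the pair as the left factor.\<close>
   let ?q = "path_lo p (i + 2)"
   have lq: "length (snd ?q) = i + 2" using i by (simp add: path_lo_def)
   have q: "?q\<in>paths G" using path_lo_in[OF p(1)] .
   have dr: "drop i (snd ?q) = [snd p ! i, snd p ! Suc i]" using i by (intro nth_equalityI) (auto simp: path_lo_def less_2_cases_iff)
   have "path_hi G ?q i\<in>paths G" using path_hi_in[OF q] .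
   hence hi: "path_hi G ?q i = (tail G (snd p ! i), [snd p ! i, snd p ! Suc i])" unfolding path_hi_def dr by simp
   have elt: "(path_elt r :: 'a \<times> 'b list => 'k) = mult (path_alg G) (path_elt (path_hi G r j)) (path_elt (path_lo r j))"
    if "r\<in>paths G" "j \<le> length (snd r)" for r j using that by (rule path_elt_prod)
   have "path_elt ?q\<in>?J" using elt[OF q, of i] lq J.I_r_closed[OF _ path_elt_in[OF path_lo_in[OF q, of i]]]
     kQ.genideal_self[OF sub] x unfolding hi by auto
   thus "path_elt p\<in>?J" using elt[OF p(1), of "i + 2"] i J.I_l_closed[OF _ path_elt_in[OF path_hi_in[OF p(1), of "i + 2"]]] by auto
  qed
 qed
qed

section \<open>Powers of the arrow ideal and the relation quiver\<close>

lemma arrow_ideal_ideal: "ideal (arrow_ideal G :: ('a \<times> 'b list => 'k::field) set) (path_alg G)"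
proof -
 interpret kQ: ring "path_alg G :: ('a \<times> 'b list => 'k) ring" by (rule path_alg_ring)
 show ?thesis unfolding arrow_ideal_def by (rule kQ.genideal_ideal) (auto intro!: path_elt_in)
qed

lemma ideal_power_ideal: "ideal (ideal_power (path_alg G) (arrow_ideal G :: ('a \<times> 'b list => 'k::field) set) n) (path_alg G)"
proof -
 interpret kQ: ring "path_alg G :: ('a \<times> 'b list => 'k) ring" by (rule path_alg_ring)
 show ?thesis by (induction n) (auto intro: kQ.oneideal kQ.ideal_prod_is_ideal arrow_ideal_ideal)
qed

lemma path_elt_ideal_power:
 "p\<in>paths G ==> n \<le> length (snd p) ==>
  path_elt p\<in>ideal_power (path_alg G) (arrow_ideal G :: ('a \<times> 'b list => 'k::field) set) n"
proof (induction n arbitrary: p)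
 case 0
 thus ?case using path_elt_in by simp
next
 case (Suc n)
 interpret kQ: ring "path_alg G :: ('a \<times> 'b list => 'k) ring" by (rule path_alg_ring)
 have "(\<lambda>i. path_elt (tail G i, [i])) ` arcs G \<subseteq> car (path_alg G :: ('a \<times> 'b list => 'k) ring)" by (auto intro!: path_elt_in)
 note self = kQ.genideal_self[OF this, folded arrow_ideal_def]
 obtain u a as where p: "p = (u, a # as)" using Suc.prems(2) by (cases p; cases "snd p") auto
 have "path_lo p 1 = (tail G a, [a])" "a\<in>arcs G" using Suc.prems(1) by (auto simp: p path_lo_def)
 hence lo: "path_elt (path_lo p 1)\<in>(arrow_ideal G :: ('a \<times> 'b list => 'k) set)" using self by auto
 have "path_elt (path_hi G p 1)\<in>ideal_power (path_alg G) (arrow_ideal G :: ('a \<times> 'b list => 'k) set) n"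
  by (rule Suc.IH[OF path_hi_in[OF Suc.prems(1)]]) (use Suc.prems(2) in \<open>auto simp: p path_hi_def\<close>)
 from ideal_prod.prod[OF this lo, of "path_alg G"]
 moreover have "(path_elt p :: 'a \<times> 'b list => 'k) = mult (path_alg G) (path_elt (path_hi G p 1)) (path_elt (path_lo p 1))"
  using Suc.prems by (intro path_elt_prod) auto
 ultimately show ?case by simp
qed

text \<open>Elements of the ideal vanish at good paths, so a path of length two in the ideal already
  belongs to \<open>X\<close>; thus \<open>relations\<close> recovers the chosen generators. The
  power of the arrow ideal inside \<open>I\<close> bounds the lengths of good paths.\<close>

lemma quadratic_monomial_algebra:
 assumes I: "quadratic_monomial G I"
 shows "\<exists>d. monomial_algebra G (relations G I) I d"
proof -
 obtain X d where X: "X \<subseteq> {p\<in>paths G. length (snd p) = 2}" and IX: "I = Idl\<^bsub>path_alg G\<^esub> (path_elt ` X)"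
  and Jd: "ideal_power (path_alg G) (arrow_ideal G) d \<subseteq> I" using I unfolding quadratic_monomial_def by blast
 have I: "I = monomial_ideal G X" using monomial_ideal_generated[OF X] IX by simp
 have vanish: "\<not> good_path G X p" if "path_elt p\<in>I" for p
 proof
  assume "good_path G X p"
  hence "path_elt p p = (0::'c)" using that unfolding I monomial_ideal_def by blast
  thus False by simp
 qed
 have "relations G I = X"
 proof
  have "X \<subseteq> {p. path_elt p\<in>I}"
  proof
   fix x assume x: "x\<in>X"
   have "path_elt x\<in>I" unfolding I monomial_ideal_def using good_path_not_elt[OF X x] x X by (auto intro!: path_elt_in path_elt_self(2))
   thus "x\<in>{p. path_elt p\<in>I}" by simp
  qed
  thus "X \<subseteq> relations G I" using X unfolding relations_def by blast
  show "relations G I \<subseteq> X"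
  proof
   fix p assume p: "p\<in>relations G I"
   then obtain a b where ab: "p = (tail G a, [a, b])" using length_two_path unfolding relations_def by blast
   have "\<not> good_path G X p" using vanish p by (simp add: relations_def)
   thus "p\<in>X" using p by (auto simp: good_path_def relations_def ab)
  qed
 qed
 moreover have "length (snd p) < d" if p: "good_path G X p" for p
 proof (rule ccontr)
  assume "\<not> length (snd p) < d"
  hence "path_elt p\<in>I" using path_elt_ideal_power[OF good_path_paths[OF p], of d] Jd by auto
  thus False using vanish p by blast
 qed
 ultimately have "monomial_algebra G (relations G I) I d" using I by unfold_locales auto
 thus ?thesis by blast
qed

lemma good_path_short: "good_path G {p\<in>paths G. length (snd p) = 2} p \<longleftrightarrow> p\<in>paths G \<and> length (snd p) < 2"
proof -
 obtain u as where p: "p = (u, as)" by (cases p)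
 show ?thesis
 proof (cases as)
  case (Cons a bs)
  thus ?thesis by (cases bs) (auto simp: p good_path_def)
 qed (auto simp: p good_path_def)
qed

text \<open>Elements of the arrow ideal vanish at trivial paths, and any cut of a path with fewer
  than two arrows leaves a trivial factor. In the other direction, each path with at least two
  arrows lies in the square.\<close>

lemma arrow_ideal_sq_monomial:
 "(arrow_ideal_sq G :: ('a \<times> 'b list => 'k::field) set) = monomial_ideal G {p\<in>paths G. length (snd p) = 2}"
proof
 let ?kQ = "path_alg G :: ('a \<times> 'b list => 'k) ring" and ?J = "arrow_ideal G :: ('a \<times> 'b list => 'k) set"
 interpret kQ: ring ?kQ by (rule path_alg_ring)
 let ?V = "{f\<in>car ?kQ. \<forall>p. p\<in>paths G \<and> snd p = [] \<longrightarrow> f p = 0}"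
 have V: "ideal ?V ?kQ" by (rule vanishing_ideal) (auto simp: path_lo_in path_hi_in, auto simp: path_lo_def path_hi_def)
 have JV: "?J \<subseteq> ?V" unfolding arrow_ideal_def by (rule kQ.genideal_minimal[OF V]) (auto intro!: path_elt_in path_elt_self(2))
 have Jc: "?J \<subseteq> car ?kQ" using JV by auto
 let ?M = "monomial_ideal G {p\<in>paths G. length (snd p) = 2} :: ('a \<times> 'b list => 'k) set"
 have M: "ideal ?M ?kQ" by (rule monomial_ideal_ideal)
 have "x\<in>?M" if "x\<in>ideal_prod ?kQ (ideal_prod ?kQ (car ?kQ) ?J) ?J" for x using that
 proof (induction rule: ideal_prod.induct)
  case (prod f g)
  have f: "f\<in>?V" using prod(1) kQ.ideal_prod_inter[OF kQ.oneideal arrow_ideal_ideal] JV by blast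
  have g: "g\<in>?V" using prod(2) JV by blast
  have "(f\<otimes>\<^sub>?kQ g) p = 0" if p: "p\<in>paths G" "length (snd p) < 2" for p
  proof -
   have "f (path_hi G p i) * g (path_lo p i) = 0" if i: "i \<le> length (snd p)" for i
   proof (cases "i = 0")
    case True
    hence "g (path_lo p i) = 0" using g path_lo_in[OF p(1), of i] by (auto simp: path_lo_def)
    thus ?thesis by simp
   next
    case False
    hence "i = length (snd p)" using i p(2) by simp
    hence "f (path_hi G p i) = 0" using f path_hi_in[OF p(1), of i] by (auto simp: path_hi_def)
    thus ?thesis by simp
   qed
   thus ?thesis unfolding path_alg_mult[OF p(1)] by (intro sum.neutral) auto
  qed
  thus ?case using f g path_alg_mult_closed by (auto simp: monomial_ideal_def good_path_short)
 next
  case (sum x y)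
  thus ?case using additive_subgroup.a_closed[OF ideal.axioms(1)[OF M]] by blast
 qed
 thus "arrow_ideal_sq G \<subseteq> ?M" by (auto simp: arrow_ideal_sq_def numeral_2_eq_2)
 show "?M \<subseteq> arrow_ideal_sq G"
 proof
  fix f assume f: "f\<in>?M"
  show "f\<in>arrow_ideal_sq G" unfolding arrow_ideal_sq_def
  proof (rule ideal_supported[OF ideal_power_ideal])
   show "f\<in>car ?kQ" using f by (simp add: monomial_ideal_def)
   fix p assume p: "p\<in>paths G" "f p \<noteq> 0"
   hence "\<not> length (snd p) < 2" using f unfolding monomial_ideal_def good_path_short by blast
   hence "2 \<le> length (snd p)" by simp
   thus "path_elt p\<in>ideal_power ?kQ ?J 2" using path_elt_ideal_power[OF p(1)] by blast
  qed
 qed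
qed

lemma rad_square_zero_algebra:
 "monomial_algebra G {p\<in>paths G. length (snd p) = 2} (arrow_ideal_sq G :: ('a \<times> 'b list => 'k::field) set) 2"
 by unfold_locales (auto simp: arrow_ideal_sq_monomial good_path_short)

lemma relation_arrow: "r\<in>relations G I ==> \<exists>a b. r = (tail G a, [a, b]) \<and> a\<in>arcs G \<and> b\<in>arcs G \<and> tail G b = head G a"
 using length_two_path[of r] by (auto simp: relations_def)

lemma relation_quiver_fin: "fin_digraph (relation_quiver G I)"
proof
 show "finite (arcs (relation_quiver G I))"
 proof (rule finite_subset)
  show "arcs (relation_quiver G I) \<subseteq> (\<lambda>(a, b). (tail G a, [a, b])) ` (arcs G \<times> arcs G)"
   using relation_arrow by (fastforce simp: relation_quiver_def)
 qed simp
qed (use relation_arrow in \<open>fastforce simp: relation_quiver_def\<close>)+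

end

section \<open>Additive functors commuting with the loop functors\<close>

context preadditive
begin

text \<open>Categorical counterpart of \<open>simple_sums\<close>; an additive functor can be
  applied to such an arrow summand by summand.\<close>

inductive_set sums_through for T X Y where
 zero: "Zero X Y\<in>sums_through T X Y"
| add: "[|f\<in>sums_through T X Y; W\<in>T; arr p; src p = X; tgt p = W; arr v; src v = W; tgt v = Y|] ==>
  f \<boxplus> v\<cdot>p\<in>sums_through T X Y"

lemma sums_through_arr: "u\<in>sums_through T X Y ==> X\<in>Obj C ==> Y\<in>Obj C ==> arr u \<and> src u = X \<and> tgt u = Y" by (induction rule: sums_through.induct) auto

definition biprod where
 "biprod M N T u v p q \<longleftrightarrow> arr u \<and> arr v \<and> arr p \<and> arr q \<and> src u = M \<and> src v = N \<and> src p = T \<and> src q = T \<and>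
   tgt u = T \<and> tgt v = T \<and> tgt p = M \<and> tgt q = N \<and> p\<cdot>u = ide M \<and> q\<cdot>v = ide N \<and>
   p\<cdot>v = Zero N M \<and> q\<cdot>u = Zero M N \<and> u\<cdot>p \<boxplus> v\<cdot>q = ide T"

lemma biprod_comparison:
 assumes b: "biprod M N T u v p q" and b': "biprod M' N' T' u' v' p' q'"
  and a: "arr a" "src a = M" "tgt a = M'" "arr a'" "src a' = M'" "tgt a' = M" "a'\<cdot>a = ide M"
  and c: "arr c" "src c = N" "tgt c = N'" "arr c'" "src c' = N'" "tgt c' = N" "c'\<cdot>c = ide N"
 shows "(u\<cdot>(a'\<cdot>p') \<boxplus> v\<cdot>(c'\<cdot>q'))\<cdot>(u'\<cdot>(a\<cdot>p) \<boxplus> v'\<cdot>(c\<cdot>q)) = ide T"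
proof -
 note [simp] = a(1-6) c(1-6)
 have [simp]: "arr u" "arr v" "arr p" "arr q" "src u = M" "src v = N" "src p = T" "src q = T"
   "tgt u = T" "tgt v = T" "tgt p = M" "tgt q = N"
  and [simp]: "arr u'" "arr v'" "arr p'" "arr q'" "src u' = M'" "src v' = N'" "src p' = T'" "src q' = T'"
   "tgt u' = T'" "tgt v' = T'" "tgt p' = M'" "tgt q' = N'"
  and id: "u\<cdot>p \<boxplus> v\<cdot>q = ide T" and r': "p'\<cdot>u' = ide M'" "q'\<cdot>v' = ide N'"
   "p'\<cdot>v' = Zero N' M'" "q'\<cdot>u' = Zero M' N'" using b b' by (auto simp: biprod_def)
 have [simp]: "M\<in>Obj C" "N\<in>Obj C" "M'\<in>Obj C" "N'\<in>Obj C" "T\<in>Obj C" "T'\<in>Obj C"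
  using src_tgt_Obj[of a] src_tgt_Obj[of c] src_tgt_Obj[of p] src_tgt_Obj[of p'] by auto
 define w where "w = u'\<cdot>(a\<cdot>p) \<boxplus> v'\<cdot>(c\<cdot>q)"
 have w [simp]: "arr w" "src w = T" "tgt w = T'" by (auto simp: w_def)
 have "p'\<cdot>w = (p'\<cdot>u')\<cdot>(a\<cdot>p) \<boxplus> (p'\<cdot>v')\<cdot>(c\<cdot>q)" by (simp add: w_def comp_plus comp_assoc)
 hence 1: "p'\<cdot>w = a\<cdot>p" by (simp add: r')
 have "q'\<cdot>w = (q'\<cdot>u')\<cdot>(a\<cdot>p) \<boxplus> (q'\<cdot>v')\<cdot>(c\<cdot>q)" by (simp add: w_def comp_plus comp_assoc)
 hence 2: "q'\<cdot>w = c\<cdot>q" by (simp add: r')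
 have "(u\<cdot>(a'\<cdot>p') \<boxplus> v\<cdot>(c'\<cdot>q'))\<cdot>w = u\<cdot>(a'\<cdot>(p'\<cdot>w)) \<boxplus> v\<cdot>(c'\<cdot>(q'\<cdot>w))" by (simp add: plus_comp comp_assoc)
 also have "\<dots> = u\<cdot>((a'\<cdot>a)\<cdot>p) \<boxplus> v\<cdot>((c'\<cdot>c)\<cdot>q)" by (simp add: 1 2 comp_assoc)
 also have "\<dots> = ide T" by (simp add: a(7) c(7) id)
 finally show ?thesis by (simp add: w_def)
qed

lemma biprod_iso:
 assumes b: "biprod M N T u v p q" and b': "biprod M' N' T' u' v' p' q'"
  and a: "iso a a'" "src a = M" "tgt a = M'" and c: "iso c c'" "src c = N" "tgt c = N'"
 shows "\<exists>w w'. iso w w' \<and> src w = T \<and> tgt w = T'"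
proof -
 have i: "arr a" "arr a'" "src a' = M'" "tgt a' = M" "a'\<cdot>a = ide M" "a\<cdot>a' = ide M'"
  "arr c" "arr c'" "src c' = N'" "tgt c' = N" "c'\<cdot>c = ide N" "c\<cdot>c' = ide N'" using a c by (auto simp: iso_def)
 let ?w = "u'\<cdot>(a\<cdot>p) \<boxplus> v'\<cdot>(c\<cdot>q)" and ?w' = "u\<cdot>(a'\<cdot>p') \<boxplus> v\<cdot>(c'\<cdot>q')"
 have "?w'\<cdot>?w = ide T" by (rule biprod_comparison[OF b b']) (use a c i in auto)
 moreover have "?w\<cdot>?w' = ide T'" by (rule biprod_comparison[OF b' b]) (use a c i in auto)
 moreover have "arr ?w \<and> src ?w = T \<and> tgt ?w = T'" "arr ?w' \<and> src ?w' = T' \<and> tgt ?w' = T" using b b' a(2,3) c(2,3) i by (auto simp: biprod_def)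
 ultimately show ?thesis by (intro exI[of _ ?w] exI[of _ ?w']) (simp add: iso_def)
qed

end

lemma full_subcat_simps [simp]:
 "Obj (full_subcat C X) = Obj C \<inter> X" "Arr (full_subcat C X) = Arr C" "Comp (full_subcat C X) = Comp C"
 "Ident (full_subcat C X) = Ident C" "Plus (full_subcat C X) = Plus C" "Scale (full_subcat C X) = Scale C"
 "LoopO (full_subcat C X) = LoopO C" "LoopA (full_subcat C X) = LoopA C" by (simp_all add: full_subcat_def)

lemma (in looped_preadditive) full_subcat_looped_preadditive:
 assumes "!!Y. Y\<in>Obj C ==> Y\<in>X ==> LoopO C Y\<in>X"
 shows "looped_preadditive (full_subcat C X) Zero"
proof
 show "is_category (full_subcat C X)" using cat unfolding is_category_def full_subcat_simps by (elim conjE, intro conjI; blast)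
 show "is_functor (full_subcat C X) (full_subcat C X) (LoopO (full_subcat C X)) (LoopA (full_subcat C X))"
  using loop assms unfolding is_functor_def full_subcat_simps by (elim conjE, intro conjI; blast)
 show "additive_on_arrows (full_subcat C X) (full_subcat C X) (LoopA (full_subcat C X))"
  using loop_add unfolding additive_on_arrows_def full_subcat_simps by blast
 show "\<exists>g\<in>Arr (full_subcat C X) Y Z. Plus (full_subcat C X) f g = Zero Y Z"
  if "Y\<in>Obj (full_subcat C X)" "Z\<in>Obj (full_subcat C X)" "f\<in>Arr (full_subcat C X) Y Z" for Y Z f using that neg_in[of Y Z f] by simp
qed (auto simp: arr_ends plus_in plus_assoc_in plus_zero_in zero_in comp_plus_in plus_comp_in intro: plus_comm_in)

locale additive_looped_functor = C: looped_preadditive C ZC + D: looped_preadditive D ZD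
 for C :: "('o, 'o \<times> 'c \<times> 'o, 'k) left_tri_cat" and ZC
  and D :: "('p, 'p \<times> 'b \<times> 'p, 'k) left_tri_cat" and ZD +
 fixes F0 :: "'o => 'p" and F1 :: "'o \<times> 'c \<times> 'o => 'p \<times> 'b \<times> 'p" and \<delta> :: "'o => 'p \<times> 'b \<times> 'p"
 assumes F_functor: "is_functor C D F0 F1" and F_additive: "additive_on_arrows C D F1"
  and F_natural: "loop_natural_iso C D F0 F1 \<delta>"
begin

lemma F_Obj [simp]: "X\<in>Obj C ==> F0 X\<in>Obj D"
 and F_ide [simp]: "X\<in>Obj C ==> F1 (Ident C X) = Ident D (F0 X)" using F_functor by (auto simp: is_functor_def)

lemma F_arr [simp]:
 assumes "C.arr f"
 shows "D.arr (F1 f)" "fst (F1 f) = F0 (fst f)" "snd (snd (F1 f)) = F0 (snd (snd f))"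
proof -
 have "F1 f\<in>Arr D (F0 (fst f)) (F0 (snd (snd f)))" using F_functor C.arrD[OF assms] unfolding is_functor_def by blast
 from D.arrI[OF this] assms show "D.arr (F1 f)" "fst (F1 f) = F0 (fst f)" "snd (snd (F1 f)) = F0 (snd (snd f))" by auto
qed

lemma F_comp: "C.arr f ==> C.arr g ==> snd (snd f) = fst g ==> F1 (Comp C g f) = Comp D (F1 g) (F1 f)"
 using F_functor C.arrD[of f] C.arrD[of g] unfolding is_functor_def by metis

lemma F_plus: "C.arr f ==> C.arr g ==> fst f = fst g ==> snd (snd f) = snd (snd g) ==> F1 (Plus C f g) = Plus D (F1 f) (F1 g)"
 using F_additive C.arrD[of f] C.arrD[of g] unfolding additive_on_arrows_def by metis

lemma F_zero [simp]: "X\<in>Obj C ==> Y\<in>Obj C ==> F1 (ZC X Y) = ZD (F0 X) (F0 Y)"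
 using F_plus[of "ZC X Y" "ZC X Y"] D.idem_plus_zero[of "F1 (ZC X Y)"] by simp

lemma F_biprod: "C.biprod M N T u v p q ==> D.biprod (F0 M) (F0 N) (F0 T) (F1 u) (F1 v) (F1 p) (F1 q)"
proof -
 assume b: "C.biprod M N T u v p q"
 hence [simp]: "C.arr u" "C.arr v" "C.arr p" "C.arr q" "fst u = M" "fst v = N" "fst p = T" "fst q = T"
   "snd (snd u) = T" "snd (snd v) = T" "snd (snd p) = M" "snd (snd q) = N"
  and r: "Comp C p u = Ident C M" "Comp C q v = Ident C N"
   "Comp C p v = ZC N M" "Comp C q u = ZC M N" "Plus C (Comp C u p) (Comp C v q) = Ident C T" by (auto simp: C.biprod_def)
 have [simp]: "M\<in>Obj C" "N\<in>Obj C" "T\<in>Obj C" using C.src_tgt_Obj[of u] C.src_tgt_Obj[of v] by auto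
 show ?thesis unfolding D.biprod_def using r[THEN arg_cong[of _ _ F1]] by (simp add: F_comp F_plus)
qed

definition \<delta>i where "\<delta>i X = inverse_of D (F0 (LoopO C X)) (LoopO D (F0 X)) (\<delta> X)"

lemma \<delta>:
 assumes "X\<in>Obj C"
 shows \<delta>_iso: "D.iso (\<delta> X) (\<delta>i X)" and \<delta>_ends [simp]: "fst (\<delta> X) = F0 (LoopO C X)" "snd (snd (\<delta> X)) = LoopO D (F0 X)"
proof -
 have "is_iso D (F0 (LoopO C X)) (LoopO D (F0 X)) (\<delta> X)" using F_natural assms by (auto simp: loop_natural_iso_def)
 then obtain g where g: "D.iso (\<delta> X) g" and e: "fst (\<delta> X) = F0 (LoopO C X)" "snd (snd (\<delta> X)) = LoopO D (F0 X)"
  using D.is_iso_iff[of "F0 (LoopO C X)" "LoopO D (F0 X)"] assms by auto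
 show "fst (\<delta> X) = F0 (LoopO C X)" "snd (snd (\<delta> X)) = LoopO D (F0 X)" by fact+
 show "D.iso (\<delta> X) (\<delta>i X)" using D.inverse_of_eq[OF g e] g by (simp add: \<delta>i_def)
qed

lemma \<delta>_arr [simp]:
 assumes "X\<in>Obj C"
 shows "D.arr (\<delta> X)" "D.arr (\<delta>i X)" "fst (\<delta>i X) = LoopO D (F0 X)" "snd (snd (\<delta>i X)) = F0 (LoopO C X)"
  "Comp D (\<delta>i X) (\<delta> X) = Ident D (F0 (LoopO C X))" "Comp D (\<delta> X) (\<delta>i X) = Ident D (LoopO D (F0 X))"
 using \<delta>_iso[OF assms] assms by (auto simp: D.iso_def)

lemma \<delta>_cancel:
 assumes "X\<in>Obj C" "D.arr h"
 shows "snd (snd h) = F0 (LoopO C X) ==> Comp D (\<delta>i X) (Comp D (\<delta> X) h) = h"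
  "snd (snd h) = LoopO D (F0 X) ==> Comp D (\<delta> X) (Comp D (\<delta>i X) h) = h"
 using D.iso_cancel_left[OF \<delta>_iso[OF assms(1)] assms(2)] D.iso_cancel_left[OF D.iso_sym[OF \<delta>_iso[OF assms(1)]] assms(2)] assms by auto

lemma \<delta>_natural: "C.arr f ==> Comp D (\<delta> (snd (snd f))) (F1 (LoopA C f)) = Comp D (LoopA D (F1 f)) (\<delta> (fst f))"
 using F_natural C.arrD[of f] unfolding loop_natural_iso_def by blast

lemma \<delta>i_natural:
 assumes f: "C.arr f"
 shows "Comp D (\<delta>i (snd (snd f))) (LoopA D (F1 f)) = Comp D (F1 (LoopA C f)) (\<delta>i (fst f))"
proof -
 have "Comp D (\<delta>i (snd (snd f))) (LoopA D (F1 f)) =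
   Comp D (\<delta>i (snd (snd f))) (Comp D (Comp D (LoopA D (F1 f)) (\<delta> (fst f))) (\<delta>i (fst f)))" using f by (simp add: D.comp_assoc)
 also have "\<dots> = Comp D (F1 (LoopA C f)) (\<delta>i (fst f))" unfolding \<delta>_natural[OF f, symmetric] using f by (simp add: D.comp_assoc \<delta>_cancel)
 finally show ?thesis .
qed

text \<open>A splitting consists of equations, which additivity carries over. The two maps at the
  loop object are corrected by \<open>\<delta>\<close> and its inverse, and naturality turns the
  image of a loop into the loop of an image.\<close>

lemma splitting_image:
 assumes sp: "C.splitting h f g r s t"
 shows "D.splitting (Comp D (F1 h) (\<delta>i (snd (snd g)))) (F1 f) (F1 g) (F1 r) (F1 s) (Comp D (\<delta> (snd (snd g))) (F1 t))"
proof -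
 define Z where "Z = snd (snd g)"
 have [simp]: "C.arr h" "C.arr f" "C.arr g" "C.arr r" "C.arr s" "C.arr t" "fst h = LoopO C Z" "snd (snd h) = fst f"
  "snd (snd f) = fst g" "snd (snd g) = Z" "fst r = fst g" "snd (snd r) = fst f" "fst s = Z" "snd (snd s) = fst g"
  "fst t = fst f" "snd (snd t) = LoopO C Z"
  and z: "Comp C g f = ZC (fst f) Z" "Comp C f h = ZC (LoopO C Z) (fst g)" "Comp C h (LoopA C g) = ZC (LoopO C (fst g)) (fst f)"
  and i: "Plus C (Comp C h t) (Comp C r f) = Ident C (fst f)" "Plus C (Comp C f r) (Comp C s g) = Ident C (fst g)"
  "Plus C (Comp C t h) (LoopA C (Comp C g s)) = Ident C (LoopO C Z)" using sp by (auto simp: C.splitting_def C.complex_def Z_def)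
 have [simp]: "Z\<in>Obj C" "fst f\<in>Obj C" "fst g\<in>Obj C" using C.src_tgt_Obj[of g] C.src_tgt_Obj[of f] by auto
 note F = arg_cong[of _ _ F1]
 have 1: "Comp D (F1 g) (F1 f) = ZD (F0 (fst f)) (F0 Z)" using F[OF z(1)] by (simp add: F_comp)
 have 2: "Comp D (F1 f) (Comp D (F1 h) (\<delta>i Z)) = ZD (LoopO D (F0 Z)) (F0 (fst g))"
 proof -
  have "Comp D (F1 f) (Comp D (F1 h) (\<delta>i Z)) = Comp D (F1 (Comp C f h)) (\<delta>i Z)" by (simp add: F_comp D.comp_assoc)
  thus ?thesis by (simp add: z)
 qed
 have 3: "Comp D (Comp D (F1 h) (\<delta>i Z)) (LoopA D (F1 g)) = ZD (LoopO D (F0 (fst g))) (F0 (fst f))"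
 proof -
  have "Comp D (Comp D (F1 h) (\<delta>i Z)) (LoopA D (F1 g)) = Comp D (F1 h) (Comp D (\<delta>i Z) (LoopA D (F1 g)))" by (simp add: D.comp_assoc)
  also have "\<dots> = Comp D (F1 (Comp C h (LoopA C g))) (\<delta>i (fst g))" using \<delta>i_natural[of g] by (simp add: F_comp D.comp_assoc)
  finally show ?thesis by (simp add: z)
 qed
 have 4: "Plus D (Comp D (Comp D (F1 h) (\<delta>i Z)) (Comp D (\<delta> Z) (F1 t))) (Comp D (F1 r) (F1 f)) = Ident D (F0 (fst f))"
  using F[OF i(1)] by (simp add: F_comp F_plus D.comp_assoc \<delta>_cancel)
 have 5: "Plus D (Comp D (F1 f) (F1 r)) (Comp D (F1 s) (F1 g)) = Ident D (F0 (fst g))" using F[OF i(2)] by (simp add: F_comp F_plus)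
 have 6: "Plus D (Comp D (Comp D (\<delta> Z) (F1 t)) (Comp D (F1 h) (\<delta>i Z))) (LoopA D (Comp D (F1 g) (F1 s))) = Ident D (LoopO D (F0 Z))"
 proof -
  have "LoopA D (Comp D (F1 g) (F1 s)) = Comp D (Comp D (LoopA D (F1 (Comp C g s))) (\<delta> Z)) (\<delta>i Z)" by (simp add: F_comp D.comp_assoc)
  also have "Comp D (LoopA D (F1 (Comp C g s))) (\<delta> Z) = Comp D (\<delta> Z) (F1 (LoopA C (Comp C g s)))" using \<delta>_natural[of "Comp C g s"] by simp
  also have "Comp D \<dots> (\<delta>i Z) = Comp D (\<delta> Z) (Comp D (F1 (LoopA C (Comp C g s))) (\<delta>i Z))" by (simp add: D.comp_assoc)
  finally have "Plus D (Comp D (Comp D (\<delta> Z) (F1 t)) (Comp D (F1 h) (\<delta>i Z))) (LoopA D (Comp D (F1 g) (F1 s))) =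
    Comp D (\<delta> Z) (Comp D (F1 (Plus C (Comp C t h) (LoopA C (Comp C g s)))) (\<delta>i Z))"
   by (simp add: F_comp F_plus D.comp_assoc D.comp_plus D.plus_comp)
  thus ?thesis by (simp add: i)
 qed
 show ?thesis unfolding D.splitting_def D.complex_def by (simp add: 1 2 3 4 5 6)
qed

text \<open>By additivity it suffices to treat an arrow \<open>k\<close> with vanishing image.
  Composed with the identity of its source, written as a sum through \<open>T\<close>, it splits
  into arrows that start in \<open>T\<close> and also have vanishing image.\<close>

lemma faithful_if_on_sums:
 assumes T: "!!X. X\<in>Obj C ==> Ident C X\<in>C.sums_through T X X"
  and core: "!!k. C.arr k ==> fst k\<in>T ==> F1 k = ZD (F0 (fst k)) (F0 (snd (snd k))) ==> k = ZC (fst k) (snd (snd k))"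
  and f: "C.arr f" "C.arr f'" "fst f = fst f'" "snd (snd f) = snd (snd f')" and eq: "F1 f = F1 f'"
 shows "f = f'"
proof -
 obtain k where k: "C.arr k" "fst k = fst f'" "snd (snd k) = snd (snd f')" "f = Plus C f' k" using C.diff_ex[OF f] by blast
 note [simp] = k(1-3) f
 have [simp]: "fst f'\<in>Obj C" "snd (snd f')\<in>Obj C" using C.src_tgt_Obj[of f'] by auto
 have "Plus D (F1 k) (F1 f') = Plus D (ZD (F0 (fst f')) (F0 (snd (snd f')))) (F1 f')"
  using eq arg_cong[OF k(4), of F1] D.plus_comm[of "F1 f'" "F1 k"] by (simp add: F_plus)
 hence Fk: "F1 k = ZD (F0 (fst f')) (F0 (snd (snd f')))" by (rule D.plus_cancel[rotated -1]) auto
 have "Comp C k u = ZC (fst f') (snd (snd f'))" if "u\<in>C.sums_through T (fst f') (fst f')" for u using that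
 proof (induction rule: C.sums_through.induct)
  case (add u W p v)
  hence [simp]: "C.arr p" "C.arr v" "fst p = fst f'" "snd (snd p) = W" "fst v = W" "snd (snd v) = fst f'" by auto
  have [simp]: "C.arr u" "fst u = fst f'" "snd (snd u) = fst f'" "W\<in>Obj C" using C.sums_through_arr[OF add(1)] C.src_tgt_Obj[of v] by auto
  have "F1 (Comp C k v) = ZD (F0 W) (F0 (snd (snd f')))" by (simp add: F_comp Fk)
  hence "Comp C k v = ZC W (snd (snd f'))" using core[of "Comp C k v"] add(2) by simp
  hence "Comp C k (Comp C v p) = ZC (fst f') (snd (snd f'))" by (simp flip: C.comp_assoc)
  thus ?case using add.IH by (simp add: C.comp_plus)
 qed simp
 from this[OF T] have "k = ZC (fst f') (snd (snd f'))" by simp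
 thus ?thesis using k(4) by simp
qed

text \<open>The arrows from \<open>F0 U\<close> to the loop of \<open>F0 Y\<close> that come from
  \<open>C\<close>. For \<open>U = LoopO C X\<close> this is (S1) with exponent one, the inverse of
  \<open>\<delta>\<close> being moved to the other side.\<close>

definition lifts where
 "lifts U Y k \<longleftrightarrow> (\<exists>f. C.arr f \<and> fst f = U \<and> snd (snd f) = LoopO C Y \<and> k = Comp D (\<delta> Y) (F1 f))"

lemma lifts_zero: "U\<in>Obj C ==> Y\<in>Obj C ==> lifts U Y (ZD (F0 U) (LoopO D (F0 Y)))" unfolding lifts_def by (intro exI[of _ "ZC U (LoopO C Y)"]) simp

lemma lifts_plus: "Y\<in>Obj C ==> lifts U Y k ==> lifts U Y k' ==> lifts U Y (Plus D k k')"
proof -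
 assume [simp]: "Y\<in>Obj C" and "lifts U Y k" "lifts U Y k'"
 then obtain f f' where [simp]: "C.arr f" "fst f = U" "snd (snd f) = LoopO C Y"
   "C.arr f'" "fst f' = U" "snd (snd f') = LoopO C Y"
  and k: "k = Comp D (\<delta> Y) (F1 f)" "k' = Comp D (\<delta> Y) (F1 f')" unfolding lifts_def by blast
 show ?thesis unfolding lifts_def by (intro exI[of _ "Plus C f f'"]) (simp add: k F_plus D.comp_plus)
qed

lemma lifts_comp:
 assumes [simp]: "Y\<in>Obj C" "C.arr p" "snd (snd p) = U" and k: "lifts U Y k"
 shows "lifts (fst p) Y (Comp D k (F1 p))"
proof -
 obtain f where [simp]: "C.arr f" "fst f = U" "snd (snd f) = LoopO C Y" and k: "k = Comp D (\<delta> Y) (F1 f)" using k unfolding lifts_def by blast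
 show ?thesis unfolding lifts_def by (intro exI[of _ "Comp C f p"]) (simp add: k F_comp D.comp_assoc)
qed

lemma lifts_loop_comp:
 assumes [simp]: "C.arr v" and k: "lifts U (fst v) k"
 shows "lifts U (snd (snd v)) (Comp D (LoopA D (F1 v)) k)"
proof -
 obtain f where [simp]: "C.arr f" "fst f = U" "snd (snd f) = LoopO C (fst v)" and k: "k = Comp D (\<delta> (fst v)) (F1 f)"
  using k unfolding lifts_def by blast
 have "Comp D (LoopA D (F1 v)) k = Comp D (Comp D (LoopA D (F1 v)) (\<delta> (fst v))) (F1 f)" by (simp add: k D.comp_assoc)
 also have "\<dots> = Comp D (\<delta> (snd (snd v))) (F1 (Comp C (LoopA C v) f))" by (simp add: \<delta>_natural[symmetric] F_comp D.comp_assoc)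
 finally show ?thesis unfolding lifts_def by (intro exI[of _ "Comp C (LoopA C v) f"]) simp
qed

lemma loop_full_if_on_sums:
 assumes T: "T \<subseteq> Obj C" "!!X. X\<in>Obj C ==> Ident C X\<in>C.sums_through T X X"
  and core: "!!W W' g v. W\<in>T ==> W'\<in>T ==> D.arr g ==> fst g = F0 W ==> snd (snd g) = F0 W' ==> C.arr v ==> fst v\<in>T ==>
   snd (snd v) = LoopO C W ==> lifts (fst v) W' (Comp D (LoopA D g) (Comp D (\<delta> W) (F1 v)))"
  and X: "X\<in>Obj C" and Y: "Y\<in>Obj C" and g: "D.arr g" "fst g = F0 X" "snd (snd g) = F0 Y"
 shows "lifts (LoopO C X) Y (Comp D (LoopA D g) (\<delta> X))"
proof -
 have 1: "lifts (LoopO C W) W' (Comp D (LoopA D g) (\<delta> W))"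
  if W: "W\<in>T" "W'\<in>T" and g: "D.arr g" "fst g = F0 W" "snd (snd g) = F0 W'" for W W' g
 proof -
  have [simp]: "W\<in>Obj C" "W'\<in>Obj C" using W T(1) by auto
  note [simp] = g
  have "lifts (LoopO C W) W' (Comp D (LoopA D g) (Comp D (\<delta> W) (F1 u)))"
   if "u\<in>C.sums_through T (LoopO C W) (LoopO C W)" for u using that
  proof (induction rule: C.sums_through.induct)
   case zero
   thus ?case using lifts_zero[of "LoopO C W" W'] by simp
  next
   case (add u V p v)
   hence [simp]: "C.arr p" "C.arr v" "fst p = LoopO C W" "snd (snd p) = V" "fst v = V" "snd (snd v) = LoopO C W" by auto
   have [simp]: "C.arr u" "fst u = LoopO C W" "snd (snd u) = LoopO C W" using C.sums_through_arr[OF add(1)] by auto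
   have "lifts V W' (Comp D (LoopA D g) (Comp D (\<delta> W) (F1 v)))" using core[OF W g, of v] add(2) by simp
   from lifts_comp[of W' p V, OF _ _ _ this]
   have "lifts (LoopO C W) W' (Comp D (Comp D (LoopA D g) (Comp D (\<delta> W) (F1 v))) (F1 p))" by simp
   from lifts_plus[OF _ add.IH this] show ?case by (simp add: F_plus F_comp D.comp_plus D.comp_assoc)
  qed
  from this[OF T(2)] show ?thesis by simp
 qed
 have 2: "lifts (LoopO C W) Y (Comp D (LoopA D g) (\<delta> W))"
  if W: "W\<in>T" and g: "D.arr g" "fst g = F0 W" "snd (snd g) = F0 Y" for W g
 proof -
  have [simp]: "W\<in>Obj C" using W T(1) by auto
  note [simp] = g Y
  have "lifts (LoopO C W) Y (Comp D (LoopA D (Comp D (F1 u) g)) (\<delta> W))" if "u\<in>C.sums_through T Y Y" for u using that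
  proof (induction rule: C.sums_through.induct)
   case zero
   thus ?case using lifts_zero[of "LoopO C W" Y] by simp
  next
   case (add u V p v)
   hence [simp]: "C.arr p" "C.arr v" "fst p = Y" "snd (snd p) = V" "fst v = V" "snd (snd v) = Y" by auto
   have [simp]: "C.arr u" "fst u = Y" "snd (snd u) = Y" "V\<in>Obj C" using C.sums_through_arr[OF add(1)] C.src_tgt_Obj[of v] by auto
   have "lifts (LoopO C W) V (Comp D (LoopA D (Comp D (F1 p) g)) (\<delta> W))" using 1[OF W add(2)] by simp
   from lifts_loop_comp[of v "LoopO C W"] this
   have "lifts (LoopO C W) Y (Comp D (LoopA D (F1 v)) (Comp D (LoopA D (Comp D (F1 p) g)) (\<delta> W)))" by simp
   from lifts_plus[OF _ add.IH this] show ?case by (simp add: F_plus F_comp D.plus_comp D.comp_assoc D.LA_plus D.LA_comp)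
  qed
  from this[OF T(2)] show ?thesis by simp
 qed
 note [simp] = g X Y
 have "lifts (LoopO C X) Y (Comp D (LoopA D (Comp D g (F1 u))) (\<delta> X))" if "u\<in>C.sums_through T X X" for u using that
 proof (induction rule: C.sums_through.induct)
  case zero
  thus ?case using lifts_zero[of "LoopO C X" Y] by simp
 next
  case (add u V p v)
  hence [simp]: "C.arr p" "C.arr v" "fst p = X" "snd (snd p) = V" "fst v = V" "snd (snd v) = X" by auto
  have [simp]: "C.arr u" "fst u = X" "snd (snd u) = X" "V\<in>Obj C" using C.sums_through_arr[OF add(1)] C.src_tgt_Obj[of v] by auto
  have "lifts (LoopO C V) Y (Comp D (LoopA D (Comp D g (F1 v))) (\<delta> V))" using 2[OF add(2)] by simp
  from lifts_comp[of Y "LoopA C p" "LoopO C V", OF _ _ _ this]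
  have "lifts (LoopO C X) Y (Comp D (Comp D (LoopA D (Comp D g (F1 v))) (\<delta> V)) (F1 (LoopA C p)))" by simp
  from lifts_plus[OF _ add.IH this] show ?case
   using \<delta>_natural[of p] by (simp add: F_plus F_comp D.plus_comp D.comp_plus D.comp_assoc D.LA_plus D.LA_comp)
 qed
 from this[OF T(2)] show ?thesis by simp
qed

lemma looped_functor: "looped_functor C D F0 F1 \<delta>"
 using C.cat C.loop D.cat D.loop F_functor F_natural by (simp add: looped_functor_def looped_category_def)

lemma triangle_functor_if_splitting:
 assumes "!!X Y Z h f g. (X, Y, Z, h, f, g)\<in>Tri C ==> fst f = X \<and> snd (snd f) = Y \<and> snd (snd g) = Z \<and> (\<exists>r s t. C.splitting h f g r s t)"
  and "!!h f g r s t. D.splitting h f g r s t ==> (fst f, snd (snd f), snd (snd g), h, f, g)\<in>Tri D"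
 shows "triangle_functor C D F0 F1 \<delta>" unfolding triangle_functor_def
proof (intro conjI looped_functor F_additive allI impI)
 fix X Y Z h f g assume "(X, Y, Z, h, f, g)\<in>Tri C"
 then obtain r s t where e: "fst f = X" "snd (snd f) = Y" "snd (snd g) = Z" and sp: "C.splitting h f g r s t" using assms(1) by blast
 hence "C.arr f" "C.arr g" by (auto simp: C.splitting_def C.complex_def)
 thus "(F0 X, F0 Y, F0 Z, Comp D (F1 h) (inverse_of D (F0 (LoopO C Z)) (LoopO D (F0 Z)) (\<delta> Z)), F1 f, F1 g)\<in>Tri D"
  using assms(2)[OF splitting_image[OF sp]] e by (simp add: \<delta>i_def)
qed

text \<open>Fixed exponents serve all objects: one in (S1), where the power of
  \<open>\<delta>\<close> is \<open>\<delta>\<close> itself, and two in (S3). For (S2) the functor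
  is even faithful.\<close>

lemma pre_triangle_equivalenceI:
 assumes tri: "triangle_functor C D F0 F1 \<delta>"
  and full: "!!X Y g. X\<in>Obj C ==> Y\<in>Obj C ==> D.arr g ==> fst g = F0 X ==> snd (snd g) = F0 Y ==>
   lifts (LoopO C X) Y (Comp D (LoopA D g) (\<delta> X))"
  and faithful: "!!f f'. C.arr f ==> C.arr f' ==> fst f = fst f' ==> snd (snd f) = snd (snd f') ==> F1 f = F1 f' ==> f = f'"
  and dense: "!!W. W\<in>Obj D ==> \<exists>X u u'. X\<in>Obj C \<and> D.iso u u' \<and> fst u = LoopO D (LoopO D W) \<and> snd (snd u) = F0 X"
 shows "pre_triangle_equivalence C D F0 F1 \<delta>" unfolding pre_triangle_equivalence_def
proof (intro conjI tri ballI impI)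
 fix X Y g assume X: "X\<in>Obj C" and Y: "Y\<in>Obj C" and "g\<in>Arr D (F0 X) (F0 Y)"
 hence g: "D.arr g" "fst g = F0 X" "snd (snd g) = F0 Y" using D.arrI[of g "F0 X" "F0 Y"] by auto
 note [simp] = X Y g
 obtain f where f [simp]: "C.arr f" "fst f = LoopO C X" "snd (snd f) = LoopO C Y"
  and eq: "Comp D (LoopA D g) (\<delta> X) = Comp D (\<delta> Y) (F1 f)" using full[OF X Y g] unfolding lifts_def by blast
 have "LoopA D g = Comp D (Comp D (LoopA D g) (\<delta> X)) (\<delta>i X)" by (simp add: D.comp_assoc)
 hence lg: "LoopA D g = Comp D (Comp D (\<delta> Y) (F1 f)) (\<delta>i X)" by (simp only: eq)
 show "\<exists>i. \<exists>f\<in>Arr C ((LoopO C ^^ i) X) ((LoopO C ^^ i) Y).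
     (LoopA D ^^ i) g =
      Comp D (Comp D (delta_power C D F0 \<delta> i Y) (F1 f))
       (inverse_of D (F0 ((LoopO C ^^ i) X)) ((LoopO D ^^ i) (F0 X)) (delta_power C D F0 \<delta> i X))"
 proof (intro exI[of _ 1] bexI[of _ f])
  show "f\<in>Arr C ((LoopO C ^^ 1) X) ((LoopO C ^^ 1) Y)" using C.arrD(1)[OF f(1)] by simp
  have "delta_power C D F0 \<delta> 1 Z = \<delta> Z" if "Z\<in>Obj C" for Z using that by simp
  thus "(LoopA D ^^ 1) g =
      Comp D (Comp D (delta_power C D F0 \<delta> 1 Y) (F1 f))
       (inverse_of D (F0 ((LoopO C ^^ 1) X)) ((LoopO D ^^ 1) (F0 X)) (delta_power C D F0 \<delta> 1 X))" using lg X Y by (simp add: \<delta>i_def)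
 qed
next
 fix X Y f f' assume a: "X\<in>Obj C" "Y\<in>Obj C" "f\<in>Arr C X Y" "f'\<in>Arr C X Y" "F1 f = F1 f'"
 hence "f = f'" using faithful[of f f'] C.arrI[OF a(3,1,2)] C.arrI[OF a(4,1,2)] by simp
 thus "\<exists>i. (LoopA C ^^ i) f = (LoopA C ^^ i) f'" by simp
next
 fix W assume W: "W\<in>Obj D"
 then obtain X u u' where "X\<in>Obj C" "D.iso u u'" "fst u = LoopO D (LoopO D W)" "snd (snd u) = F0 X" using dense by blast
 thus "\<exists>i. \<exists>X\<in>Obj C. \<exists>u. is_iso D ((LoopO D ^^ i) W) (F0 X) u"
  using D.iso_is_iso[of u u'] by (intro exI[of _ 2] bexI[of _ X] exI[of _ u]) (auto simp: numeral_2_eq_2)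
qed

end

section \<open>Components of syzygies of ideals generated by arrows\<close>

locale monomial_stable_modules = monomial_algebra Q F I d + stable_modules_sums "quiver_alg Q I" "scalar Q I" P \<pi>
 for Q :: "('v, 'e) pre_digraph" and F and I :: "(('v, 'e) path => 'k::field) set" and d
  and P :: "((('v, 'e) path => 'k) set, 'u) module => ((('v, 'e) path => 'k) set, 'u) module" and \<pi> +
 assumes universe: "\<exists>\<iota> :: 'k list => 'u. inj \<iota>"
begin

lemma left_ideal_simps [simp]:
 "car (left_ideal_module A w) = {a\<otimes>\<^sub>A w |a. a\<in>car A}" "add (left_ideal_module A w) = add A"
 "zero (left_ideal_module A w) = zero A" "smult (left_ideal_module A w) = mult A" by (simp_all add: left_ideal_module_def)

lemma left_ideal_hom:
 assumes "w\<in>car A" "i\<in>mod_hom A M (left_ideal_module A w)"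
 shows "i\<in>mod_hom A M reg"
proof (rule mod_homI)
 show "i x\<in>car reg" if "x\<in>car M" for x using hom_closed[OF assms(2) that] assms(1) by auto
qed (use hom_add[OF assms(2)] hom_smult[OF assms(2)] hom_ext[OF assms(2)] in auto)

lemma smult_hom:
 assumes M: "left_module A M" and N: "left_module A N" and i: "i\<in>mod_hom A M reg" and m: "m\<in>car N"
 shows "(\<lambda>x\<in>car M. i x\<odot>\<^sub>N m)\<in>mod_hom A M N"
proof (rule hom_restrictI[OF M])
 interpret N: left_module A N by (rule N)
 have c: "i x\<in>car A" if "x\<in>car M" for x using hom_closed[OF i that] by simp
 show "i x\<odot>\<^sub>N m\<in>car N" if "x\<in>car M" for x using c[OF that] m by (rule N.lsmult_closed)
 show "i (x \<oplus>\<^sub>M y)\<odot>\<^sub>N m = i x\<odot>\<^sub>N m \<oplus>\<^sub>N i y\<odot>\<^sub>N m" if "x\<in>car M" "y\<in>car M" for x y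
  using that c m hom_add[OF i that] by (simp add: N.lsmult_l_distr)
 show "i (a\<odot>\<^sub>M x)\<odot>\<^sub>N m = a\<odot>\<^sub>N (i x\<odot>\<^sub>N m)" if "a\<in>car A" "x\<in>car M" for a x
  using that c m hom_smult[OF i that] by (simp add: N.lsmult_assoc)
qed

text \<open>The difference of the two maps is multiplication by an element of the syzygy; lifting this element
 to the projective cover of the syzygy factors the difference through a projective module.\<close>

lemma smult_map_steq:
 assumes M: "M\<in>fg" and Z: "Z\<in>fg" and i: "i\<in>mod_hom A M reg"
  and m: "m\<in>car (P Z)" "m'\<in>car (P Z)" "\<pi> Z m = \<pi> Z m'"
  and ker: "!!x. x\<in>car M ==> \<pi> Z (i x\<odot>\<^sub>(P Z) m) = \<zero>\<^sub>Z"
 shows "(\<lambda>x\<in>car M. i x\<odot>\<^sub>(P Z) m)\<in>hom M (Syz Z)"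
  "steq M (Syz Z) (\<lambda>x\<in>car M. i x\<odot>\<^sub>(P Z) m) (\<lambda>x\<in>car M. i x\<odot>\<^sub>(P Z) m')"
proof -
 note lmM = fg_modD[OF M] and lmZ = fg_modD[OF Z] and lmP = fg_modD[OF cover_fg[OF Z]]
 interpret PZ: left_module A "P Z" by (rule lmP)
 interpret Z: left_module A Z by (rule lmZ)
 note pz = cover_hom[OF Z] and Syz = syzygy_fg[OF Z]
 have ic: "i x\<in>car A" if "x\<in>car M" for x using hom_closed[OF i that] by simp
 have ker': "\<pi> Z (i x\<odot>\<^sub>(P Z) m') = \<zero>\<^sub>Z" if "x\<in>car M" for x using ker[OF that] ic[OF that] m by (simp add: hom_smult[OF pz])
 have into: "(\<lambda>x\<in>car M. i x\<odot>\<^sub>(P Z) k)\<in>hom M (Syz Z)"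
  if "k\<in>car (P Z)" "!!x. x\<in>car M ==> \<pi> Z (i x\<odot>\<^sub>(P Z) k) = \<zero>\<^sub>Z" for k
  using smult_hom[OF lmM lmP i that(1)] that(2) by (intro hom_into_syzygy[OF Z]) auto
 show 1: "(\<lambda>x\<in>car M. i x\<odot>\<^sub>(P Z) m)\<in>hom M (Syz Z)" by (rule into[OF m(1) ker])
 have 2: "(\<lambda>x\<in>car M. i x\<odot>\<^sub>(P Z) m')\<in>hom M (Syz Z)" by (rule into[OF m(2) ker'])
 let ?t = "m \<oplus>\<^sub>(P Z) \<ominus>\<^sub>(P Z) m'"
 have "\<pi> Z ?t = \<zero>\<^sub>Z" using m hom_closed[OF pz m(2)] by (simp add: hom_add[OF pz] hom_minus[OF lmP lmZ pz] Z.M.r_neg)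
 hence "?t\<in>car (Syz Z)" using m by (simp add: in_syzygy)
 then obtain t where t: "t\<in>car (P (Syz Z))" "\<pi> (Syz Z) t = ?t" using cover_surj[OF Syz] by force
 have a: "(\<lambda>x\<in>car M. i x\<odot>\<^sub>(P (Syz Z)) t)\<in>hom M (P (Syz Z))" by (rule smult_hom[OF lmM fg_modD[OF cover_fg[OF Syz]] i t(1)])
 show "steq M (Syz Z) (\<lambda>x\<in>car M. i x\<odot>\<^sub>(P Z) m) (\<lambda>x\<in>car M. i x\<odot>\<^sub>(P Z) m')"
 proof (rule steqI[OF M Syz 1 2 cover_fg[OF Syz] cover_projective[OF Syz] a cover_hom[OF Syz]])
  fix x assume x: "x\<in>car M"
  have "i x\<odot>\<^sub>(P Z) m = i x\<odot>\<^sub>(P Z) (m' \<oplus>\<^sub>(P Z) ?t)" using PZ.diff_add[OF m(1,2)] by simp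
  also have "\<dots> = i x\<odot>\<^sub>(P Z) m' \<oplus>\<^sub>(P Z) i x\<odot>\<^sub>(P Z) ?t" using ic[OF x] m by (intro PZ.lsmult_r_distr) auto
  finally show "(\<lambda>x\<in>car M. i x\<odot>\<^sub>(P Z) m) x =
    (\<lambda>x\<in>car M. i x\<odot>\<^sub>(P Z) m') x \<oplus>\<^sub>(Syz Z) \<pi> (Syz Z) ((\<lambda>x\<in>car M. i x\<odot>\<^sub>(P (Syz Z)) t) x)"
   using x ic[OF x] t hom_smult[OF cover_hom[OF Syz] ic[OF x] t(1)] by simp
 qed
qed

text \<open>A lift from the projective module generated by \<open>e v\<close> is determined by its
  value at \<open>e v\<close>, and all these values agree up to elements of the syzygy. By
  \<open>smult_map_steq\<close> the class of the component is then represented by multiplication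
  with any one \<open>z\<close> over the right element.\<close>

lemma syzygy_component_cl:
 assumes M: "M\<in>fg" and Z: "Z\<in>fg" and v: "v\<in>verts Q"
  and i: "i\<in>mod_hom A M (left_ideal_module A (e v))"
  and z: "z\<in>car (P Z)" "!!y. y\<in>car (left_ideal_module A (e v)) ==> \<pi> Z (y\<odot>\<^sub>(P Z) z) = p y"
  and ker: "!!x. x\<in>car M ==> p (i x) = \<zero>\<^sub>Z"
 shows "syzygy_component A P \<pi> M (left_ideal_module A (e v)) Z i p = cl M (Syz Z) (\<lambda>x\<in>car M. i x\<odot>\<^sub>(P Z) z)"
proof -
 let ?V = "left_ideal_module A (e v)"
 interpret PZ: left_module A "P Z" by (rule fg_modD[OF cover_fg[OF Z]])
 note Syz = syzygy_fg[OF Z]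
 have ev: "e v\<in>car A" using v by simp
 have iV: "i x\<in>car ?V" if "x\<in>car M" for x using hom_closed[OF i that] .
 have Vc: "y\<in>car A" "y\<otimes>\<^sub>A e v = y" if "y\<in>car ?V" for y using that v e_e[of v v] by (auto simp: A.m_assoc)
 have eV: "e v\<in>car ?V" using v e_e[of v v] by (auto intro!: exI[of _ "e v"])
 note ir = left_ideal_hom[OF ev i]
 define j where "j = (\<lambda>x\<in>car M. i x\<odot>\<^sub>(P Z) z)"
 have pz: "\<pi> Z (i x\<odot>\<^sub>(P Z) z) = \<zero>\<^sub>Z" if "x\<in>car M" for x using z(2)[OF iV[OF that]] ker[OF that] by simp
 have same: "steq M (Syz Z) (\<lambda>x\<in>car M. l (i x)) g \<longleftrightarrow> steq M (Syz Z) j g"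
  if l: "l\<in>mod_hom A ?V (P Z)" "\<forall>y\<in>car ?V. \<pi> Z (l y) = p y" for l g
 proof -
  let ?m = "l (e v)"
  have m: "?m\<in>car (P Z)" using hom_closed[OF l(1) eV] .
  have li: "l y = y\<odot>\<^sub>(P Z) ?m" if "y\<in>car ?V" for y using hom_smult[OF l(1) Vc(1)[OF that] eV] Vc(2)[OF that] by simp
  hence eq: "(\<lambda>x\<in>car M. l (i x)) = (\<lambda>x\<in>car M. i x\<odot>\<^sub>(P Z) ?m)" using iV by (auto simp: restrict_def)
  have zm: "e v\<odot>\<^sub>(P Z) z\<in>car (P Z)" using ev z(1) by (rule PZ.lsmult_closed)
  have pm: "\<pi> Z ?m = \<pi> Z (e v\<odot>\<^sub>(P Z) z)" using l(2) eV z(2)[OF eV] by simp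
  have jz: "j = (\<lambda>x\<in>car M. i x\<odot>\<^sub>(P Z) (e v\<odot>\<^sub>(P Z) z))"
   unfolding j_def using iV Vc[OF iV] ev z(1) by (auto simp: restrict_def fun_eq_iff PZ.lsmult_assoc[symmetric])
  have km: "\<pi> Z (i x\<odot>\<^sub>(P Z) ?m) = \<zero>\<^sub>Z" if "x\<in>car M" for x using bspec[OF l(2) iV[OF that]] by (simp only: li[OF iV[OF that]] ker[OF that])
  have s: "steq M (Syz Z) (\<lambda>x\<in>car M. l (i x)) j" unfolding eq jz by (rule smult_map_steq(2)[OF M Z ir m zm pm km])
  show ?thesis using s steq_sym[OF M Syz s] steq_trans[OF M Syz] by blast
 qed
 define l0 where "l0 = (\<lambda>y\<in>car ?V. y\<odot>\<^sub>(P Z) z)"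
 have l0: "l0\<in>mod_hom A ?V (P Z)"
 proof (rule mod_homI)
  have V: "y\<in>car ?V" if "y\<in>car A" "y\<otimes>\<^sub>A e v = y" for y
   using that(1) that(2)[symmetric] by (simp only: left_ideal_simps mem_Collect_eq) blast
  show "l0 y\<in>car (P Z)" if "y\<in>car ?V" for y using that Vc(1)[OF that] z(1) by (simp add: l0_def PZ.lsmult_closed)
  show "l0 (x \<oplus>\<^sub>?V y) = l0 x \<oplus>\<^sub>(P Z) l0 y" if "x\<in>car ?V" "y\<in>car ?V" for x y
  proof -
   note xy = Vc[OF that(1)] Vc[OF that(2)]
   have "x \<oplus>\<^sub>A y\<in>car ?V" using xy ev by (intro V) (simp_all add: A.l_distr)
   thus ?thesis using that xy z(1) by (simp add: l0_def PZ.lsmult_l_distr del: left_ideal_simps(1))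
  qed
  show "l0 (a\<odot>\<^sub>?V x) = a\<odot>\<^sub>(P Z) l0 x" if "a\<in>car A" "x\<in>car ?V" for a x
  proof -
   note x = Vc[OF that(2)]
   have "a\<otimes>\<^sub>A x\<in>car ?V" using x ev that(1) by (intro V) (simp_all add: A.m_assoc)
   thus ?thesis using that x z(1) by (simp add: l0_def PZ.lsmult_assoc del: left_ideal_simps(1))
  qed
 qed (simp add: l0_def)
 have "\<forall>y\<in>car ?V. \<pi> Z (l0 y) = p y" using z(2) by (simp add: l0_def)
 hence "{g. \<exists>l\<in>mod_hom A ?V (P Z). (\<forall>y\<in>car ?V. \<pi> Z (l y) = p y) \<and> steq M (Syz Z) (\<lambda>x\<in>car M. l (i x)) g} =
   {g. steq M (Syz Z) j g}" using l0 same by blast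
 thus ?thesis by (simp add: syzygy_component_def st_class_def j_def)
qed

text \<open>The element \<open>r\<close> is obtained from \<open>a\<close> by dropping all paths whose composite with \<open>i\<close> is zero.\<close>

lemma arrow_mult_arrow:
 assumes i: "i\<in>arcs Q" and j: "j\<in>arcs Q" and a: "a\<in>car A" and z: "ar j\<otimes>\<^sub>A (a\<otimes>\<^sub>A ar i) = \<zero>\<^sub>A"
 shows "\<exists>r\<in>car A. r\<otimes>\<^sub>A ar i = a\<otimes>\<^sub>A ar i \<and>
  (ar j\<otimes>\<^sub>A r = \<zero>\<^sub>A \<or> \<not> good (tail Q i, [i, j]) \<and> tail Q j = head Q i \<and> (\<exists>c. ar j\<otimes>\<^sub>A r = sc c\<otimes>\<^sub>A ar j))"
proof -
 define r where "r = mk (\<lambda>p. if fst p = head Q i \<and> good (tail Q i, i # snd p) then cf a p else 0)"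
 have r: "r\<in>car A" "!!p. good p ==> cf r p = (if fst p = head Q i \<and> good (tail Q i, i # snd p) then cf a p else 0)" by (auto simp: r_def)
 have ra: "r\<otimes>\<^sub>A ar i = a\<otimes>\<^sub>A ar i"
 proof (rule A_eqI)
  fix p assume p: "good p"
  obtain u as where pu: "p = (u, as)" by (cases p)
  show "cf (r\<otimes>\<^sub>A ar i) p = cf (a\<otimes>\<^sub>A ar i) p"
  proof (cases as)
   case Nil
   thus ?thesis using cf_mult_ar_Nil[OF i] a r(1) p by (simp add: pu)
  next
   case (Cons x bs)
   have g: "good (u, x # bs)" using p by (simp add: pu Cons)
   have "cf r (head Q i, bs) = cf a (head Q i, bs)" if "x = i" using good_Cons[OF g] good_paths[OF g] g that by (simp add: r(2))
   thus ?thesis using cf_mult_ar_Cons[OF i _ g] a r(1) by (simp add: pu Cons)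
  qed
 qed (use a r(1) i in auto)
 \<comment> \<open>If \<open>as\<close> is nonempty, the relations only see its last arrow next to
   \<open>j\<close>, so \<open>i\<close>, \<open>as\<close>, \<open>j\<close> form a good path; its
   coefficient in \<open>j a i\<close> is that of \<open>as\<close> in \<open>a\<close>, and this
   product vanishes.\<close>
 have zero: "cf r (u, as) = 0"
  if g: "good (u, as @ [j])" and ne: "as \<noteq> [] \<or> good (tail Q i, [i, j])" for u as
 proof (rule ccontr)
  assume "cf r (u, as) \<noteq> 0"
  moreover have gu: "good (u, as)" using good_append(1)[OF g] .
  ultimately have u: "u = head Q i" "good (tail Q i, i # as)" "cf r (u, as) = cf a (u, as)" "cf a (u, as) \<noteq> 0" by (auto simp: r(2) split: if_splits)
  have "good (tail Q i, i # as @ [j])"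
  proof (cases as rule: rev_cases)
   case Nil
   thus ?thesis using ne by simp
  next
   case (snoc bs x)
   have g': "good (u, bs @ [x, j])" using g snoc by simp
   have "good (tail Q x, [x, j])" using good_append(2)[OF g'] good_paths[OF good_append(2)[OF g']] by simp
   thus ?thesis using good_extend[of "tail Q i" "i # bs" x j] u(2) snoc by simp
  qed
  hence g2: "good (tail Q i, (i # as) @ [j])" by simp
  have "cf (ar j\<otimes>\<^sub>A (a\<otimes>\<^sub>A ar i)) (tail Q i, (i # as) @ [j]) = cf (a\<otimes>\<^sub>A ar i) (tail Q i, i # as)"
   using cf_ar_mult_snoc[OF j _ g2, of "a\<otimes>\<^sub>A ar i"] a i by simp
  also have "\<dots> = cf a (head Q i, as)" using cf_mult_ar_Cons[OF i a u(2)] by simp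
  finally show False using u(1,4) z g2 by simp
 qed
 let ?c = "cf r (head Q i, [])"
 have br: "cf (ar j\<otimes>\<^sub>A r) p = (if \<not> good (tail Q i, [i, j]) \<and> tail Q j = head Q i \<and> p = (tail Q j, [j]) then ?c else 0)"
  if p: "good p" for p
 proof -
  obtain u as where pu: "p = (u, as)" by (cases p)
  show ?thesis
  proof (cases as rule: rev_cases)
   case Nil
   thus ?thesis using cf_ar_mult[OF j r(1) p] by (simp add: pu)
  next
   case (snoc bs x)
   have g: "good (u, bs @ [x])" using p by (simp add: pu snoc)
   have e: "cf (ar j\<otimes>\<^sub>A r) p = (if x = j then cf r (u, bs) else 0)" using cf_ar_mult_snoc[OF j r(1) g] by (simp add: pu snoc)
   show ?thesis
   proof (cases "x = j \<and> bs = []")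
    case True
    hence u: "u = tail Q j" "u\<in>verts Q" using good_paths[OF g] j by auto
    have "cf r (u, []) = 0" if "u \<noteq> head Q i" using r(2)[of "(u, [])"] u that by simp
    moreover have "cf r (u, []) = 0" if "good (tail Q i, [i, j])" using zero[of u bs] that g True by simp
    ultimately show ?thesis using e u True by (auto simp: pu snoc)
   next
    case False
    thus ?thesis using e zero[of u bs] g by (auto simp: pu snoc)
   qed
  qed
 qed
 show ?thesis
 proof (intro bexI[OF _ r(1)] conjI ra)
  show "ar j\<otimes>\<^sub>A r = \<zero>\<^sub>A \<or> \<not> good (tail Q i, [i, j]) \<and> tail Q j = head Q i \<and> (\<exists>c. ar j\<otimes>\<^sub>A r = sc c\<otimes>\<^sub>A ar j)"
  proof (cases "\<not> good (tail Q i, [i, j]) \<and> tail Q j = head Q i")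
   case True
   have "ar j\<otimes>\<^sub>A r = sc ?c\<otimes>\<^sub>A ar j" by (rule A_eqI) (use True j r(1) br in auto)
   thus ?thesis using True by blast
  next
   case False
   have "ar j\<otimes>\<^sub>A r = \<zero>\<^sub>A" by (rule A_eqI) (use False j r(1) br in auto)
   thus ?thesis by blast
  qed
 qed
qed

text \<open>If the identity of \<open>L\<close> is stably zero, the surjection from the regular
  module onto \<open>L\<close> splits. The image of the generator is an element \<open>?s\<close>
  with \<open>?s i = i\<close>, so it has coefficient one at the vertex \<open>head Q i\<close>.
  Were \<open>j i\<close> a relation, \<open>j\<close> would kill the generator and hence
  \<open>?s\<close>, so the same coefficient would be zero.\<close>

lemma stably_zero_arrow_ideal:
 assumes i: "i\<in>arcs Q" and j: "j\<in>arcs Q" "tail Q j = head Q i"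
  and L: "L\<in>fg" "t\<in>mod_iso A L (left_ideal_module A (ar i))" and z: "steq L L (hom_id L) (hom_zero L L)"
 shows "good (tail Q i, [i, j])"
proof (rule ccontr)
 assume bad: "\<not> good (tail Q i, [i, j])"
 note lmL = fg_modD[OF L(1)]
 interpret L: left_module A L by (rule lmL)
 have t: "t\<in>mod_hom A L reg" using left_ideal_hom[OF _ mod_iso_hom[OF L(2)]] i by simp
 have tb: "bij_betw t (car L) {a\<otimes>\<^sub>A ar i |a. a\<in>car A}" using mod_iso_bij[OF L(2)] by simp
 have "ar i\<in>{a\<otimes>\<^sub>A ar i |a. a\<in>car A}" using e_ar[OF i] i by (auto intro!: exI[of _ "e (head Q i)"])
 hence "ar i\<in>t ` car L" by (simp only: bij_betw_imp_surj_on[OF tb])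
 then obtain l where l: "l\<in>car L" "t l = ar i" by (auto elim: imageE)
 obtain enc :: "(('v, 'e) path => 'k) set => 'k list" and n where "inj_on enc (car reg)" "!!m. length (enc m) = n"
  using fg_encoding[OF reg_fg] by blast
 moreover obtain \<iota> :: "'k list => 'u" where "inj \<iota>" using universe by blast
 ultimately have "inj_on (\<iota> \<circ> enc) (car reg)" by (intro comp_inj_on) (auto intro: inj_on_subset)
 from transport_module[OF reg_fg this] obtain R' :: "((('v, 'e) path => 'k) set, 'u) module" and f
  where R': "R'\<in>fg_mod A" "f\<in>mod_iso A R' reg" by blast
 have f: "f\<in>mod_hom A R' reg" "f ` car R' = car A" using mod_iso_hom[OF R'(2)] mod_iso_bij[OF R'(2)] by (auto simp: bij_betw_def)
 let ?q = "\<lambda>x\<in>car R'. f x\<odot>\<^sub>L l"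
 have q: "?q\<in>hom R' L" by (rule smult_hom[OF fg_modD[OF R'(1)] lmL f(1) l(1)])
 have qs: "?q ` car R' = car L"
 proof
  show "?q ` car R' \<subseteq> car L" using hom_closed[OF q] by blast
  show "car L \<subseteq> ?q ` car R'"
  proof
   fix x assume x: "x\<in>car L"
   hence "t x\<in>t ` car L" by blast
   then obtain a where a: "a\<in>car A" "t x = a\<otimes>\<^sub>A ar i" by (simp only: bij_betw_imp_surj_on[OF tb]) blast
   have "a\<in>f ` car R'" using a(1) by (simp only: f(2))
   then obtain y where y: "y\<in>car R'" "a = f y" by blast
   have "t (a\<odot>\<^sub>L l) = t x" using hom_smult[OF t a(1) l(1)] a(2) l(2) by simp
   hence "a\<odot>\<^sub>L l = x" using tb x L.lsmult_closed[OF a(1) l(1)] by (auto simp: bij_betw_def dest: inj_onD)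
   thus "x\<in>?q ` car R'" using y by auto
  qed
 qed
 obtain a where a: "a\<in>hom L (P L)" "!!x. x\<in>car L ==> hom_id L x = hom_zero L L x \<oplus>\<^sub>L \<pi> L (a x)"
  using z steq_iff[OF L(1) L(1) hom_id_in[OF lmL] hom_zero_in[OF lmL lmL]] by blast
 obtain g where g: "g\<in>hom (P L) R'" "!!x. x\<in>car (P L) ==> ?q (g x) = \<pi> L x"
  using lift_projective[OF cover_projective[OF L(1)] R'(1) L(1) q qs cover_hom[OF L(1)]] by blast
 let ?s = "f (g (a l))"
 have al: "a l\<in>car (P L)" "g (a l)\<in>car R'" using hom_closed[OF a(1) l(1)] hom_closed[OF g(1)] by auto
 hence s: "?s\<in>car A" using hom_closed[OF f(1)] by auto
 have "?s\<odot>\<^sub>L l = l" using g(2)[OF al(1)] a(2)[OF l(1)] al l hom_closed[OF cover_hom[OF L(1)] al(1)] by simp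
 hence sa: "?s\<otimes>\<^sub>A ar i = ar i" using hom_smult[OF t s l(1)] l(2) by simp
 have "cf (?s\<otimes>\<^sub>A ar i) (tail Q i, [i]) = cf ?s (head Q i, [])" using cf_mult_ar_Cons[OF i s, of "tail Q i" i "[]"] i by simp
 hence 1: "cf ?s (head Q i, []) = 1" using sa i by simp
 have "t (ar j\<odot>\<^sub>L l) = t \<zero>\<^sub>L" using hom_smult[OF t _ l(1), of "ar j"] j l(2) ar_ar[OF j(1) i bad] hom_zero[OF lmL reg_left_module t] by simp
 hence bl: "ar j\<odot>\<^sub>L l = \<zero>\<^sub>L" using tb L.lsmult_closed[OF _ l(1), of "ar j"] j(1) by (auto simp: bij_betw_def dest: inj_onD)
 note lmP = fg_modD[OF cover_fg[OF L(1)]] and lmR = fg_modD[OF R'(1)]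
 have "ar j\<otimes>\<^sub>A ?s = f (g (a (ar j\<odot>\<^sub>L l)))"
  using hom_smult[OF a(1) _ l(1), of "ar j"] hom_smult[OF g(1) _ al(1), of "ar j"] hom_smult[OF f(1) _ al(2), of "ar j"] j(1) by simp
 also have "\<dots> = \<zero>\<^sub>A" by (simp add: bl hom_zero[OF lmL lmP a(1)] hom_zero[OF lmP lmR g(1)] hom_zero[OF lmR reg_left_module f(1)])
 finally have "ar j\<otimes>\<^sub>A ?s = \<zero>\<^sub>A" .
 hence "cf ?s (tail Q j, []) = 0" using cf_ar_mult_snoc[OF j(1) s, of "tail Q j" "[]" j] j(1) by simp
 thus False using 1 j(2) by simp
qed

end

section \<open>The functor from semisimple modules\<close>

locale relation_functor = A: monomial_stable_modules Q "relations Q I" I d PA \<pi>A +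
  B: rad_square_zero G X K S \<sigma> + MB: monomial_stable_modules G X K 2 PB \<pi>B
 for Q :: "('v, 'e) pre_digraph" and I :: "(('v, 'e) path => 'k::field) set" and d
  and PA :: "((('v, 'e) path => 'k) set, 'u) module => ((('v, 'e) path => 'k) set, 'u) module" and \<pi>A
  and G :: "('e, ('v, 'e) path) pre_digraph" and X and K :: "(('e, ('v, 'e) path) path => 'k) set"
  and S :: "'e => ((('e, ('v, 'e) path) path => 'k) set, 'u) module" and \<sigma>
  and PB :: "((('e, ('v, 'e) path) path => 'k) set, 'u) module => ((('e, ('v, 'e) path) path => 'k) set, 'u) module" and \<pi>B +
 fixes L \<tau> F0 F1 \<delta>
 assumes G: "G = relation_quiver Q I" and K: "K = arrow_ideal_sq G"
  and ideals: "!!\<alpha>. \<alpha>\<in>arcs Q ==> L \<alpha>\<in>fg_mod (quiver_alg Q I) \<and>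
   \<tau> \<alpha>\<in>mod_iso (quiver_alg Q I) (L \<alpha>) (left_ideal_module (quiver_alg Q I) (residue Q I (path_elt (tail Q \<alpha>, [\<alpha>]))))"
  and functor_F: "is_functor (ssmod (quiver_alg G K) (scalar G K) PB \<pi>B) (stmod (quiver_alg Q I) (scalar Q I) PA \<pi>A) F0 F1"
  and linear_F: "linear_on_arrows (ssmod (quiver_alg G K) (scalar G K) PB \<pi>B) (stmod (quiver_alg Q I) (scalar Q I) PA \<pi>A) F1"
  and F_simple: "!!\<alpha>. \<alpha>\<in>arcs Q ==> F0 (S \<alpha>) = L \<alpha>"
  and natural_\<delta>: "loop_natural_iso (ssmod (quiver_alg G K) (scalar G K) PB \<pi>B) (stmod (quiver_alg Q I) (scalar Q I) PA \<pi>A) F0 F1 \<delta>"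
  and \<delta>_simple: "!!\<alpha> \<beta>. (tail Q \<alpha>, [\<alpha>, \<beta>])\<in>relations Q I ==>
   Comp (stmod (quiver_alg Q I) (scalar Q I) PA \<pi>A) (\<delta> (S \<alpha>)) (F1 (simple_syzygy_component Q I PB \<pi>B S \<sigma> \<alpha> \<beta>)) =
    ideal_syzygy_component Q I PA \<pi>A L \<tau> \<alpha> \<beta>"
begin

abbreviation C where "C \<equiv> ssmod (quiver_alg G K) (scalar G K) PB \<pi>B"

lemma vertsG [simp]: "verts G = arcs Q" "arcs G = relations Q I" "tail G = (\<lambda>p. hd (snd p))" "head G = (\<lambda>p. last (snd p))"
 by (simp_all add: G relation_quiver_def)

lemma C_simps [simp]: "Obj C = {M\<in>MB.fg. semisimple_module B.A M}" "Arr C = Arr MB.D" "Comp C = Comp MB.D"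
 "Plus C = Plus MB.D" "Scale C = Scale MB.D" "LoopO C = MB.Syz" "LoopA C = LoopA MB.D" "Ident C = Ident MB.D" by (auto simp: ssmod_def)

lemma Obj_C: "M\<in>MB.fg ==> M\<in>Obj C \<longleftrightarrow> B.is_killed M" using B.semisimple_iff_killed[OF fg_modD] by simp

lemma Obj_CD: "M\<in>Obj C ==> M\<in>MB.fg" "M\<in>Obj C ==> B.is_killed M" using Obj_C by auto

lemma syzygy_Obj_C: assumes M: "M\<in>MB.fg" shows "MB.Syz M\<in>Obj C"
proof -
 have pc: "projective_cover B.A (PB M) (\<pi>B M) M" using MB.covers M by (auto simp: projective_covers_def)
 have "B.is_killed (MB.Syz M)" unfolding B.killed_iff[OF fg_modD[OF MB.syzygy_fg[OF M]]]
  using B.rad_annihilated[OF fg_modD[OF MB.cover_fg[OF M]]] B.cover_ker_rad[OF fg_modD[OF M] pc] by auto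
 thus ?thesis using Obj_C MB.syzygy_fg[OF M] by simp
qed

lemma simple_Obj_C: "i\<in>arcs Q ==> S i\<in>Obj C" using Obj_C[of "S i"] B.simple_fg B.simple_killed by simp

sublocale C: looped_preadditive C MB.Zst
 unfolding ssmod_def by (rule MB.st.full_subcat_looped_preadditive) (use syzygy_Obj_C in \<open>auto simp: ssmod_def\<close>)

sublocale CF: additive_looped_functor C MB.Zst A.D A.Zst F0 F1 \<delta>
 by unfold_locales (use functor_F linear_F natural_\<delta> in \<open>auto simp: linear_on_arrows_def\<close>)

lemma C_arr_iff: "C.arr f \<longleftrightarrow> MB.st.arr f \<and> fst f\<in>Obj C \<and> snd (snd f)\<in>Obj C" unfolding C.arr_def MB.st.arr_def by auto

lemma cl_C_arr: "M\<in>Obj C ==> N\<in>Obj C ==> f\<in>MB.hom M N ==> C.arr (MB.cl M N f)" using MB.cl_arr[of M N f] by (simp add: C_arr_iff)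

lemma C_arr_rep:
 assumes "C.arr f"
 obtains f0 where "f0\<in>MB.hom (fst f) (snd (snd f))" "f = MB.cl (fst f) (snd (snd f)) f0" using MB.arr_rep[of f] assms C_arr_iff by blast

lemma simple_sums_through:
 assumes M: "M\<in>Obj C" and N: "N\<in>Obj C"
 shows "f\<in>B.simple_sums M N ==> MB.cl M N f\<in>C.sums_through (S ` arcs Q) M N"
proof (induction rule: B.simple_sums.induct)
 case zero
 thus ?case by (rule C.sums_through.zero)
next
 case (add f i p v)
 note fg = Obj_CD(1)[OF M] Obj_CD(1)[OF N]
 have i: "i\<in>arcs Q" using add by simp
 note Sfg = Obj_CD(1)[OF simple_Obj_C[OF i]]
 have f: "f\<in>MB.hom M N" using B.simple_sums_hom[OF add(1)] fg by (auto dest: fg_modD)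
 have vp: "cmps M v p\<in>MB.hom M N" using hom_compose[OF add(3,4)] fg by (auto dest: fg_modD)
 have "MB.cl M N (hom_add M N f (cmps M v p)) =
   Plus C (MB.cl M N f) (Comp C (MB.cl (S i) N v) (MB.cl M (S i) p))" using MB.Plus_cl[OF fg f vp] MB.Comp_cl[OF fg(1) Sfg fg(2) add(3,4)] by simp
 moreover have "Plus C (MB.cl M N f) (Comp C (MB.cl (S i) N v) (MB.cl M (S i) p))\<in>C.sums_through (S ` arcs Q) M N"
  by (rule C.sums_through.add[OF add.IH, of "S i"])
   (use add i M N simple_Obj_C[OF i] cl_C_arr in \<open>auto simp del: C_simps(1)\<close>)
 ultimately show ?case by simp
qed

lemma ide_sums_through: "M\<in>Obj C ==> Ident C M\<in>C.sums_through (S ` arcs Q) M M"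
 using simple_sums_through[OF _ _ B.id_simple_sum] Obj_CD[of M] MB.D_simps(3)[of M] by simp

text \<open>A triangle of the subcategory is one of the stable category with semisimple terms; a
  representative of its last map is regular, and this gives the section needed in
  \<open>Tri_splitting\<close>.\<close>

lemma Tri_C_splitting:
 assumes "(U, V, W, h, f, g)\<in>Tri C"
 shows "fst f = U \<and> snd (snd f) = V \<and> snd (snd g) = W \<and> (\<exists>r s t. C.splitting h f g r s t)"
proof -
 have tri: "(U, V, W, h, f, g)\<in>Tri MB.D" and ss: "semisimple_module B.A U" "semisimple_module B.A V" "semisimple_module B.A W"
  using assms by (auto simp: ssmod_def full_subcat_def)
 have fg: "U\<in>MB.fg" "V\<in>MB.fg" "W\<in>MB.fg" and e: "fst f = U" "snd (snd f) = V" "fst g = V" "snd (snd g) = W" "MB.st.arr g"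
  using tri unfolding MB.Tri_D_iff by auto
 have Obj: "U\<in>Obj C" "V\<in>Obj C" "W\<in>Obj C" using fg ss by auto
 obtain g0 where g0: "g0\<in>MB.hom V W" "g = MB.cl V W g0" using MB.arr_rep[OF e(5)] e by metis
 note lm = fg_modD[OF fg(2)] fg_modD[OF fg(3)]
 obtain s0 where s0: "s0\<in>B.simple_sums W V" "\<forall>y\<in>car V. g0 (s0 (g0 y)) = g0 y"
  using B.regular[OF fg(2) Obj_CD(2)[OF Obj(2)] lm(2) Obj_CD(2)[OF Obj(3)] g0(1)] by blast
 have s0h: "s0\<in>MB.hom W V" by (rule B.simple_sums_hom[OF s0(1) lm(2,1)])
 have c: "cmps V s0 g0\<in>MB.hom V V" by (rule hom_compose[OF g0(1) s0h lm(1)])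
 have "cmps V g0 (cmps V s0 g0) = g0"
  by (rule hom_eqI[OF hom_compose[OF c g0(1) lm(1)] g0(1)]) (use s0(2) in \<open>simp add: compose_eq\<close>)
 hence gsg: "Comp MB.D g (Comp MB.D (MB.cl W V s0) g) = g"
  using MB.Comp_cl[OF fg(2,3,2) g0(1) s0h] MB.Comp_cl[OF fg(2,2,3) c g0(1)] by (simp add: g0(2))
 obtain r s t where sp: "MB.st.splitting h f g r s t" using MB.Tri_splitting[OF tri _ _ _ gsg] MB.cl_arr[OF fg(3,2) s0h] by auto
 have O: "MB.Syz W\<in>Obj C" by (rule syzygy_Obj_C[OF fg(3)])
 have "C.splitting h f g r s t" using sp Obj O e unfolding C.splitting_def MB.st.splitting_def C.complex_def MB.st.complex_def C_arr_iff
  by (auto simp del: C_simps(1))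
 thus ?thesis using e by blast
qed

lemma triangle_functor: "triangle_functor C A.D F0 F1 \<delta>" by (rule CF.triangle_functor_if_splitting[OF Tri_C_splitting A.splitting_Tri])

text \<open>No arrow of the relation quiver starts at \<open>i\<close>, so all arrows kill the
  generator \<open>z\<close> of the cover. Sending the basis vector of \<open>S i\<close> to
  \<open>z\<close> then factors the identity through the cover.\<close>

lemma no_relation_simple_zero:
 assumes i: "i\<in>arcs Q" and no: "!!j. (tail Q i, [i, j]) \<notin> relations Q I"
 shows "Ident C (S i) = MB.Zst (S i) (S i)"
proof -
 let ?P = "PB (S i)"
 have fg: "S i\<in>MB.fg" using Obj_CD(1)[OF simple_Obj_C[OF i]] .
 note lm = fg_modD[OF fg] and lmP = fg_modD[OF MB.cover_fg[OF fg]]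
 interpret P: monomial_module G X K 2 "?P" by (rule B.monomial_module[OF lmP])
 interpret Sm: left_module B.A "S i" by (rule lm)
 have pc: "projective_cover B.A ?P (\<pi>B (S i)) (S i)" using MB.covers fg by (auto simp: projective_covers_def)
 have i': "i\<in>verts G" using i by simp
 obtain z where z: "z\<in>car ?P" "B.e i\<odot>\<^sub>?P z = z" "\<pi>B (S i) z = B.\<sigma>_inv i 1" using B.simple_cover_top[OF i' pc] by blast
 have arz: "B.ar s\<odot>\<^sub>?P z = \<zero>\<^sub>?P" if g: "s\<in>arcs G" for s
 proof -
  obtain a b where ab: "s = (tail Q a, [a, b])" "a\<in>arcs Q" using A.relation_arrow g by fastforce
  hence "a \<noteq> i" using no g by auto
  moreover have "tail G s = a" using ab by simp
  ultimately have "B.e (tail G s)\<odot>\<^sub>?P z = \<zero>\<^sub>?P" using P.e_e_smult[of a i z] ab(2) i z by simp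
  thus ?thesis using P.ar_e_smult[OF g z(1)] P.lsmult_zero[OF B.bas(1)[OF B.arc_path[OF g]]] by simp
 qed
 have a: "B.from_simple ?P i z\<in>MB.hom (S i) ?P" by (rule B.from_simple[OF lmP i' z(1,2) arz])
 have "MB.steq (S i) (S i) (hom_id (S i)) (hom_zero (S i) (S i))"
 proof (rule MB.steqI[OF fg fg hom_id_in[OF lm] hom_zero_in[OF lm lm] MB.cover_fg[OF fg] MB.cover_projective[OF fg] a MB.cover_hom[OF fg]])
  fix x assume x: "x\<in>car (S i)"
  have "x = B.sc (\<sigma> i x)\<odot>\<^sub>(S i) B.\<sigma>_inv i 1" using x B.\<sigma>_inv[OF i'] i by (intro B.\<sigma>_eqD[OF i']) (auto simp: B.\<sigma>_smult[OF i'] Sm.lsmult_closed)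
  thus "hom_id (S i) x = hom_zero (S i) (S i) x \<oplus>\<^sub>(S i) \<pi>B (S i) (B.from_simple ?P i z x)"
   using x z hom_smult[OF MB.cover_hom[OF fg] _ z(1), of "B.sc (\<sigma> i x)"] by (simp add: B.from_simple_def)
 qed
 thus ?thesis using MB.cl_eqI[OF fg fg] MB.D_simps(3)[of "S i"] by simp
qed

text \<open>A nonzero map from a simple module into a semisimple one has a left inverse
  \<open>p\<close>. If \<open>F\<close> kills \<open>k\<close>, it therefore kills the identity of
  \<open>S j\<close>; then no relation starts with \<open>j\<close>, so this identity, and with it
  \<open>k\<close>, is stably zero.\<close>

lemma faithful_core:
 assumes k: "C.arr k" "fst k\<in>S ` arcs Q" "F1 k = A.Zst (F0 (fst k)) (F0 (snd (snd k)))"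
 shows "k = MB.Zst (fst k) (snd (snd k))"
proof -
 obtain j where j: "j\<in>arcs Q" "fst k = S j" using k(2) by blast
 define Y where "Y = snd (snd k)"
 have Y: "Y\<in>Obj C" using k(1) unfolding C_arr_iff Y_def by blast
 obtain k0 where k0: "k0\<in>MB.hom (S j) Y" "k = MB.cl (S j) Y k0" using C_arr_rep[OF k(1)] j(2) Y_def by metis
 note SO = simple_Obj_C[OF j(1)]
 note fg = Obj_CD(1)[OF SO] Obj_CD(1)[OF Y]
 note lm = fg_modD[OF fg(1)] fg_modD[OF fg(2)]
 interpret Y: left_module B.A Y by (rule lm(2))
 have j': "j\<in>verts G" using j by simp
 let ?x = "k0 (B.\<sigma>_inv j 1)"
 note x = B.hom_from_simple[OF lm(2) j' k0(1)]
 show ?thesis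
 proof (cases "?x = \<zero>\<^sub>Y")
  case True
  have "k0 = hom_zero (S j) Y" by (rule hom_eqI[OF k0(1) hom_zero_in[OF lm]], subst x(1)) (simp add: True B.from_simple_def Y.lsmult_zero)
  thus ?thesis using k0(2) by simp
 next
  case False
  then obtain p where p: "p\<in>MB.hom Y (S j)" "p ?x = B.\<sigma>_inv j 1"
   using B.to_simple[OF lm(2) Obj_CD(2)[OF Y] j' Y.zero_lsubmodule x(2) _ x(3)] by auto
  have pk: "cmps (S j) p k0\<in>MB.hom (S j) (S j)" by (rule hom_compose[OF k0(1) p(1) lm(1)])
  have s1: "B.\<sigma>_inv j 1\<in>car (S j)" using B.\<sigma>_inv[OF j'] by blast
  have "cmps (S j) p k0 = hom_id (S j)"
   using B.hom_from_simple(1)[OF lm(1) j' pk] B.hom_from_simple(1)[OF lm(1) j' hom_id_in[OF lm(1)]] p(2) s1 by (simp add: compose_eq)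
  hence pk_id: "Comp C (MB.cl Y (S j) p) k = Ident C (S j)" using MB.Comp_cl[OF fg(1,2,1) k0(1) p(1)] by (simp add: k0(2) MB.D_simps(3))
  have pa: "C.arr (MB.cl Y (S j) p)" by (rule cl_C_arr[OF Y SO p(1)])
  have "F1 (Ident C (S j)) = Comp A.D (F1 (MB.cl Y (S j) p)) (F1 k)" unfolding pk_id[symmetric] by (rule CF.F_comp[OF k(1) pa]) (simp add: k0(2))
  also have "\<dots> = A.Zst (F0 (S j)) (F0 (S j))" unfolding k(3) using CF.F_arr[OF pa] CF.F_Obj[OF SO] CF.F_Obj[OF Y] j(2) Y_def by simp
  finally have "Ident A.D (L j) = A.Zst (L j) (L j)" using CF.F_ide[OF SO] F_simple[OF j(1)] by simp
  moreover have Lfg: "L j\<in>A.fg" using ideals[OF j(1)] by blast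
  note lmL = fg_modD[OF this]
  ultimately have st: "A.steq (L j) (L j) (hom_id (L j)) (hom_zero (L j) (L j))"
   using A.cl_eq_iff[OF Lfg Lfg hom_id_in[OF lmL] hom_zero_in[OF lmL lmL]] by (simp add: A.D_simps(3))
  have "(tail Q j, [j, t]) \<notin> relations Q I" for t
  proof
   assume rel: "(tail Q j, [j, t])\<in>relations Q I"
   hence t: "t\<in>arcs Q" "tail Q t = head Q j" using A.relation_arrow[OF rel] by auto
   have "\<tau> j\<in>mod_iso A.A (L j) (left_ideal_module A.A (A.ar j))" using ideals[OF j(1)] by (simp add: A.bas_def)
   from A.stably_zero_arrow_ideal[OF j(1) t Lfg this st] have "A.good (tail Q j, [j, t])" .
   thus False using rel by (simp add: good_path_def)
  qed
  note i = no_relation_simple_zero[OF j(1) this]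
  have "k = Comp C k (Ident C (S j))" by (rule C.comp_ide(1)[OF k(1), symmetric]) (simp add: j(2))
  also have "\<dots> = MB.Zst (S j) (snd (snd k))" unfolding i by (rule C.comp_zero(1)[OF k(1) SO]) (simp add: j(2))
  finally show ?thesis unfolding j(2) .
 qed
qed

lemma faithful:
 assumes "C.arr f" "C.arr f'" "fst f = fst f'" "snd (snd f) = snd (snd f')" "F1 f = F1 f'"
 shows "f = f'"
proof (rule CF.faithful_if_on_sums[of "S ` arcs Q"])
 show "Ident C M\<in>C.sums_through (S ` arcs Q) M M" if "M\<in>Obj C" for M by (rule ide_sums_through[OF that])
 show "k = MB.Zst (fst k) (snd (snd k))"
  if "C.arr k" "fst k\<in>S ` arcs Q" "F1 k = A.Zst (F0 (fst k)) (F0 (snd (snd k)))" for k by (rule faithful_core[OF that])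
qed (rule assms)+

end

lemma syzygy_component_restrict:
 "syzygy_component R P \<pi> M V Z i p = syzygy_component R P \<pi> M V Z (\<lambda>x\<in>car M. i x) p" unfolding syzygy_component_def by (simp cong: restrict_cong)

lemma (in stable_modules) cl_biprod:
 assumes M: "M\<in>fg" and N: "N\<in>fg" and b: "is_biprod R M N T u v p q"
 shows "st.biprod M N T (cl M T u) (cl N T v) (cl T M p) (cl T N q)"
proof -
 have T: "T\<in>fg" and h: "u\<in>hom M T" "v\<in>hom N T" "p\<in>hom T M" "q\<in>hom T N"
  and pu: "!!x. x\<in>car M ==> p (u x) = x \<and> q (u x) = \<zero>\<^sub>N"
  and qv: "!!y. y\<in>car N ==> p (v y) = \<zero>\<^sub>M \<and> q (v y) = y"
  and dec: "!!z. z\<in>car T ==> z = u (p z) \<oplus>\<^sub>T v (q z)" using b unfolding is_biprod_def by blast+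
 note lm = fg_modD[OF M] fg_modD[OF N] fg_modD[OF T]
 have 1: "cmps M p u = hom_id M"
  by (rule hom_eqI[OF hom_compose[OF h(1,3) lm(1)] hom_id_in[OF lm(1)]]) (simp add: compose_eq pu)
 have 2: "cmps N q v = hom_id N"
  by (rule hom_eqI[OF hom_compose[OF h(2,4) lm(2)] hom_id_in[OF lm(2)]]) (simp add: compose_eq qv)
 have 3: "cmps N p v = hom_zero N M"
  by (rule hom_eqI[OF hom_compose[OF h(2,3) lm(2)] hom_zero_in[OF lm(2,1)]]) (simp add: compose_eq qv)
 have 4: "cmps M q u = hom_zero M N"
  by (rule hom_eqI[OF hom_compose[OF h(1,4) lm(1)] hom_zero_in[OF lm(1,2)]]) (simp add: compose_eq pu)
 note up = hom_compose[OF h(3,1) lm(3)] and vq = hom_compose[OF h(4,2) lm(3)]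
 have 5: "hom_add T T (cmps T u p) (cmps T v q) = hom_id T"
  by (rule hom_eqI[OF hom_add_in[OF lm(3,3) up vq] hom_id_in[OF lm(3)]]) (simp add: compose_eq flip: dec)
 show ?thesis unfolding st.biprod_def using M N T h 1 2 3 4 5 up vq by (simp add: Comp_cl Plus_cl D_simps(3))
qed

section \<open>Explicit representatives of the components of both syzygy identifications\<close>

context relation_functor
begin

abbreviation comp_simple where "comp_simple \<equiv> simple_syzygy_component Q I PB \<pi>B S \<sigma>"
abbreviation comp_ideal where "comp_ideal \<equiv> ideal_syzygy_component Q I PA \<pi>A L \<tau>"

lemma bas_arrow: "A.ar i = residue Q I (path_elt (tail Q i, [i]))" "A.e v = residue Q I (path_elt (v, []))" by (simp_all add: A.bas_def)

lemma L_fg: "i\<in>arcs Q ==> L i\<in>A.fg" using ideals by blast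

lemma \<tau>_iso:
 assumes "i\<in>arcs Q"
 shows "\<tau> i\<in>mod_iso A.A (L i) (left_ideal_module A.A (A.ar i))" using ideals[OF assms] by (simp add: A.bas_def)

lemma \<tau>_hom:
 assumes "i\<in>arcs Q"
 shows "\<tau> i\<in>mod_hom A.A (L i) A.reg" using A.left_ideal_hom[OF _ mod_iso_hom[OF \<tau>_iso[OF assms]]] assms by simp

lemma \<tau>_bij:
 assumes "i\<in>arcs Q"
 shows "bij_betw (\<tau> i) (car (L i)) {a\<otimes>\<^sub>A.A A.ar i |a. a\<in>car A.A}" using mod_iso_bij[OF \<tau>_iso[OF assms]] by simp

lemma \<tau>_form:
 assumes "i\<in>arcs Q" "x\<in>car (L i)"
 obtains a where "a\<in>car A.A" "\<tau> i x = a\<otimes>\<^sub>A.A A.ar i" using bij_betwE[OF \<tau>_bij[OF assms(1)]] assms(2) by blast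

lemma \<tau>_inverse:
 assumes "i\<in>arcs Q" "a\<in>car A.A"
 obtains x where "x\<in>car (L i)" "\<tau> i x = a\<otimes>\<^sub>A.A A.ar i"
proof -
 have "a\<otimes>\<^sub>A.A A.ar i\<in>\<tau> i ` car (L i)" unfolding bij_betw_imp_surj_on[OF \<tau>_bij[OF assms(1)]] using assms(2) by blast
 thus ?thesis using that by (metis imageE)
qed

lemma \<tau>_eqD: "i\<in>arcs Q ==> x\<in>car (L i) ==> y\<in>car (L i) ==> \<tau> i x = \<tau> i y ==> x = y" using inj_onD[OF bij_betw_imp_inj_on[OF \<tau>_bij]] by blast

lemma \<tau>_closed: "i\<in>arcs Q ==> x\<in>car (L i) ==> \<tau> i x\<in>car A.A" using hom_closed[OF \<tau>_hom] by simp

lemma \<tau>_smult: "i\<in>arcs Q ==> x\<in>car (L i) ==> a\<in>car A.A ==> \<tau> i (a\<odot>\<^sub>(L i) x) = a\<otimes>\<^sub>A.A \<tau> i x" using hom_smult[OF \<tau>_hom] by simp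

lemma \<tau>_zero: "i\<in>arcs Q ==> \<tau> i \<zero>\<^sub>(L i) = \<zero>\<^sub>A.A" using hom_zero[OF fg_modD[OF L_fg] A.reg_left_module \<tau>_hom] by simp

definition gen_elt where "gen_elt \<alpha> = (SOME l. l\<in>car (L \<alpha>) \<and> \<tau> \<alpha> l = A.ar \<alpha>)"

lemma gen_elt: "i\<in>arcs Q ==> gen_elt i\<in>car (L i) \<and> \<tau> i (gen_elt i) = A.ar i"
proof -
 assume i: "i\<in>arcs Q"
 obtain l where "l\<in>car (L i)" "\<tau> i l = \<one>\<^sub>A.A\<otimes>\<^sub>A.A A.ar i" using \<tau>_inverse[OF i A.A.one_closed] by blast
 moreover have "\<one>\<^sub>A.A\<otimes>\<^sub>A.A A.ar i = A.ar i" using i by simp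
 ultimately have "\<exists>l. l\<in>car (L i) \<and> \<tau> i l = A.ar i" by auto
 thus ?thesis unfolding gen_elt_def by (rule someI_ex)
qed

lemma relation_iff: "(tail Q i, [i, j])\<in>relations Q I \<longleftrightarrow>
  i\<in>arcs Q \<and> j\<in>arcs Q \<and> tail Q j = head Q i \<and> \<not> A.good (tail Q i, [i, j])" by (auto simp: good_path_def relations_def)

text \<open>Every \<open>z\<close> over the generator of \<open>L i\<close> gives a lift of
  \<open>A e \<rightarrow> A\<alpha>\<close>, namely multiplication with \<open>z\<close>; the
  sequence vanishes on \<open>A\<beta>\<close> because \<open>\<beta>\<alpha>\<close> is a
  relation.\<close>

lemma ideal_component:
 assumes rel: "(tail Q i, [i, j])\<in>relations Q I" and z: "z\<in>car (PA (L i))" "\<pi>A (L i) z = gen_elt i"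
 shows "comp_ideal i j = A.cl (L j) (A.Syz (L i)) (\<lambda>x\<in>car (L j). \<tau> j x\<odot>\<^sub>(PA (L i)) z)"
proof -
 have i: "i\<in>arcs Q" and j: "j\<in>arcs Q" "tail Q j = head Q i" and bad: "\<not> A.good (tail Q i, [i, j])" using rel relation_iff by auto
 interpret La: left_module A.A "L i" by (rule fg_modD[OF L_fg[OF i]])
 have hv: "head Q i\<in>verts Q" using i by simp
 note l = gen_elt[OF i]
 have inv: "inv_into (car (L i)) (\<tau> i) (\<tau> i x) = x" if "x\<in>car (L i)" for x
  by (rule inv_into_f_f[OF bij_betw_imp_inj_on[OF \<tau>_bij[OF i]] that])
 show ?thesis unfolding ideal_syzygy_component_def Let_def bas_arrow[symmetric]
 proof (rule A.syzygy_component_cl[OF L_fg[OF j(1)] L_fg[OF i] hv _ z(1)])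
  show "\<tau> j\<in>mod_hom A.A (L j) (left_ideal_module A.A (A.e (head Q i)))"
  proof (rule mod_homI)
   fix x assume x: "x\<in>car (L j)"
   obtain a where a: "a\<in>car A.A" "\<tau> j x = a\<otimes>\<^sub>A.A A.ar j" using \<tau>_form[OF j(1) x] .
   hence "\<tau> j x = (a\<otimes>\<^sub>A.A A.ar j)\<otimes>\<^sub>A.A A.e (head Q i)" using A.ar_e[OF j(1)] j hv by (simp add: A.A.m_assoc)
   thus "\<tau> j x\<in>car (left_ideal_module A.A (A.e (head Q i)))" using a(1) j(1) by (auto intro!: exI[of _ "a\<otimes>\<^sub>A.A A.ar j"])
  qed (use hom_add[OF \<tau>_hom[OF j(1)]] \<tau>_smult[OF j(1)] hom_ext[OF \<tau>_hom[OF j(1)]] in auto)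
  show "\<pi>A (L i) (y\<odot>\<^sub>(PA (L i)) z) = inv_into (car (L i)) (\<tau> i) (y\<otimes>\<^sub>A.A A.ar i)"
   if y: "y\<in>car (left_ideal_module A.A (A.e (head Q i)))" for y
  proof -
   have yc: "y\<in>car A.A" using y hv by auto
   hence "y\<otimes>\<^sub>A.A A.ar i = \<tau> i (y\<odot>\<^sub>(L i) gen_elt i)" using l \<tau>_smult[OF i] by simp
   thus ?thesis using inv[of "y\<odot>\<^sub>(L i) gen_elt i"] hom_smult[OF A.cover_hom[OF L_fg[OF i]] yc z(1)] z(2) yc l by (simp add: La.lsmult_closed)
  qed
  show "inv_into (car (L i)) (\<tau> i) (\<tau> j x\<otimes>\<^sub>A.A A.ar i) = \<zero>\<^sub>(L i)" if x: "x\<in>car (L j)" for x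
  proof -
   obtain a where a: "a\<in>car A.A" "\<tau> j x = a\<otimes>\<^sub>A.A A.ar j" using \<tau>_form[OF j(1) x] .
   hence "\<tau> j x\<otimes>\<^sub>A.A A.ar i = \<tau> i \<zero>\<^sub>(L i)" using A.ar_ar[OF j(1) i bad] i j(1) by (simp add: A.A.m_assoc \<tau>_zero)
   thus ?thesis using inv[of "\<zero>\<^sub>(L i)"] by simp
  qed
 qed
qed

text \<open>The embedding sends the basis vector of \<open>S k\<close> to the arrow of the relation
  quiver from \<open>j\<close> to \<open>k\<close>, and the lift multiplies by \<open>z\<close>; so
  the component picks this arrow applied to \<open>z\<close>.\<close>

lemma simple_component:
 assumes rel: "(tail Q j, [j, k])\<in>relations Q I"
  and z: "z\<in>car (PB (S j))" "B.e j\<odot>\<^sub>(PB (S j)) z = z" "\<pi>B (S j) z = B.\<sigma>_inv j 1"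
 shows "comp_simple j k =
  MB.cl (S k) (MB.Syz (S j)) (B.from_simple (PB (S j)) k (B.ar (tail Q j, [j, k])\<odot>\<^sub>(PB (S j)) z))"
proof -
 let ?P = "PB (S j)"
 let ?r = "(tail Q j, [j, k])"
 have j: "j\<in>arcs Q" and k: "k\<in>arcs Q" using rel relation_iff by auto
 have r: "?r\<in>arcs G" "B.ar ?r = B.bas (j, [?r])" "?r\<in>relations Q I" "(j, [?r])\<in>paths G" using rel j k by auto
 have arc: "B.bas (j, [?r])\<in>car B.A" by (rule B.bas(1)[OF r(4)])
 note Sfg = Obj_CD(1)[OF simple_Obj_C]
 interpret Sa: left_module B.A "S j" by (rule fg_modD[OF Sfg[OF j]])
 interpret Pa: left_module B.A "?P" by (rule fg_modD[OF MB.cover_fg[OF Sfg[OF j]]])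
 have v: "j\<in>verts G" "k\<in>verts G" using j k by auto
 let ?i = "B.from_simple B.reg k (B.bas (j, [?r]))"
 have i: "?i\<in>mod_hom B.A (S k) B.reg"
 proof (rule B.from_simple[OF B.reg_left_module v(2)])
  show "B.e k\<odot>\<^sub>B.reg B.bas (j, [?r]) = B.bas (j, [?r])" using B.e_bas[OF v(2) r(4)] by (simp add: path_target_def)
  show "B.ar g\<odot>\<^sub>B.reg B.bas (j, [?r]) = \<zero>\<^sub>B.reg" if "g\<in>arcs G" for g using B.ar_ar_zero[OF that r(1)] by simp
 qed (use arc in simp)
 have ix: "?i x = B.sc (\<sigma> k x)\<otimes>\<^sub>B.A B.bas (j, [?r])" if "x\<in>car (S k)" for x using that by (simp add: B.from_simple_def)
 have ri: "(\<lambda>x\<in>car (S k). residue G K (\<lambda>r. \<sigma> k x * path_elt (j, [?r]) r)) = ?i" unfolding B.from_simple_def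
 proof (rule restrict_ext)
  fix x
  show "residue G K (\<lambda>r. \<sigma> k x * path_elt (j, [?r]) r) = B.sc (\<sigma> k x)\<odot>\<^sub>B.reg B.bas (j, [?r])"
  proof (rule B.A_eqI)
   note c = B.path_elt_scaled_in[OF r(4), of "\<sigma> k x"]
   show "residue G K (\<lambda>r. \<sigma> k x * path_elt (j, [?r]) r)\<in>car B.A" by (rule B.res_closed[OF c])
   fix p assume p: "B.good p"
   show "B.cf (residue G K (\<lambda>r. \<sigma> k x * path_elt (j, [?r]) r)) p = B.cf (B.sc (\<sigma> k x)\<odot>\<^sub>B.reg B.bas (j, [?r])) p"
    using B.cf_res[OF c p] B.cf_sc_mult(1)[OF arc p] B.bas(2)[OF r(4) p] by (simp add: path_elt_def)
  qed (use arc in simp)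
 qed
 have e: "B.bas (j, [?r])\<otimes>\<^sub>B.A B.e j = B.bas (j, [?r])" using B.ar_e[OF r(1)] by simp
 have ec: "B.e j\<in>car B.A" using v by simp
 note s1 = B.\<sigma>_inv[OF v(1)]
 have "comp_simple j k =
   syzygy_component B.A PB \<pi>B (S k) (left_ideal_module B.A (B.e j)) (S j) ?i (\<lambda>y. B.\<sigma>_inv j (residue_coeff y (j, [])))"
  unfolding simple_syzygy_component_def Let_def G[symmetric] K[symmetric] ri[symmetric]
  by (subst syzygy_component_restrict) (simp add: B.bas_def B.\<sigma>_inv_def)
 also have "\<dots> = MB.cl (S k) (MB.Syz (S j)) (\<lambda>x\<in>car (S k). ?i x\<odot>\<^sub>?P z)"
 proof (rule MB.syzygy_component_cl[OF Sfg[OF k] Sfg[OF j] v(1) _ z(1)])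
  show "?i\<in>mod_hom B.A (S k) (left_ideal_module B.A (B.e j))"
  proof (rule mod_homI)
   fix x assume x: "x\<in>car (S k)"
   have "?i x = (B.sc (\<sigma> k x)\<otimes>\<^sub>B.A B.bas (j, [?r]))\<otimes>\<^sub>B.A B.e j" using ix[OF x] arc ec e by (simp add: B.A.m_assoc)
   thus "?i x\<in>car (left_ideal_module B.A (B.e j))" using arc by (auto intro!: exI[of _ "B.sc (\<sigma> k x)\<otimes>\<^sub>B.A B.bas (j, [?r])"])
  qed (use hom_add[OF i] hom_smult[OF i] hom_ext[OF i] in auto)
  show "\<pi>B (S j) (y\<odot>\<^sub>?P z) = B.\<sigma>_inv j (residue_coeff y (j, []))"
   if y: "y\<in>car (left_ideal_module B.A (B.e j))" for y
  proof -
   have yc: "y\<in>car B.A" using y ec by auto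
   have "\<pi>B (S j) (y\<odot>\<^sub>?P z) = y\<odot>\<^sub>(S j) B.\<sigma>_inv j 1" using hom_smult[OF MB.cover_hom[OF Sfg[OF j]] yc z(1)] z(3) by simp
   also have "\<dots> = B.\<sigma>_inv j (residue_coeff y (j, []))" using s1 yc by (intro B.\<sigma>_eqD[OF v(1)]) (auto simp: Sa.lsmult_closed B.\<sigma>_smult[OF v(1)])
   finally show ?thesis .
  qed
  show "B.\<sigma>_inv j (residue_coeff (?i x) (j, [])) = \<zero>\<^sub>(S j)" if x: "x\<in>car (S k)" for x
  proof -
   have "residue_coeff (?i x) (j, []) = 0" unfolding ix[OF x] using B.cf_sc_mult(1)[OF arc, of "(j, [])"] B.bas(2)[OF r(4), of "(j, [])"] v by simp
   thus ?thesis using s1 by (intro B.\<sigma>_eqD[OF v(1)]) (auto simp: B.\<sigma>_zero[OF v(1)])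
  qed
 qed
 also have "(\<lambda>x\<in>car (S k). ?i x\<odot>\<^sub>?P z) = B.from_simple ?P k (B.bas (j, [?r])\<odot>\<^sub>?P z)" unfolding B.from_simple_def[of "?P"]
  by (rule restrict_ext) (use ix arc z(1) in \<open>simp add: Pa.lsmult_assoc\<close>)
 finally show ?thesis by simp
qed

text \<open>A lift \<open>h\<close> of \<open>g\<close> sends \<open>z\<close> to an element over
  the image of the generator, that is over a multiple \<open>r\<close> of the other generator.
  Stably \<open>h z\<close> may be replaced by \<open>r z'\<close>, and on the summand of
  \<open>u\<close> only the product \<open>u r\<close> matters, which
  \<open>arrow_mult_arrow\<close> shows to be zero or a multiple of \<open>u\<close>.\<close>

lemma loop_ideal_component:
 assumes rel: "(tail Q t, [t, u])\<in>relations Q I" and t': "t'\<in>arcs Q"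
  and g: "A.st.arr g" "fst g = L t" "snd (snd g) = L t'"
 shows "Comp A.D (LoopA A.D g) (comp_ideal t u) = A.Zst (L u) (A.Syz (L t')) \<or>
  (tail Q t', [t', u])\<in>relations Q I \<and> (\<exists>c. Comp A.D (LoopA A.D g) (comp_ideal t u) =
   Comp A.D (comp_ideal t' u) (Scale A.D c (Ident A.D (L u))))"
proof -
 let ?P = "PA (L t)" and ?P' = "PA (L t')" and ?L = "L t" and ?L' = "L t'" and ?l = "gen_elt t" and ?l' = "gen_elt t'"
 have t: "t\<in>arcs Q" and u: "u\<in>arcs Q" "tail Q u = head Q t" and bad: "\<not> A.good (tail Q t, [t, u])" using rel relation_iff by auto
 note fg = L_fg[OF t] L_fg[OF t'] L_fg[OF u(1)]
 note lm = fg_modD[OF fg(1)] fg_modD[OF fg(2)] fg_modD[OF fg(3)]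
 interpret La: left_module A.A "?L" by (rule lm(1))
 interpret La': left_module A.A "?L'" by (rule lm(2))
 interpret P': left_module A.A "?P'" by (rule fg_modD[OF A.cover_fg[OF fg(2)]])
 interpret P: left_module A.A "?P" by (rule fg_modD[OF A.cover_fg[OF fg(1)]])
 note l = gen_elt[OF t] and l' = gen_elt[OF t']
 obtain g0 where g0: "g0\<in>A.hom ?L ?L'" "g = A.cl ?L ?L' g0" using A.arr_rep[OF g(1)] g by metis
 obtain h where h: "A.is_lift ?L ?L' g0 h" using A.lift_ex[OF fg(1,2) g0(1)] by blast
 hence hh: "h\<in>A.hom ?P ?P'" and hp: "!!x. x\<in>car ?P ==> \<pi>A ?L' (h x) = g0 (\<pi>A ?L x)" unfolding A.is_lift_def by auto
 obtain z where z: "z\<in>car ?P" "\<pi>A ?L z = ?l" using A.cover_surj[OF fg(1)] l by (metis imageE)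
 obtain z' where z': "z'\<in>car ?P'" "\<pi>A ?L' z' = ?l'" using A.cover_surj[OF fg(2)] l' by (metis imageE)
 have gl: "g0 ?l\<in>car ?L'" using hom_closed[OF g0(1)] l by blast
 obtain a where a: "a\<in>car A.A" "\<tau> t' (g0 ?l) = a\<otimes>\<^sub>A.A A.ar t'" using \<tau>_form[OF t' gl] .
 have b: "A.ar u\<in>car A.A" using u(1) by simp
 have "\<tau> t (A.ar u\<odot>\<^sub>?L ?l) = \<tau> t \<zero>\<^sub>?L" using \<tau>_smult[OF t _ b] l A.ar_ar[OF u(1) t bad] \<tau>_zero[OF t] by simp
 hence bl: "A.ar u\<odot>\<^sub>?L ?l = \<zero>\<^sub>?L" using l b by (intro \<tau>_eqD[OF t]) (auto simp: La.lsmult_closed)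
 have "A.ar u\<otimes>\<^sub>A.A (a\<otimes>\<^sub>A.A A.ar t') = \<tau> t' (g0 (A.ar u\<odot>\<^sub>?L ?l))" using hom_smult[OF g0(1) b, of "?l"] \<tau>_smult[OF t' gl b] a(2) l by simp
 also have "\<dots> = \<zero>\<^sub>A.A" by (simp add: bl hom_zero[OF lm(1,2) g0(1)] \<tau>_zero[OF t'])
 \<comment> \<open>Multiplying \<open>a\<close> by \<open>t'\<close> on the right forgets some of
   its paths; \<open>r\<close> is the representative for which the product with \<open>u\<close>
   becomes a scalar multiple of \<open>u\<close>.\<close>
 finally obtain r where r: "r\<in>car A.A" "r\<otimes>\<^sub>A.A A.ar t' = a\<otimes>\<^sub>A.A A.ar t'"
  and dich: "A.ar u\<otimes>\<^sub>A.A r = \<zero>\<^sub>A.A \<or> \<not> A.good (tail Q t', [t', u]) \<and> tail Q u = head Q t' \<and>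
   (\<exists>c. A.ar u\<otimes>\<^sub>A.A r = A.sc c\<otimes>\<^sub>A.A A.ar u)" using A.arrow_mult_arrow[OF t' u(1) a(1)] by blast
 have "\<tau> t' (r \<odot>\<^sub>?L' ?l') = \<tau> t' (g0 ?l)" using \<tau>_smult[OF t' _ r(1)] l' r(2) a(2) by simp
 hence rl: "r \<odot>\<^sub>?L' ?l' = g0 ?l" using gl l' r(1) by (intro \<tau>_eqD[OF t']) (auto simp: La'.lsmult_closed)
 let ?j = "\<lambda>x\<in>car (L u). \<tau> u x\<odot>\<^sub>?P z" and ?k = "\<lambda>x\<in>car (L u). \<tau> u x \<odot>\<^sub>?P' h z"
  and ?k' = "\<lambda>x\<in>car (L u). \<tau> u x \<odot>\<^sub>?P' (r \<odot>\<^sub>?P' z')"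
 have hz: "h z\<in>car ?P'" using hom_closed[OF hh z(1)] .
 have rz: "r \<odot>\<^sub>?P' z'\<in>car ?P'" using r(1) z'(1) by (rule P'.lsmult_closed)
 \<comment> \<open>Both elements lie over the image of the generator, so they differ by an element
   of the syzygy, and multiplication with either gives the same stable map.\<close>
 have \<pi>eq: "\<pi>A ?L' (h z) = \<pi>A ?L' (r \<odot>\<^sub>?P' z')" using hp[OF z(1)] z(2) hom_smult[OF A.cover_hom[OF fg(2)] r(1) z'(1)] z'(2) rl by simp
 have tl: "\<tau> u x\<odot>\<^sub>?L ?l = \<zero>\<^sub>?L" if x: "x\<in>car (L u)" for x
 proof -
  obtain b' where "b'\<in>car A.A" "\<tau> u x = b'\<otimes>\<^sub>A.A A.ar u" using \<tau>_form[OF u(1) x] .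
  thus ?thesis using b l bl by (simp add: La.lsmult_assoc La.lsmult_zero)
 qed
 have kerj: "\<pi>A ?L (\<tau> u x\<odot>\<^sub>?P z) = \<zero>\<^sub>?L" if x: "x\<in>car (L u)" for x
  using hom_smult[OF A.cover_hom[OF fg(1)] \<tau>_closed[OF u(1) x] z(1)] z(2) tl[OF x] by simp
 have hj: "\<tau> u x \<odot>\<^sub>?P' h z = h (\<tau> u x\<odot>\<^sub>?P z)" if x: "x\<in>car (L u)" for x using hom_smult[OF hh \<tau>_closed[OF u(1) x] z(1)] by simp
 have kerk: "\<pi>A ?L' (\<tau> u x \<odot>\<^sub>?P' h z) = \<zero>\<^sub>?L'" if x: "x\<in>car (L u)" for x
  using hj[OF x] hp[of "\<tau> u x\<odot>\<^sub>?P z"] P.lsmult_closed[OF \<tau>_closed[OF u(1) x] z(1)] kerj[OF x]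
   hom_zero[OF lm(1,2) g0(1)] by simp
 note j = A.smult_map_steq(1)[OF fg(3,1) \<tau>_hom[OF u(1)] z(1) z(1) refl kerj]
 note k = A.smult_map_steq[OF fg(3,2) \<tau>_hom[OF u(1)] hz rz \<pi>eq kerk]
 note Syz = A.syzygy_fg[OF fg(1)] A.syzygy_fg[OF fg(2)]
 note hr = A.lift_restrict[OF fg(1,2) g0(1) h]
 have hjk: "cmps (L u) (restrict h (hom_ker ?P ?L (\<pi>A ?L))) ?j = ?k"
 proof (rule hom_eqI[OF hom_compose[OF j hr lm(3)] k(1)])
  fix x assume x: "x\<in>car (L u)"
  thus "cmps (L u) (restrict h (hom_ker ?P ?L (\<pi>A ?L))) ?j x = ?k x"
   using kerj[OF x] P.lsmult_closed[OF \<tau>_closed[OF u(1) x] z(1)] hj[OF x] by (simp add: compose_eq hom_ker_def)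
 qed
 have main: "Comp A.D (LoopA A.D g) (comp_ideal t u) = A.cl (L u) (A.Syz ?L') ?k'"
  using ideal_component[OF rel z] A.LoopA_cl[OF fg(1,2) g0(1) h] A.Comp_cl[OF fg(3) Syz j hr] hjk A.cl_eqI[OF fg(3) Syz(2) k(2)] g0(2) by simp
 have k'x: "\<tau> u x \<odot>\<^sub>?P' (r \<odot>\<^sub>?P' z') = b' \<odot>\<^sub>?P' ((A.ar u\<otimes>\<^sub>A.A r) \<odot>\<^sub>?P' z')"
  if "b'\<in>car A.A" "\<tau> u x = b'\<otimes>\<^sub>A.A A.ar u" for x b' using that b r(1) z'(1) by (simp add: P'.lsmult_assoc P'.lsmult_closed)
 from dich show ?thesis
 proof (elim disjE conjE exE)
  assume 0: "A.ar u\<otimes>\<^sub>A.A r = \<zero>\<^sub>A.A"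
  have "?k' = hom_zero (L u) (A.Syz ?L')" unfolding hom_zero_def
  proof (rule restrict_ext)
   fix x assume "x\<in>car (L u)"
   then obtain b' where b': "b'\<in>car A.A" "\<tau> u x = b'\<otimes>\<^sub>A.A A.ar u" using \<tau>_form[OF u(1)] by blast
   from k'x[OF this] show "\<tau> u x \<odot>\<^sub>?P' (r \<odot>\<^sub>?P' z') = \<zero>\<^sub>(A.Syz ?L')" using b'(1) z'(1) by (simp add: 0 P'.zero_lsmult P'.lsmult_zero)
  qed
  thus ?thesis using main by simp
 next
  fix c assume bad': "\<not> A.good (tail Q t', [t', u])" "tail Q u = head Q t'" and c: "A.ar u\<otimes>\<^sub>A.A r = A.sc c\<otimes>\<^sub>A.A A.ar u"
  have rel': "(tail Q t', [t', u])\<in>relations Q I" using relation_iff t' u(1) bad' by blast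
  let ?i = "\<lambda>x\<in>car (L u). \<tau> u x \<odot>\<^sub>?P' z'"
  have bl': "\<tau> u x \<odot>\<^sub>?L' ?l' = \<zero>\<^sub>?L'" if x: "x\<in>car (L u)" for x
  proof -
   obtain b' where b': "b'\<in>car A.A" "\<tau> u x = b'\<otimes>\<^sub>A.A A.ar u" using \<tau>_form[OF u(1) x] .
   have "\<tau> t' (\<tau> u x \<odot>\<^sub>?L' ?l') = (b'\<otimes>\<^sub>A.A A.ar u)\<otimes>\<^sub>A.A A.ar t'" using \<tau>_smult[OF t' _ \<tau>_closed[OF u(1) x]] l' b'(2) by simp
   also have "\<dots> = \<tau> t' \<zero>\<^sub>?L'" using b'(1) b t' A.ar_ar[OF u(1) t' bad'(1)] by (simp add: A.A.m_assoc \<tau>_zero)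
   finally show ?thesis using l' \<tau>_closed[OF u(1) x] by (intro \<tau>_eqD[OF t']) (auto simp: La'.lsmult_closed)
  qed
  have keri: "\<pi>A ?L' (\<tau> u x \<odot>\<^sub>?P' z') = \<zero>\<^sub>?L'" if x: "x\<in>car (L u)" for x
   using hom_smult[OF A.cover_hom[OF fg(2)] \<tau>_closed[OF u(1) x] z'(1)] z'(2) bl'[OF x] by simp
  note i = A.smult_map_steq(1)[OF fg(3,2) \<tau>_hom[OF u(1)] z'(1) z'(1) refl keri]
  let ?s = "A.hom_scale (L u) (L u) c (hom_id (L u))"
  have s: "?s\<in>A.hom (L u) (L u)" by (rule A.hom_scale_in[OF lm(3,3) hom_id_in[OF lm(3)]])
  interpret Lb: monomial_module Q "relations Q I" I d "L u" by (rule A.monomial_module[OF lm(3)])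
  interpret Pm: monomial_module Q "relations Q I" I d "?P'" by (rule A.monomial_module[OF P'.left_module_axioms])
  have "cmps (L u) ?i ?s = ?k'" unfolding compose_def
  proof (rule restrict_ext)
   fix x assume x: "x\<in>car (L u)"
   then obtain b' where b': "b'\<in>car A.A" "\<tau> u x = b'\<otimes>\<^sub>A.A A.ar u" using \<tau>_form[OF u(1)] by blast
   have "?i (?s x) = A.sc c \<odot>\<^sub>?P' (\<tau> u x \<odot>\<^sub>?P' z')"
    using x z'(1) \<tau>_closed[OF u(1) x] \<tau>_smult[OF u(1) x, of "A.sc c"] by (simp add: P'.lsmult_assoc)
   also have "\<tau> u x \<odot>\<^sub>?P' z' = b' \<odot>\<^sub>?P' (A.ar u \<odot>\<^sub>?P' z')" using b' b z'(1) by (simp add: P'.lsmult_assoc)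
   also have "A.sc c \<odot>\<^sub>?P' (b' \<odot>\<^sub>?P' (A.ar u \<odot>\<^sub>?P' z')) =
     b' \<odot>\<^sub>?P' (A.sc c \<odot>\<^sub>?P' (A.ar u \<odot>\<^sub>?P' z'))" using b'(1) b z'(1) by (intro Pm.sc_smult_commute[symmetric]) (auto simp: P'.lsmult_closed)
   also have "A.sc c \<odot>\<^sub>?P' (A.ar u \<odot>\<^sub>?P' z') = (A.ar u\<otimes>\<^sub>A.A r) \<odot>\<^sub>?P' z'" unfolding c using b z'(1) by (intro P'.lsmult_assoc[symmetric]) auto
   finally show "?i (?s x) = \<tau> u x \<odot>\<^sub>?P' (r \<odot>\<^sub>?P' z')" using k'x[OF b'] by simp
  qed
  hence "A.cl (L u) (A.Syz ?L') ?k' = Comp A.D (comp_ideal t' u) (Scale A.D c (Ident A.D (L u)))"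
   using ideal_component[OF rel' z'] A.Comp_cl[OF fg(3,3) Syz(2) s i] A.Scale_cl[OF fg(3,3) hom_id_in[OF lm(3)], of c] by (simp add: A.D_simps(3))
  thus ?thesis using main rel' by (intro disjI2 conjI exI[of _ c]) simp_all
 qed
qed

end

section \<open>Fullness after one application of the loop functors\<close>

context relation_functor
begin

text \<open>Here linearity of \<open>F\<close> over the field, beyond additivity, enters: the scalar
  found on the side of the ideals has to be realised on the side of the simple modules.\<close>

lemma F_scaled_ide: "M\<in>Obj C ==> F1 (Scale C c (Ident C M)) = Scale A.D c (Ident A.D (F0 M))"
proof -
 assume M: "M\<in>Obj C"
 have "Ident C M\<in>Arr C M M" using C.arrD(1)[OF C.ide_arr(1)[OF M]] C.ide_arr(2,3)[OF M] by simp
 hence "F1 (Scale C c (Ident C M)) = Scale A.D c (F1 (Ident C M))" using linear_F M unfolding linear_on_arrows_def by blast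
 thus ?thesis using CF.F_ide[OF M] by simp
qed

lemma scaled_ide:
 assumes M: "M\<in>Obj C"
 shows "Scale C c (Ident C M) = MB.cl M M (MB.hom_scale M M c (hom_id M))"
  and "MB.hom_scale M M c (hom_id M)\<in>MB.hom M M" and "C.arr (Scale C c (Ident C M))"
  and "fst (Scale C c (Ident C M)) = M" and "snd (snd (Scale C c (Ident C M))) = M"
proof -
 note fg = Obj_CD(1)[OF M]
 note id = hom_id_in[OF fg_modD[OF fg]]
 show 1: "Scale C c (Ident C M) = MB.cl M M (MB.hom_scale M M c (hom_id M))" using MB.Scale_cl[OF fg fg id] by (simp add: MB.D_simps(3))
 show 2: "MB.hom_scale M M c (hom_id M)\<in>MB.hom M M" using fg_modD[OF fg] id by (intro MB.hom_scale_in) auto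
 show "C.arr (Scale C c (Ident C M))" unfolding 1 by (rule cl_C_arr[OF M M 2])
 show "fst (Scale C c (Ident C M)) = M" "snd (snd (Scale C c (Ident C M))) = M" unfolding 1 by simp_all
qed

lemma simple_component_arr:
 assumes rel: "(tail Q i, [i, j])\<in>relations Q I"
  and z: "z\<in>car (PB (S i))" "B.e i\<odot>\<^sub>(PB (S i)) z = z" "\<pi>B (S i) z = B.\<sigma>_inv i 1"
 shows "B.from_simple (PB (S i)) j (B.ar (tail Q i, [i, j])\<odot>\<^sub>(PB (S i)) z)\<in>MB.hom (S j) (MB.Syz (S i))" (is "?f\<in>_")
  and "C.arr (comp_simple i j)"
  and "fst (comp_simple i j) = S j"
  and "snd (snd (comp_simple i j)) = MB.Syz (S i)"
proof -
 let ?P = "PB (S i)"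
 let ?r = "(tail Q i, [i, j])"
 have i: "i\<in>arcs Q" and j: "j\<in>arcs Q" using rel relation_iff by auto
 have v: "i\<in>verts G" "j\<in>verts G" and r: "?r\<in>arcs G" "head G ?r = j" using i j rel by auto
 note SO = simple_Obj_C[OF i] simple_Obj_C[OF j]
 note fg = Obj_CD(1)[OF SO(1)] Obj_CD(1)[OF SO(2)]
 note lmP = fg_modD[OF MB.cover_fg[OF fg(1)]] and lmO = fg_modD[OF MB.syzygy_fg[OF fg(1)]]
 interpret P: monomial_module G X K 2 "?P" by (rule B.monomial_module[OF lmP])
 interpret Sa: monomial_module G X K 2 "S i" by (rule B.monomial_module[OF fg_modD[OF fg(1)]])
 let ?w = "B.ar ?r\<odot>\<^sub>?P z"
 have wc: "?w\<in>car ?P" by (rule P.ar_closed[OF r(1) z(1)])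
 have rc: "B.ar ?r\<in>car B.A" by (rule B.bas(1)[OF B.arc_path[OF r(1)]])
 have "\<pi>B (S i) ?w = B.ar ?r\<odot>\<^sub>(S i) B.\<sigma>_inv i 1" using hom_smult[OF MB.cover_hom[OF fg(1)] rc z(1)] z(3) by simp
 also have "\<dots> = \<zero>\<^sub>(S i)" using B.simple_killed[OF v(1)] B.killed_iff[OF fg_modD[OF fg(1)]] r(1) B.\<sigma>_inv(1)[OF v(1)] by blast
 finally have wO: "?w\<in>car (MB.Syz (S i))" using wc by (simp add: MB.in_syzygy)
 have "B.from_simple (MB.Syz (S i)) j ?w\<in>MB.hom (S j) (MB.Syz (S i))"
 proof (rule B.from_simple[OF lmO v(2) wO])
  show "B.e j\<odot>\<^sub>(MB.Syz (S i)) ?w = ?w" using P.e_ar_smult[OF r(1) z(1)] r(2) by simp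
  show "B.ar g\<odot>\<^sub>(MB.Syz (S i)) ?w = \<zero>\<^sub>(MB.Syz (S i))" if "g\<in>arcs G" for g using B.ar_ar_smult[OF lmP that r(1) z(1)] by simp
 qed
 moreover have "B.from_simple (MB.Syz (S i)) j ?w = ?f" by (simp add: B.from_simple_def)
 ultimately show f: "?f\<in>MB.hom (S j) (MB.Syz (S i))" by simp
 show "C.arr (comp_simple i j)"
  "fst (comp_simple i j) = S j"
  "snd (snd (comp_simple i j)) = MB.Syz (S i)" unfolding simple_component[OF rel z] using cl_C_arr[OF SO(2) syzygy_Obj_C[OF fg(1)] f] by simp_all
qed

lemma simple_cover_element:
 assumes "i\<in>arcs Q"
 obtains z where "z\<in>car (PB (S i))" "B.e i\<odot>\<^sub>(PB (S i)) z = z" "\<pi>B (S i) z = B.\<sigma>_inv i 1"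
  "projective_cover B.A (PB (S i)) (\<pi>B (S i)) (S i)"
proof -
 have v: "i\<in>verts G" using assms by simp
 have pc: "projective_cover B.A (PB (S i)) (\<pi>B (S i)) (S i)"
  using MB.covers Obj_CD(1)[OF simple_Obj_C[OF assms]] by (auto simp: projective_covers_def)
 from B.simple_cover_top[OF v pc] that[OF _ _ _ pc] show ?thesis by blast
qed

lemma ideal_component_lifts:
 assumes rel: "(tail Q i, [i, j])\<in>relations Q I"
 shows "CF.lifts (S j) (S i) (comp_ideal i j)"
proof -
 have i: "i\<in>arcs Q" using rel relation_iff by auto
 obtain z where z: "z\<in>car (PB (S i))" "B.e i\<odot>\<^sub>(PB (S i)) z = z" "\<pi>B (S i) z = B.\<sigma>_inv i 1" using simple_cover_element[OF i] by blast
 show ?thesis unfolding CF.lifts_def using simple_component_arr(2-4)[OF rel z] \<delta>_simple[OF rel, symmetric]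
  by (intro exI[of _ "comp_simple i j"] conjI) simp_all
qed

text \<open>A map from \<open>S j\<close> into the syzygy of \<open>S i\<close> is given by an
  element of that syzygy, so it is zero or a scalar multiple of the component of the relation formed
  by \<open>i\<close> and \<open>j\<close>. There \<open>\<delta>\<close> is known, and
  \<open>loop_ideal_component\<close> shows that the loop of \<open>g\<close> yields zero or a
  multiple of another component.\<close>

lemma loop_core:
 assumes W: "W\<in>S ` arcs Q" "W'\<in>S ` arcs Q" and g: "A.st.arr g" "fst g = F0 W" "snd (snd g) = F0 W'"
  and v: "C.arr v" "fst v\<in>S ` arcs Q" "snd (snd v) = LoopO C W"
 shows "CF.lifts (fst v) W' (Comp A.D (LoopA A.D g) (Comp A.D (\<delta> W) (F1 v)))"
proof -
 obtain i i' j where i: "i\<in>arcs Q" "W = S i" and i': "i'\<in>arcs Q" "W' = S i'" and j: "j\<in>arcs Q" "fst v = S j" using W v(2) by blast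
 let ?P = "PB (S i)"
 have vG: "i\<in>verts G" "j\<in>verts G" using i j by auto
 note SO = simple_Obj_C[OF i(1)] simple_Obj_C[OF i'(1)] simple_Obj_C[OF j(1)]
 note fg = Obj_CD(1)[OF SO(1)] Obj_CD(1)[OF SO(3)]
 note Syz = MB.syzygy_fg[OF fg(1)] and SyzO = syzygy_Obj_C[OF fg(1)]
 have g': "fst g = L i" "snd (snd g) = L i'" using g F_simple i i' by auto
 have vt: "snd (snd v) = MB.Syz (S i)" using v(3) i(2) by simp
 obtain v0 where v0: "v0\<in>MB.hom (S j) (MB.Syz (S i))" "v = MB.cl (S j) (MB.Syz (S i)) v0" using C_arr_rep[OF v(1)] j(2) vt by metis
 obtain z where z: "z\<in>car ?P" "B.e i\<odot>\<^sub>?P z = z" "\<pi>B (S i) z = B.\<sigma>_inv i 1"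
  and pc: "projective_cover B.A ?P (\<pi>B (S i)) (S i)" using simple_cover_element[OF i(1)] by blast
 interpret P: monomial_module G X K 2 "?P" by (rule B.monomial_module[OF fg_modD[OF MB.cover_fg[OF fg(1)]]])
 let ?w = "v0 (B.\<sigma>_inv j 1)" and ?r = "(tail Q i, [i, j])"
 note w = B.hom_from_simple[OF fg_modD[OF Syz] vG(2) v0(1)]
 \<comment> \<open>A relation is determined by its two arrows, so the relation quiver has no
   parallel arrows.\<close>
 have par: "t = ?r" if "t\<in>arcs G" "tail G t = i" "head G t = j" for t using A.relation_arrow[of t I] that by auto
 have z0: "Comp A.D (LoopA A.D g) (A.Zst (L j) (A.Syz (L i))) = A.Zst (L j) (A.Syz (L i'))"
  using A.st.comp_zero(1)[OF A.st.LA_arr(1)[OF g(1)], of "L j" "A.Syz (L i)"] A.st.LA_arr(2,3)[OF g(1)] g' L_fg[OF j(1)] by simp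
 have zl: "CF.lifts (S j) (S i') (A.Zst (L j) (A.Syz (L i')))" using CF.lifts_zero[OF SO(3,2)] F_simple i'(1) j(1) by simp
 have wk: "?w\<in>hom_ker ?P (S i) (\<pi>B (S i))" "B.e j\<odot>\<^sub>?P ?w = ?w" using w(2,3) by simp_all
 have "?w = \<zero>\<^sub>?P \<or> ?r\<in>arcs G \<and> tail G ?r = i \<and> head G ?r = j \<and>
   (\<exists>c. ?w = B.sc c\<odot>\<^sub>?P (B.ar ?r\<odot>\<^sub>?P z))" by (rule B.simple_syzygy_element[OF vG pc z wk]) (rule par)
 thus ?thesis
 proof (elim disjE conjE exE)
  assume w0: "?w = \<zero>\<^sub>?P"
  interpret O: left_module B.A "MB.Syz (S i)" by (rule fg_modD[OF Syz])
  have "v0 = hom_zero (S j) (MB.Syz (S i))" by (rule hom_eqI[OF v0(1) hom_zero_in[OF fg_modD[OF fg(2)] fg_modD[OF Syz]]], subst w(1))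
    (simp add: w0 B.from_simple_def P.lsmult_zero)
  hence "F1 v = A.Zst (L j) (F0 (MB.Syz (S i)))" using CF.F_zero[OF SO(3) SyzO] F_simple[OF j(1)] v0(2) by simp
  hence "Comp A.D (\<delta> W) (F1 v) = A.Zst (L j) (A.Syz (L i))"
   using A.st.comp_zero(1)[OF CF.\<delta>_arr(1)[OF SO(1)], of "L j" "F0 (MB.Syz (S i))"] CF.\<delta>_ends[OF SO(1)]
    L_fg[OF j(1)] F_simple[OF i(1)] i(2) by simp
  thus ?thesis using z0 zl i'(2) j(2) by simp
 next
  fix c assume r: "?r\<in>arcs G" and wc: "?w = B.sc c\<odot>\<^sub>?P (B.ar ?r\<odot>\<^sub>?P z)"
  have rel: "?r\<in>relations Q I" using r by simp
  let ?y = "B.ar ?r\<odot>\<^sub>?P z" and ?s = "MB.hom_scale (S j) (S j) c (hom_id (S j))"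
  have y: "?y\<in>car ?P" by (rule P.ar_closed[OF r z(1)])
  note c = simple_component_arr[OF rel z] and s = scaled_ide[OF SO(3), of c]
  interpret Sb: left_module B.A "S j" by (rule fg_modD[OF fg(2)])
  have "v0 = cmps (S j) (B.from_simple ?P j ?y) ?s"
  proof (rule hom_eqI[OF v0(1) hom_compose[OF s(2) c(1) fg_modD[OF fg(2)]]], subst w(1))
   fix x assume x: "x\<in>car (S j)"
   have "B.sc c\<odot>\<^sub>(S j) x\<in>car (S j)" using x by (simp add: Sb.lsmult_closed)
   moreover have "\<sigma> j (B.sc c\<odot>\<^sub>(S j) x) = \<sigma> j x * c" using x vG(2) by (simp add: B.\<sigma>_smult[OF vG(2)])
   ultimately show "B.from_simple (MB.Syz (S i)) j ?w x = cmps (S j) (B.from_simple ?P j ?y) ?s x"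
    unfolding wc using x y by (simp add: B.from_simple_def compose_eq)
  qed
  hence "v = Comp C (comp_simple i j) (Scale C c (Ident C (S j)))"
   unfolding v0(2) s(1) simple_component[OF rel z] using MB.Comp_cl[OF fg(2,2) Syz s(2) c(1)] by simp
  hence Fv: "F1 v = Comp A.D (F1 (comp_simple i j)) (F1 (Scale C c (Ident C (S j))))" using CF.F_comp[OF s(3) c(2)] s(5) c(3) by simp
  let ?\<iota> = "comp_simple i j" and ?\<kappa> = "comp_ideal i j"
   and ?sc = "Scale C c (Ident C (S j))"
  note arrs = CF.F_arr[OF s(3)] CF.F_arr[OF c(2)] CF.\<delta>_arr(1)[OF SO(1)] A.st.LA_arr[OF g(1)]
  have ends: "snd (snd (F1 ?sc)) = fst (F1 ?\<iota>)" "snd (snd (F1 ?\<iota>)) = fst (\<delta> (S i))" "snd (snd (\<delta> (S i))) = fst (LoopA A.D g)"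
   using arrs s(5) c(3,4) CF.\<delta>_ends[OF SO(1)] g' F_simple[OF i(1)] by simp_all
  have "Comp A.D (LoopA A.D g) (Comp A.D (\<delta> W) (F1 v)) = Comp A.D (Comp A.D (LoopA A.D g) (Comp A.D (\<delta> (S i)) (F1 ?\<iota>))) (F1 ?sc)"
   unfolding Fv i(2) using arrs(1,4,7,8) ends by (simp add: A.st.comp_assoc)
  also have "Comp A.D (\<delta> (S i)) (F1 ?\<iota>) = ?\<kappa>" by (rule \<delta>_simple[OF rel])
  finally have eq: "Comp A.D (LoopA A.D g) (Comp A.D (\<delta> W) (F1 v)) = Comp A.D (Comp A.D (LoopA A.D g) ?\<kappa>) (F1 ?sc)" .
  have "CF.lifts (S j) (S i') (Comp A.D (LoopA A.D g) ?\<kappa>)" using loop_ideal_component[OF rel i'(1) g(1) g']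
  proof (elim disjE conjE exE)
   assume "Comp A.D (LoopA A.D g) ?\<kappa> = A.Zst (L j) (A.Syz (L i'))"
   thus ?thesis using zl by simp
  next
   fix c' assume rel': "(tail Q i', [i', j])\<in>relations Q I"
    and e: "Comp A.D (LoopA A.D g) ?\<kappa> = Comp A.D (comp_ideal i' j) (Scale A.D c' (Ident A.D (L j)))"
   from CF.lifts_comp[OF SO(2) scaled_ide(3,5)[OF SO(3), of c'] ideal_component_lifts[OF rel']]
   show ?thesis unfolding e F_scaled_ide[OF SO(3)] F_simple[OF j(1)] scaled_ide(4)[OF SO(3)] .
  qed
  from CF.lifts_comp[OF SO(2) s(3,5) this] show ?thesis unfolding eq s(4) j(2) i'(2) .
 qed
qed

lemma loop_full:
 assumes "M\<in>Obj C" "N\<in>Obj C" "A.st.arr g" "fst g = F0 M" "snd (snd g) = F0 N"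
 shows "CF.lifts (LoopO C M) N (Comp A.D (LoopA A.D g) (\<delta> M))"
proof (rule CF.loop_full_if_on_sums[of "S ` arcs Q"])
 show "S ` arcs Q \<subseteq> Obj C" using simple_Obj_C by blast
 show "Ident C M\<in>C.sums_through (S ` arcs Q) M M" if "M\<in>Obj C" for M by (rule ide_sums_through[OF that])
 show "CF.lifts (fst v) W' (Comp A.D (LoopA A.D g) (Comp A.D (\<delta> W) (F1 v)))"
  if "W\<in>S ` arcs Q" "W'\<in>S ` arcs Q" "A.st.arr g" "fst g = F0 W" "snd (snd g) = F0 W'"
   "C.arr v" "fst v\<in>S ` arcs Q" "snd (snd v) = LoopO C W" for W W' g v by (rule loop_core[OF that])
qed (rule assms)+

end

section \<open>Second syzygies are sums of ideals generated by arrows\<close>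

lemma trivial_module:
 assumes "ring R"
 shows "\<lparr>carrier = {x}, mult = undefined, one = undefined, zero = x, add = (\<lambda>_ _. x), smult = (\<lambda>_ _. x)\<rparr>\<in>fg_mod R"
  (is "?M\<in>_")
proof -
 have "abelian_group ?M" by (rule abelian_groupI) auto
 hence lm: "left_module R ?M" using assms by (auto simp: left_module_def left_module_axioms_def)
 interpret M: left_module R ?M by (rule lm)
 show ?thesis
 proof (rule fg_modI[OF lm, of "{}"])
  fix H assume "submodule H R ?M"
  from M.lsubmoduleD(1,2)[OF this] show "H = car ?M" by auto
 qed auto
qed

lemma (in stable_modules) trivial_ide_zero:
 assumes M: "M\<in>fg" and c: "car M = {\<zero>\<^sub>M}"
 shows "Ident D M = Zst M M"
proof -
 have "hom_id M = hom_zero M M" by (rule hom_eqI[OF hom_id_in[OF fg_modD[OF M]] hom_zero_in[OF fg_modD[OF M] fg_modD[OF M]]]) (use c in auto)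
 thus ?thesis by (simp add: D_simps(3))
qed

lemma (in preadditive) zero_objects_iso:
 assumes "M\<in>Obj C" "N\<in>Obj C" "ide M = Zero M M" "ide N = Zero N N"
 shows "iso (Zero M N) (Zero N M)" using assms by (simp add: iso_def)

context relation_functor
begin

lemma biprod_Obj_C:
 assumes M: "M\<in>Obj C" and N: "N\<in>Obj C" and b: "is_biprod B.A M N T u v p q"
 shows "T\<in>Obj C"
proof -
 note fg = Obj_CD(1)[OF M] Obj_CD(1)[OF N]
 have T: "T\<in>MB.fg" and h: "u\<in>MB.hom M T" "v\<in>MB.hom N T" "p\<in>MB.hom T M" "q\<in>MB.hom T N"
  and dec: "!!z. z\<in>car T ==> z = u (p z) \<oplus>\<^sub>T v (q z)" using b unfolding is_biprod_def by blast+
 note lm = fg_modD[OF fg(1)] fg_modD[OF fg(2)] fg_modD[OF T]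
 interpret T: left_module B.A T by (rule lm(3))
 have "B.is_killed T" unfolding B.killed_iff[OF lm(3)]
 proof (intro ballI)
  fix g x assume g: "g\<in>arcs G" and x: "x\<in>car T"
  have a: "B.ar g\<in>car B.A" by (rule B.bas(1)[OF B.arc_path[OF g]])
  have "p (B.ar g\<odot>\<^sub>T x) = \<zero>\<^sub>M" "q (B.ar g\<odot>\<^sub>T x) = \<zero>\<^sub>N"
   using hom_smult[OF h(3) a x] hom_smult[OF h(4) a x] hom_closed[OF h(3) x] hom_closed[OF h(4) x]
    Obj_CD(2)[OF M] Obj_CD(2)[OF N] B.killed_iff[OF lm(1)] B.killed_iff[OF lm(2)] g by auto
  thus "B.ar g\<odot>\<^sub>T x = \<zero>\<^sub>T" using dec[OF T.lsmult_closed[OF a x]] hom_zero[OF lm(1,3) h(1)] hom_zero[OF lm(2,3) h(2)] by simp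
 qed
 thus ?thesis using Obj_C[OF T] by blast
qed

lemma biprod_C:
 assumes M: "M\<in>Obj C" and N: "N\<in>Obj C"
 obtains T u v p q where "T\<in>Obj C" "C.biprod M N T u v p q"
proof -
 note fg = Obj_CD(1)[OF M] Obj_CD(1)[OF N]
 obtain T u v p q where b: "is_biprod B.A M N T u v p q" using MB.biprod_ex[OF fg] by blast
 have T: "T\<in>Obj C" by (rule biprod_Obj_C[OF M N b])
 from MB.cl_biprod[OF fg b] T M N
 have "C.biprod M N T (MB.cl M T u) (MB.cl N T v) (MB.cl T M p) (MB.cl T N q)"
  unfolding C.biprod_def MB.st.biprod_def C_arr_iff by (simp del: C_simps(1))
 thus ?thesis using that T by blast
qed

text \<open>By \<open>ind\<close>, adding \<open>y\<close> to the family adds a direct summand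
  generated by \<open>el y\<close>, and this summand is a copy of the ideal of \<open>fst y\<close>.
  As \<open>F\<close> preserves biproducts, the semisimple module grows by \<open>S (fst y)\<close>
  at the same time.\<close>

lemma generated_iso:
 fixes N
 assumes N: "N\<in>A.fg"
 defines "gen \<equiv> monomial_module.gen Q I N" and "lc \<equiv> monomial_module.lc Q I N"
 assumes Y: "finite Y" "Y \<subseteq> arcs Q \<times> car N"
  and ind: "!!a y. a\<in>Y \<rightarrow> car A.A ==> lc a Y = \<zero>\<^sub>N ==> y\<in>Y ==> a y\<otimes>\<^sub>A.A A.ar (fst y) = \<zero>\<^sub>A.A"
 shows "\<exists>U w w'. U\<in>Obj C \<and> A.st.iso w w' \<and> fst w = N\<lparr>carrier := gen Y\<rparr> \<and> snd (snd w) = F0 U" using Y ind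
proof (induction Y rule: finite_induct)
 interpret N: monomial_module Q "relations Q I" I d N by (rule A.monomial_module[OF fg_modD[OF N]])
 case empty
 have g: "gen {} = {\<zero>\<^sub>N}" unfolding gen_def lc_def N.gen_def N.lc_def by auto
 let ?M = "N\<lparr>carrier := gen {}\<rparr>"
 have M: "?M\<in>A.fg" unfolding g by (rule A.sub_fg[OF N N.zero_lsubmodule])
 have Mz: "Ident A.D ?M = A.Zst ?M ?M" by (rule A.trivial_ide_zero[OF M]) (simp add: g)
 \<comment> \<open>For the empty family both sides are zero objects stably: of \<open>F0 U\<close>
   only the vanishing of its identity is known, and that is enough for an isomorphism.\<close>
 define U :: "((('e, ('v, 'e) path) path => 'k) set, 'u) module"
  where "U = \<lparr>carrier = {undefined}, mult = undefined, one = undefined, zero = undefined, add = (\<lambda>_ _. undefined), smult = (\<lambda>_ _. undefined)\<rparr>"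
 have Ufg: "U\<in>MB.fg" unfolding U_def by (rule trivial_module[OF B.A.ring_axioms])
 have Uc: "car U = {\<zero>\<^sub>U}" by (simp add: U_def)
 have "B.is_killed U" unfolding B.killed_iff[OF fg_modD[OF Ufg]] by (simp add: U_def)
 hence U: "U\<in>Obj C" using Obj_C[OF Ufg] by blast
 have "Ident C U = MB.Zst U U" using MB.trivial_ide_zero[OF Ufg Uc] by simp
 hence "Ident A.D (F0 U) = A.Zst (F0 U) (F0 U)" using CF.F_ide[OF U] CF.F_zero[OF U U] by simp
 from A.st.zero_objects_iso[OF _ CF.F_Obj[OF U] Mz this] M
 have "A.st.iso (A.Zst ?M (F0 U)) (A.Zst (F0 U) ?M)" by simp
 thus ?case using U by (intro exI[of _ U] exI[of _ "A.Zst ?M (F0 U)"] exI) auto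
next
 interpret N: monomial_module Q "relations Q I" I d N by (rule A.monomial_module[OF fg_modD[OF N]])
 case (insert y Y)
 have y: "fst y\<in>arcs Q" "snd y\<in>car N" and Y: "Y \<subseteq> arcs Q \<times> car N" using insert.prems(1) by auto
 note lci = N.lc_insert[OF insert.hyps insert.prems(1), folded lc_def]
 have elY: "N.el x\<in>car N" if "x\<in>insert y Y" for x using N.el_closed insert.prems(1) that by auto
 have arc: "A.ar (fst y)\<in>car A.A" using y by simp
 \<comment> \<open>A relation over \<open>Y\<close> becomes one over the larger family by giving
   \<open>y\<close> the coefficient zero.\<close>
 have ind': "a x\<otimes>\<^sub>A.A A.ar (fst x) = \<zero>\<^sub>A.A" if a: "a\<in>Y \<rightarrow> car A.A" "lc a Y = \<zero>\<^sub>N" and x: "x\<in>Y" for a x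
 proof -
  let ?a = "\<lambda>x. if x = y then \<zero>\<^sub>A.A else a x"
  have a': "?a\<in>insert y Y \<rightarrow> car A.A" using a(1) by auto
  have "lc ?a Y = lc a Y" unfolding lc_def N.lc_def using insert.hyps(2) a(1) elY by (intro N.M.finsum_cong') (auto simp: Pi_iff N.lsmult_closed)
  hence "lc ?a (insert y Y) = \<zero>\<^sub>N" using lci[OF a'] a(2) elY by (simp add: N.zero_lsmult)
  from insert.prems(2)[OF a' this, of x] show ?thesis using x insert.hyps(2) by (auto split: if_splits)
 qed
 have "\<exists>U w w'. U\<in>Obj C \<and> A.st.iso w w' \<and> fst w = N\<lparr>carrier := gen Y\<rparr> \<and> snd (snd w) = F0 U" by (rule insert.IH[OF Y]) (rule ind')
 then obtain U w w' where U: "U\<in>Obj C" and w: "A.st.iso w w'" "fst w = N\<lparr>carrier := gen Y\<rparr>" "snd (snd w) = F0 U" by blast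
 let ?K = "N\<lparr>carrier := gen (insert y Y)\<rparr>"
 have sub: "submodule (gen (insert y Y)) A.A N" "submodule (gen Y) A.A N" unfolding gen_def using N.gen_submodule insert.prems(1) Y by blast+
 note KD = N.lsubmoduleD[OF sub(1)] and YD = N.lsubmoduleD[OF sub(2)]
 have K: "?K\<in>A.fg" by (rule A.sub_fg[OF N sub(1)])
 have gY: "N\<lparr>carrier := gen Y\<rparr>\<in>A.fg" by (rule A.sub_fg[OF N sub(2)])
 interpret K: left_module A.A ?K by (rule fg_modD[OF K])
 have elg: "N.el x\<in>gen (insert y Y)" if "x\<in>insert y Y" for x unfolding gen_def using N.el_gen[OF insert.prems(1) _ that] insert.hyps(1) by simp
 have gsub: "gen Y \<subseteq> gen (insert y Y)" unfolding gen_def by (rule N.gen_least[OF sub(1)[unfolded gen_def]]) (use elg in \<open>simp add: gen_def\<close>)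
 have subK: "submodule (gen Y) A.A ?K" using YD gsub by (intro K.lsubmoduleI) auto
 \<comment> \<open>Multiplication by \<open>snd y\<close> is defined on the whole algebra, so on the
   ideal of \<open>fst y\<close> it sends \<open>a \<gamma>\<close> to \<open>a \<gamma> q\<close>
   without any comparison of annihilators.\<close>
 let ?u = "\<lambda>x\<in>car (L (fst y)). \<tau> (fst y) x\<odot>\<^sub>N snd y"
 have lmL: "left_module A.A (L (fst y))" by (rule fg_modD[OF L_fg[OF y(1)]])
 have ux: "\<tau> (fst y) x\<odot>\<^sub>N snd y = a\<odot>\<^sub>N N.el y" if "a\<in>car A.A" "\<tau> (fst y) x = a\<otimes>\<^sub>A.A A.ar (fst y)" for a x
  using that arc y(2) by (simp add: N.el_def N.lsmult_assoc)
 have u: "?u\<in>A.hom (L (fst y)) ?K"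
 proof (rule hom_corestrict[OF A.smult_hom[OF lmL N.left_module_axioms \<tau>_hom[OF y(1)] y(2)]])
  fix x assume x: "x\<in>car (L (fst y))"
  obtain a where a: "a\<in>car A.A" "\<tau> (fst y) x = a\<otimes>\<^sub>A.A A.ar (fst y)" using \<tau>_form[OF y(1) x] .
  from ux[OF a] show "?u x\<in>gen (insert y Y)" using x KD(4)[OF a(1) elg[of y]] by simp
 qed
 have eqm: "?K\<lparr>carrier := gen Y\<rparr> = N\<lparr>carrier := gen Y\<rparr>" by simp
 have "\<exists>v p q. is_biprod A.A (L (fst y)) (?K\<lparr>carrier := gen Y\<rparr>) ?K ?u v p q"
 proof (rule internal_biprod[OF K L_fg[OF y(1)] u subK])
  show "?K\<lparr>carrier := gen Y\<rparr>\<in>A.fg" unfolding eqm by (rule gY)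
  fix k assume "k\<in>car ?K"
  then obtain a where a: "a\<in>insert y Y \<rightarrow> car A.A" "k = lc a (insert y Y)" by (auto simp: gen_def lc_def N.gen_def)
  have ay: "a y\<in>car A.A" using a(1) by auto
  obtain x where x: "x\<in>car (L (fst y))" "\<tau> (fst y) x = a y\<otimes>\<^sub>A.A A.ar (fst y)" using \<tau>_inverse[OF y(1) ay] .
  have "lc a Y\<in>gen Y" unfolding gen_def lc_def N.gen_def using a(1) by blast
  moreover have "k = ?u x \<oplus>\<^sub>?K lc a Y" using a lci[OF a(1)] ux[OF ay x(2)] x(1) by simp
  ultimately show "\<exists>x\<in>car (L (fst y)). \<exists>n\<in>gen Y. k = ?u x \<oplus>\<^sub>?K n" using x(1) by blast
 next
  fix x assume x: "x\<in>car (L (fst y))" and ug: "?u x\<in>gen Y"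
  obtain a where a: "a\<in>car A.A" "\<tau> (fst y) x = a\<otimes>\<^sub>A.A A.ar (fst y)" using \<tau>_form[OF y(1) x] .
  have ug': "a\<odot>\<^sub>N N.el y\<in>gen Y" using ug ux[OF a] x by simp
  from YD(5)[OF this] obtain b where b: "b\<in>Y \<rightarrow> car A.A" "\<ominus>\<^sub>N (a\<odot>\<^sub>N N.el y) = lc b Y" by (auto simp: gen_def lc_def N.gen_def)
  \<comment> \<open>An element of the new summand inside \<open>gen Y\<close> is a relation with
    coefficient \<open>a\<close> at \<open>y\<close>; the hypothesis gives
    \<open>a \<gamma> = 0\<close>, that is \<open>\<tau> (fst y) x = 0\<close>.\<close>
  let ?b = "\<lambda>x. if x = y then a else b x"
  have b': "?b\<in>insert y Y \<rightarrow> car A.A" using b(1) a(1) by auto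
  have "lc ?b Y = lc b Y" unfolding lc_def N.lc_def using insert.hyps(2) b(1) elY by (intro N.M.finsum_cong') (auto simp: Pi_iff N.lsmult_closed)
  hence "lc ?b (insert y Y) = \<zero>\<^sub>N" using lci[OF b'] b(2)[symmetric] N.M.r_neg[of "a\<odot>\<^sub>N N.el y"] YD(1) ug' by auto
  from insert.prems(2)[OF b' this, of y] have "\<tau> (fst y) x = \<zero>\<^sub>A.A" using a(2) by simp
  thus "x = \<zero>\<^sub>(L (fst y))"
   using \<tau>_eqD[OF y(1) x] \<tau>_zero[OF y(1)] abelian_monoid.zero_closed[OF abelian_group.axioms(1)[OF left_module.axioms(2)[OF lmL]]] by simp
 qed
 then obtain v p q where "is_biprod A.A (L (fst y)) (N\<lparr>carrier := gen Y\<rparr>) ?K ?u v p q" unfolding eqm by blast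
 from A.cl_biprod[OF L_fg[OF y(1)] gY this]
 obtain u1 v1 p1 q1 where b1: "A.st.biprod (L (fst y)) (N\<lparr>carrier := gen Y\<rparr>) ?K u1 v1 p1 q1" by blast
 obtain T u2 v2 p2 q2 where T: "T\<in>Obj C" and "C.biprod (S (fst y)) U T u2 v2 p2 q2" using biprod_C[OF simple_Obj_C[OF y(1)] U] by blast
 from CF.F_biprod[OF this(2)]
 have b2: "A.st.biprod (L (fst y)) (F0 U) (F0 T) (F1 u2) (F1 v2) (F1 p2) (F1 q2)" unfolding F_simple[OF y(1)] .
 have LO: "L (fst y)\<in>Obj A.D" using L_fg[OF y(1)] by simp
 show ?case using A.st.biprod_iso[OF b1 b2 A.st.iso_ide[OF LO] A.st.ide_arr(2,3)[OF LO] w] T by blast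
qed

lemma dense:
 assumes W: "W\<in>A.fg"
 shows "\<exists>U w w'. U\<in>Obj C \<and> A.st.iso w w' \<and> fst w = A.Syz (A.Syz W) \<and> snd (snd w) = F0 U"
proof -
 let ?V = "A.Syz W" and ?N = "PA (A.Syz W)"
 let ?K = "hom_ker ?N ?V (\<pi>A ?V)"
 have V: "?V\<in>A.fg" by (rule A.syzygy_fg[OF W])
 have N: "?N\<in>A.fg" by (rule A.cover_fg[OF V])
 note lmV = fg_modD[OF V] and lmN = fg_modD[OF N] and lmP = fg_modD[OF A.cover_fg[OF W]]
 interpret N: monomial_module Q "relations Q I" I d ?N by (rule A.monomial_module[OF lmN])
 have tN: "A.torsionless ?N" by (rule A.projective_torsionless[OF N A.cover_projective[OF V] A.universe])
 have tP: "A.torsionless (PA W)" by (rule A.projective_torsionless[OF A.cover_fg[OF W] A.cover_projective[OF W] A.universe])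
 have "inj_on (A.syz_inc W) (car ?V)" by (auto simp: inj_on_def A.syz_inc_def)
 hence tV: "A.torsionless ?V" by (rule A.torsionless_inj[OF lmV lmP A.syz_inc[OF W] _ tP])
 have pc: "projective_cover A.A ?N (\<pi>A ?V) ?V" using A.covers V by (auto simp: projective_covers_def)
 have sub: "submodule ?K A.A ?N" by (rule A.syzygy_submodule[OF V])
 have "finitely_generated A.A (?N\<lparr>carrier := ?K\<rparr>)" using A.sub_fg[OF N sub] by (simp add: fg_mod_def)
 from N.minimal_generators[OF sub this A.cover_ker_rad[OF lmV pc]] N.syzygy_homogeneous[OF lmV tV A.cover_hom[OF V]]
 obtain Y where Y: "finite Y" "Y \<subseteq> arcs Q \<times> car ?N" "N.gen Y = ?K" "!!y. y\<in>Y ==> N.el y \<notin> N.gen (Y - {y})" by blast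
 have "\<exists>U w w'. U\<in>Obj C \<and> A.st.iso w w' \<and> fst w = ?N\<lparr>carrier := N.gen Y\<rparr> \<and> snd (snd w) = F0 U"
  by (rule generated_iso[OF N Y(1,2)]) (rule N.independent[OF tN Y(1,2,4)])
 thus ?thesis unfolding Y(3) by (simp add: syzygy_def)
qed

theorem relation_functor_equivalence: "pre_triangle_equivalence C A.D F0 F1 \<delta>"
proof (rule CF.pre_triangle_equivalenceI[OF triangle_functor])
 show "CF.lifts (LoopO C M) N (Comp A.D (LoopA A.D g) (\<delta> M))"
  if "M\<in>Obj C" "N\<in>Obj C" "A.st.arr g" "fst g = F0 M" "snd (snd g) = F0 N" for M N g by (rule loop_full[OF that])
 show "f = f'" if "C.arr f" "C.arr f'" "fst f = fst f'" "snd (snd f) = snd (snd f')" "F1 f = F1 f'" for f f' by (rule faithful[OF that])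
 show "\<exists>U w w'. U\<in>Obj C \<and> A.st.iso w w' \<and> fst w = LoopO A.D (LoopO A.D W) \<and> snd (snd w) = F0 U" if "W\<in>Obj A.D" for W using dense[of W] that by simp
qed

end

theorem lemma4p5:
  fixes Q :: "('v, 'e) pre_digraph"
    and I :: "(('v, 'e) path \<Rightarrow> 'k::field) set"
    and A :: "(('v, 'e) path \<Rightarrow> 'k) set ring"
    and R\<^sub>A :: "('e, ('v, 'e) path) pre_digraph"
    and K :: "(('e, ('v, 'e) path) path \<Rightarrow> 'k) set"
    and B :: "(('e, ('v, 'e) path) path \<Rightarrow> 'k) set ring"
    and P\<^sub>A :: "((('v, 'e) path \<Rightarrow> 'k) set, 'u) module \<Rightarrow> ((('v, 'e) path \<Rightarrow> 'k) set, 'u) module"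
    and P\<^sub>B :: "((('e, ('v, 'e) path) path \<Rightarrow> 'k) set, 'u) module \<Rightarrow>
               ((('e, ('v, 'e) path) path \<Rightarrow> 'k) set, 'u) module"
  assumes Q: "fin_digraph Q"
    and I: "quadratic_monomial Q I"
    and A: "A = quiver_alg Q I"
    and R\<^sub>A: "R\<^sub>A = relation_quiver Q I"
    and K: "K = arrow_ideal_sq R\<^sub>A"
    and B: "B = quiver_alg R\<^sub>A K"
    \<comment> \<open>the type \<open>'u\<close> of module elements is large enough to contain a copy of each
        finite-dimensional vector space\<close>
    and universe: "\<exists>\<iota> :: 'k list \<Rightarrow> 'u. inj \<iota>"
    and covers_A: "projective_covers A P\<^sub>A \<pi>\<^sub>A"
    and covers_B: "projective_covers B P\<^sub>B \<pi>\<^sub>B"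
    and C: "C = ssmod B (scalar R\<^sub>A K) P\<^sub>B \<pi>\<^sub>B"
    and D: "D = stmod A (scalar Q I) P\<^sub>A \<pi>\<^sub>A"
    and simples: "\<And>\<alpha>. \<alpha> \<in> arcs Q \<Longrightarrow> S \<alpha> \<in> fg_mod B \<and> \<sigma> \<alpha> \<in> mod_iso B (S \<alpha>) (vertex_simple \<alpha>)"
    and ideals: "\<And>\<alpha>. \<alpha> \<in> arcs Q \<Longrightarrow> L \<alpha> \<in> fg_mod A \<and>
          \<tau> \<alpha> \<in> mod_iso A (L \<alpha>) (left_ideal_module A (residue Q I (path_elt (tail Q \<alpha>, [\<alpha>]))))"
    and F_functor: "is_functor C D F0 F1"
    and F_linear: "linear_on_arrows C D F1"
    and F_simples: "\<And>\<alpha>. \<alpha> \<in> arcs Q \<Longrightarrow> F0 (S \<alpha>) = L \<alpha>"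
    and \<delta>_iso: "loop_natural_iso C D F0 F1 \<delta>"
    and \<delta>_simples: "\<And>\<alpha> \<beta>. (tail Q \<alpha>, [\<alpha>, \<beta>]) \<in> relations Q I \<Longrightarrow>
          Comp D (\<delta> (S \<alpha>)) (F1 (simple_syzygy_component Q I P\<^sub>B \<pi>\<^sub>B S \<sigma> \<alpha> \<beta>)) =
            ideal_syzygy_component Q I P\<^sub>A \<pi>\<^sub>A L \<tau> \<alpha> \<beta>"
  shows "pre_triangle_equivalence C D F0 F1 \<delta>"
proof -
  interpret Q: fin_digraph Q by (rule Q)
  obtain d where d: "monomial_algebra Q (relations Q I) I d" using Q.quadratic_monomial_algebra[OF I] by blast
  interpret A: monomial_algebra Q "relations Q I" I d by (rule d)
  interpret R: fin_digraph R\<^sub>A unfolding R\<^sub>A by (rule Q.relation_quiver_fin)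
  \<comment> \<open>Modulo the square of the arrow ideal all paths of length two are relations, so
    the same theory of monomial algebras serves for both sides, with bound two here.\<close>
  let ?X = "{p \<in> paths R\<^sub>A. length (snd p) = 2}"
  have "monomial_algebra R\<^sub>A ?X K 2" unfolding K by (rule R.rad_square_zero_algebra)
  then interpret B: monomial_algebra R\<^sub>A ?X K 2 .
  have V: "verts R\<^sub>A = arcs Q" by (simp add: R\<^sub>A relation_quiver_def)
  interpret B: rad_square_zero R\<^sub>A ?X K S \<sigma>
    by unfold_locales (use simples in \<open>auto simp: V B\<close>)
  interpret MA: stable_modules_sums "quiver_alg Q I" "scalar Q I" P\<^sub>A \<pi>\<^sub>A
    by (rule A.stable_modules_sums[OF covers_A[unfolded A] universe])
  interpret MB: stable_modules_sums "quiver_alg R\<^sub>A K" "scalar R\<^sub>A K" P\<^sub>B \<pi>\<^sub>B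
    by (rule B.stable_modules_sums[OF covers_B[unfolded B] universe])
  interpret relation_functor Q I d P\<^sub>A \<pi>\<^sub>A R\<^sub>A ?X K S \<sigma> P\<^sub>B \<pi>\<^sub>B L \<tau> F0 F1 \<delta>
    by unfold_locales
      (use universe K ideals[unfolded A] F_functor[unfolded C D A B] F_linear[unfolded C D A B] F_simples
        \<delta>_iso[unfolded C D A B] \<delta>_simples[unfolded D A] in \<open>assumption | simp only: R\<^sub>A\<close>)+
  show ?thesis unfolding C D A B by (rule relation_functor_equivalence)
qed

end
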